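(* Let $A$ be a unital associative algebra over a field $k$. There is a natural embedding of complexes $\iota^*:\mathcal D^*(A,A)\hookrightarrow C^*_{\mathrm{sg}}(A,A)$ from the generalized Tate-Hochschild complex into the singular Hochschild cochain complex.
   Context: Notation. $k$ is a field, $\otimes=\otimes_k$, $\overline A=A/(k\cdot 1)$, $s\overline A$ is $\overline A$ placed in degree $-1$, $s\overline a_{i,j}:=s\overline a_i\otimes\cdots\otimes s\overline a_j$ (empty tensor if $j<i$). $\Omega^p_{\mathrm{nc}}(A):=A\otimes (s\overline A)^{\otimes p}$, in degree $-p$, is an $A$-$A$-bimodule: left action by multiplication on the first factor, right action $$(a_0\otimes s\overline a_{1,p})\blacktriangleleft a_{p+1}=\sum_{i=0}^{p}(-1)^{p-i}a_0\otimes s\overline a_{1,i-1}\otimes s\overline{a_ia_{i+1}}\otimes s\overline a_{i+2,p+1}$$ (the $i=0$ term is $(-1)^pa_0a_1\otimes s\overline a_{2,p+1}$). For $m\in\mathbb Z$, $p\ge0$, $N=m+p$: $C^m(A,\Omega^p_{\mathrm{nc}}(A))=\mathrm{Hom}_k((s\overline A)^{\otimes N},A\otimes(s\overline A)^{\otimes p})$ (zero if $N<0$) with differential $$(-1)^{m+1}\delta(f)(s\overline a_{1,N+1})=a_1f(s\overline a_{2,N+1})+\sum_{j=1}^{N}(-1)^jf(s\overline a_{1,j-1}\otimes s\overline{a_ja_{j+1}}\otimes s\overline a_{j+2,N+1})+(-1)^{N+1}f(s\overline a_{1,N})\blacktriangleleft a_{N+1}.$$ $C^*_{\mathrm{sg}}(A,A)$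 is the colimit of the complexes $C^*(A,\Omega^p_{\mathrm{nc}}(A))$ along the injective cochain maps $\theta_p(f)=f\otimes\mathrm{id}_{s\overline A}$. The case $p=0$ is the normalized Hochschild cochain complex $C^*(A,A)$. Generalized Tate-Hochschild complex. $A^\vee:=\mathrm{Hom}_{A\otimes A^{\mathrm{op}}}(A,A\otimes A^{\mathrm{op}})$ is identified with $\{\sum_ix_i\otimes y_i\in A\otimes A:\ \sum_iax_i\otimes y_i=\sum_ix_i\otimes y_ia\ \ \forall a\in A\}$, with bimodule structure $a\cdot(\sum x_i\otimes y_i)\cdot b=\sum x_ib\otimes ay_i$. $C_p(A,A^\vee)=A^\vee\otimes(s\overline A)^{\otimes p}$ has the Hochschild differential $$b(m\otimes s\overline a_{1,p})=ma_1\otimes s\overline a_{2,p}+\sum_{j=1}^{p-1}(-1)^jm\otimes s\overline a_{1,j-1}\otimes s\overline{a_ja_{j+1}}\otimes s\overline a_{j+2,p}+(-1)^pa_pm\otimes s\overline a_{1,p-1}.$$ $\mathcal D^*(A,A)$ is the complex $\cdots\xrightarrow{b_2}C_1(A,A^\vee)\xrightarrow{b_1}A^\vee\xrightarrow{\mu}A\xrightarrow{\delta^0}C^1(A,A)\xrightarrow{\delta^1}\cdots$ with $C^i(A,A)$ in degree $i\geq 0$ and $C_p(A,A^\vee)$ in degree $-p-1$, where $\mu(\sum x_i\otimes y_i)=\sum x_iy_i$. The map $\iota^*$ is the inclusion $C^i(A,A)\subset C^i_{\mathrm{sg}}(A,A)$ in degrees $i\ge0$, and in degree $-p-1$, $p\ge0$,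 it sends $(\sum_jx_j\otimes y_j)\otimes s\overline a_{1,p}$ to $\sum_jx_j\otimes s\overline a_{1,p}\otimes s\overline{y_j}\in\Omega^{p+1}_{\mathrm{nc}}(A)=C^{-p-1}(A,\Omega^{p+1}_{\mathrm{nc}}(A))\subset C^{-p-1}_{\mathrm{sg}}(A,A)$.
   Formalization: The formal statement assumes that A is not the ground field k itself (the structure map k → A is not bijective); for A = k the singular Hochschild complex is zero while D^0 = k, so no embedding exists. *)

theory Defs
  imports "HOL-Algebra.Module" "HOL-Algebra.AbelCoset"
begin

section \<open>Vector spaces\<close>

text \<open>
  A vector space over the field \<open>K\<close> is a \<^const>\<open>module\<close> over \<open>K\<close>. The fields \<open>mult\<close> and \<open>one\<close>,
  which the record of modules inherits from the record of rings, play no role and are left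
  undefined in all the vector spaces built here.
\<close>

definition vspace ::
    "'v set \<Rightarrow> 'v \<Rightarrow> ('v \<Rightarrow> 'v \<Rightarrow> 'v) \<Rightarrow> ('k \<Rightarrow> 'v \<Rightarrow> 'v) \<Rightarrow> ('k, 'v) module" where
  "vspace C z a s =
     \<lparr>carrier = C, mult = undefined, one = undefined, zero = z, add = a, smult = s\<rparr>"

definition zero_space :: "'v \<Rightarrow> ('k, 'v) module" where
  "zero_space z = vspace {z} z (\<lambda>_ _. z) (\<lambda>_ _. z)"

definition linear_map ::
    "('k, 'c) ring_scheme \<Rightarrow> ('k, 'v, 'd) module_scheme \<Rightarrow> ('k, 'w, 'e) module_scheme
       \<Rightarrow> ('v \<Rightarrow> 'w) \<Rightarrow> bool" where
  "linear_map K V W f \<longleftrightarrow>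
     f \<in> carrier V \<rightarrow> carrier W \<and>
     (\<forall>x\<in>carrier V. \<forall>y\<in>carrier V. f (x \<oplus>\<^bsub>V\<^esub> y) = f x \<oplus>\<^bsub>W\<^esub> f y) \<and>
     (\<forall>c\<in>carrier K. \<forall>x\<in>carrier V. f (c \<odot>\<^bsub>V\<^esub> x) = c \<odot>\<^bsub>W\<^esub> f x)"

text \<open>
  Linear maps that form the elements of a Hom space take the value \<^const>\<open>undefined\<close> outside the
  carrier, so that two of them are equal as soon as they agree on the carrier.
\<close>

definition Hom ::
    "('k, 'c) ring_scheme \<Rightarrow> ('k, 'v, 'd) module_scheme \<Rightarrow> ('k, 'w, 'e) module_scheme
       \<Rightarrow> ('k, 'v \<Rightarrow> 'w) module" where
  "Hom K V W = vspace
     {f \<in> extensional (carrier V). linear_map K V W f}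
     (\<lambda>x\<in>carrier V. \<zero>\<^bsub>W\<^esub>)
     (\<lambda>f g. \<lambda>x\<in>carrier V. f x \<oplus>\<^bsub>W\<^esub> g x)
     (\<lambda>c f. \<lambda>x\<in>carrier V. c \<odot>\<^bsub>W\<^esub> f x)"

definition the_linear_map ::
    "('k, 'c) ring_scheme \<Rightarrow> ('k, 'v, 'd) module_scheme \<Rightarrow> ('k, 'w, 'e) module_scheme
       \<Rightarrow> (('v \<Rightarrow> 'w) \<Rightarrow> bool) \<Rightarrow> ('v \<Rightarrow> 'w)" where
  "the_linear_map K V W P = (THE f. f \<in> carrier (Hom K V W) \<and> P f)"

definition span_of ::
    "('k, 'c) ring_scheme \<Rightarrow> ('k, 'v, 'd) module_scheme \<Rightarrow> 'v set \<Rightarrow> 'v set" where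
  "span_of K V S = \<Inter>{N. submodule N K V \<and> S \<subseteq> N}"

definition quot_space ::
    "('k, 'v, 'd) module_scheme \<Rightarrow> 'v set \<Rightarrow> ('k, 'v set) module" where
  "quot_space V N = vspace
     (a_rcosets\<^bsub>V\<^esub> N) N (\<lambda>X Y. X <+>\<^bsub>V\<^esub> Y) (\<lambda>c X. \<Union>x\<in>X. N +>\<^bsub>V\<^esub> (c \<odot>\<^bsub>V\<^esub> x))"

definition free_space :: "('k, 'c) ring_scheme \<Rightarrow> 'x set \<Rightarrow> ('k, 'x \<Rightarrow> 'k) module" where
  "free_space K X = vspace
     {f. range f \<subseteq> carrier K \<and> {x. f x \<noteq> \<zero>\<^bsub>K\<^esub>} \<subseteq> X \<and> finite {x. f x \<noteq> \<zero>\<^bsub>K\<^esub>}}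
     (\<lambda>_. \<zero>\<^bsub>K\<^esub>)
     (\<lambda>f g x. f x \<oplus>\<^bsub>K\<^esub> g x)
     (\<lambda>c f x. c \<otimes>\<^bsub>K\<^esub> f x)"

definition gen :: "('k, 'c) ring_scheme \<Rightarrow> 'x \<Rightarrow> 'x \<Rightarrow> 'k" where
  "gen K x = (\<lambda>y. if y = x then \<one>\<^bsub>K\<^esub> else \<zero>\<^bsub>K\<^esub>)"


section \<open>Tensor products and tensor powers\<close>

definition tensor_rels ::
    "('k, 'c) ring_scheme \<Rightarrow> ('k, 'v, 'd) module_scheme \<Rightarrow> ('k, 'w, 'e) module_scheme
       \<Rightarrow> ('v \<times> 'w \<Rightarrow> 'k) set" where
  "tensor_rels K V W = (let F = free_space K (carrier V \<times> carrier W); g = gen K in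
       {g (x \<oplus>\<^bsub>V\<^esub> x', y) \<ominus>\<^bsub>F\<^esub> (g (x, y) \<oplus>\<^bsub>F\<^esub> g (x', y)) | x x' y.
          x \<in> carrier V \<and> x' \<in> carrier V \<and> y \<in> carrier W}
     \<union> {g (x, y \<oplus>\<^bsub>W\<^esub> y') \<ominus>\<^bsub>F\<^esub> (g (x, y) \<oplus>\<^bsub>F\<^esub> g (x, y')) | x y y'.
          x \<in> carrier V \<and> y \<in> carrier W \<and> y' \<in> carrier W}
     \<union> {g (c \<odot>\<^bsub>V\<^esub> x, y) \<ominus>\<^bsub>F\<^esub> c \<odot>\<^bsub>F\<^esub> g (x, y) | c x y.
          c \<in> carrier K \<and> x \<in> carrier V \<and> y \<in> carrier W}
     \<union> {g (x, c \<odot>\<^bsub>W\<^esub> y) \<ominus>\<^bsub>F\<^esub> c \<odot>\<^bsub>F\<^esub> g (x, y) | c x y.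
          c \<in> carrier K \<and> x \<in> carrier V \<and> y \<in> carrier W})"

definition tensor_null ::
    "('k, 'c) ring_scheme \<Rightarrow> ('k, 'v, 'd) module_scheme \<Rightarrow> ('k, 'w, 'e) module_scheme
       \<Rightarrow> ('v \<times> 'w \<Rightarrow> 'k) set" where
  "tensor_null K V W = span_of K (free_space K (carrier V \<times> carrier W)) (tensor_rels K V W)"

definition tensor ::
    "('k, 'c) ring_scheme \<Rightarrow> ('k, 'v, 'd) module_scheme \<Rightarrow> ('k, 'w, 'e) module_scheme
       \<Rightarrow> ('k, ('v \<times> 'w \<Rightarrow> 'k) set) module" where
  "tensor K V W = quot_space (free_space K (carrier V \<times> carrier W)) (tensor_null K V W)"

definition pure ::
    "('k, 'c) ring_scheme \<Rightarrow> ('k, 'v, 'd) module_scheme \<Rightarrow> ('k, 'w, 'e) module_scheme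
       \<Rightarrow> 'v \<Rightarrow> 'w \<Rightarrow> ('v \<times> 'w \<Rightarrow> 'k) set" where
  "pure K V W x y =
     tensor_null K V W +>\<^bsub>free_space K (carrier V \<times> carrier W)\<^esub> gen K (x, y)"

text \<open>
  The \<open>n\<close>-th tensor power of \<open>V\<close> is presented by generators \<open>v\<^sub>1 \<otimes> \<dots> \<otimes> v\<^sub>n\<close>, indexed by the lists
  of length \<open>n\<close>, and the relations of linearity in each slot. For \<open>n = 0\<close> there are no relations
  and one generator, the empty tensor.
\<close>

definition words :: "('k, 'v, 'd) module_scheme \<Rightarrow> nat \<Rightarrow> 'v list set" where
  "words V n = {xs. length xs = n \<and> set xs \<subseteq> carrier V}"

definition power_rels ::
    "('k, 'c) ring_scheme \<Rightarrow> ('k, 'v, 'd) module_scheme \<Rightarrow> nat \<Rightarrow> ('v list \<Rightarrow> 'k) set" where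
  "power_rels K V n = (let F = free_space K (words V n); g = gen K in
       {g (us @ [x \<oplus>\<^bsub>V\<^esub> y] @ ws) \<ominus>\<^bsub>F\<^esub> (g (us @ [x] @ ws) \<oplus>\<^bsub>F\<^esub> g (us @ [y] @ ws)) | us ws x y.
          us @ [x] @ ws \<in> words V n \<and> y \<in> carrier V}
     \<union> {g (us @ [c \<odot>\<^bsub>V\<^esub> x] @ ws) \<ominus>\<^bsub>F\<^esub> c \<odot>\<^bsub>F\<^esub> g (us @ [x] @ ws) | us ws c x.
          us @ [x] @ ws \<in> words V n \<and> c \<in> carrier K})"

definition power_null ::
    "('k, 'c) ring_scheme \<Rightarrow> ('k, 'v, 'd) module_scheme \<Rightarrow> nat \<Rightarrow> ('v list \<Rightarrow> 'k) set" where
  "power_null K V n = span_of K (free_space K (words V n)) (power_rels K V n)"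

definition tensor_power ::
    "('k, 'c) ring_scheme \<Rightarrow> ('k, 'v, 'd) module_scheme \<Rightarrow> nat
       \<Rightarrow> ('k, ('v list \<Rightarrow> 'k) set) module" where
  "tensor_power K V n = quot_space (free_space K (words V n)) (power_null K V n)"

definition pure_power ::
    "('k, 'c) ring_scheme \<Rightarrow> ('k, 'v, 'd) module_scheme \<Rightarrow> 'v list \<Rightarrow> ('v list \<Rightarrow> 'k) set" where
  "pure_power K V xs =
     power_null K V (length xs) +>\<^bsub>free_space K (words V (length xs))\<^esub> gen K xs"


section \<open>Cochain complexes and embeddings\<close>

text \<open>Complexes are graded by all integers, with differentials of degree \<open>+1\<close>.\<close>

definition cochain_complex ::
    "('k, 'c) ring_scheme \<Rightarrow> (int \<Rightarrow> ('k, 'v, 'd) module_scheme) \<Rightarrow> (int \<Rightarrow> 'v \<Rightarrow> 'v) \<Rightarrow> bool" where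
  "cochain_complex K X d \<longleftrightarrow>
     (\<forall>n. module K (X n)) \<and>
     (\<forall>n. linear_map K (X n) (X (n + 1)) (d n)) \<and>
     (\<forall>n. \<forall>x\<in>carrier (X n). d (n + 1) (d n x) = \<zero>\<^bsub>X (n + 2)\<^esub>)"

definition cochain_map ::
    "('k, 'c) ring_scheme
       \<Rightarrow> (int \<Rightarrow> ('k, 'v, 'd) module_scheme) \<Rightarrow> (int \<Rightarrow> 'v \<Rightarrow> 'v)
       \<Rightarrow> (int \<Rightarrow> ('k, 'w, 'e) module_scheme) \<Rightarrow> (int \<Rightarrow> 'w \<Rightarrow> 'w)
       \<Rightarrow> (int \<Rightarrow> 'v \<Rightarrow> 'w) \<Rightarrow> bool" where
  "cochain_map K X dX Y dY f \<longleftrightarrow>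
     (\<forall>n. linear_map K (X n) (Y n) (f n)) \<and>
     (\<forall>n. \<forall>x\<in>carrier (X n). f (n + 1) (dX n x) = dY n (f n x))"

definition complex_embedding ::
    "('k, 'c) ring_scheme
       \<Rightarrow> (int \<Rightarrow> ('k, 'v, 'd) module_scheme) \<Rightarrow> (int \<Rightarrow> 'v \<Rightarrow> 'v)
       \<Rightarrow> (int \<Rightarrow> ('k, 'w, 'e) module_scheme) \<Rightarrow> (int \<Rightarrow> 'w \<Rightarrow> 'w)
       \<Rightarrow> (int \<Rightarrow> 'v \<Rightarrow> 'w) \<Rightarrow> bool" where
  "complex_embedding K X dX Y dY f \<longleftrightarrow>
     cochain_complex K X dX \<and> cochain_complex K Y dY \<and> cochain_map K X dX Y dY f \<and>
     (\<forall>n. inj_on (f n) (carrier (X n)))"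


section \<open>Colimits of sequences of vector spaces\<close>

text \<open>
  The sequence is \<open>V 0 \<rightarrow> V 1 \<rightarrow> V 2 \<rightarrow> \<dots>\<close> with \<open>t p : V p \<rightarrow> V (p + 1)\<close>; \<open>push t p k\<close> is the
  composite map from \<open>V p\<close> to \<open>V (p + k)\<close>. Elements of the colimit are the classes of pairs
  \<open>(p, x)\<close> with \<open>x\<close> in \<open>V p\<close>, two pairs being identified if they become equal at some later stage.
\<close>

primrec push :: "(nat \<Rightarrow> 'v \<Rightarrow> 'v) \<Rightarrow> nat \<Rightarrow> nat \<Rightarrow> 'v \<Rightarrow> 'v" where
  "push t p 0 x = x"
| "push t p (Suc k) x = t (p + k) (push t p k x)"

definition colim_rel ::
    "(nat \<Rightarrow> ('k, 'v, 'd) module_scheme) \<Rightarrow> (nat \<Rightarrow> 'v \<Rightarrow> 'v)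
       \<Rightarrow> ((nat \<times> 'v) \<times> (nat \<times> 'v)) set" where
  "colim_rel V t = {((p, x), (q, y)). x \<in> carrier (V p) \<and> y \<in> carrier (V q) \<and>
     (\<exists>r. p \<le> r \<and> q \<le> r \<and> push t p (r - p) x = push t q (r - q) y)}"

definition colim_in ::
    "(nat \<Rightarrow> ('k, 'v, 'd) module_scheme) \<Rightarrow> (nat \<Rightarrow> 'v \<Rightarrow> 'v) \<Rightarrow> nat \<Rightarrow> 'v
       \<Rightarrow> (nat \<times> 'v) set" where
  "colim_in V t p x = colim_rel V t `` {(p, x)}"

definition colim ::
    "(nat \<Rightarrow> ('k, 'v, 'd) module_scheme) \<Rightarrow> (nat \<Rightarrow> 'v \<Rightarrow> 'v) \<Rightarrow> ('k, (nat \<times> 'v) set) module" where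
  "colim V t = vspace
     ((SIGMA p : UNIV. carrier (V p)) // colim_rel V t)
     (colim_in V t 0 \<zero>\<^bsub>V 0\<^esub>)
     (\<lambda>X Y. \<Union>(p, x)\<in>X. \<Union>(q, y)\<in>Y.
        colim_in V t (max p q)
          (push t p (max p q - p) x \<oplus>\<^bsub>V (max p q)\<^esub> push t q (max p q - q) y))
     (\<lambda>c X. \<Union>(p, x)\<in>X. colim_in V t p (c \<odot>\<^bsub>V p\<^esub> x))"

text \<open>The map into the colimit of \<open>W\<close> along \<open>u\<close> induced by maps \<open>f p\<close> defined on the stages.\<close>

definition colim_map ::
    "(nat \<Rightarrow> ('k, 'w, 'd) module_scheme) \<Rightarrow> (nat \<Rightarrow> 'w \<Rightarrow> 'w) \<Rightarrow> (nat \<Rightarrow> 'v \<Rightarrow> 'w)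
       \<Rightarrow> (nat \<times> 'v) set \<Rightarrow> (nat \<times> 'w) set" where
  "colim_map W u f X = (\<Union>(p, x)\<in>X. colim_in W u p (f p x))"


section \<open>Unital associative algebras over a field\<close>

text \<open>The zero algebra is allowed.\<close>

locale k_algebra = K?: field K + A?: ring A + module K A
  for K (structure) and A (structure) +
  assumes smult_mult_left:
      "\<lbrakk>c \<in> carrier K; x \<in> carrier A; y \<in> carrier A\<rbrakk>
         \<Longrightarrow> (c \<odot>\<^bsub>A\<^esub> x) \<otimes>\<^bsub>A\<^esub> y = c \<odot>\<^bsub>A\<^esub> (x \<otimes>\<^bsub>A\<^esub> y)"
    and smult_mult_right:
      "\<lbrakk>c \<in> carrier K; x \<in> carrier A; y \<in> carrier A\<rbrakk>
         \<Longrightarrow> x \<otimes>\<^bsub>A\<^esub> (c \<odot>\<^bsub>A\<^esub> y) = c \<odot>\<^bsub>A\<^esub> (x \<otimes>\<^bsub>A\<^esub> y)"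

text \<open>\<open>(-1)\<^sup>j x\<close> in the abelian group \<open>V\<close>\<close>

definition alt :: "('v, 'd) ring_scheme \<Rightarrow> int \<Rightarrow> 'v \<Rightarrow> 'v" where
  "alt V j x = (if even j then x else \<ominus>\<^bsub>V\<^esub> x)"

text \<open>Replace the adjacent entries with indices \<open>i\<close> and \<open>i + 1\<close> (counting from 0) by their product.\<close>

definition merge :: "('a, 'd) ring_scheme \<Rightarrow> nat \<Rightarrow> 'a list \<Rightarrow> 'a list" where
  "merge A i xs = take i xs @ [xs ! i \<otimes>\<^bsub>A\<^esub> xs ! (i + 1)] @ drop (i + 2) xs"


section \<open>The singular Hochschild cochain complex\<close>

context k_algebra
begin

definition Abar where
  "Abar = quot_space A {c \<odot>\<^bsub>A\<^esub> \<one>\<^bsub>A\<^esub> | c. c \<in> carrier K}"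

definition bar where
  "bar a = {c \<odot>\<^bsub>A\<^esub> \<one>\<^bsub>A\<^esub> | c. c \<in> carrier K} +>\<^bsub>A\<^esub> a"

text \<open>
  \<open>sbars [a\<^sub>1, \<dots>, a\<^sub>p]\<close> is the element of the tensor power \<open>SAbar p\<close> of \<open>s A\<close>-bar that is the tensor
  of the classes of the \<open>a\<^sub>i\<close>. The shift \<open>s\<close> only affects degrees; all signs caused by it are
  explicit in the formulas below.
\<close>

definition SAbar where
  "SAbar p = tensor_power K Abar p"

definition sbars where
  "sbars as = pure_power K Abar (map bar as)"

definition Omega where
  "Omega p = tensor K A (SAbar p)"

text \<open>\<open>om [a\<^sub>0, a\<^sub>1, \<dots>, a\<^sub>p]\<close> is the element of \<open>Omega p\<close> with first factor \<open>a\<^sub>0\<close>.\<close>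

definition om where
  "om as = pure K A (SAbar (length as - 1)) (hd as) (sbars (tl as))"

definition Omega_left where
  "Omega_left p a = the_linear_map K (Omega p) (Omega p)
     (\<lambda>f. \<forall>xs\<in>words A (p + 1). f (om xs) = om ((a \<otimes>\<^bsub>A\<^esub> hd xs) # tl xs))"

definition Omega_right where
  "Omega_right p a = the_linear_map K (Omega p) (Omega p)
     (\<lambda>f. \<forall>xs\<in>words A (p + 1).
        f (om xs) = (\<Oplus>\<^bsub>Omega p\<^esub>i\<in>{0..p}. alt (Omega p) (int p - int i) (om (merge A i (xs @ [a])))))"

text \<open>\<open>w \<mapsto> w \<otimes> s a\<close>\<close>

definition Omega_snoc where
  "Omega_snoc p a = the_linear_map K (Omega p) (Omega (p + 1))
     (\<lambda>f. \<forall>xs\<in>words A (p + 1). f (om xs) = om (xs @ [a]))"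

definition Coch where
  "Coch m p = (if m + int p \<ge> 0 then Hom K (SAbar (nat (m + int p))) (Omega p)
            else zero_space (\<lambda>_. undefined))"

definition delta where
  "delta m p f = (if m + int p \<ge> 0 then
     (let N = nat (m + int p) in
      THE g. g \<in> carrier (Coch (m + 1) p) \<and>
        (\<forall>as\<in>words A (N + 1).
           alt (Omega p) (m + 1) (g (sbars as)) =
             Omega_left p (hd as) (f (sbars (tl as)))
             \<oplus>\<^bsub>Omega p\<^esub> (\<Oplus>\<^bsub>Omega p\<^esub>j\<in>{1..N}. alt (Omega p) (int j) (f (sbars (merge A (j - 1) as))))
             \<oplus>\<^bsub>Omega p\<^esub> alt (Omega p) (int N + 1) (Omega_right p (last as) (f (sbars (butlast as))))))
     else \<zero>\<^bsub>Coch (m + 1) p\<^esub>)"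

definition theta where
  "theta m p f = (if m + int p \<ge> 0 then
     (let N = nat (m + int p) in
      THE g. g \<in> carrier (Coch m (p + 1)) \<and>
        (\<forall>as\<in>words A N. \<forall>a\<in>carrier A. g (sbars (as @ [a])) = Omega_snoc p a (f (sbars as))))
     else \<zero>\<^bsub>Coch m (p + 1)\<^esub>)"

definition Csg where
  "Csg m = colim (Coch m) (theta m)"

definition delta_sg where
  "delta_sg m = colim_map (Coch (m + 1)) (theta (m + 1)) (delta m)"

text \<open>
  The element \<open>w\<close> of \<open>Omega p\<close>, regarded as the cochain of degree \<open>-p\<close> that sends the empty
  tensor to \<open>w\<close>
\<close>

definition elem_cochain where
  "elem_cochain p w = (THE f. f \<in> carrier (Coch (- int p) p) \<and> f (sbars []) = w)"


section \<open>The generalized Tate-Hochschild complex\<close>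

definition AA where
  "AA = tensor K A A"

text \<open>\<open>x \<otimes> y \<mapsto> ax \<otimes> yb\<close>\<close>

definition outer where
  "outer a b = the_linear_map K AA AA
     (\<lambda>f. \<forall>x\<in>carrier A. \<forall>y\<in>carrier A. f (pure K A A x y) = pure K A A (a \<otimes>\<^bsub>A\<^esub> x) (y \<otimes>\<^bsub>A\<^esub> b))"

text \<open>\<open>x \<otimes> y \<mapsto> xb \<otimes> ay\<close>\<close>

definition inner where
  "inner a b = the_linear_map K AA AA
     (\<lambda>f. \<forall>x\<in>carrier A. \<forall>y\<in>carrier A. f (pure K A A x y) = pure K A A (x \<otimes>\<^bsub>A\<^esub> b) (a \<otimes>\<^bsub>A\<^esub> y))"

definition mult_map where
  "mult_map = the_linear_map K AA A
     (\<lambda>f. \<forall>x\<in>carrier A. \<forall>y\<in>carrier A. f (pure K A A x y) = x \<otimes>\<^bsub>A\<^esub> y)"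

text \<open>
  The bimodule maps from \<open>A\<close> to \<open>A \<otimes> A\<close> (with its outer bimodule structure), each identified with
  its value at \<open>\<one>\<close>; the bimodule structure left on them is the inner one.
\<close>

definition Adual where
  "Adual = AA\<lparr>carrier :=
     {w \<in> carrier AA. \<forall>a\<in>carrier A. outer a \<one>\<^bsub>A\<^esub> w = outer \<one>\<^bsub>A\<^esub> a w}\<rparr>"

text \<open>Hochschild chains with coefficients in \<open>Adual\<close>, spanned by \<open>w \<otimes> s a\<^sub>1 \<otimes> \<dots> \<otimes> s a\<^sub>p = ch w [a\<^sub>1, \<dots>, a\<^sub>p]\<close>\<close>

definition Ch where
  "Ch p = tensor K Adual (SAbar p)"

definition ch where
  "ch w as = pure K Adual (SAbar (length as)) w (sbars as)"

text \<open>\<open>hoch_b p\<close> is the differential from \<open>Ch p\<close> to \<open>Ch (p - 1)\<close>, for \<open>p \<ge> 1\<close>.\<close>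

definition hoch_b where
  "hoch_b p = the_linear_map K (Ch p) (Ch (p - 1))
     (\<lambda>f. \<forall>w\<in>carrier Adual. \<forall>as\<in>words A p.
        f (ch w as) =
          ch (inner \<one>\<^bsub>A\<^esub> (hd as) w) (tl as)
          \<oplus>\<^bsub>Ch (p - 1)\<^esub> (\<Oplus>\<^bsub>Ch (p - 1)\<^esub>j\<in>{1..p - 1}. alt (Ch (p - 1)) (int j) (ch w (merge A (j - 1) as)))
          \<oplus>\<^bsub>Ch (p - 1)\<^esub> alt (Ch (p - 1)) (int p) (ch (inner (last as) \<one>\<^bsub>A\<^esub> w) (butlast as)))"

text \<open>
  The map \<open>\<mu>\<close> from \<open>Ch 0\<close> (the dual \<open>Adual\<close> tensored with the ground field) to \<open>Coch 0 0\<close> (that is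
  \<open>A\<close>, an element \<open>a\<close> being the cochain that sends the empty tensor to \<open>om [a]\<close>)
\<close>

definition mu where
  "mu = the_linear_map K (Ch 0) (Coch 0 0)
     (\<lambda>f. \<forall>w\<in>carrier Adual. f (ch w []) = elem_cochain 0 (om [mult_map w]))"

text \<open>
  The Tate-Hochschild complex has \<open>Coch i 0\<close> in degree \<open>i \<ge> 0\<close>, tagged by \<^const>\<open>Inl\<close>, and \<open>Ch p\<close>
  in degree \<open>i = - p - 1\<close>, tagged by \<^const>\<open>Inr\<close>.
\<close>

definition Tate where
  "Tate i = (if i \<ge> 0 then
       vspace (Inl ` carrier (Coch i 0)) (Inl \<zero>\<^bsub>Coch i 0\<^esub>)
         (\<lambda>x y. Inl (projl x \<oplus>\<^bsub>Coch i 0\<^esub> projl y)) (\<lambda>c x. Inl (c \<odot>\<^bsub>Coch i 0\<^esub> projl x))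
     else (let p = nat (- i - 1) in
       vspace (Inr ` carrier (Ch p)) (Inr \<zero>\<^bsub>Ch p\<^esub>)
         (\<lambda>x y. Inr (projr x \<oplus>\<^bsub>Ch p\<^esub> projr y)) (\<lambda>c x. Inr (c \<odot>\<^bsub>Ch p\<^esub> projr x))))"

definition d_Tate where
  "d_Tate i x = (if i \<ge> 0 then Inl (delta i 0 (projl x))
     else if i = -1 then Inl (mu (projr x))
     else Inr (hoch_b (nat (- i - 1)) (projr x)))"


section \<open>The map from the Tate-Hochschild complex to the singular Hochschild complex\<close>

text \<open>\<open>x \<otimes> y \<mapsto> x \<otimes> s a\<^sub>1 \<otimes> \<dots> \<otimes> s a\<^sub>p \<otimes> s y\<close>, for a list \<open>as\<close> of length \<open>p\<close>\<close>

definition insert_between where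
  "insert_between as = the_linear_map K AA (Omega (length as + 1))
     (\<lambda>f. \<forall>x\<in>carrier A. \<forall>y\<in>carrier A. f (pure K A A x y) = om (x # as @ [y]))"

definition iota_neg where
  "iota_neg p = the_linear_map K (Ch p) (Omega (p + 1))
     (\<lambda>f. \<forall>w\<in>carrier Adual. \<forall>as\<in>words A p. f (ch w as) = insert_between as w)"

definition iota where
  "iota i x = (if i \<ge> 0 then colim_in (Coch i) (theta i) 0 (projl x)
     else (let p = nat (- i - 1) in
       colim_in (Coch i) (theta i) (p + 1) (elem_cochain (p + 1) (iota_neg p (projr x)))))"

end

end

theory Submission
  imports Defs
begin

text \<open>
  Every map here is determined by a multilinear function on words in \<open>A\<close> that vanishes as soon as
  an entry of a slot in \<open>s A\<close>-bar is the unit. On words, all the differentials and the right action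
  on \<open>Omega p\<close> come from a single operator, the dual of the differential of the unreduced bar
  complex, and the identities between them reduce to its square being zero.

  Since \<open>A\<close> is not the ground field, the maps \<open>theta\<close> are injective (unless \<open>A = 0\<close>), and so is
  \<open>iota\<close>: an element of the dual that dies in \<open>A \<otimes> A\<close>-bar has the form \<open>x \<otimes> 1\<close> with
  \<open>ax \<otimes> 1 = x \<otimes> a\<close> for all \<open>a\<close>, and \<open>a\<close> outside the ground field gives \<open>x = 0\<close>; splittings of
  vector spaces carry this over to the chains. The differential of a chain, taken in the singular
  complex, lies in the image of \<open>iota\<close>; by injectivity this defines the differentials of the
  Tate-Hochschild complex and gives that their composites vanish.
\<close>

section \<open>Linear maps\<close>

text \<open>The hypothesis is essential: over \<open>A\<close> = \<open>K\<close> the space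
  \<open>Abar\<close> is 0, so \<open>Omega p\<close> vanishes for p > 0 and the whole singular
  complex is zero, while the Tate complex still has \<open>A\<close> in degree 0. All maps are given
  by definite descriptions from their values on generators, and each description owes a proof that
  these values are consistent. Functions of words in \<open>A\<close> reduce this debt to two
  checks, multilinearity and vanishing on units, both of which are inherited through
  \<open>bar_d\<close>. For \<open>hoch_b\<close> and \<open>mu\<close> not even these checks are
  made: the required map is obtained by factoring a map that already exists through an injective
  one, which also makes compatibility with \<open>iota\<close> hold by construction. The splitting
  used for the chains is a linear retraction of \<open>insert_between []\<close>. It need not
  respect any bimodule structure, since it is applied to the outer two letters of a word only. Its
  existence in arbitrary dimension, like that of the functionals detecting elements outside the
  ground field, is where Zorn's lemma and division in \<open>K\<close> enter.\<close>

lemma vspace_simps [simp]: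
  "carrier (vspace C z a s) = C" "zero (vspace C z a s) = z"
  "add (vspace C z a s) = a" "smult (vspace C z a s) = s"
  by (simp_all add: vspace_def)

lemma linear_mapI:
  assumes "\<And>x. x \<in> carrier V \<Longrightarrow> f x \<in> carrier W"
    and "\<And>x y. x \<in> carrier V \<Longrightarrow> y \<in> carrier V \<Longrightarrow> f (x \<oplus>\<^bsub>V\<^esub> y) = f x \<oplus>\<^bsub>W\<^esub> f y"
    and "\<And>c x. c \<in> carrier K \<Longrightarrow> x \<in> carrier V \<Longrightarrow> f (c \<odot>\<^bsub>V\<^esub> x) = c \<odot>\<^bsub>W\<^esub> f x"
  shows "linear_map K V W f"
  using assms by (auto simp: linear_map_def)

lemma linear_map_closed: "linear_map K V W f \<Longrightarrow> x \<in> carrier V \<Longrightarrow> f x \<in> carrier W"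
  by (auto simp: linear_map_def)

lemma linear_map_add:
  "linear_map K V W f \<Longrightarrow> x \<in> carrier V \<Longrightarrow> y \<in> carrier V \<Longrightarrow> f (x \<oplus>\<^bsub>V\<^esub> y) = f x \<oplus>\<^bsub>W\<^esub> f y"
  by (auto simp: linear_map_def)

lemma linear_map_smult:
  "linear_map K V W f \<Longrightarrow> c \<in> carrier K \<Longrightarrow> x \<in> carrier V \<Longrightarrow> f (c \<odot>\<^bsub>V\<^esub> x) = c \<odot>\<^bsub>W\<^esub> f x"
  by (auto simp: linear_map_def)

lemma module_abelian_group: "module K V \<Longrightarrow> abelian_group V"
  by (simp add: module_def)

lemma module_a_closed:
  "module K V \<Longrightarrow> x \<in> carrier V \<Longrightarrow> y \<in> carrier V \<Longrightarrow> x \<oplus>\<^bsub>V\<^esub> y \<in> carrier V"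
  by (simp add: module_abelian_group abelian_groupE(1))

lemma module_zero_closed: "module K V \<Longrightarrow> \<zero>\<^bsub>V\<^esub> \<in> carrier V"
  by (simp add: module_abelian_group abelian_groupE(2))

lemma module_a_inv_closed: "module K V \<Longrightarrow> x \<in> carrier V \<Longrightarrow> \<ominus>\<^bsub>V\<^esub> x \<in> carrier V"
  by (simp add: module_abelian_group abelian_group.a_inv_closed)

lemma module_minus_closed:
  "module K V \<Longrightarrow> x \<in> carrier V \<Longrightarrow> y \<in> carrier V \<Longrightarrow> x \<ominus>\<^bsub>V\<^esub> y \<in> carrier V"
  by (simp add: module_abelian_group abelian_group.minus_closed)

lemma linear_map_zero:
  assumes "module K V" "module K W" "linear_map K V W f"
  shows "f \<zero>\<^bsub>V\<^esub> = \<zero>\<^bsub>W\<^esub>"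
proof -
  interpret V: module K V by fact
  interpret W: module K W by fact
  have "f (\<zero>\<^bsub>K\<^esub> \<odot>\<^bsub>V\<^esub> \<zero>\<^bsub>V\<^esub>) = \<zero>\<^bsub>K\<^esub> \<odot>\<^bsub>W\<^esub> f \<zero>\<^bsub>V\<^esub>"
    by (rule linear_map_smult[OF assms(3)]) auto
  then show ?thesis using linear_map_closed[OF assms(3) V.zero_closed] by simp
qed

lemma linear_map_a_inv:
  assumes "module K V" "module K W" "linear_map K V W f" "x \<in> carrier V"
  shows "f (\<ominus>\<^bsub>V\<^esub> x) = \<ominus>\<^bsub>W\<^esub> f x"
proof -
  interpret V: module K V by fact
  interpret W: module K W by fact
  note cl = linear_map_closed[OF assms(3)]
  have "f (\<ominus>\<^bsub>V\<^esub> x) \<oplus>\<^bsub>W\<^esub> f x = \<zero>\<^bsub>W\<^esub>"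
    using linear_map_add[OF assms(3), of "\<ominus>\<^bsub>V\<^esub> x" x] linear_map_zero[OF assms(1-3)] assms(4)
    by (simp add: V.l_neg)
  then show ?thesis using cl assms(4) by (metis W.minus_equality V.a_inv_closed)
qed

lemma linear_map_minus:
  assumes "module K V" "module K W" "linear_map K V W f" "x \<in> carrier V" "y \<in> carrier V"
  shows "f (x \<ominus>\<^bsub>V\<^esub> y) = f x \<ominus>\<^bsub>W\<^esub> f y"
  using assms linear_map_add[OF assms(3), of x "\<ominus>\<^bsub>V\<^esub> y"]
  by (simp add: a_minus_def linear_map_a_inv module_a_inv_closed)

lemma alt_closed: "module K V \<Longrightarrow> x \<in> carrier V \<Longrightarrow> alt V j x \<in> carrier V"
  by (simp add: alt_def module_a_inv_closed)

lemma linear_map_alt: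
  assumes "module K V" "module K W" "linear_map K V W f" "x \<in> carrier V"
  shows "f (alt V j x) = alt W j (f x)"
  using assms by (simp add: alt_def linear_map_a_inv)

lemma linear_map_finsum:
  assumes "module K V" "module K W" "linear_map K V W f" "finite I" "x \<in> I \<rightarrow> carrier V"
  shows "f (\<Oplus>\<^bsub>V\<^esub>i\<in>I. x i) = (\<Oplus>\<^bsub>W\<^esub>i\<in>I. f (x i))"
proof -
  interpret V: module K V by fact
  interpret W: module K W by fact
  show ?thesis using assms(4,5)
  proof (induction I rule: finite_induct)
    case empty
    then show ?case by (simp add: linear_map_zero[OF assms(1-3)])
  next
    case (insert i I)
    then have "(\<lambda>i. f (x i)) \<in> I \<rightarrow> carrier W" "f (x i) \<in> carrier W"
      using linear_map_closed[OF assms(3)] by auto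
    with insert show ?case by (simp add: linear_map_add[OF assms(3)] Pi_def)
  qed
qed

lemma linear_map_compose:
  "linear_map K U V f \<Longrightarrow> linear_map K V W g \<Longrightarrow> linear_map K U W (\<lambda>x. g (f x))"
  by (auto simp: linear_map_def Pi_iff)

lemma linear_map_id: "linear_map K V V (\<lambda>x. x)"
  by (simp add: linear_map_def)

lemma linear_map_cong:
  assumes "module K V" "\<And>x. x \<in> carrier V \<Longrightarrow> f x = g x"
  shows "linear_map K V W f \<longleftrightarrow> linear_map K V W g"
proof -
  interpret V: module K V by fact
  show ?thesis using assms(2) by (auto simp: linear_map_def Pi_iff)
qed

lemma linear_map_plus:
  assumes "module K W" "linear_map K V W f" "linear_map K V W g"
  shows "linear_map K V W (\<lambda>x. f x \<oplus>\<^bsub>W\<^esub> g x)"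
proof -
  interpret W: module K W by fact
  note [simp] = linear_map_closed[OF assms(2)] linear_map_closed[OF assms(3)]
    linear_map_add[OF assms(2)] linear_map_add[OF assms(3)]
    linear_map_smult[OF assms(2)] linear_map_smult[OF assms(3)]
  show ?thesis by (rule linear_mapI) (simp_all add: W.a_ac W.smult_r_distr)
qed

lemma linear_map_const_zero:
  assumes "module K W" shows "linear_map K V W (\<lambda>x. \<zero>\<^bsub>W\<^esub>)"
proof -
  interpret W: module K W by fact
  show ?thesis by (rule linear_mapI) simp_all
qed

lemma linear_map_scale:
  assumes "module K W" "linear_map K V W f" "c \<in> carrier K"
  shows "linear_map K V W (\<lambda>x. c \<odot>\<^bsub>W\<^esub> f x)"
proof -
  interpret W: module K W by fact
  note [simp] = linear_map_closed[OF assms(2)] linear_map_add[OF assms(2)] linear_map_smult[OF assms(2)]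
  show ?thesis using assms(3)
    by (intro linear_mapI) (simp_all add: W.smult_r_distr flip: W.smult_assoc1 add: W.R.m_comm)
qed

lemma linear_map_neg:
  assumes "module K W" "linear_map K V W f"
  shows "linear_map K V W (\<lambda>x. \<ominus>\<^bsub>W\<^esub> f x)"
proof -
  interpret W: module K W by fact
  note [simp] = linear_map_closed[OF assms(2)] linear_map_add[OF assms(2)] linear_map_smult[OF assms(2)]
  show ?thesis
    by (intro linear_mapI) (simp_all add: W.minus_add W.smult_r_minus)
qed

lemma linear_map_diff:
  assumes "module K W" "linear_map K V W f" "linear_map K V W g"
  shows "linear_map K V W (\<lambda>x. f x \<ominus>\<^bsub>W\<^esub> g x)"
  unfolding a_minus_def by (intro linear_map_plus linear_map_neg assms)

lemma linear_map_alt_fun: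
  assumes "module K W" "linear_map K V W f"
  shows "linear_map K V W (\<lambda>x. alt W j (f x))"
  using linear_map_neg[OF assms] assms(2) by (cases "even j") (simp_all add: alt_def)

lemma linear_map_finsum_fun:
  assumes "module K W" "finite I" "\<And>i. i \<in> I \<Longrightarrow> linear_map K V W (f i)"
  shows "linear_map K V W (\<lambda>x. \<Oplus>\<^bsub>W\<^esub>i\<in>I. f i x)"
proof -
  interpret W: module K W by fact
  note [simp] = linear_map_closed[OF assms(3)] linear_map_add[OF assms(3)] linear_map_smult[OF assms(3)]
  show ?thesis
  proof (rule linear_mapI)
    fix x y assume xy: "x \<in> carrier V" "y \<in> carrier V"
    have "(\<Oplus>\<^bsub>W\<^esub>i\<in>I. f i (x \<oplus>\<^bsub>V\<^esub> y)) = (\<Oplus>\<^bsub>W\<^esub>i\<in>I. f i x \<oplus>\<^bsub>W\<^esub> f i y)"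
      using xy by (intro W.finsum_cong') auto
    also have "\<dots> = (\<Oplus>\<^bsub>W\<^esub>i\<in>I. f i x) \<oplus>\<^bsub>W\<^esub> (\<Oplus>\<^bsub>W\<^esub>i\<in>I. f i y)"
      using xy by (intro W.finsum_addf) auto
    finally show "(\<Oplus>\<^bsub>W\<^esub>i\<in>I. f i (x \<oplus>\<^bsub>V\<^esub> y)) = (\<Oplus>\<^bsub>W\<^esub>i\<in>I. f i x) \<oplus>\<^bsub>W\<^esub> (\<Oplus>\<^bsub>W\<^esub>i\<in>I. f i y)" .
  next
    fix c x assume cx: "c \<in> carrier K" "x \<in> carrier V"
    have "(\<Oplus>\<^bsub>W\<^esub>i\<in>I. f i (c \<odot>\<^bsub>V\<^esub> x)) = (\<Oplus>\<^bsub>W\<^esub>i\<in>I. c \<odot>\<^bsub>W\<^esub> f i x)"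
      using cx by (intro W.finsum_cong') auto
    also have "\<dots> = c \<odot>\<^bsub>W\<^esub> (\<Oplus>\<^bsub>W\<^esub>i\<in>I. f i x)"
      using cx by (intro W.finsum_smult_ldistr[symmetric] assms(2)) auto
    finally show "(\<Oplus>\<^bsub>W\<^esub>i\<in>I. f i (c \<odot>\<^bsub>V\<^esub> x)) = c \<odot>\<^bsub>W\<^esub> (\<Oplus>\<^bsub>W\<^esub>i\<in>I. f i x)" .
  qed (auto intro!: W.finsum_closed)
qed

text \<open>This is what makes generators suffice for uniqueness: a submodule containing the
  generators is everything, so linear maps that agree on generators coincide. The extensionality
  lemmas for the tensor spaces below rest on it.\<close>

lemma submodule_equalizer:
  assumes "module K V" "module K W" "linear_map K V W f" "linear_map K V W g"
  shows "submodule {x \<in> carrier V. f x = g x} K V"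
proof -
  interpret V: module K V by fact
  show ?thesis
    by (rule V.submoduleI)
      (auto simp: linear_map_zero[OF assms(1,2)] linear_map_a_inv[OF assms(1,2)] assms(3,4)
        linear_map_add[OF assms(3)] linear_map_add[OF assms(4)]
        linear_map_smult[OF assms(3)] linear_map_smult[OF assms(4)])
qed

lemma submodule_kernel:
  assumes "module K V" "module K W" "linear_map K V W f"
  shows "submodule {x \<in> carrier V. f x = \<zero>\<^bsub>W\<^esub>} K V"
  by (rule submodule_equalizer[OF assms linear_map_const_zero[OF assms(2)]])

lemma submodule_image:
  assumes "module K V" "module K W" "linear_map K V W f"
  shows "submodule (f ` carrier V) K W"
proof -
  interpret V: module K V by fact
  interpret W: module K W by fact
  note cl = linear_map_closed[OF assms(3)]
  show ?thesis
  proof (rule W.submoduleI)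
    show "\<zero>\<^bsub>W\<^esub> \<in> f ` carrier V"
      using linear_map_zero[OF assms] V.zero_closed by (metis imageI)
  next
    fix a assume "a \<in> f ` carrier V"
    then show "\<ominus>\<^bsub>W\<^esub> a \<in> f ` carrier V"
      by (auto simp flip: linear_map_a_inv[OF assms])
  next
    fix a b assume "a \<in> f ` carrier V" "b \<in> f ` carrier V"
    then show "a \<oplus>\<^bsub>W\<^esub> b \<in> f ` carrier V"
      by (auto simp flip: linear_map_add[OF assms(3)])
  next
    fix c b assume "c \<in> carrier K" "b \<in> f ` carrier V"
    then show "c \<odot>\<^bsub>W\<^esub> b \<in> f ` carrier V"
      by (auto simp flip: linear_map_smult[OF assms(3)])
  qed (use cl in auto)
qed

text \<open>Serves arguments by generators: to see that a map sends everything into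
  \<open>N\<close>, it is enough to look at generators of its source.\<close>

lemma submodule_vimage:
  assumes "module K V" "module K W" "linear_map K V W f" "submodule N K W"
  shows "submodule {x \<in> carrier V. f x \<in> N} K V"
proof -
  interpret V: module K V by fact
  interpret W: module K W by fact
  note N = W.submoduleE[OF assms(4)]
  have "\<zero>\<^bsub>W\<^esub> \<in> N"
    using assms(4) by (simp add: submodule_def subgroup_def)
  then show ?thesis
    by (intro V.submoduleI)
      (auto simp: linear_map_zero[OF assms(1-3)] linear_map_a_inv[OF assms(1-3)]
        linear_map_add[OF assms(3)] linear_map_smult[OF assms(3)] N)
qed

lemma inj_on_linear_map:
  assumes "module K V" "module K W" "linear_map K V W f"
    and "\<And>x. x \<in> carrier V \<Longrightarrow> f x = \<zero>\<^bsub>W\<^esub> \<Longrightarrow> x = \<zero>\<^bsub>V\<^esub>"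
  shows "inj_on f (carrier V)"
proof (rule inj_onI)
  interpret V: module K V by fact
  interpret W: module K W by fact
  fix x y assume xy: "x \<in> carrier V" "y \<in> carrier V" "f x = f y"
  then have "f (x \<ominus>\<^bsub>V\<^esub> y) = \<zero>\<^bsub>W\<^esub>"
    using linear_map_closed[OF assms(3)] by (simp add: linear_map_minus[OF assms(1-3)] W.minus_eq W.r_neg)
  then have "x \<ominus>\<^bsub>V\<^esub> y = \<zero>\<^bsub>V\<^esub>" using assms(4) xy by simp
  then show "x = y"
    using V.minus_equality[of x "\<ominus>\<^bsub>V\<^esub> y"] xy by (simp add: V.minus_eq)
qed

lemma inj_on_compose:
  assumes "inj_on f (carrier V)" "inj_on g (carrier W)" "linear_map K V W f"
  shows "inj_on (\<lambda>x. g (f x)) (carrier V)"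
proof (rule inj_onI)
  fix x y assume xy: "x \<in> carrier V" "y \<in> carrier V" "g (f x) = g (f y)"
  then have "f x = f y" by (intro inj_onD[OF assms(2)] linear_map_closed[OF assms(3)])
  then show "x = y" using inj_onD[OF assms(1)] xy by blast
qed

text \<open>The axioms are verified on representatives \<open>h x\<close> and pulled back to
  \<open>V\<close>, so \<open>h\<close> need not be injective. This covers quotient spaces, where
  \<open>h\<close> forms cosets, as well as the tagged copies in the Tate complex, where
  \<open>h\<close> is \<open>Inl\<close> or \<open>Inr\<close>.\<close>

lemma module_transport:
  assumes V: "module K V"
    and onto: "h ` carrier V = C"
    and z: "z = h \<zero>\<^bsub>V\<^esub>"
    and a: "\<And>x y. x \<in> carrier V \<Longrightarrow> y \<in> carrier V \<Longrightarrow> a (h x) (h y) = h (x \<oplus>\<^bsub>V\<^esub> y)"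
    and s: "\<And>c x. c \<in> carrier K \<Longrightarrow> x \<in> carrier V \<Longrightarrow> s c (h x) = h (c \<odot>\<^bsub>V\<^esub> x)"
  shows "module K (vspace C z a s)"
proof -
  interpret V: module K V by fact
  have C: "\<exists>x\<in>carrier V. X = h x" if "X \<in> C" for X using that onto by auto
  have hC: "h x \<in> C" if "x \<in> carrier V" for x using that onto by auto
  show ?thesis
  proof (rule moduleI, goal_cases)
    case 1 show ?case by (rule V.R.is_cring)
  next
    case 2
    show ?case
    proof (rule abelian_groupI, goal_cases)
      case (1 x y) then show ?case by (auto dest!: C simp: a hC)
    next
      case 2 then show ?case by (simp add: z hC)
    next
      case (3 x y z) then show ?case by (auto dest!: C simp: a V.a_assoc)
    next
      case (4 x y) then show ?case by (auto dest!: C simp: a V.a_comm)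
    next
      case (5 x) then show ?case by (auto dest!: C simp: a z)
    next
      case (6 x)
      then obtain u where u: "u \<in> carrier V" "x = h u" by (auto dest!: C)
      have "a (h (\<ominus>\<^bsub>V\<^esub> u)) x = z" using u by (simp add: a z V.l_neg)
      then show ?case using u hC by (intro bexI[of _ "h (\<ominus>\<^bsub>V\<^esub> u)"]) auto
    qed
  next
    case (3 c x) then show ?case by (auto dest!: C simp: s hC)
  next
    case (4 c d x) then show ?case by (auto dest!: C simp: a s V.smult_l_distr)
  next
    case (5 c x y) then show ?case by (auto dest!: C simp: a s V.smult_r_distr)
  next
    case (6 c d x) then show ?case by (auto dest!: C simp: a s V.smult_assoc1)
  next
    case (7 x) then show ?case by (auto dest!: C simp: s)
  qed
qed

lemma Hom_iff:
  "f \<in> carrier (Hom K V W) \<longleftrightarrow> f \<in> extensional (carrier V) \<and> linear_map K V W f"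
  by (simp add: Hom_def)

lemma module_Hom:
  assumes "module K V" "module K W"
  shows "module K (Hom K V W)"
proof -
  interpret V: module K V by fact
  interpret W: module K W by fact
  \<comment> \<open>Operations in \<open>Hom\<close> return restricted functions. \<open>lin\<close>
    settles closure, and \<open>eq\<close> the laws in which a bare element of \<open>Hom\<close>
    stands on one side.\<close>
  have lin: "restrict f (carrier V) \<in> carrier (Hom K V W)" if "linear_map K V W f" for f
    using that linear_map_cong[OF assms(1), of "restrict f (carrier V)" f]
    by (auto simp: Hom_iff)
  note H = Hom_iff linear_map_closed[of K V W] linear_map_plus[OF assms(2)] linear_map_scale[OF assms(2)]
    linear_map_neg[OF assms(2)] linear_map_const_zero[OF assms(2)]
  have eq: "restrict f (carrier V) = g"
    if "g \<in> carrier (Hom K V W)" "\<And>x. x \<in> carrier V \<Longrightarrow> f x = g x" for f g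
    using that by (auto simp: fun_eq_iff extensional_def Hom_iff)
  have ops: "f \<oplus>\<^bsub>Hom K V W\<^esub> g = restrict (\<lambda>x. f x \<oplus>\<^bsub>W\<^esub> g x) (carrier V)"
    "c \<odot>\<^bsub>Hom K V W\<^esub> f = restrict (\<lambda>x. c \<odot>\<^bsub>W\<^esub> f x) (carrier V)"
    "\<zero>\<^bsub>Hom K V W\<^esub> = restrict (\<lambda>x. \<zero>\<^bsub>W\<^esub>) (carrier V)" for f g c
    by (simp_all add: Hom_def)
  show ?thesis
  proof (rule moduleI, goal_cases)
    case 1 show ?case by (rule V.R.is_cring)
  next
    case 2
    show ?case
    proof (rule abelian_groupI, goal_cases)
      case (1 x y) then show ?case unfolding ops by (intro lin) (auto simp: H)
    next
      case 2 then show ?case unfolding ops by (intro lin) (auto simp: H)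
    next
      case (3 x y z) then show ?case unfolding ops
        by (intro restrict_ext) (auto simp: H W.a_assoc)
    next
      case (4 x y) then show ?case unfolding ops by (intro restrict_ext) (auto simp: H W.a_comm)
    next
      case (5 x) then show ?case unfolding ops by (intro eq) (auto simp: H)
    next
      case (6 x)
      then show ?case unfolding ops
        by (intro bexI[of _ "restrict (\<lambda>v. \<ominus>\<^bsub>W\<^esub> x v) (carrier V)"] lin restrict_ext) (auto simp: H W.l_neg)
    qed
  next
    case (3 c x) then show ?case unfolding ops by (intro lin) (auto simp: H)
  next
    case (4 c d x) then show ?case unfolding ops by (intro restrict_ext) (auto simp: H W.smult_l_distr)
  next
    case (5 c x y) then show ?case unfolding ops by (intro restrict_ext) (auto simp: H W.smult_r_distr)
  next
    case (6 c d x) then show ?case unfolding ops by (intro restrict_ext) (auto simp: H W.smult_assoc1)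
  next
    case (7 x) then show ?case unfolding ops by (intro eq) (auto simp: H)
  qed
qed

text \<open>Unpacks a definite description. Any linear map may witness existence: restricting it
  makes it extensional, and \<open>cong\<close> says that \<open>P\<close> only sees values on the
  carrier. Uniqueness is asked pointwise on the carrier, since extensional functions are determined
  there.\<close>

lemma the_linear_map_spec:
  assumes "module K V"
    and ex: "\<exists>h. linear_map K V W h \<and> P h"
    and cong: "\<And>h. P h \<Longrightarrow> P (restrict h (carrier V))"
    and uniq: "\<And>f g x. linear_map K V W f \<Longrightarrow> linear_map K V W g \<Longrightarrow> P f \<Longrightarrow> P g \<Longrightarrow> x \<in> carrier V \<Longrightarrow> f x = g x"
  shows "linear_map K V W (the_linear_map K V W P)" "P (the_linear_map K V W P)"
proof -
  obtain h where h: "linear_map K V W h" "P h" using ex by auto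
  let ?h = "restrict h (carrier V)"
  have "?h \<in> carrier (Hom K V W) \<and> P ?h"
    using h cong linear_map_cong[OF assms(1), of ?h h] by (auto simp: Hom_iff)
  moreover have "f = ?h" if "f \<in> carrier (Hom K V W) \<and> P f" for f
  proof (rule extensionalityI)
    show "f \<in> extensional (carrier V)" using that by (simp add: Hom_iff)
    show "f x = ?h x" if "x \<in> carrier V" for x
      using uniq[of f h x] h that \<open>f \<in> carrier (Hom K V W) \<and> P f\<close> by (simp add: Hom_iff)
  qed simp
  ultimately have "the_linear_map K V W P \<in> carrier (Hom K V W) \<and> P (the_linear_map K V W P)"
    unfolding the_linear_map_def by (rule theI)
  then show "linear_map K V W (the_linear_map K V W P)" "P (the_linear_map K V W P)"
    by (simp_all add: Hom_iff)
qed


section \<open>Quotients, free spaces and presentations\<close>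

lemma submodule_abelian_subgroup:
  assumes "module K V" "submodule N K V"
  shows "abelian_subgroup N V"
  using assms by (intro abelian_subgroupI3 additive_subgroupI)
    (simp_all add: submodule_def module_abelian_group)

lemma coset_eq_iff:
  assumes "module K V" "submodule N K V" "x \<in> carrier V" "y \<in> carrier V"
  shows "N +>\<^bsub>V\<^esub> x = N +>\<^bsub>V\<^esub> y \<longleftrightarrow> x \<ominus>\<^bsub>V\<^esub> y \<in> N"
proof -
  interpret V: module K V by fact
  interpret N: abelian_subgroup N V by (rule submodule_abelian_subgroup[OF assms(1,2)])
  show ?thesis
  proof
    assume "N +>\<^bsub>V\<^esub> x = N +>\<^bsub>V\<^esub> y"
    then have "N +>\<^bsub>V\<^esub> (x \<ominus>\<^bsub>V\<^esub> y) = N"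
      using assms(3,4) N.a_subset by (simp add: V.minus_eq V.a_coset_add_inv2)
    then show "x \<ominus>\<^bsub>V\<^esub> y \<in> N"
      using V.a_coset_join1[OF _ _ N.a_subgroup] assms(3,4) by simp
  next
    assume "x \<ominus>\<^bsub>V\<^esub> y \<in> N"
    then have "N +>\<^bsub>V\<^esub> (x \<ominus>\<^bsub>V\<^esub> y) = N"
      using V.a_coset_join2[OF _ N.a_subgroup] assms(3,4) by simp
    then show "N +>\<^bsub>V\<^esub> x = N +>\<^bsub>V\<^esub> y"
      using assms(3,4) N.a_subset by (simp add: V.minus_eq V.a_coset_add_inv1)
  qed
qed

lemma quot_space_module:
  assumes "module K V" "submodule N K V"
  shows "module K (quot_space V N)"
    and "linear_map K V (quot_space V N) (\<lambda>x. N +>\<^bsub>V\<^esub> x)"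
    and "carrier (quot_space V N) = (\<lambda>x. N +>\<^bsub>V\<^esub> x) ` carrier V"
    and "\<zero>\<^bsub>quot_space V N\<^esub> = N"
proof -
  interpret V: module K V by fact
  interpret N: abelian_subgroup N V by (rule submodule_abelian_subgroup[OF assms])
  note E = V.submoduleE[OF assms(2)]
  let ?s = "\<lambda>c X. \<Union>x\<in>X. N +>\<^bsub>V\<^esub> (c \<odot>\<^bsub>V\<^esub> x)"
  \<comment> \<open>The scalar multiple in \<open>quot_space\<close> is a union over all
    representatives; as \<open>N\<close> is stable under scalars they all yield the same coset, and
    the union collapses to it.\<close>
  have s: "?s c (N +>\<^bsub>V\<^esub> x) = N +>\<^bsub>V\<^esub> (c \<odot>\<^bsub>V\<^esub> x)" if "c \<in> carrier K" "x \<in> carrier V" for c x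
  proof -
    have "N +>\<^bsub>V\<^esub> (c \<odot>\<^bsub>V\<^esub> y) = N +>\<^bsub>V\<^esub> (c \<odot>\<^bsub>V\<^esub> x)" if y: "y \<in> N +>\<^bsub>V\<^esub> x" for y
    proof -
      have yc: "y \<in> carrier V"
        using y V.a_r_coset_subset_G[OF N.a_subset] \<open>x \<in> carrier V\<close> by blast
      have "N +>\<^bsub>V\<^esub> y = N +>\<^bsub>V\<^esub> x"
        using V.a_repr_independence[OF y _ N.a_subgroup] \<open>x \<in> carrier V\<close> by simp
      then have "y \<ominus>\<^bsub>V\<^esub> x \<in> N" using coset_eq_iff[OF assms yc \<open>x \<in> carrier V\<close>] by simp
      then have "c \<odot>\<^bsub>V\<^esub> (y \<ominus>\<^bsub>V\<^esub> x) \<in> N" using E(4) \<open>c \<in> carrier K\<close> by blast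
      then have "c \<odot>\<^bsub>V\<^esub> y \<ominus>\<^bsub>V\<^esub> c \<odot>\<^bsub>V\<^esub> x \<in> N"
        using yc \<open>x \<in> carrier V\<close> \<open>c \<in> carrier K\<close>
        by (simp add: V.minus_eq V.smult_r_distr V.smult_r_minus)
      then show ?thesis
        using coset_eq_iff[OF assms, of "c \<odot>\<^bsub>V\<^esub> y" "c \<odot>\<^bsub>V\<^esub> x"] yc that \<open>c \<in> carrier K\<close> \<open>x \<in> carrier V\<close> by simp
    qed
    moreover have "x \<in> N +>\<^bsub>V\<^esub> x" using that by (rule_tac N.a_rcos_self)
    ultimately show ?thesis by blast
  qed
  have im: "(\<lambda>x. N +>\<^bsub>V\<^esub> x) ` carrier V = a_rcosets\<^bsub>V\<^esub> N"
    by (auto simp: A_RCOSETS_def')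
  have z: "N = N +>\<^bsub>V\<^esub> \<zero>\<^bsub>V\<^esub>" using N.a_subset by simp
  show "module K (quot_space V N)"
    unfolding quot_space_def
    by (rule module_transport[OF assms(1) im z]) (simp_all add: N.a_rcos_sum s)
  show "linear_map K V (quot_space V N) (\<lambda>x. N +>\<^bsub>V\<^esub> x)"
    by (rule linear_mapI) (simp_all add: quot_space_def N.a_rcos_sum s flip: im)
  show "carrier (quot_space V N) = (\<lambda>x. N +>\<^bsub>V\<^esub> x) ` carrier V"
    by (simp add: quot_space_def im)
  show "\<zero>\<^bsub>quot_space V N\<^esub> = N" by (simp add: quot_space_def)
qed

text \<open>\<open>h\<close> evaluates \<open>f\<close> at a preimage picked by \<open>SOME\<close>;
  two preimages differ by an element of the kernel of \<open>p\<close>, on which \<open>f\<close>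
  vanishes, so the choice is immaterial.\<close>

lemma factor_through_surjective:
  assumes "module K V" "module K Q" "module K W"
    and p: "linear_map K V Q p" "carrier Q = p ` carrier V"
    and f: "linear_map K V W f"
    and ker: "\<And>x. x \<in> carrier V \<Longrightarrow> p x = \<zero>\<^bsub>Q\<^esub> \<Longrightarrow> f x = \<zero>\<^bsub>W\<^esub>"
  shows "\<exists>h. linear_map K Q W h \<and> (\<forall>x\<in>carrier V. h (p x) = f x)"
proof -
  interpret V: module K V by fact
  interpret Q: module K Q by fact
  interpret W: module K W by fact
  note pc = linear_map_closed[OF p(1)] and fc = linear_map_closed[OF f]
  define h where "h X = f (SOME x. x \<in> carrier V \<and> p x = X)" for X
  have h: "h (p x) = f x" if x: "x \<in> carrier V" for x
  proof -
    define y where "y = (SOME y. y \<in> carrier V \<and> p y = p x)"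
    have y: "y \<in> carrier V" "p y = p x"
      using someI[of "\<lambda>y. y \<in> carrier V \<and> p y = p x" x] x by (auto simp: y_def)
    have "f (y \<ominus>\<^bsub>V\<^esub> x) = \<zero>\<^bsub>W\<^esub>"
      using x y pc by (intro ker) (simp_all add: linear_map_minus[OF assms(1,2) p(1)] Q.minus_eq Q.r_neg)
    then have "f y \<ominus>\<^bsub>W\<^esub> f x = \<zero>\<^bsub>W\<^esub>"
      using x y by (simp add: linear_map_minus[OF assms(1,3) f])
    then have "f y = f x"
      using W.minus_equality[of "f y" "\<ominus>\<^bsub>W\<^esub> f x"] x y fc by (simp add: W.minus_eq)
    then show ?thesis by (simp add: h_def y_def)
  qed
  have Q: "\<exists>x\<in>carrier V. X = p x" if "X \<in> carrier Q" for X using that p(2) by auto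
  have "linear_map K Q W h"
  proof (rule linear_mapI)
    fix X assume "X \<in> carrier Q" then show "h X \<in> carrier W" using Q h fc by force
  next
    fix X Y assume "X \<in> carrier Q" "Y \<in> carrier Q"
    then obtain x y where "x \<in> carrier V" "y \<in> carrier V" "X = p x" "Y = p y" using Q by metis
    then show "h (X \<oplus>\<^bsub>Q\<^esub> Y) = h X \<oplus>\<^bsub>W\<^esub> h Y"
      using h by (simp add: linear_map_add[OF f] flip: linear_map_add[OF p(1)])
  next
    fix c X assume "c \<in> carrier K" "X \<in> carrier Q"
    then obtain x where "x \<in> carrier V" "X = p x" using Q by metis
    then show "h (c \<odot>\<^bsub>Q\<^esub> X) = c \<odot>\<^bsub>W\<^esub> h X"
      using h \<open>c \<in> carrier K\<close> by (simp add: linear_map_smult[OF f] flip: linear_map_smult[OF p(1)])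
  qed
  with h show ?thesis by blast
qed

text \<open>Linearity of the lift is forced by injectivity of \<open>T\<close>: both sides of each
  law have the same image. Later this produces the negative Tate differentials, with
  \<open>T\<close> an embedding into cochains.\<close>

lemma factor_through_injective:
  assumes "module K U" "module K V" "module K Z"
    and T: "linear_map K V Z T" "inj_on T (carrier V)"
    and S: "linear_map K U Z S"
    and img: "\<And>x. x \<in> carrier U \<Longrightarrow> S x \<in> T ` carrier V"
  shows "\<exists>h. linear_map K U V h \<and> (\<forall>x\<in>carrier U. T (h x) = S x)"
proof -
  interpret U: module K U by fact
  interpret V: module K V by fact
  define h where "h x = inv_into (carrier V) T (S x)" for x
  have h: "h x \<in> carrier V" "T (h x) = S x" if "x \<in> carrier U" for x
    using inv_into_into[OF img[OF that]] f_inv_into_f[OF img[OF that]] by (simp_all add: h_def)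
  have "linear_map K U V h"
  proof (rule linear_mapI)
    fix x y assume xy: "x \<in> carrier U" "y \<in> carrier U"
    show "h (x \<oplus>\<^bsub>U\<^esub> y) = h x \<oplus>\<^bsub>V\<^esub> h y"
      by (rule inj_onD[OF T(2)]) (use xy h in \<open>simp_all add: linear_map_add[OF T(1)] linear_map_add[OF S]\<close>)
  next
    fix c x assume xy: "c \<in> carrier K" "x \<in> carrier U"
    show "h (c \<odot>\<^bsub>U\<^esub> x) = c \<odot>\<^bsub>V\<^esub> h x"
      by (rule inj_onD[OF T(2)]) (use xy h in \<open>simp_all add: linear_map_smult[OF T(1)] linear_map_smult[OF S]\<close>)
  qed (rule h)
  with h show ?thesis by blast
qed

lemma span_of:
  assumes "module K V" "S \<subseteq> carrier V"
  shows "submodule (span_of K V S) K V" "S \<subseteq> span_of K V S"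
    and "\<And>N. submodule N K V \<Longrightarrow> S \<subseteq> N \<Longrightarrow> span_of K V S \<subseteq> N"
proof -
  interpret V: module K V by fact
  have car: "submodule (carrier V) K V" by (rule V.carrier_is_submodule)
  have z: "\<zero>\<^bsub>V\<^esub> \<in> N" if "submodule N K V" for N
    using that by (simp add: submodule_def subgroup_def)
  show "submodule (span_of K V S) K V"
  proof (rule V.submoduleI)
    show "span_of K V S \<subseteq> carrier V" using car assms(2) by (auto simp: span_of_def)
  qed (auto simp: span_of_def z V.submoduleE)
qed (auto simp: span_of_def)

lemma free_space_simps:
  "f \<in> carrier (free_space K X) \<longleftrightarrow>
     range f \<subseteq> carrier K \<and> {x. f x \<noteq> \<zero>\<^bsub>K\<^esub>} \<subseteq> X \<and> finite {x. f x \<noteq> \<zero>\<^bsub>K\<^esub>}"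
  "\<zero>\<^bsub>free_space K X\<^esub> = (\<lambda>_. \<zero>\<^bsub>K\<^esub>)"
  "f \<oplus>\<^bsub>free_space K X\<^esub> g = (\<lambda>x. f x \<oplus>\<^bsub>K\<^esub> g x)"
  "c \<odot>\<^bsub>free_space K X\<^esub> f = (\<lambda>x. c \<otimes>\<^bsub>K\<^esub> f x)"
  by (simp_all add: free_space_def)

lemma free_space_module:
  assumes "cring K" shows "module K (free_space K X)"
proof -
  interpret K: cring K by fact
  have fin2: "finite {x. f x \<oplus>\<^bsub>K\<^esub> g x \<noteq> \<zero>\<^bsub>K\<^esub>}"
    if "finite {x. f x \<noteq> \<zero>\<^bsub>K\<^esub>}" "finite {x. g x \<noteq> \<zero>\<^bsub>K\<^esub>}" for f g :: "'c \<Rightarrow> 'a"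
    by (rule finite_subset[of _ "{x. f x \<noteq> \<zero>\<^bsub>K\<^esub>} \<union> {x. g x \<noteq> \<zero>\<^bsub>K\<^esub>}"]) (use that in auto)
  have fin1: "finite {x. c \<otimes>\<^bsub>K\<^esub> f x \<noteq> \<zero>\<^bsub>K\<^esub>}"
    if "finite {x. f x \<noteq> \<zero>\<^bsub>K\<^esub>}" "c \<in> carrier K" for f :: "'c \<Rightarrow> 'a" and c
    by (rule finite_subset[of _ "{x. f x \<noteq> \<zero>\<^bsub>K\<^esub>}"]) (use that in auto)
  have C: "f x \<in> carrier K" if "f \<in> carrier (free_space K X)" for f x
    using that by (auto simp: free_space_simps)
  show ?thesis
  proof (rule moduleI, goal_cases)
    case 1 show ?case by (rule K.is_cring)
  next
    case 2
    show ?case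
    proof (rule abelian_groupI, goal_cases)
      case (1 f g)
      then have "{x. f x \<oplus>\<^bsub>K\<^esub> g x \<noteq> \<zero>\<^bsub>K\<^esub>} \<subseteq> {x. f x \<noteq> \<zero>\<^bsub>K\<^esub>} \<union> {x. g x \<noteq> \<zero>\<^bsub>K\<^esub>}"
        "{x. f x \<noteq> \<zero>\<^bsub>K\<^esub>} \<subseteq> X" "{x. g x \<noteq> \<zero>\<^bsub>K\<^esub>} \<subseteq> X"
        "finite {x. f x \<oplus>\<^bsub>K\<^esub> g x \<noteq> \<zero>\<^bsub>K\<^esub>}"
        by (auto simp: free_space_simps intro: fin2)
      then show ?case using C[OF 1(1)] C[OF 1(2)] by (auto simp: free_space_simps)
    next
      case 2 then show ?case by (auto simp: free_space_simps)
    next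
      case (3 x y z) from C[OF this(1)] C[OF this(2)] C[OF this(3)] show ?case
        by (auto simp: free_space_simps K.a_assoc)
    next
      case (4 x y) from C[OF this(1)] C[OF this(2)] show ?case by (auto simp: free_space_simps K.a_comm)
    next
      case (5 x) from C[OF this] show ?case by (auto simp: free_space_simps)
    next
      case (6 f)
      have "(\<lambda>x. \<ominus>\<^bsub>K\<^esub> f x) \<in> carrier (free_space K X)"
        using 6 C[OF 6] by (auto simp: free_space_simps elim!: finite_subset[rotated])
      then show ?case
        using C[OF 6] by (intro bexI[of _ "\<lambda>x. \<ominus>\<^bsub>K\<^esub> f x"]) (auto simp: free_space_simps K.l_neg)
    qed
  next
    case (3 c f)
    then have "{x. c \<otimes>\<^bsub>K\<^esub> f x \<noteq> \<zero>\<^bsub>K\<^esub>} \<subseteq> {x. f x \<noteq> \<zero>\<^bsub>K\<^esub>}"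
      "{x. f x \<noteq> \<zero>\<^bsub>K\<^esub>} \<subseteq> X" "finite {x. c \<otimes>\<^bsub>K\<^esub> f x \<noteq> \<zero>\<^bsub>K\<^esub>}"
      by (auto simp: free_space_simps intro: fin1)
    then show ?case using C[OF 3(2)] 3(1) by (auto simp: free_space_simps)
  next
    case (4 c d x) from C[OF this(3)] this(1,2) show ?case by (auto simp: free_space_simps K.l_distr)
  next
    case (5 c x y) from C[OF this(2)] C[OF this(3)] this(1) show ?case by (auto simp: free_space_simps K.r_distr)
  next
    case (6 c d x) from C[OF this(3)] this(1,2) show ?case by (auto simp: free_space_simps K.m_assoc)
  next
    case (7 x) from C[OF this] show ?case by (auto simp: free_space_simps)
  qed
qed

lemma gen_closed:
  assumes "cring K" "x \<in> X" shows "gen K x \<in> carrier (free_space K X)"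
proof -
  interpret K: cring K by fact
  have "finite {y. gen K x y \<noteq> \<zero>\<^bsub>K\<^esub>}"
    by (rule finite_subset[of _ "{x}"]) (auto simp: gen_def)
  then show ?thesis using assms(2) by (auto simp: free_space_simps gen_def)
qed

text \<open>Induction on the finite support: setting one value of \<open>f\<close> to zero removes
  one point from the support and subtracts a multiple of a generator.\<close>

lemma free_space_generated:
  assumes "cring K" "submodule M K (free_space K X)" "\<And>x. x \<in> X \<Longrightarrow> gen K x \<in> M"
    and f: "f \<in> carrier (free_space K X)"
  shows "f \<in> M"
proof -
  interpret K: cring K by fact
  interpret F: module K "free_space K X" by (rule free_space_module[OF assms(1)])
  note M = F.submoduleE[OF assms(2)]
  have z: "\<zero>\<^bsub>free_space K X\<^esub> \<in> M" using assms(2) by (simp add: submodule_def subgroup_def)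
  have "finite S \<Longrightarrow> f \<in> carrier (free_space K X) \<Longrightarrow> {x. f x \<noteq> \<zero>\<^bsub>K\<^esub>} = S \<Longrightarrow> f \<in> M" for S f
  proof (induction S arbitrary: f rule: finite_induct)
    case empty
    then have "f = \<zero>\<^bsub>free_space K X\<^esub>" by (auto simp: free_space_simps)
    then show ?case using z by simp
  next
    case (insert x S)
    then have fx: "f x \<in> carrier K" "f y \<in> carrier K" for y by (auto simp: free_space_simps)
    have x: "x \<in> X" using insert.prems by (auto simp: free_space_simps)
    let ?g = "f(x := \<zero>\<^bsub>K\<^esub>)"
    have sg: "{y. ?g y \<noteq> \<zero>\<^bsub>K\<^esub>} = S" using insert by auto
    have "?g \<in> carrier (free_space K X)"
      using insert.prems sg insert.hyps by (auto simp: free_space_simps)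
    then have "?g \<in> M" using sg by (rule insert.IH)
    moreover have "f x \<odot>\<^bsub>free_space K X\<^esub> gen K x \<in> M" using M(4) fx assms(3)[OF x] by blast
    ultimately have "f x \<odot>\<^bsub>free_space K X\<^esub> gen K x \<oplus>\<^bsub>free_space K X\<^esub> ?g \<in> M" using M(5) by blast
    moreover have "f x \<odot>\<^bsub>free_space K X\<^esub> gen K x \<oplus>\<^bsub>free_space K X\<^esub> ?g = f"
      using fx by (auto simp: free_space_simps gen_def)
    ultimately show ?case by simp
  qed
  then show ?thesis using f by (auto simp: free_space_simps)
qed

lemma free_space_lift:
  assumes "module K W" "\<And>x. x \<in> X \<Longrightarrow> \<phi> x \<in> carrier W"
  shows "\<exists>h. linear_map K (free_space K X) W h \<and> (\<forall>x\<in>X. h (gen K x) = \<phi> x)"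
proof -
  interpret W: module K W by fact
  let ?F = "free_space K X"
  define h where "h f = (\<Oplus>\<^bsub>W\<^esub>x\<in>{x. f x \<noteq> \<zero>\<^bsub>K\<^esub>}. f x \<odot>\<^bsub>W\<^esub> \<phi> x)" for f
  have C: "f x \<in> carrier K" if "f \<in> carrier ?F" for f x
    using that by (auto simp: free_space_simps)
  \<comment> \<open>The sum defining \<open>h\<close> may be taken over any finite part of
    \<open>X\<close> that contains the support. This gives \<open>f\<close>, \<open>g\<close> and
    their sum a common index set, so cancellation in the support of the sum need not be
    tracked.\<close>
  have hS: "h f = (\<Oplus>\<^bsub>W\<^esub>x\<in>S. f x \<odot>\<^bsub>W\<^esub> \<phi> x)"
    if "f \<in> carrier ?F" "finite S" "{x. f x \<noteq> \<zero>\<^bsub>K\<^esub>} \<subseteq> S" "S \<subseteq> X" for f S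
    unfolding h_def
    by (rule W.add.finprod_mono_neutral_cong_left) (use that assms(2) C[OF that(1)] in auto)
  have "linear_map K ?F W h"
  proof (rule linear_mapI)
    fix f assume "f \<in> carrier ?F"
    then have "{x. f x \<noteq> \<zero>\<^bsub>K\<^esub>} \<subseteq> X" "\<And>x. f x \<in> carrier K"
      using C by (auto simp: free_space_simps)
    then show "h f \<in> carrier W"
      unfolding h_def using assms(2) by (intro W.finsum_closed) auto
  next
    fix f g assume fg: "f \<in> carrier ?F" "g \<in> carrier ?F"
    let ?S = "{x. f x \<noteq> \<zero>\<^bsub>K\<^esub>} \<union> {x. g x \<noteq> \<zero>\<^bsub>K\<^esub>}"
    have S: "finite ?S" "?S \<subseteq> X" using fg by (auto simp: free_space_simps)
    have fg': "f \<oplus>\<^bsub>?F\<^esub> g \<in> carrier ?F"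
      using module_a_closed[OF free_space_module[OF W.R.is_cring]] fg by blast
    have "h (f \<oplus>\<^bsub>?F\<^esub> g) = (\<Oplus>\<^bsub>W\<^esub>x\<in>?S. (f x \<oplus>\<^bsub>K\<^esub> g x) \<odot>\<^bsub>W\<^esub> \<phi> x)"
    proof -
      have "{x. (f \<oplus>\<^bsub>?F\<^esub> g) x \<noteq> \<zero>\<^bsub>K\<^esub>} \<subseteq> ?S" by (auto simp: free_space_simps)
      from hS[OF fg' S(1) this S(2)] show ?thesis by (simp add: free_space_simps)
    qed
    also have "\<dots> = (\<Oplus>\<^bsub>W\<^esub>x\<in>?S. f x \<odot>\<^bsub>W\<^esub> \<phi> x \<oplus>\<^bsub>W\<^esub> g x \<odot>\<^bsub>W\<^esub> \<phi> x)"
      using S(2) assms(2) C[OF fg(1)] C[OF fg(2)]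
      by (intro W.finsum_cong') (auto simp: W.smult_l_distr)
    also have "\<dots> = (\<Oplus>\<^bsub>W\<^esub>x\<in>?S. f x \<odot>\<^bsub>W\<^esub> \<phi> x) \<oplus>\<^bsub>W\<^esub> (\<Oplus>\<^bsub>W\<^esub>x\<in>?S. g x \<odot>\<^bsub>W\<^esub> \<phi> x)"
      using S(2) assms(2) C[OF fg(1)] C[OF fg(2)] by (intro W.finsum_addf) auto
    finally show "h (f \<oplus>\<^bsub>?F\<^esub> g) = h f \<oplus>\<^bsub>W\<^esub> h g"
      using hS[OF fg(1) S(1) _ S(2)] hS[OF fg(2) S(1) _ S(2)] by simp
  next
    fix c f assume c: "c \<in> carrier K" and f: "f \<in> carrier ?F"
    let ?S = "{x. f x \<noteq> \<zero>\<^bsub>K\<^esub>}"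
    have S: "finite ?S" "?S \<subseteq> X" using f by (auto simp: free_space_simps)
    have cf: "c \<odot>\<^bsub>?F\<^esub> f \<in> carrier ?F"
      using module.smult_closed[OF free_space_module[OF W.R.is_cring]] f c by blast
    have "h (c \<odot>\<^bsub>?F\<^esub> f) = (\<Oplus>\<^bsub>W\<^esub>x\<in>?S. (c \<otimes>\<^bsub>K\<^esub> f x) \<odot>\<^bsub>W\<^esub> \<phi> x)"
    proof -
      have "{x. (c \<odot>\<^bsub>?F\<^esub> f) x \<noteq> \<zero>\<^bsub>K\<^esub>} \<subseteq> ?S" using c by (auto simp: free_space_simps)
      from hS[OF cf S(1) this S(2)] show ?thesis by (simp add: free_space_simps)
    qed
    also have "\<dots> = (\<Oplus>\<^bsub>W\<^esub>x\<in>?S. c \<odot>\<^bsub>W\<^esub> (f x \<odot>\<^bsub>W\<^esub> \<phi> x))"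
      using S(2) assms(2) C[OF f] c by (intro W.finsum_cong') (auto simp: W.smult_assoc1)
    also have "\<dots> = c \<odot>\<^bsub>W\<^esub> (\<Oplus>\<^bsub>W\<^esub>x\<in>?S. f x \<odot>\<^bsub>W\<^esub> \<phi> x)"
      using S assms(2) C[OF f] c by (intro W.finsum_smult_ldistr[symmetric]) auto
    finally show "h (c \<odot>\<^bsub>?F\<^esub> f) = c \<odot>\<^bsub>W\<^esub> h f"
      by (simp add: h_def)
  qed
  moreover have "h (gen K x) = \<phi> x" if "x \<in> X" for x
  proof -
    have "h (gen K x) = (\<Oplus>\<^bsub>W\<^esub>y\<in>{x}. gen K x y \<odot>\<^bsub>W\<^esub> \<phi> y)"
      using that by (intro hS gen_closed W.R.is_cring) (auto simp: gen_def)
    then show ?thesis using that assms(2) by (simp add: gen_def)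
  qed
  ultimately show ?thesis by blast
qed

text \<open>Tensor products and tensor powers are both free spaces modulo the span of relations and
  are treated at once here; \<open>g\<close> sends a generator to its class.\<close>

locale presentation =
  fixes K :: "('k, 'c) ring_scheme" and X :: "'x set" and R :: "('x \<Rightarrow> 'k) set"
    and F and N and Q and g
  assumes F_def: "F = free_space K X" and N_def: "N = span_of K F R" and Q_def: "Q = quot_space F N"
    and g_def: "g = (\<lambda>x. N +>\<^bsub>F\<^esub> gen K x)"
    and K: "cring K" and R: "R \<subseteq> carrier F"
begin

lemma F_module: "module K F"
  using free_space_module[OF K] by (simp add: F_def)

lemma N_submodule: "submodule N K F"
  using span_of(1)[OF F_module R] by (simp add: N_def)

lemmas Q_props = quot_space_module[OF F_module N_submodule, folded Q_def]

lemma g_closed: "x \<in> X \<Longrightarrow> g x \<in> carrier Q"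
  using gen_closed[OF K, of x X] linear_map_closed[OF Q_props(2)] by (simp add: g_def F_def)

lemma relation_eq:
  assumes "u \<ominus>\<^bsub>F\<^esub> v \<in> R" "u \<in> carrier F" "v \<in> carrier F"
  shows "N +>\<^bsub>F\<^esub> u = N +>\<^bsub>F\<^esub> v"
  using span_of(2)[OF F_module R] assms coset_eq_iff[OF F_module N_submodule assms(2,3)]
  by (auto simp: N_def)

lemma generated:
  assumes "submodule M K Q" "\<And>x. x \<in> X \<Longrightarrow> g x \<in> M"
  shows "carrier Q \<subseteq> M"
proof -
  let ?M = "{x \<in> carrier F. N +>\<^bsub>F\<^esub> x \<in> M}"
  have "submodule ?M K F"
    by (rule submodule_vimage[OF F_module Q_props(1,2) assms(1)])
  then have "f \<in> ?M" if "f \<in> carrier F" for f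
    using free_space_generated[OF K, of ?M X f] that assms(2) gen_closed[OF K, of _ X]
    by (auto simp: F_def g_def)
  then show ?thesis by (auto simp: Q_props(3))
qed

text \<open>\<open>rel\<close> is demanded for every linear extension \<open>h\<close> of \<phi>, so
  an instance can expand \<open>h r\<close> by linearity alone, with no knowledge of how the
  extension was built.\<close>

lemma lift:
  assumes W: "module K W" and \<phi>: "\<And>x. x \<in> X \<Longrightarrow> \<phi> x \<in> carrier W"
    and rel: "\<And>h r. linear_map K F W h \<Longrightarrow> (\<And>x. x \<in> X \<Longrightarrow> h (gen K x) = \<phi> x) \<Longrightarrow> r \<in> R \<Longrightarrow> h r = \<zero>\<^bsub>W\<^esub>"
  shows "\<exists>h. linear_map K Q W h \<and> (\<forall>x\<in>X. h (g x) = \<phi> x)"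
proof -
  obtain f where f: "linear_map K F W f" "\<And>x. x \<in> X \<Longrightarrow> f (gen K x) = \<phi> x"
    using free_space_lift[OF W, of X \<phi>] \<phi> by (auto simp: F_def)
  have "R \<subseteq> {x \<in> carrier F. f x = \<zero>\<^bsub>W\<^esub>}"
    using rel[OF f] R by auto
  then have "N \<subseteq> {x \<in> carrier F. f x = \<zero>\<^bsub>W\<^esub>}"
    unfolding N_def
    by (rule span_of(3)[OF F_module R submodule_kernel[OF F_module W f(1)]])
  moreover have "x \<in> N" if "x \<in> carrier F" "N +>\<^bsub>F\<^esub> x = \<zero>\<^bsub>Q\<^esub>" for x
  proof -
    interpret F: module K F by (rule F_module)
    show ?thesis
      using F.a_coset_join1[of N x] that N_submodule by (simp add: Q_props(4) submodule_def)
  qed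
  ultimately obtain h where "linear_map K Q W h" "\<forall>x\<in>carrier F. h (N +>\<^bsub>F\<^esub> x) = f x"
    using factor_through_surjective[OF F_module Q_props(1) W Q_props(2,3) f(1)] by blast
  then show ?thesis using f(2) gen_closed[OF K, of _ X] by (auto simp: g_def F_def)
qed

end


section \<open>Universal properties of tensor products and tensor powers\<close>

definition bilinear where
  "bilinear K V W U \<beta> \<longleftrightarrow>
     (\<forall>y\<in>carrier W. linear_map K V U (\<lambda>x. \<beta> x y)) \<and> (\<forall>x\<in>carrier V. linear_map K W U (\<beta> x))"

lemma tensor_presentation:
  assumes "module K V" "module K W"
  shows "presentation K (carrier V \<times> carrier W) (tensor_rels K V W)
    (free_space K (carrier V \<times> carrier W)) (tensor_null K V W) (tensor K V W)
    (\<lambda>z. pure K V W (fst z) (snd z))"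
proof -
  interpret V: module K V by fact
  interpret W: module K W by fact
  interpret F: module K "free_space K (carrier V \<times> carrier W)"
    by (rule free_space_module[OF V.R.is_cring])
  show ?thesis
  proof
    show "tensor_rels K V W \<subseteq> carrier (free_space K (carrier V \<times> carrier W))"
      by (auto simp: tensor_rels_def Let_def intro!: F.minus_closed F.a_closed F.smult_closed
          gen_closed[OF V.R.is_cring])
  qed (simp_all add: tensor_null_def tensor_def pure_def V.R.is_cring)
qed

lemma tensor_module:
  assumes "module K V" "module K W" shows "module K (tensor K V W)"
  by (rule presentation.Q_props(1)[OF tensor_presentation[OF assms]])

lemma pure_bilinear:
  assumes "module K V" "module K W"
  shows "bilinear K V W (tensor K V W) (pure K V W)"
proof -
  interpret V: module K V by fact
  interpret W: module K W by fact
  let ?F = "free_space K (carrier V \<times> carrier W)"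
  interpret P: presentation K "carrier V \<times> carrier W" "tensor_rels K V W" ?F
    "tensor_null K V W" "tensor K V W" "\<lambda>z. pure K V W (fst z) (snd z)"
    by (rule tensor_presentation[OF assms])
  interpret F: module K ?F by (rule P.F_module)
  note gc = gen_closed[OF V.R.is_cring, of _ "carrier V \<times> carrier W"]
  have p: "tensor_null K V W +>\<^bsub>?F\<^esub> gen K (x, y) = pure K V W x y" for x y
    by (simp add: pure_def)
  note [simp] = linear_map_add[OF P.Q_props(2)] linear_map_smult[OF P.Q_props(2)]
  have "pure K V W (x \<oplus>\<^bsub>V\<^esub> x') y = pure K V W x y \<oplus>\<^bsub>tensor K V W\<^esub> pure K V W x' y"
    if "x \<in> carrier V" "x' \<in> carrier V" "y \<in> carrier W" for x x' y
  proof -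
    have "gen K (x \<oplus>\<^bsub>V\<^esub> x', y) \<ominus>\<^bsub>?F\<^esub> (gen K (x, y) \<oplus>\<^bsub>?F\<^esub> gen K (x', y)) \<in> tensor_rels K V W"
      unfolding tensor_rels_def Let_def using that by blast
    from P.relation_eq[OF this] show ?thesis using that by (simp add: gc p)
  qed
  moreover have "pure K V W x (y \<oplus>\<^bsub>W\<^esub> y') = pure K V W x y \<oplus>\<^bsub>tensor K V W\<^esub> pure K V W x y'"
    if "x \<in> carrier V" "y \<in> carrier W" "y' \<in> carrier W" for x y y'
  proof -
    have "gen K (x, y \<oplus>\<^bsub>W\<^esub> y') \<ominus>\<^bsub>?F\<^esub> (gen K (x, y) \<oplus>\<^bsub>?F\<^esub> gen K (x, y')) \<in> tensor_rels K V W"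
      unfolding tensor_rels_def Let_def using that by blast
    from P.relation_eq[OF this] show ?thesis using that by (simp add: gc p)
  qed
  moreover have "pure K V W (c \<odot>\<^bsub>V\<^esub> x) y = c \<odot>\<^bsub>tensor K V W\<^esub> pure K V W x y"
    if "x \<in> carrier V" "c \<in> carrier K" "y \<in> carrier W" for x c y
  proof -
    have "gen K (c \<odot>\<^bsub>V\<^esub> x, y) \<ominus>\<^bsub>?F\<^esub> c \<odot>\<^bsub>?F\<^esub> gen K (x, y) \<in> tensor_rels K V W"
      unfolding tensor_rels_def Let_def using that by blast
    from P.relation_eq[OF this] show ?thesis using that by (simp add: gc p)
  qed
  moreover have "pure K V W x (c \<odot>\<^bsub>W\<^esub> y) = c \<odot>\<^bsub>tensor K V W\<^esub> pure K V W x y"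
    if "x \<in> carrier V" "c \<in> carrier K" "y \<in> carrier W" for x c y
  proof -
    have "gen K (x, c \<odot>\<^bsub>W\<^esub> y) \<ominus>\<^bsub>?F\<^esub> c \<odot>\<^bsub>?F\<^esub> gen K (x, y) \<in> tensor_rels K V W"
      unfolding tensor_rels_def Let_def using that by blast
    from P.relation_eq[OF this] show ?thesis using that by (simp add: gc p)
  qed
  moreover have "pure K V W x y \<in> carrier (tensor K V W)" if "x \<in> carrier V" "y \<in> carrier W" for x y
    using P.g_closed[of "(x, y)"] that by simp
  ultimately show ?thesis by (auto simp: bilinear_def intro!: linear_mapI)
qed

lemma pure_closed:
  assumes "module K V" "module K W" "x \<in> carrier V" "y \<in> carrier W"
  shows "pure K V W x y \<in> carrier (tensor K V W)"
  using pure_bilinear[OF assms(1,2)] assms(3,4) by (auto simp: bilinear_def dest: linear_map_closed)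

lemma tensor_generated:
  assumes "module K V" "module K W" "submodule M K (tensor K V W)"
    and "\<And>x y. x \<in> carrier V \<Longrightarrow> y \<in> carrier W \<Longrightarrow> pure K V W x y \<in> M"
  shows "carrier (tensor K V W) \<subseteq> M"
  by (rule presentation.generated[OF tensor_presentation[OF assms(1,2)] assms(3)]) (auto intro: assms(4))

lemma tensor_lift:
  assumes "module K V" "module K W" "module K U" and \<beta>: "bilinear K V W U \<beta>"
  shows "\<exists>h. linear_map K (tensor K V W) U h \<and>
    (\<forall>x\<in>carrier V. \<forall>y\<in>carrier W. h (pure K V W x y) = \<beta> x y)"
proof -
  interpret V: module K V by fact
  interpret W: module K W by fact
  interpret U: module K U by fact
  let ?F = "free_space K (carrier V \<times> carrier W)"
  interpret P: presentation K "carrier V \<times> carrier W" "tensor_rels K V W" ?F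
    "tensor_null K V W" "tensor K V W" "\<lambda>z. pure K V W (fst z) (snd z)"
    by (rule tensor_presentation[OF assms(1,2)])
  interpret F: module K ?F by (rule P.F_module)
  note gc = gen_closed[OF V.R.is_cring, of _ "carrier V \<times> carrier W"]
  have l: "linear_map K V U (\<lambda>x. \<beta> x y)" if "y \<in> carrier W" for y
    using \<beta> that by (simp add: bilinear_def)
  have r: "linear_map K W U (\<beta> x)" if "x \<in> carrier V" for x
    using \<beta> that by (simp add: bilinear_def)
  have cl: "\<beta> x y \<in> carrier U" if "x \<in> carrier V" "y \<in> carrier W" for x y
    using linear_map_closed[OF l] that by auto
  note lin = linear_map_add[OF l] linear_map_add[OF r] linear_map_smult[OF l] linear_map_smult[OF r]
  have "\<exists>h. linear_map K (tensor K V W) U h \<and>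
    (\<forall>z\<in>carrier V \<times> carrier W. h (pure K V W (fst z) (snd z)) = \<beta> (fst z) (snd z))"
  proof (rule P.lift[OF assms(3)])
    show "\<beta> (fst z) (snd z) \<in> carrier U" if "z \<in> carrier V \<times> carrier W" for z
      using that cl by auto
  next
    fix h r assume h: "linear_map K ?F U h"
      and hg: "\<And>z. z \<in> carrier V \<times> carrier W \<Longrightarrow> h (gen K z) = \<beta> (fst z) (snd z)"
      and r: "r \<in> tensor_rels K V W"
    note [simp] = linear_map_minus[OF P.F_module assms(3) h] linear_map_add[OF h] linear_map_smult[OF h] gc cl
    have hg': "h (gen K (x, y)) = \<beta> x y" if "x \<in> carrier V" "y \<in> carrier W" for x y
      using hg[of "(x, y)"] that by simp
    show "h r = \<zero>\<^bsub>U\<^esub>"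
      using r by (auto simp: tensor_rels_def Let_def hg' lin U.minus_eq U.r_neg)
  qed
  then show ?thesis by auto
qed

lemma words_iff: "xs \<in> words V n \<longleftrightarrow> length xs = n \<and> set xs \<subseteq> carrier V"
  by (simp add: words_def)

text \<open>Slots are addressed by splitting the word as \<open>us @ x # ws\<close>, the shape used
  in \<open>power_rels\<close>. The separate closure clause matters for n = 0, where there is no
  slot and the value at the empty word would otherwise be unconstrained.\<close>

definition multilinear where
  "multilinear K V n U G \<longleftrightarrow> (\<forall>xs\<in>words V n. G xs \<in> carrier U) \<and>
     (\<forall>us ws. set us \<subseteq> carrier V \<longrightarrow> set ws \<subseteq> carrier V \<longrightarrow> Suc (length us + length ws) = n \<longrightarrow>
        linear_map K V U (\<lambda>x. G (us @ x # ws)))"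

lemma multilinear_closed: "multilinear K V n U G \<Longrightarrow> xs \<in> words V n \<Longrightarrow> G xs \<in> carrier U"
  by (simp add: multilinear_def)

lemma multilinear_slot:
  "multilinear K V n U G \<Longrightarrow> set us \<subseteq> carrier V \<Longrightarrow> set ws \<subseteq> carrier V \<Longrightarrow>
     Suc (length us + length ws) = n \<Longrightarrow> linear_map K V U (\<lambda>x. G (us @ x # ws))"
  by (simp add: multilinear_def)

lemma power_presentation:
  assumes "module K V"
  shows "presentation K (words V n) (power_rels K V n)
    (free_space K (words V n)) (power_null K V n) (tensor_power K V n)
    (\<lambda>xs. power_null K V n +>\<^bsub>free_space K (words V n)\<^esub> gen K xs)"
proof -
  interpret V: module K V by fact
  interpret F: module K "free_space K (words V n)"
    by (rule free_space_module[OF V.R.is_cring])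
  show ?thesis
  proof
    show "power_rels K V n \<subseteq> carrier (free_space K (words V n))"
    proof
      have w: "us @ [z] @ ws \<in> words V n" if "us @ [x] @ ws \<in> words V n" "z \<in> carrier V" for us ws x z
        using that by (auto simp: words_iff)
      have x: "x \<in> carrier V" if "us @ [x] @ ws \<in> words V n" for us ws x
        using that by (auto simp: words_iff)
      fix r assume "r \<in> power_rels K V n"
      then consider
        (add) us ws x y where "r = gen K (us @ [x \<oplus>\<^bsub>V\<^esub> y] @ ws) \<ominus>\<^bsub>free_space K (words V n)\<^esub>
            (gen K (us @ [x] @ ws) \<oplus>\<^bsub>free_space K (words V n)\<^esub> gen K (us @ [y] @ ws))"
          "us @ [x] @ ws \<in> words V n" "y \<in> carrier V"
        | (smult) us ws c x where "r = gen K (us @ [c \<odot>\<^bsub>V\<^esub> x] @ ws) \<ominus>\<^bsub>free_space K (words V n)\<^esub>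
            c \<odot>\<^bsub>free_space K (words V n)\<^esub> gen K (us @ [x] @ ws)"
          "us @ [x] @ ws \<in> words V n" "c \<in> carrier K"
        unfolding power_rels_def Let_def by blast
      then show "r \<in> carrier (free_space K (words V n))"
      proof cases
        case add
        then show ?thesis unfolding add(1)
          by (intro F.minus_closed F.a_closed gen_closed[OF V.R.is_cring] V.a_closed add(3) w[OF add(2)] x[OF add(2)])
      next
        case smult
        then show ?thesis unfolding smult(1)
          by (intro F.minus_closed F.smult_closed gen_closed[OF V.R.is_cring] V.smult_closed smult(3) w[OF smult(2)] x[OF smult(2)])
      qed
    qed
  qed (simp_all add: power_null_def tensor_power_def V.R.is_cring)
qed

lemma power_module:
  assumes "module K V" shows "module K (tensor_power K V n)"
  by (rule presentation.Q_props(1)[OF power_presentation[OF assms]])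

lemma pure_power_multilinear:
  assumes "module K V"
  shows "multilinear K V n (tensor_power K V n) (pure_power K V)"
proof -
  interpret V: module K V by fact
  let ?F = "free_space K (words V n)"
  interpret P: presentation K "words V n" "power_rels K V n" ?F "power_null K V n" "tensor_power K V n"
    "\<lambda>xs. power_null K V n +>\<^bsub>free_space K (words V n)\<^esub> gen K xs"
    by (rule power_presentation[OF assms])
  interpret F: module K ?F by (rule P.F_module)
  note gc = gen_closed[OF V.R.is_cring, of _ "words V n"]
  have p: "power_null K V n +>\<^bsub>?F\<^esub> gen K xs = pure_power K V xs" if "length xs = n" for xs
    using that by (simp add: pure_power_def)
  note [simp] = linear_map_add[OF P.Q_props(2)] linear_map_smult[OF P.Q_props(2)]
  have cl: "pure_power K V xs \<in> carrier (tensor_power K V n)" if "xs \<in> words V n" for xs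
    using P.g_closed[OF that] that by (simp add: p words_iff)
  moreover have "linear_map K V (tensor_power K V n) (\<lambda>x. pure_power K V (us @ x # ws))"
    if us: "set us \<subseteq> carrier V" and ws: "set ws \<subseteq> carrier V" and n: "Suc (length us + length ws) = n" for us ws
  proof (rule linear_mapI)
    have w: "us @ x # ws \<in> words V n" if "x \<in> carrier V" for x using that us ws n by (simp add: words_iff)
    show "pure_power K V (us @ x # ws) \<in> carrier (tensor_power K V n)" if "x \<in> carrier V" for x
      using w[OF that] by (rule cl)
    fix x assume x: "x \<in> carrier V"
    show "pure_power K V (us @ (x \<oplus>\<^bsub>V\<^esub> y) # ws) =
      pure_power K V (us @ x # ws) \<oplus>\<^bsub>tensor_power K V n\<^esub> pure_power K V (us @ y # ws)" if y: "y \<in> carrier V" for y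
    proof -
      have "gen K (us @ (x \<oplus>\<^bsub>V\<^esub> y) # ws) \<ominus>\<^bsub>?F\<^esub> (gen K (us @ x # ws) \<oplus>\<^bsub>?F\<^esub> gen K (us @ y # ws)) \<in> power_rels K V n"
        unfolding power_rels_def Let_def using w[OF x] y by force
      from P.relation_eq[OF this] show ?thesis using x y n by (simp add: gc w p)
    qed
    show "pure_power K V (us @ (c \<odot>\<^bsub>V\<^esub> x) # ws) =
      c \<odot>\<^bsub>tensor_power K V n\<^esub> pure_power K V (us @ x # ws)" if c: "c \<in> carrier K" for c
    proof -
      have "gen K (us @ (c \<odot>\<^bsub>V\<^esub> x) # ws) \<ominus>\<^bsub>?F\<^esub> c \<odot>\<^bsub>?F\<^esub> gen K (us @ x # ws) \<in> power_rels K V n"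
        unfolding power_rels_def Let_def using w[OF x] c by force
      from P.relation_eq[OF this] show ?thesis using x c n by (simp add: gc w p)
    qed
  qed
  ultimately show ?thesis by (simp add: multilinear_def)
qed

lemma power_generated:
  assumes "module K V" "submodule M K (tensor_power K V n)"
    and "\<And>xs. xs \<in> words V n \<Longrightarrow> pure_power K V xs \<in> M"
  shows "carrier (tensor_power K V n) \<subseteq> M"
  by (rule presentation.generated[OF power_presentation[OF assms(1)] assms(2)])
    (use assms(3) in \<open>auto simp: pure_power_def words_iff\<close>)

lemma power_lift:
  assumes "module K V" "module K U" and G: "multilinear K V n U G"
  shows "\<exists>h. linear_map K (tensor_power K V n) U h \<and> (\<forall>xs\<in>words V n. h (pure_power K V xs) = G xs)"
proof -
  interpret V: module K V by fact
  interpret U: module K U by fact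
  let ?F = "free_space K (words V n)"
  interpret P: presentation K "words V n" "power_rels K V n" ?F "power_null K V n" "tensor_power K V n"
    "\<lambda>xs. power_null K V n +>\<^bsub>free_space K (words V n)\<^esub> gen K xs"
    by (rule power_presentation[OF assms(1)])
  interpret F: module K ?F by (rule P.F_module)
  note gc = gen_closed[OF V.R.is_cring, of _ "words V n"]
  note cl = multilinear_closed[OF G] and slot = multilinear_slot[OF G]
  have "\<exists>h. linear_map K (tensor_power K V n) U h \<and>
    (\<forall>xs\<in>words V n. h (power_null K V n +>\<^bsub>?F\<^esub> gen K xs) = G xs)"
  proof (rule P.lift[OF assms(2) cl])
    fix h r assume h: "linear_map K ?F U h"
      and hg: "\<And>z. z \<in> words V n \<Longrightarrow> h (gen K z) = G z"
      and r: "r \<in> power_rels K V n"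
    note [simp] = linear_map_minus[OF P.F_module assms(2) h] linear_map_add[OF h] linear_map_smult[OF h]
    from r consider
      (add) us ws x y where "r = gen K (us @ [x \<oplus>\<^bsub>V\<^esub> y] @ ws) \<ominus>\<^bsub>?F\<^esub> (gen K (us @ [x] @ ws) \<oplus>\<^bsub>?F\<^esub> gen K (us @ [y] @ ws))"
        "us @ [x] @ ws \<in> words V n" "y \<in> carrier V"
      | (smult) us ws c x where "r = gen K (us @ [c \<odot>\<^bsub>V\<^esub> x] @ ws) \<ominus>\<^bsub>?F\<^esub> c \<odot>\<^bsub>?F\<^esub> gen K (us @ [x] @ ws)"
        "us @ [x] @ ws \<in> words V n" "c \<in> carrier K"
      unfolding power_rels_def Let_def by blast
    then show "h r = \<zero>\<^bsub>U\<^esub>"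
    proof cases
      case add
      have w: "us @ z # ws \<in> words V n" if "z \<in> carrier V" for z using add that by (auto simp: words_iff)
      have x: "x \<in> carrier V" and S: "linear_map K V U (\<lambda>x. G (us @ x # ws))"
        using add(2) by (auto simp: words_iff intro!: slot)
      show ?thesis using add(1,3) x
        by (simp add: gc w hg linear_map_add[OF S] cl U.minus_eq U.r_neg)
    next
      case smult
      have w: "us @ z # ws \<in> words V n" if "z \<in> carrier V" for z using smult that by (auto simp: words_iff)
      have x: "x \<in> carrier V" and S: "linear_map K V U (\<lambda>x. G (us @ x # ws))"
        using smult(2) by (auto simp: words_iff intro!: slot)
      show ?thesis using smult(1,3) x
        by (simp add: gc w hg linear_map_smult[OF S] cl U.minus_eq U.r_neg)
    qed
  qed
  then show ?thesis by (auto simp: pure_power_def words_iff)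
qed


section \<open>Complements\<close>

text \<open>The inverse is the projection along a complement of the image, which is a submodule
  maximal among those that meet the image trivially.\<close>

lemma linear_left_inverse:
  assumes "field K" "module K U" "module K V" and j: "linear_map K U V j" "inj_on j (carrier U)"
  shows "\<exists>r. linear_map K V U r \<and> (\<forall>x\<in>carrier U. r (j x) = x)"
proof -
  interpret K: field K by fact
  interpret U: module K U by fact
  interpret V: module K V by fact
  note jc = linear_map_closed[OF j(1)]
  define \<A> where "\<A> = {N. submodule N K V \<and> N \<inter> j ` carrier U \<subseteq> {\<zero>\<^bsub>V\<^esub>}}"
  have zmem: "\<zero>\<^bsub>V\<^esub> \<in> N" if "submodule N K V" for N
    using that by (simp add: submodule_def subgroup_def)
  have "submodule {\<zero>\<^bsub>V\<^esub>} K V" by (rule V.submoduleI) auto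
  then have "{\<zero>\<^bsub>V\<^esub>} \<in> \<A>" by (auto simp: \<A>_def)
  then have ne: "\<A> \<noteq> {}" by blast
  have "\<exists>M\<in>\<A>. \<forall>X\<in>\<A>. M \<subseteq> X \<longrightarrow> X = M"
  proof (rule subset_Zorn_nonempty[OF ne])
    fix \<C> assume C: "\<C> \<noteq> {}" "subset.chain \<A> \<C>"
    have sub: "submodule N K V" "N \<inter> j ` carrier U \<subseteq> {\<zero>\<^bsub>V\<^esub>}" if "N \<in> \<C>" for N
      using C(2) that by (auto simp: subset.chain_def \<A>_def)
    \<comment> \<open>In a chain, any two elements of the union already lie in one member, which is
      what closure under addition needs.\<close>
    have two: "\<exists>N\<in>\<C>. a \<in> N \<and> b \<in> N" if ab: "a \<in> \<Union>\<C>" "b \<in> \<Union>\<C>" for a b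
    proof -
      obtain X Y where XY: "X \<in> \<C>" "a \<in> X" "Y \<in> \<C>" "b \<in> Y" using ab by blast
      then have "X \<subseteq> Y \<or> Y \<subseteq> X" using C(2) unfolding subset_chain_def by blast
      then show ?thesis using XY by blast
    qed
    have "submodule (\<Union>\<C>) K V"
    proof (rule V.submoduleI)
      show "\<Union>\<C> \<subseteq> carrier V" using V.submoduleE(1)[OF sub(1)] by blast
      show "\<zero>\<^bsub>V\<^esub> \<in> \<Union>\<C>" using C(1) zmem sub(1) by blast
      show "\<ominus>\<^bsub>V\<^esub> a \<in> \<Union>\<C>" if "a \<in> \<Union>\<C>" for a using that V.submoduleE(3)[OF sub(1)] by blast
      show "a \<oplus>\<^bsub>V\<^esub> b \<in> \<Union>\<C>" if "a \<in> \<Union>\<C>" "b \<in> \<Union>\<C>" for a b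
        using two[OF that] V.submoduleE(5)[OF sub(1)] by blast
      show "c \<odot>\<^bsub>V\<^esub> a \<in> \<Union>\<C>" if "c \<in> carrier K" "a \<in> \<Union>\<C>" for c a
        using that V.submoduleE(4)[OF sub(1)] by blast
    qed
    moreover have "\<Union>\<C> \<inter> j ` carrier U \<subseteq> {\<zero>\<^bsub>V\<^esub>}" using sub(2) by blast
    ultimately show "\<Union>\<C> \<in> \<A>" by (simp add: \<A>_def)
  qed
  then obtain N where N: "submodule N K V" "N \<inter> j ` carrier U \<subseteq> {\<zero>\<^bsub>V\<^esub>}"
    and max: "\<And>X. X \<in> \<A> \<Longrightarrow> N \<subseteq> X \<Longrightarrow> X = N" by (auto simp: \<A>_def)
  note NE = V.submoduleE[OF N(1)]
  have Nc: "x \<in> carrier V" if "x \<in> N" for x using that NE(1) by blast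
  \<comment> \<open>\<open>N\<close> and the image of \<open>j\<close> together span
    \<open>V\<close>; otherwise enlarging \<open>N\<close> by a missing vector \<open>v\<close>
    would contradict maximality.\<close>
  have decomp: "\<exists>x\<in>carrier U. v \<ominus>\<^bsub>V\<^esub> j x \<in> N" if v: "v \<in> carrier V" for v
  proof (cases "v \<in> N")
    case True
    have "v \<ominus>\<^bsub>V\<^esub> j \<zero>\<^bsub>U\<^esub> = v" using v by (simp add: linear_map_zero[OF assms(2,3) j(1)] V.minus_eq)
    then show ?thesis using True by (intro bexI[of _ "\<zero>\<^bsub>U\<^esub>"]) auto
  next
    case False
    define M where "M = {n \<oplus>\<^bsub>V\<^esub> c \<odot>\<^bsub>V\<^esub> v | n c. n \<in> N \<and> c \<in> carrier K}"
    have M: "submodule M K V"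
    proof (rule V.submoduleI)
      show "M \<subseteq> carrier V" using v Nc by (auto simp: M_def)
      show "\<zero>\<^bsub>V\<^esub> \<in> M" unfolding M_def using zmem[OF N(1)] v
        by (intro CollectI exI[of _ "\<zero>\<^bsub>V\<^esub>"] exI[of _ "\<zero>\<^bsub>K\<^esub>"]) auto
      show "\<ominus>\<^bsub>V\<^esub> a \<in> M" if a: "a \<in> M" for a
      proof -
        obtain n c where "n \<in> N" "c \<in> carrier K" "a = n \<oplus>\<^bsub>V\<^esub> c \<odot>\<^bsub>V\<^esub> v" using a by (auto simp: M_def)
        then have "\<ominus>\<^bsub>V\<^esub> a = \<ominus>\<^bsub>V\<^esub> n \<oplus>\<^bsub>V\<^esub> (\<ominus>\<^bsub>K\<^esub> c) \<odot>\<^bsub>V\<^esub> v" "\<ominus>\<^bsub>V\<^esub> n \<in> N" "\<ominus>\<^bsub>K\<^esub> c \<in> carrier K"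
          using v Nc NE(3) by (auto simp: V.minus_add V.smult_l_minus)
        then show ?thesis unfolding M_def by blast
      qed
      show "a \<oplus>\<^bsub>V\<^esub> b \<in> M" if ab: "a \<in> M" "b \<in> M" for a b
      proof -
        obtain n c m d where "n \<in> N" "c \<in> carrier K" "a = n \<oplus>\<^bsub>V\<^esub> c \<odot>\<^bsub>V\<^esub> v"
          "m \<in> N" "d \<in> carrier K" "b = m \<oplus>\<^bsub>V\<^esub> d \<odot>\<^bsub>V\<^esub> v" using ab by (auto simp: M_def)
        then have "a \<oplus>\<^bsub>V\<^esub> b = (n \<oplus>\<^bsub>V\<^esub> m) \<oplus>\<^bsub>V\<^esub> (c \<oplus>\<^bsub>K\<^esub> d) \<odot>\<^bsub>V\<^esub> v" "n \<oplus>\<^bsub>V\<^esub> m \<in> N" "c \<oplus>\<^bsub>K\<^esub> d \<in> carrier K"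
          using v Nc NE(5) by (auto simp: V.smult_l_distr V.a_ac)
        then show ?thesis unfolding M_def by blast
      qed
      show "d \<odot>\<^bsub>V\<^esub> a \<in> M" if d: "d \<in> carrier K" and a: "a \<in> M" for d a
      proof -
        obtain n c where "n \<in> N" "c \<in> carrier K" "a = n \<oplus>\<^bsub>V\<^esub> c \<odot>\<^bsub>V\<^esub> v" using a by (auto simp: M_def)
        then have "d \<odot>\<^bsub>V\<^esub> a = d \<odot>\<^bsub>V\<^esub> n \<oplus>\<^bsub>V\<^esub> (d \<otimes>\<^bsub>K\<^esub> c) \<odot>\<^bsub>V\<^esub> v" "d \<odot>\<^bsub>V\<^esub> n \<in> N" "d \<otimes>\<^bsub>K\<^esub> c \<in> carrier K"
          using v Nc NE(4) d by (auto simp: V.smult_r_distr V.smult_assoc1)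
        then show ?thesis unfolding M_def by blast
      qed
    qed
    have NM: "N \<subseteq> M"
    proof
      fix n assume "n \<in> N"
      then show "n \<in> M" unfolding M_def using v Nc
        by (intro CollectI exI[of _ n] exI[of _ "\<zero>\<^bsub>K\<^esub>"]) auto
    qed
    have "v \<in> M" unfolding M_def using v zmem[OF N(1)]
      by (intro CollectI exI[of _ "\<zero>\<^bsub>V\<^esub>"] exI[of _ "\<one>\<^bsub>K\<^esub>"]) auto
    then have "M \<notin> \<A>" using max[OF _ NM] False by blast
    then obtain y where y: "y \<in> M" "y \<in> j ` carrier U" "y \<noteq> \<zero>\<^bsub>V\<^esub>"
      using M unfolding \<A>_def by blast
    then obtain n c where nc: "n \<in> N" "c \<in> carrier K" "y = n \<oplus>\<^bsub>V\<^esub> c \<odot>\<^bsub>V\<^esub> v"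
      unfolding M_def by blast
    obtain x where ncx: "n \<in> N" "c \<in> carrier K" "x \<in> carrier U"
      "n \<oplus>\<^bsub>V\<^esub> c \<odot>\<^bsub>V\<^esub> v = j x" "j x \<noteq> \<zero>\<^bsub>V\<^esub>"
      using nc y by force
    \<comment> \<open>If c were 0, the nonzero vector \<open>j x\<close> would lie both in
      \<open>N\<close> and in the image. So c is invertible, \<open>K\<close> being a field, and
      dividing n + c v = j x by c places v in the image modulo \<open>N\<close>.\<close>
    have "c \<noteq> \<zero>\<^bsub>K\<^esub>"
    proof
      assume "c = \<zero>\<^bsub>K\<^esub>"
      then have "n = j x" using ncx(4) v Nc[OF ncx(1)] by simp
      then show False using ncx(1,3,5) N(2) by blast
    qed
    then have cu: "c \<in> Units K" using ncx(2) by (simp add: K.field_Units)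
    let ?d = "inv\<^bsub>K\<^esub> c"
    have d: "?d \<in> carrier K" "?d \<otimes>\<^bsub>K\<^esub> c = \<one>\<^bsub>K\<^esub>"
      using K.Units_inv_closed[OF cu] K.Units_l_inv[OF cu] by simp_all
    have "?d \<odot>\<^bsub>V\<^esub> n \<oplus>\<^bsub>V\<^esub> v = j (?d \<odot>\<^bsub>U\<^esub> x)"
    proof -
      have "j (?d \<odot>\<^bsub>U\<^esub> x) = ?d \<odot>\<^bsub>V\<^esub> (n \<oplus>\<^bsub>V\<^esub> c \<odot>\<^bsub>V\<^esub> v)"
        using ncx d by (simp add: linear_map_smult[OF j(1)])
      also have "\<dots> = ?d \<odot>\<^bsub>V\<^esub> n \<oplus>\<^bsub>V\<^esub> v"
        using ncx(1,2) d v Nc by (simp add: V.smult_r_distr flip: V.smult_assoc1)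
      finally show ?thesis by simp
    qed
    moreover have "v \<ominus>\<^bsub>V\<^esub> (?d \<odot>\<^bsub>V\<^esub> n \<oplus>\<^bsub>V\<^esub> v) = \<ominus>\<^bsub>V\<^esub> (?d \<odot>\<^bsub>V\<^esub> n)"
      using v d Nc[OF ncx(1)] by (simp add: V.minus_eq V.minus_add V.a_ac V.r_neg2 V.r_neg)
    ultimately have "v \<ominus>\<^bsub>V\<^esub> j (?d \<odot>\<^bsub>U\<^esub> x) = \<ominus>\<^bsub>V\<^esub> (?d \<odot>\<^bsub>V\<^esub> n)" by simp
    moreover have "\<ominus>\<^bsub>V\<^esub> (?d \<odot>\<^bsub>V\<^esub> n) \<in> N" using NE(3,4) ncx d by blast
    ultimately show ?thesis using ncx d by (intro bexI[of _ "?d \<odot>\<^bsub>U\<^esub> x"]) auto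
  qed
  \<comment> \<open>Two candidates make \<open>j x\<close> and \<open>j y\<close> congruent modulo
    \<open>N\<close>, so their difference lies in the trivial intersection. Linearity of
    \<open>r\<close> follows from this, since sums and multiples of components are again
    components.\<close>
  have uniq: "x = y" if "x \<in> carrier U" "y \<in> carrier U" "v \<in> carrier V" "v \<ominus>\<^bsub>V\<^esub> j x \<in> N" "v \<ominus>\<^bsub>V\<^esub> j y \<in> N" for x y v
  proof -
    have "\<ominus>\<^bsub>V\<^esub> (v \<ominus>\<^bsub>V\<^esub> j x) \<oplus>\<^bsub>V\<^esub> (v \<ominus>\<^bsub>V\<^esub> j y) \<in> N" using that NE(3,5) by blast
    moreover have "\<ominus>\<^bsub>V\<^esub> (v \<ominus>\<^bsub>V\<^esub> j x) \<oplus>\<^bsub>V\<^esub> (v \<ominus>\<^bsub>V\<^esub> j y) = j (x \<ominus>\<^bsub>U\<^esub> y)"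
      using that jc by (simp add: linear_map_minus[OF assms(2,3) j(1)] V.minus_eq V.minus_add V.a_ac V.r_neg2 V.r_neg1)
    ultimately have "j (x \<ominus>\<^bsub>U\<^esub> y) \<in> N \<inter> j ` carrier U" using that by auto
    then have "j (x \<ominus>\<^bsub>U\<^esub> y) = j \<zero>\<^bsub>U\<^esub>" using N(2) by (auto simp: linear_map_zero[OF assms(2,3) j(1)])
    then have "x \<ominus>\<^bsub>U\<^esub> y = \<zero>\<^bsub>U\<^esub>" using inj_onD[OF j(2)] that by blast
    then show ?thesis using U.minus_equality[of x "\<ominus>\<^bsub>U\<^esub> y"] that by (simp add: U.minus_eq)
  qed
  obtain r where r: "r v \<in> carrier U" "v \<ominus>\<^bsub>V\<^esub> j (r v) \<in> N" if "v \<in> carrier V" for v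
    using decomp by metis
  have "linear_map K V U r"
  proof (rule linear_mapI)
    fix v w assume vw: "v \<in> carrier V" "w \<in> carrier V"
    have "(v \<ominus>\<^bsub>V\<^esub> j (r v)) \<oplus>\<^bsub>V\<^esub> (w \<ominus>\<^bsub>V\<^esub> j (r w)) \<in> N" using r vw NE(5) by blast
    then have "(v \<oplus>\<^bsub>V\<^esub> w) \<ominus>\<^bsub>V\<^esub> j (r v \<oplus>\<^bsub>U\<^esub> r w) \<in> N"
      using vw r jc by (simp add: linear_map_add[OF j(1)] V.minus_eq V.minus_add V.a_ac)
    then show "r (v \<oplus>\<^bsub>V\<^esub> w) = r v \<oplus>\<^bsub>U\<^esub> r w"
      using vw r by (intro uniq[of _ _ "v \<oplus>\<^bsub>V\<^esub> w"]) auto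
  next
    fix c v assume cv: "c \<in> carrier K" "v \<in> carrier V"
    have "c \<odot>\<^bsub>V\<^esub> (v \<ominus>\<^bsub>V\<^esub> j (r v)) \<in> N" using r cv NE(4) by blast
    then have "c \<odot>\<^bsub>V\<^esub> v \<ominus>\<^bsub>V\<^esub> j (c \<odot>\<^bsub>U\<^esub> r v) \<in> N"
      using cv r jc by (simp add: linear_map_smult[OF j(1)] V.minus_eq V.smult_r_distr V.smult_r_minus)
    then show "r (c \<odot>\<^bsub>V\<^esub> v) = c \<odot>\<^bsub>U\<^esub> r v"
      using cv r by (intro uniq[of _ _ "c \<odot>\<^bsub>V\<^esub> v"]) auto
  qed (rule r)
  moreover have "r (j x) = x" if "x \<in> carrier U" for x
    using that r jc zmem[OF N(1)] by (intro uniq[of _ _ "j x"]) (auto simp: V.minus_eq V.r_neg)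
  ultimately show ?thesis by blast
qed

text \<open>A retraction of the line map c to c v is a functional with value 1 at v; the line map is
  injective because v is nonzero. \<open>k\<close> is the field repackaged as a module over
  itself.\<close>

lemma linear_functional_exists:
  assumes "field K" "module K V" "v \<in> carrier V" "v \<noteq> \<zero>\<^bsub>V\<^esub>"
  defines "k \<equiv> vspace (carrier K) \<zero>\<^bsub>K\<^esub> (add K) (mult K)"
  shows "module K k" "\<exists>\<phi>. linear_map K V k \<phi> \<and> \<phi> v = \<one>\<^bsub>K\<^esub>"
proof -
  interpret K: field K by fact
  interpret V: module K V by fact
  show k: "module K k"
    unfolding k_def
    by (rule moduleI, rule K.is_cring, rule abelian_groupI)
      (auto simp: K.a_ac K.m_assoc K.l_distr K.r_distr intro!: bexI[of _ "\<ominus>\<^bsub>K\<^esub> _"] K.l_neg)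
  have j: "linear_map K k V (\<lambda>c. c \<odot>\<^bsub>V\<^esub> v)"
    using assms(3) by (intro linear_mapI) (auto simp: k_def V.smult_l_distr V.smult_assoc1)
  have "inj_on (\<lambda>c. c \<odot>\<^bsub>V\<^esub> v) (carrier k)"
  proof (rule inj_on_linear_map[OF k assms(2) j], rule ccontr)
    fix c assume c: "c \<in> carrier k" "c \<odot>\<^bsub>V\<^esub> v = \<zero>\<^bsub>V\<^esub>" "c \<noteq> \<zero>\<^bsub>k\<^esub>"
    then have u: "c \<in> Units K" by (simp add: K.field_Units k_def)
    then have "v = inv\<^bsub>K\<^esub> c \<odot>\<^bsub>V\<^esub> (c \<odot>\<^bsub>V\<^esub> v)"
      using assms(3) K.Units_closed[OF u] by (simp flip: V.smult_assoc1)
    then show False using c u assms(4) by simp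
  qed
  from linear_left_inverse[OF assms(1) k assms(2) j this]
  obtain r where r: "linear_map K V k r" "\<forall>c\<in>carrier k. r (c \<odot>\<^bsub>V\<^esub> v) = c" by blast
  then have "r v = \<one>\<^bsub>K\<^esub>" using bspec[OF r(2), of "\<one>\<^bsub>K\<^esub>"] assms(3) by (simp add: k_def)
  then show "\<exists>\<phi>. linear_map K V k \<phi> \<and> \<phi> v = \<one>\<^bsub>K\<^esub>" using r(1) by blast
qed


section \<open>Multilinear functions of words and the alternating sum of merges\<close>

lemma words_0 [simp]: "xs \<in> words V 0 \<longleftrightarrow> xs = []"
  by (auto simp: words_iff)

lemma words_Cons [simp]: "x # xs \<in> words V (Suc n) \<longleftrightarrow> x \<in> carrier V \<and> xs \<in> words V n"
  by (auto simp: words_iff)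

lemma words_SucE:
  assumes "xs \<in> words V (Suc n)"
  obtains a as where "xs = a # as" "a \<in> carrier V" "as \<in> words V n"
  using assms by (cases xs) (auto simp: words_iff)

lemma words_snocE:
  assumes "xs \<in> words V (Suc n)"
  obtains as a where "xs = as @ [a]" "a \<in> carrier V" "as \<in> words V n"
  using assms by (cases xs rule: rev_cases) (auto simp: words_iff)

lemma multilinear_0 [simp]: "multilinear K V 0 U G \<longleftrightarrow> G [] \<in> carrier U"
  by (auto simp: multilinear_def)

text \<open>The definition by slots fits the universal property of tensor powers; this recursive
  form fits \<open>bar_d\<close>, which consumes a word from the front.\<close>

lemma multilinear_Suc:
  "multilinear K V (Suc n) U G \<longleftrightarrow>
     (\<forall>l\<in>words V n. linear_map K V U (\<lambda>x. G (x # l))) \<and>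
     (\<forall>a\<in>carrier V. multilinear K V n U (\<lambda>l. G (a # l)))" (is "?L \<longleftrightarrow> ?R")
proof
  assume L: ?L
  have "linear_map K V U (\<lambda>x. G (x # l))" if "l \<in> words V n" for l
    using multilinear_slot[OF L, of "[]" l] that by (simp add: words_iff)
  moreover have "multilinear K V n U (\<lambda>l. G (a # l))" if "a \<in> carrier V" for a
    unfolding multilinear_def
    using multilinear_closed[OF L] multilinear_slot[OF L, of "a # _"] that by auto
  ultimately show ?R by blast
next
  assume R: ?R
  have "G xs \<in> carrier U" if "xs \<in> words V (Suc n)" for xs
    using that R by (auto elim!: words_SucE dest: multilinear_closed)
  moreover have "linear_map K V U (\<lambda>x. G (us @ x # ws))"
    if "set us \<subseteq> carrier V" "set ws \<subseteq> carrier V" "Suc (length us + length ws) = Suc n" for us ws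
  proof (cases us)
    case Nil
    then show ?thesis using R that by (simp add: words_iff)
  next
    case (Cons a us')
    then have "multilinear K V n U (\<lambda>l. G (a # l))" using R that by simp
    from multilinear_slot[OF this, of us' ws] show ?thesis using Cons that by simp
  qed
  ultimately show ?L by (simp add: multilinear_def)
qed

lemma multilinear_cong:
  assumes "module K V" "\<And>xs. xs \<in> words V n \<Longrightarrow> G xs = H xs"
  shows "multilinear K V n U G \<longleftrightarrow> multilinear K V n U H"
proof -
  have "linear_map K V U (\<lambda>x. G (us @ x # ws)) \<longleftrightarrow> linear_map K V U (\<lambda>x. H (us @ x # ws))"
    if "set us \<subseteq> carrier V" "set ws \<subseteq> carrier V" "Suc (length us + length ws) = n" for us ws
    by (rule linear_map_cong[OF assms(1)], rule assms(2)) (use that in \<open>auto simp: words_iff\<close>)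
  then show ?thesis using assms(2) by (auto simp: multilinear_def)
qed

lemma multilinear_minus:
  assumes "module K U" "multilinear K V n U G" "multilinear K V n U H"
  shows "multilinear K V n U (\<lambda>xs. G xs \<ominus>\<^bsub>U\<^esub> H xs)"
  using assms unfolding multilinear_def
  by (auto intro!: module_minus_closed[of K U] linear_map_diff)

lemma multilinear_compose:
  assumes "multilinear K V n U G" "linear_map K U W h"
  shows "multilinear K V n W (\<lambda>xs. h (G xs))"
  using assms unfolding multilinear_def
  by (auto intro!: linear_map_closed[OF assms(2)] linear_map_compose[OF _ assms(2)])

lemma alt_0 [simp]: "alt U 0 x = x"
  by (simp add: alt_def)

lemma alt_Suc:
  "module K U \<Longrightarrow> x \<in> carrier U \<Longrightarrow> alt U (j + 1) x = \<ominus>\<^bsub>U\<^esub> alt U j x"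
  by (auto simp: alt_def abelian_group.minus_minus dest!: module_abelian_group)

lemma alt_alt:
  "module K U \<Longrightarrow> x \<in> carrier U \<Longrightarrow> alt U i (alt U j x) = alt U (i + j) x"
  by (auto simp: alt_def abelian_group.minus_minus dest!: module_abelian_group)

lemma alt_cong: "even i = even j \<Longrightarrow> alt U i x = alt U j x"
  by (simp add: alt_def)

lemma alt_zero: "module K U \<Longrightarrow> alt U j \<zero>\<^bsub>U\<^esub> = \<zero>\<^bsub>U\<^esub>"
proof -
  assume "module K U"
  then interpret U: module K U .
  show ?thesis using U.minus_equality[of "\<zero>\<^bsub>U\<^esub>" "\<zero>\<^bsub>U\<^esub>"] by (simp add: alt_def)
qed

lemma alt_linear: "module K U \<Longrightarrow> linear_map K U U (alt U j)"
  using linear_map_alt_fun[of K U U "\<lambda>x. x" j] by (simp add: linear_map_def)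

lemma module_zero_minus_zero: "module K U \<Longrightarrow> \<zero>\<^bsub>U\<^esub> \<ominus>\<^bsub>U\<^esub> \<zero>\<^bsub>U\<^esub> = \<zero>\<^bsub>U\<^esub>"
  using alt_zero[of K U 1] by (simp add: alt_def a_minus_def module_zero_closed module_abelian_group
      abelian_group.axioms abelian_monoid.l_zero)

text \<open>\<open>bar_d A U G [a\<^sub>0, \<dots>, a\<^sub>n]\<close> is the sum of \<open>(-1)\<^sup>i G [a\<^sub>0, \<dots>, a\<^sub>i a\<^sub>i\<^sub>+\<^sub>1, \<dots>, a\<^sub>n]\<close> over
  \<open>i < n\<close>, that is, the dual of the differential of the unreduced bar complex.\<close>

fun bar_d where
  "bar_d A U G [] = \<zero>\<^bsub>U\<^esub>"
| "bar_d A U G [a] = \<zero>\<^bsub>U\<^esub>"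
| "bar_d A U G (a # b # cs) = G ((a \<otimes>\<^bsub>A\<^esub> b) # cs) \<ominus>\<^bsub>U\<^esub> bar_d A U (\<lambda>l. G (a # l)) (b # cs)"

text \<open>The first and last letters of a word play the role of coefficients, so only a unit
  strictly between other letters has to kill \<open>G\<close>. This is the form of normalization
  that \<open>bar_d\<close> preserves.\<close>

definition interior_normalized where
  "interior_normalized A n U G \<longleftrightarrow> (\<forall>us ws. us \<noteq> [] \<longrightarrow> ws \<noteq> [] \<longrightarrow>
     set us \<subseteq> carrier A \<longrightarrow> set ws \<subseteq> carrier A \<longrightarrow> Suc (length us + length ws) = n \<longrightarrow>
     G (us @ \<one>\<^bsub>A\<^esub> # ws) = \<zero>\<^bsub>U\<^esub>)"

lemma interior_normalizedD:
  "interior_normalized A n U G \<Longrightarrow> us \<noteq> [] \<Longrightarrow> ws \<noteq> [] \<Longrightarrow> set us \<subseteq> carrier A \<Longrightarrow>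
   set ws \<subseteq> carrier A \<Longrightarrow> Suc (length us + length ws) = n \<Longrightarrow> G (us @ \<one>\<^bsub>A\<^esub> # ws) = \<zero>\<^bsub>U\<^esub>"
  by (simp add: interior_normalized_def)

section \<open>The dual bar differential on functions of words\<close>

context k_algebra
begin

lemma A_module: "module K A" ..

lemma bar_d_cong:
  assumes "\<And>l. l \<in> words A n \<Longrightarrow> G l = H l" "xs \<in> words A (Suc n)"
  shows "bar_d A U G xs = bar_d A U H xs"
  using assms
proof (induction n arbitrary: G H xs)
  case 0
  then show ?case by (auto elim!: words_SucE)
next
  case (Suc n)
  from Suc.prems(2) obtain a b cs where xs: "xs = a # b # cs" "a \<in> carrier A" "b \<in> carrier A" "cs \<in> words A n"
    by (auto elim!: words_SucE)
  have "bar_d A U (\<lambda>l. G (a # l)) (b # cs) = bar_d A U (\<lambda>l. H (a # l)) (b # cs)"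
    using Suc.IH[of "\<lambda>l. G (a # l)" "\<lambda>l. H (a # l)"] Suc.prems(1) xs by simp
  then show ?case using Suc.prems(1) xs by simp
qed

lemma bar_d_closed:
  assumes "module K U" "\<And>l. l \<in> words A n \<Longrightarrow> G l \<in> carrier U" "xs \<in> words A (Suc n)"
  shows "bar_d A U G xs \<in> carrier U"
  using assms(2-)
proof (induction n arbitrary: G xs)
  case 0
  then show ?case using module_zero_closed[OF assms(1)] by (auto elim!: words_SucE)
next
  case (Suc n)
  from Suc.prems(2) obtain a b cs where xs: "xs = a # b # cs" "a \<in> carrier A" "b \<in> carrier A" "cs \<in> words A n"
    by (auto elim!: words_SucE)
  have "bar_d A U (\<lambda>l. G (a # l)) (b # cs) \<in> carrier U"
    using Suc.IH[of "\<lambda>l. G (a # l)"] Suc.prems(1) xs by simp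
  then show ?case using Suc.prems(1) xs module_minus_closed[OF assms(1)] by simp
qed

lemma bar_d_minus:
  assumes "module K U" "\<And>l. l \<in> words A n \<Longrightarrow> G l \<in> carrier U" "\<And>l. l \<in> words A n \<Longrightarrow> H l \<in> carrier U"
    and "xs \<in> words A (Suc n)"
  shows "bar_d A U (\<lambda>l. G l \<ominus>\<^bsub>U\<^esub> H l) xs = bar_d A U G xs \<ominus>\<^bsub>U\<^esub> bar_d A U H xs"
  using assms(2-)
proof (induction n arbitrary: G H xs)
  case 0
  then show ?case using module_zero_minus_zero[OF assms(1)] by (auto elim!: words_SucE)
next
  case (Suc n)
  interpret U: module K U by fact
  from Suc.prems(3) obtain a b cs where xs: "xs = a # b # cs" "a \<in> carrier A" "b \<in> carrier A" "cs \<in> words A n"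
    by (auto elim!: words_SucE)
  have cl: "bar_d A U (\<lambda>l. G (a # l)) (b # cs) \<in> carrier U" "bar_d A U (\<lambda>l. H (a # l)) (b # cs) \<in> carrier U"
    using bar_d_closed[OF assms(1), of n "\<lambda>l. G (a # l)"] bar_d_closed[OF assms(1), of n "\<lambda>l. H (a # l)"]
      Suc.prems xs by simp_all
  have "bar_d A U (\<lambda>l. G (a # l) \<ominus>\<^bsub>U\<^esub> H (a # l)) (b # cs) =
    bar_d A U (\<lambda>l. G (a # l)) (b # cs) \<ominus>\<^bsub>U\<^esub> bar_d A U (\<lambda>l. H (a # l)) (b # cs)"
    using Suc.IH[of "\<lambda>l. G (a # l)" "\<lambda>l. H (a # l)"] Suc.prems xs by simp
  then show ?case using Suc.prems xs cl
    by (simp add: U.minus_eq U.minus_add U.a_ac)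
qed

lemma bar_d_linear:
  assumes "module K U" "\<And>l. l \<in> words A n \<Longrightarrow> linear_map K V U (\<lambda>v. H v l)" "xs \<in> words A (Suc n)"
  shows "linear_map K V U (\<lambda>v. bar_d A U (H v) xs)"
  using assms(2-)
proof (induction n arbitrary: H xs)
  case 0
  then show ?case using linear_map_const_zero[OF assms(1)] by (auto elim!: words_SucE)
next
  case (Suc n)
  from Suc.prems(2) obtain a b cs where xs: "xs = a # b # cs" "a \<in> carrier A" "b \<in> carrier A" "cs \<in> words A n"
    by (auto elim!: words_SucE)
  have "linear_map K V U (\<lambda>v. bar_d A U (\<lambda>l. H v (a # l)) (b # cs))"
    using Suc.IH[of "\<lambda>v l. H v (a # l)"] Suc.prems(1) xs by simp
  then show ?case using Suc.prems(1)[of "a \<otimes>\<^bsub>A\<^esub> b # cs"] xs by (simp add: linear_map_diff[OF assms(1)])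
qed

lemma bar_d_hom:
  assumes "module K U" "module K W" "linear_map K U W h"
    and "\<And>l. l \<in> words A n \<Longrightarrow> G l \<in> carrier U" "xs \<in> words A (Suc n)"
  shows "h (bar_d A U G xs) = bar_d A W (\<lambda>l. h (G l)) xs"
  using assms(4-)
proof (induction n arbitrary: G xs)
  case 0
  then show ?case using linear_map_zero[OF assms(1-3)] by (auto elim!: words_SucE)
next
  case (Suc n)
  from Suc.prems(2) obtain a b cs where xs: "xs = a # b # cs" "a \<in> carrier A" "b \<in> carrier A" "cs \<in> words A n"
    by (auto elim!: words_SucE)
  have cl: "bar_d A U (\<lambda>l. G (a # l)) (b # cs) \<in> carrier U"
    using bar_d_closed[OF assms(1), of n "\<lambda>l. G (a # l)"] Suc.prems xs by simp_all
  have "h (bar_d A U (\<lambda>l. G (a # l)) (b # cs)) = bar_d A W (\<lambda>l. h (G (a # l))) (b # cs)"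
    using Suc.IH[of "\<lambda>l. G (a # l)"] Suc.prems xs by simp
  then show ?case using Suc.prems xs cl by (simp add: linear_map_minus[OF assms(1-3)])
qed

lemma mult_left_linear: "a \<in> carrier A \<Longrightarrow> linear_map K A A (\<lambda>x. a \<otimes>\<^bsub>A\<^esub> x)"
  by (rule linear_mapI) (simp_all add: A.r_distr smult_mult_right)

lemma mult_right_linear: "b \<in> carrier A \<Longrightarrow> linear_map K A A (\<lambda>x. x \<otimes>\<^bsub>A\<^esub> b)"
  by (rule linear_mapI) (simp_all add: A.l_distr smult_mult_left)

lemma multilinear_mult_hd:
  assumes "multilinear K A (Suc n) U G" "a \<in> carrier A"
  shows "multilinear K A (Suc n) U (\<lambda>l. G ((a \<otimes>\<^bsub>A\<^esub> hd l) # tl l))"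
  using assms unfolding multilinear_Suc
  by (auto intro!: linear_map_compose[OF mult_left_linear[OF assms(2)], where g = "\<lambda>x. G (x # _)"])

text \<open>Restates the recursion for a nonempty tail that is not spelled out, so that it can be
  applied under the binder of an outer \<open>bar_d\<close>.\<close>

lemma bar_d_Cons_cong:
  assumes "l \<in> words A (Suc n)"
  shows "bar_d A U G (a # l) = G ((a \<otimes>\<^bsub>A\<^esub> hd l) # tl l) \<ominus>\<^bsub>U\<^esub> bar_d A U (\<lambda>l. G (a # l)) l"
  using assms by (auto elim!: words_SucE)

lemma multilinear_bar_d:
  assumes "module K U" "multilinear K A n U G"
  shows "multilinear K A (Suc n) U (bar_d A U G)"
  using assms(2)
proof (induction n arbitrary: G)
  case 0
  then show ?case using assms(1)
    by (simp add: multilinear_Suc linear_map_const_zero module_zero_closed)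
next
  case (Suc n)
  have "linear_map K A U (\<lambda>x. bar_d A U G (x # l))" if l: "l \<in> words A (Suc n)" for l
  proof -
    obtain b cs where bcs: "l = b # cs" "b \<in> carrier A" "cs \<in> words A n" using l by (rule words_SucE)
    have "linear_map K A U (\<lambda>x. G ((x \<otimes>\<^bsub>A\<^esub> b) # cs))"
      using Suc.prems bcs
      by (intro linear_map_compose[OF mult_right_linear[of b], where g = "\<lambda>x. G (x # _)"]) (simp_all add: multilinear_Suc)
    moreover have "linear_map K A U (\<lambda>x. bar_d A U (\<lambda>l. G (x # l)) (b # cs))"
      using Suc.prems bcs by (intro bar_d_linear[OF assms(1), of n]) (simp_all add: multilinear_Suc)
    ultimately show ?thesis by (simp add: bcs linear_map_diff[OF assms(1)])
  qed
  moreover have "multilinear K A (Suc n) U (\<lambda>l. bar_d A U G (a # l))" if a: "a \<in> carrier A" for a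
  proof -
    have "multilinear K A (Suc n) U (\<lambda>l. G ((a \<otimes>\<^bsub>A\<^esub> hd l) # tl l) \<ominus>\<^bsub>U\<^esub> bar_d A U (\<lambda>l. G (a # l)) l)"
      using Suc.prems a
      by (intro multilinear_minus[OF assms(1)] multilinear_mult_hd Suc.IH) (simp_all add: multilinear_Suc)
    then show ?thesis
      by (subst multilinear_cong[OF A_module bar_d_Cons_cong])
  qed
  ultimately show ?case by (subst multilinear_Suc) blast
qed

text \<open>Induction on the word. Expanding the inner operator at the first letter a leaves the
  square for \<open>\<lambda>l. G (a # l)\<close>, zero by induction, and \<open>bar_d\<close> of
  the function \<open>?H\<close> that multiplies a into the next letter. By associativity the latter
  equals \<open>bar_d\<close> of \<open>G\<close> on the word beginning with ab, and the two occur
  with opposite signs.\<close>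

lemma bar_d_bar_d:
  assumes "module K U" "\<And>l. l \<in> words A n \<Longrightarrow> G l \<in> carrier U" "xs \<in> words A (Suc (Suc n))"
  shows "bar_d A U (bar_d A U G) xs = \<zero>\<^bsub>U\<^esub>"
  using assms(2-)
proof (induction n arbitrary: G xs)
  case 0
  then show ?case using module_zero_minus_zero[OF assms(1)] by (auto elim!: words_SucE)
next
  case (Suc n)
  interpret U: module K U by fact
  from Suc.prems(2) obtain a b c ds where xs: "xs = a # b # c # ds"
    "a \<in> carrier A" "b \<in> carrier A" "c \<in> carrier A" "ds \<in> words A n"
    by (auto elim!: words_SucE)
  let ?H = "\<lambda>l. G ((a \<otimes>\<^bsub>A\<^esub> hd l) # tl l)"
  have clH: "?H l \<in> carrier U" if "l \<in> words A (Suc n)" for l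
    using that Suc.prems(1) xs(2) by (auto elim!: words_SucE)
  have cl1: "bar_d A U (\<lambda>l. G (a # l)) l \<in> carrier U" if "l \<in> words A (Suc n)" for l
    using bar_d_closed[OF assms(1), of n "\<lambda>l. G (a # l)"] Suc.prems(1) xs(2) that by simp
  have cl2: "bar_d A U (\<lambda>l. G ((a \<otimes>\<^bsub>A\<^esub> b) # l)) (c # ds) \<in> carrier U"
    using bar_d_closed[OF assms(1), of n "\<lambda>l. G ((a \<otimes>\<^bsub>A\<^esub> b) # l)"] Suc.prems(1) xs(2-) by simp
  have cl3: "G (((a \<otimes>\<^bsub>A\<^esub> b) \<otimes>\<^bsub>A\<^esub> c) # ds) \<in> carrier U" using Suc.prems(1) xs(2-) by simp
  have "bar_d A U (\<lambda>l. bar_d A U G (a # l)) (b # c # ds) =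
      bar_d A U (\<lambda>l. ?H l \<ominus>\<^bsub>U\<^esub> bar_d A U (\<lambda>l. G (a # l)) l) (b # c # ds)"
    using xs by (intro bar_d_cong[of "Suc n"] bar_d_Cons_cong) auto
  also have "\<dots> = bar_d A U ?H (b # c # ds) \<ominus>\<^bsub>U\<^esub> bar_d A U (bar_d A U (\<lambda>l. G (a # l))) (b # c # ds)"
    using xs clH cl1 by (intro bar_d_minus[OF assms(1), of "Suc n"]) auto
  also have "bar_d A U (bar_d A U (\<lambda>l. G (a # l))) (b # c # ds) = \<zero>\<^bsub>U\<^esub>"
    using xs Suc.prems(1) by (intro Suc.IH) auto
  finally have "bar_d A U (\<lambda>l. bar_d A U G (a # l)) (b # c # ds) = bar_d A U G ((a \<otimes>\<^bsub>A\<^esub> b) # c # ds)"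
    using xs cl2 cl3 alt_zero[OF assms(1), of 1] by (simp add: A.m_assoc alt_def U.minus_eq)
  then show ?case using xs cl2 cl3 by (simp add: U.minus_eq U.r_neg del: bar_d.simps(3))
      (simp add: U.minus_eq U.r_neg)
qed

text \<open>\<open>bar_d\<close> reads a word from the front, whereas right actions and
  \<open>theta\<close> change its end. Here the last merge is split off instead; it has index n,
  hence its sign.\<close>

lemma bar_d_snoc:
  assumes "module K U" "\<And>l. l \<in> words A (Suc n) \<Longrightarrow> G l \<in> carrier U"
    and "ys \<in> words A n" "a \<in> carrier A" "b \<in> carrier A"
  shows "bar_d A U G (ys @ [a, b]) =
    bar_d A U (\<lambda>l. G (l @ [b])) (ys @ [a]) \<oplus>\<^bsub>U\<^esub> alt U (int n) (G (ys @ [a \<otimes>\<^bsub>A\<^esub> b]))"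
  using assms(2,3)
proof (induction n arbitrary: G ys)
  case 0
  interpret U: module K U by fact
  show ?case using 0 assms(4,5) U.minus_equality[of "\<zero>\<^bsub>U\<^esub>" "\<zero>\<^bsub>U\<^esub>"] by (simp add: U.minus_eq)
next
  case (Suc n)
  interpret U: module K U by fact
  from Suc.prems(2) obtain y ys' where ys: "ys = y # ys'" "y \<in> carrier A" "ys' \<in> words A n"
    by (rule words_SucE)
  obtain z zs where z: "ys' @ [a] = z # zs" by (cases "ys' @ [a]") auto
  have w: "z \<in> carrier A" "zs \<in> words A n"
    using arg_cong[OF z, of set] arg_cong[OF z, of length] ys(3) assms(4) by (auto simp: words_iff)
  have z': "ys' @ [a, b] = z # zs @ [b]" using z by (metis append.assoc append_Cons append_Nil)
  have sn: "l @ [b] \<in> words A (Suc n)" if "l \<in> words A n" for l n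
    using that assms(5) by (auto simp: words_iff)
  have c1: "G ((y \<otimes>\<^bsub>A\<^esub> z) # zs @ [b]) \<in> carrier U" using Suc.prems(1) ys w sn by simp
  have c2: "bar_d A U (\<lambda>l. G (y # l @ [b])) (z # zs) \<in> carrier U"
    using Suc.prems(1) ys w sn by (intro bar_d_closed[OF assms(1), of n]) auto
  have c3: "G (y # ys' @ [a \<otimes>\<^bsub>A\<^esub> b]) \<in> carrier U"
    using Suc.prems(1) ys assms(4,5) by (auto simp: words_iff)
  have "bar_d A U (\<lambda>l. G (y # l)) (ys' @ [a, b]) =
    bar_d A U (\<lambda>l. G (y # l @ [b])) (z # zs) \<oplus>\<^bsub>U\<^esub> alt U (int n) (G (y # ys' @ [a \<otimes>\<^bsub>A\<^esub> b]))"
    using Suc.IH[of "\<lambda>l. G (y # l)" ys'] Suc.prems(1) ys by (simp add: z)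
  then have "bar_d A U G (ys @ [a, b]) = G ((y \<otimes>\<^bsub>A\<^esub> z) # zs @ [b]) \<ominus>\<^bsub>U\<^esub>
    (bar_d A U (\<lambda>l. G (y # l @ [b])) (z # zs) \<oplus>\<^bsub>U\<^esub> alt U (int n) (G (y # ys' @ [a \<otimes>\<^bsub>A\<^esub> b])))"
    by (simp add: ys z')
  moreover have "bar_d A U (\<lambda>l. G (l @ [b])) (ys @ [a]) =
    G ((y \<otimes>\<^bsub>A\<^esub> z) # zs @ [b]) \<ominus>\<^bsub>U\<^esub> bar_d A U (\<lambda>l. G (y # l @ [b])) (z # zs)"
    by (simp add: ys z)
  moreover have "alt U (int (Suc n)) (G (ys @ [a \<otimes>\<^bsub>A\<^esub> b])) = \<ominus>\<^bsub>U\<^esub> alt U (int n) (G (y # ys' @ [a \<otimes>\<^bsub>A\<^esub> b]))"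
    using alt_Suc[OF assms(1) c3, of "int n"] by (simp add: ys add.commute)
  ultimately show ?case using c1 c2 alt_closed[OF assms(1) c3]
    by (simp add: U.minus_eq U.minus_add U.a_ac)
qed

text \<open>Merging the unit with its left and with its right neighbour gives the same word, at
  adjacent indices and hence with opposite signs. In all other faces the unit stays strictly inside,
  where \<open>G\<close> vanishes.\<close>

lemma bar_d_interior_normalized:
  assumes "module K U" "\<And>l. l \<in> words A n \<Longrightarrow> G l \<in> carrier U" "interior_normalized A n U G"
  shows "interior_normalized A (Suc n) U (bar_d A U G)"
proof -
  interpret U: module K U by fact
  have "bar_d A U G (us @ \<one>\<^bsub>A\<^esub> # ws) = \<zero>\<^bsub>U\<^esub>"
    if "us \<noteq> []" "ws \<noteq> []" "set us \<subseteq> carrier A" "set ws \<subseteq> carrier A" "length us + length ws = n" for us ws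
    using that assms(2,3)
  proof (induction us arbitrary: G n rule: induct_list012)
    case 1 then show ?case by simp
  next
    case (2 u)
    obtain w ws' where ws: "ws = w # ws'" using 2(2) by (cases ws) auto
    have c: "G (u # w # ws') \<in> carrier U" using 2 ws by (auto simp: words_iff)
    \<comment> \<open>With a single letter u on the left, the two merges of the unit are the first
      two faces and cancel; this disposes of the remaining faces.\<close>
    have "bar_d A U (\<lambda>l. G (u # \<one>\<^bsub>A\<^esub> # l)) (w # ws') = \<zero>\<^bsub>U\<^esub>"
    proof (cases ws')
      case Nil then show ?thesis by simp
    next
      case (Cons v vs)
      have "bar_d A U (\<lambda>l. G (u # \<one>\<^bsub>A\<^esub> # l)) (w # ws') = bar_d A U (\<lambda>l. \<zero>\<^bsub>U\<^esub>) (w # ws')"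
      proof (rule bar_d_cong[of "length ws'"])
        fix l assume "l \<in> words A (length ws')"
        then show "G (u # \<one>\<^bsub>A\<^esub> # l) = \<zero>\<^bsub>U\<^esub>"
          using interior_normalizedD[OF 2(7), of "[u]" l] 2(3-6) ws Cons by (cases l) (auto simp: words_iff)
      qed (use 2 ws in \<open>auto simp: words_iff\<close>)
      moreover have "bar_d A U (\<lambda>l. \<zero>\<^bsub>U\<^esub>) xs = \<zero>\<^bsub>U\<^esub>" for xs
        by (induction xs rule: induct_list012) (auto simp: module_zero_minus_zero[OF assms(1)])
      ultimately show ?thesis by simp
    qed
    then show ?case using 2(3,4) ws c by (simp add: U.minus_eq U.minus_add U.r_neg)
  next
    case (3 u v us)
    have "n > 0" using 3 by auto
    then obtain m where n: "n = Suc m" by (cases n) auto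
    have "bar_d A U (\<lambda>l. G (u # l)) ((v # us) @ \<one>\<^bsub>A\<^esub> # ws) = \<zero>\<^bsub>U\<^esub>"
    proof (rule "3.IH"(2))
      show "interior_normalized A m U (\<lambda>l. G (u # l))"
        unfolding interior_normalized_def
        using interior_normalizedD[OF 3(9), of "u # _"] 3(5) n by auto
    qed (use 3 n in auto)
    moreover have "G ((u \<otimes>\<^bsub>A\<^esub> v) # us @ \<one>\<^bsub>A\<^esub> # ws) = \<zero>\<^bsub>U\<^esub>"
      using interior_normalizedD[OF 3(9), of "(u \<otimes>\<^bsub>A\<^esub> v) # us" ws] 3 by auto
    ultimately show ?case by (simp add: module_zero_minus_zero[OF assms(1)])
  qed
  then show ?thesis by (auto simp: interior_normalized_def)
qed

lemma merge_0 [simp]: "merge A 0 (a # b # cs) = (a \<otimes>\<^bsub>A\<^esub> b) # cs"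
  by (simp add: merge_def)

lemma merge_Suc [simp]: "merge A (Suc i) (a # cs) = a # merge A i cs"
  by (simp add: merge_def)

lemma merge_words: "xs \<in> words A (Suc n) \<Longrightarrow> i < n \<Longrightarrow> merge A i xs \<in> words A n"
proof (induction n arbitrary: i xs)
  case (Suc n)
  then obtain a b cs where xs: "xs = a # b # cs" "a \<in> carrier A" "b \<in> carrier A" "cs \<in> words A n"
    by (auto elim!: words_SucE)
  then show ?case using Suc by (cases i) auto
qed simp

text \<open>Connects the recursion with the explicit alternating sums in the definitions of the
  right action and the differentials. Splitting off index 0 and shifting the other indices by one
  produces the minus sign of the recursive clause.\<close>

lemma bar_d_sum:
  assumes "module K U" "\<And>l. l \<in> words A n \<Longrightarrow> G l \<in> carrier U" "xs \<in> words A (Suc n)"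
  shows "bar_d A U G xs = (\<Oplus>\<^bsub>U\<^esub>i\<in>{..<n}. alt U (int i) (G (merge A i xs)))"
  using assms(2-)
proof (induction n arbitrary: G xs)
  case 0
  interpret U: module K U by fact
  show ?case using 0 by (auto elim!: words_SucE)
next
  case (Suc n)
  interpret U: module K U by fact
  from Suc.prems(2) obtain a b cs where xs: "xs = a # b # cs" "a \<in> carrier A" "b \<in> carrier A" "cs \<in> words A n"
    by (auto elim!: words_SucE)
  have cl: "alt U (int i) (G (merge A i xs)) \<in> carrier U" if "i < Suc n" for i
    using Suc.prems merge_words[OF Suc.prems(2) that] by (intro alt_closed[OF assms(1)]) auto
  have cl': "alt U (int i) (G (a # merge A i (b # cs))) \<in> carrier U" if "i < n" for i
    using Suc.prems(1) merge_words[of "b # cs" n i] xs that by (intro alt_closed[OF assms(1)]) auto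
  have "(\<Oplus>\<^bsub>U\<^esub>i\<in>{..<Suc n}. alt U (int i) (G (merge A i xs))) =
      (\<Oplus>\<^bsub>U\<^esub>i\<in>insert 0 (Suc ` {..<n}). alt U (int i) (G (merge A i xs)))"
    by (simp add: lessThan_Suc_eq_insert_0)
  also have "\<dots> = alt U (int 0) (G (merge A 0 xs)) \<oplus>\<^bsub>U\<^esub>
      (\<Oplus>\<^bsub>U\<^esub>i\<in>Suc ` {..<n}. alt U (int i) (G (merge A i xs)))"
    using cl cl[of 0] by (intro U.finsum_insert) auto
  also have "(\<Oplus>\<^bsub>U\<^esub>i\<in>Suc ` {..<n}. alt U (int i) (G (merge A i xs))) =
      (\<Oplus>\<^bsub>U\<^esub>i\<in>{..<n}. alt U (int (Suc i)) (G (merge A (Suc i) xs)))"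
    using cl by (intro U.finsum_reindex) auto
  also have "\<dots> = (\<Oplus>\<^bsub>U\<^esub>i\<in>{..<n}. \<ominus>\<^bsub>U\<^esub> alt U (int i) (G (a # merge A i (b # cs))))"
  proof (rule U.finsum_cong')
    fix i assume i: "i \<in> {..<n}"
    then have "G (a # merge A i (b # cs)) \<in> carrier U"
      using Suc.prems(1) merge_words[of "b # cs" n i] xs by simp
    from alt_Suc[OF assms(1) this, of "int i"]
    show "alt U (int (Suc i)) (G (merge A (Suc i) xs)) = \<ominus>\<^bsub>U\<^esub> alt U (int i) (G (a # merge A i (b # cs)))"
      by (simp add: xs add.commute)
  qed (use cl' in auto)
  also have "\<dots> = \<ominus>\<^bsub>U\<^esub> (\<Oplus>\<^bsub>U\<^esub>i\<in>{..<n}. alt U (int i) (G (a # merge A i (b # cs))))"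
    using cl' by (intro linear_map_finsum[OF assms(1) assms(1) linear_map_neg[OF assms(1)], symmetric])
      (auto simp: linear_map_def)
  also have "\<dots> = \<ominus>\<^bsub>U\<^esub> bar_d A U (\<lambda>l. G (a # l)) (b # cs)"
    using Suc.IH[of "\<lambda>l. G (a # l)" "b # cs"] Suc.prems xs by simp
  finally show ?case using xs by (simp add: U.minus_eq)
qed

end


section \<open>The bimodules \<open>Omega p\<close>\<close>

text \<open>\<open>k\<close> counts the leading slots exempt from normalization: 0 for cochains,
  whose arguments all come from \<open>Abar\<close>, and 1 for \<open>Omega p\<close>, whose first
  factor is \<open>A\<close> itself.\<close>

definition unit_null where
  "unit_null A k n U G \<longleftrightarrow> (\<forall>us ws. k \<le> length us \<longrightarrow> set us \<subseteq> carrier A \<longrightarrow> set ws \<subseteq> carrier A \<longrightarrow>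
     Suc (length us + length ws) = n \<longrightarrow> G (us @ \<one>\<^bsub>A\<^esub> # ws) = \<zero>\<^bsub>U\<^esub>)"

lemma unit_nullD:
  "unit_null A k n U G \<Longrightarrow> k \<le> length us \<Longrightarrow> set us \<subseteq> carrier A \<Longrightarrow> set ws \<subseteq> carrier A \<Longrightarrow>
   Suc (length us + length ws) = n \<Longrightarrow> G (us @ \<one>\<^bsub>A\<^esub> # ws) = \<zero>\<^bsub>U\<^esub>"
  by (simp add: unit_null_def)

lemma unit_null_compose:
  assumes "module K U" "module K W" "linear_map K U W h" "unit_null A k n U G"
  shows "unit_null A k n W (\<lambda>l. h (G l))"
  using assms(4) linear_map_zero[OF assms(1-3)] by (simp add: unit_null_def)

text \<open>The maps \<open>T a\<close> are linear in w; linearity in the parameter a is a further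
  condition on w, and since it cuts out a submodule it can be tested on generators.\<close>

lemma submodule_linear_parameter:
  assumes "module K V" "module K U" "\<And>a. a \<in> carrier P \<Longrightarrow> linear_map K V U (T a)" "module K P"
  shows "submodule {w \<in> carrier V. linear_map K P U (\<lambda>a. T a w)} K V"
proof -
  interpret V: module K V by fact
  interpret U: module K U by fact
  interpret P: module K P by fact
  note T = linear_map_zero[OF assms(1,2,3)] linear_map_a_inv[OF assms(1,2,3)]
    linear_map_add[OF assms(3)] linear_map_smult[OF assms(3)]
  show ?thesis
  proof (rule V.submoduleI)
    have "linear_map K P U (\<lambda>a. T a \<zero>\<^bsub>V\<^esub>)"
      by (subst linear_map_cong[OF assms(4) T(1)]) (auto intro: linear_map_const_zero[OF assms(2)])
    then show "\<zero>\<^bsub>V\<^esub> \<in> {w \<in> carrier V. linear_map K P U (\<lambda>a. T a w)}" by simp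
  next
    fix w assume w: "w \<in> {w \<in> carrier V. linear_map K P U (\<lambda>a. T a w)}"
    then have "linear_map K P U (\<lambda>a. T a (\<ominus>\<^bsub>V\<^esub> w))"
      by (subst linear_map_cong[OF assms(4) T(2)]) (auto intro: linear_map_neg[OF assms(2)])
    then show "\<ominus>\<^bsub>V\<^esub> w \<in> {w \<in> carrier V. linear_map K P U (\<lambda>a. T a w)}" using w by simp
  next
    fix w v assume w: "w \<in> {w \<in> carrier V. linear_map K P U (\<lambda>a. T a w)}"
      "v \<in> {w \<in> carrier V. linear_map K P U (\<lambda>a. T a w)}"
    then have "linear_map K P U (\<lambda>a. T a (w \<oplus>\<^bsub>V\<^esub> v))"
      by (subst linear_map_cong[OF assms(4) T(3)]) (auto intro: linear_map_plus[OF assms(2)])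
    then show "w \<oplus>\<^bsub>V\<^esub> v \<in> {w \<in> carrier V. linear_map K P U (\<lambda>a. T a w)}" using w by simp
  next
    fix c w assume w: "c \<in> carrier K" "w \<in> {w \<in> carrier V. linear_map K P U (\<lambda>a. T a w)}"
    then have "linear_map K P U (\<lambda>a. T a (c \<odot>\<^bsub>V\<^esub> w))"
      by (subst linear_map_cong[OF assms(4) T(4)]) (auto intro: linear_map_scale[OF assms(2)])
    then show "c \<odot>\<^bsub>V\<^esub> w \<in> {w \<in> carrier V. linear_map K P U (\<lambda>a. T a w)}" using w by simp
  qed auto
qed

lemma tensor_ext:
  assumes "module K V" "module K W" "module K U"
    and "linear_map K (tensor K V W) U f" "linear_map K (tensor K V W) U g"
    and "\<And>x y. x \<in> carrier V \<Longrightarrow> y \<in> carrier W \<Longrightarrow> f (pure K V W x y) = g (pure K V W x y)"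
    and "t \<in> carrier (tensor K V W)"
  shows "f t = g t"
proof -
  have "carrier (tensor K V W) \<subseteq> {t \<in> carrier (tensor K V W). f t = g t}"
    by (rule tensor_generated[OF assms(1,2) submodule_equalizer[OF tensor_module[OF assms(1,2)] assms(3-5)]])
      (use assms(6) pure_closed[OF assms(1,2)] in auto)
  then show ?thesis using assms(7) by auto
qed

section \<open>The quotient of \<open>A\<close> by the ground field, and its tensor powers\<close>

context k_algebra
begin

definition ground where "ground = {c \<odot>\<^bsub>A\<^esub> \<one>\<^bsub>A\<^esub> | c. c \<in> carrier K}"

lemma ground_submodule: "submodule ground K A"
proof (rule submoduleI)
  show "\<zero>\<^bsub>A\<^esub> \<in> ground" unfolding ground_def
    by (intro CollectI exI[of _ "\<zero>\<^bsub>K\<^esub>"]) auto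
  show "\<ominus>\<^bsub>A\<^esub> a \<in> ground" if a: "a \<in> ground" for a
  proof -
    obtain c where "c \<in> carrier K" "a = c \<odot>\<^bsub>A\<^esub> \<one>\<^bsub>A\<^esub>" using a by (auto simp: ground_def)
    then have "\<ominus>\<^bsub>A\<^esub> a = (\<ominus>\<^bsub>K\<^esub> c) \<odot>\<^bsub>A\<^esub> \<one>\<^bsub>A\<^esub>" "\<ominus>\<^bsub>K\<^esub> c \<in> carrier K" by (simp_all add: smult_l_minus)
    then show ?thesis unfolding ground_def by blast
  qed
  show "a \<oplus>\<^bsub>A\<^esub> b \<in> ground" if ab: "a \<in> ground" "b \<in> ground" for a b
  proof -
    obtain c d where "c \<in> carrier K" "a = c \<odot>\<^bsub>A\<^esub> \<one>\<^bsub>A\<^esub>" "d \<in> carrier K" "b = d \<odot>\<^bsub>A\<^esub> \<one>\<^bsub>A\<^esub>"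
      using ab by (auto simp: ground_def)
    then have "a \<oplus>\<^bsub>A\<^esub> b = (c \<oplus>\<^bsub>K\<^esub> d) \<odot>\<^bsub>A\<^esub> \<one>\<^bsub>A\<^esub>" "c \<oplus>\<^bsub>K\<^esub> d \<in> carrier K" by (simp_all add: smult_l_distr)
    then show ?thesis unfolding ground_def by blast
  qed
  show "d \<odot>\<^bsub>A\<^esub> a \<in> ground" if da: "d \<in> carrier K" "a \<in> ground" for d a
  proof -
    obtain c where "c \<in> carrier K" "a = c \<odot>\<^bsub>A\<^esub> \<one>\<^bsub>A\<^esub>" using da by (auto simp: ground_def)
    then have "d \<odot>\<^bsub>A\<^esub> a = (d \<otimes>\<^bsub>K\<^esub> c) \<odot>\<^bsub>A\<^esub> \<one>\<^bsub>A\<^esub>" "d \<otimes>\<^bsub>K\<^esub> c \<in> carrier K" using da by (simp_all add: smult_assoc1)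
    then show ?thesis unfolding ground_def by blast
  qed
qed (auto simp: ground_def)

lemmas Abar_props = quot_space_module[OF A_module ground_submodule, folded Abar_def[folded ground_def]]

lemmas Abar_module = Abar_props(1)

lemma bar_eq: "bar = (\<lambda>x. ground +>\<^bsub>A\<^esub> x)"
  by (simp add: fun_eq_iff bar_def ground_def)

lemma bar_linear: "linear_map K A Abar bar"
  using Abar_props(2) by (simp add: bar_eq)

lemma Abar_carrier: "carrier Abar = bar ` carrier A"
  using Abar_props(3) by (simp add: bar_eq)

lemma bar_eq_iff: "x \<in> carrier A \<Longrightarrow> y \<in> carrier A \<Longrightarrow> bar x = bar y \<longleftrightarrow> x \<ominus>\<^bsub>A\<^esub> y \<in> ground"
  using coset_eq_iff[OF A_module ground_submodule] by (simp add: bar_eq)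

lemma one_ground: "\<one>\<^bsub>A\<^esub> \<in> ground"
  unfolding ground_def by (intro CollectI exI[of _ "\<one>\<^bsub>K\<^esub>"]) auto

lemma bar_zero_iff: "x \<in> carrier A \<Longrightarrow> bar x = \<zero>\<^bsub>Abar\<^esub> \<longleftrightarrow> x \<in> ground"
  using bar_eq_iff[of x "\<zero>\<^bsub>A\<^esub>"] linear_map_zero[OF A_module Abar_module bar_linear] by (simp add: A.minus_eq)

lemma bar_one: "bar \<one>\<^bsub>A\<^esub> = \<zero>\<^bsub>Abar\<^esub>"
  using bar_zero_iff one_ground by simp

lemma bar_closed: "x \<in> carrier A \<Longrightarrow> bar x \<in> carrier Abar"
  by (rule linear_map_closed[OF bar_linear])

lemma SAbar_module: "module K (SAbar n)"
  unfolding SAbar_def by (rule power_module[OF Abar_module])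

lemma map_bar_words: "xs \<in> words A n \<Longrightarrow> map bar xs \<in> words Abar n"
  using bar_closed by (auto simp: words_iff)

lemma words_AbarE:
  assumes "Xs \<in> words Abar n" obtains xs where "xs \<in> words A n" "Xs = map bar xs"
proof -
  have "\<exists>xs. xs \<in> words A n \<and> Xs = map bar xs"
    using assms
  proof (induction n arbitrary: Xs)
    case (Suc n)
    then obtain X Ys where X: "Xs = X # Ys" "X \<in> carrier Abar" "Ys \<in> words Abar n" by (auto elim: words_SucE)
    obtain x where "x \<in> carrier A" "X = bar x" using X(2) by (auto simp: Abar_carrier)
    moreover obtain ys where "ys \<in> words A n" "Ys = map bar ys" using Suc.IH X(3) by blast
    ultimately show ?case using X(1) by (intro exI[of _ "x # ys"]) simp
  qed simp
  then show ?thesis using that by blast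
qed

lemma sbars_multilinear: "multilinear K A n (SAbar n) sbars"
proof -
  note P = pure_power_multilinear[OF Abar_module, of n]
  show ?thesis
    unfolding multilinear_def sbars_def SAbar_def
  proof (intro conjI ballI allI impI)
    fix xs assume "xs \<in> words A n"
    then show "pure_power K Abar (map bar xs) \<in> carrier (tensor_power K Abar n)"
      using multilinear_closed[OF P] map_bar_words by blast
  next
    fix us ws assume "set us \<subseteq> carrier A" "set ws \<subseteq> carrier A" "Suc (length us + length ws) = n"
    then have "linear_map K Abar (tensor_power K Abar n) (\<lambda>x. pure_power K Abar (map bar us @ x # map bar ws))"
      using bar_closed by (intro multilinear_slot[OF P]) auto
    from linear_map_compose[OF bar_linear this]
    show "linear_map K A (tensor_power K Abar n) (\<lambda>x. pure_power K Abar (map bar (us @ x # ws)))" by simp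
  qed
qed

lemma sbars_closed: "xs \<in> words A n \<Longrightarrow> sbars xs \<in> carrier (SAbar n)"
  by (rule multilinear_closed[OF sbars_multilinear])

lemma sbars_unit_null: "unit_null A 0 n (SAbar n) sbars"
proof -
  have "sbars (us @ \<one>\<^bsub>A\<^esub> # ws) = \<zero>\<^bsub>SAbar n\<^esub>"
    if "set us \<subseteq> carrier A" "set ws \<subseteq> carrier A" "Suc (length us + length ws) = n" for us ws
  proof -
    have "linear_map K Abar (SAbar n) (\<lambda>x. pure_power K Abar (map bar us @ x # map bar ws))"
      unfolding SAbar_def
      using bar_closed that by (intro multilinear_slot[OF pure_power_multilinear[OF Abar_module]]) auto
    from linear_map_zero[OF Abar_module SAbar_module this] show ?thesis by (simp add: sbars_def bar_one)
  qed
  then show ?thesis by (simp add: unit_null_def)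
qed

lemma normalized_slot_cong:
  assumes U: "module K U" and G: "multilinear K A n U G" "unit_null A 0 n U G"
    and "set us \<subseteq> carrier A" "set ws \<subseteq> carrier A" "Suc (length us + length ws) = n"
    and "x \<in> carrier A" "y \<in> carrier A" "bar x = bar y"
  shows "G (us @ x # ws) = G (us @ y # ws)"
proof -
  interpret U: module K U by fact
  have l: "linear_map K A U (\<lambda>x. G (us @ x # ws))" by (rule multilinear_slot[OF G(1) assms(4-6)])
  obtain c where c: "c \<in> carrier K" "x \<ominus>\<^bsub>A\<^esub> y = c \<odot>\<^bsub>A\<^esub> \<one>\<^bsub>A\<^esub>"
    using bar_eq_iff[of x y] assms(7-9) by (auto simp: ground_def)
  have x: "x = c \<odot>\<^bsub>A\<^esub> \<one>\<^bsub>A\<^esub> \<oplus>\<^bsub>A\<^esub> y"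
    using c(2)[symmetric] assms(7,8) by (simp add: A.minus_eq A.a_assoc A.l_neg)
  have "G (us @ x # ws) = c \<odot>\<^bsub>U\<^esub> G (us @ \<one>\<^bsub>A\<^esub> # ws) \<oplus>\<^bsub>U\<^esub> G (us @ y # ws)"
    unfolding x using linear_map_add[OF l, of "c \<odot>\<^bsub>A\<^esub> \<one>\<^bsub>A\<^esub>" y] linear_map_smult[OF l c(1)] c(1) assms(8) by simp
  then show ?thesis
    using unit_nullD[OF G(2), of us ws] assms(4-6,8) c(1) linear_map_closed[OF l] by simp
qed

text \<open>Letters are exchanged one at a time, the exchanged ones being collected in the prefix
  \<open>us\<close>. Each exchange alters a letter by a multiple of the unit, which a normalized
  function ignores.\<close>

lemma normalized_cong:
  assumes U: "module K U" and G: "multilinear K A n U G" "unit_null A 0 n U G"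
    and "xs \<in> words A n" "ys \<in> words A n" "map bar xs = map bar ys"
  shows "G xs = G ys"
proof -
  have "G (us @ xs) = G (us @ ys)"
    if "us @ xs \<in> words A n" "us @ ys \<in> words A n" "map bar xs = map bar ys" for us
    using that
  proof (induction xs arbitrary: us ys)
    case (Cons x xs)
    then obtain y ys' where ys: "ys = y # ys'" "bar x = bar y" "map bar xs = map bar ys'" by (cases ys) auto
    have "G (us @ x # xs) = G (us @ y # xs)"
      using Cons.prems ys by (intro normalized_slot_cong[OF U G]) (auto simp: words_iff)
    also have "\<dots> = G ((us @ [y]) @ xs)" by simp
    also have "\<dots> = G ((us @ [y]) @ ys')"
      using Cons.prems ys by (intro Cons.IH) (auto simp: words_iff)
    finally show ?case by (simp add: ys)
  qed simp
  from this[of "[]"] show ?thesis using assms(4-6) by simp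
qed

text \<open>Tensor powers of \<open>Abar\<close> are generated by words of cosets, while
  \<open>G\<close> takes words in \<open>A\<close>. \<open>H\<close> evaluates \<open>G\<close> on
  chosen representatives; \<open>normalized_cong\<close> makes the choice irrelevant, so
  \<open>H\<close> is again multilinear and the universal property applies.\<close>

lemma SAbar_lift:
  assumes U: "module K U" and G: "multilinear K A n U G" "unit_null A 0 n U G"
  shows "\<exists>h. linear_map K (SAbar n) U h \<and> (\<forall>xs\<in>words A n. h (sbars xs) = G xs)"
proof -
  define rep where "rep X = (SOME x. x \<in> carrier A \<and> bar x = X)" for X
  have rep: "rep X \<in> carrier A" "bar (rep X) = X" if "X \<in> carrier Abar" for X
    using that someI_ex[of "\<lambda>x. x \<in> carrier A \<and> bar x = X"] by (auto simp: rep_def Abar_carrier)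
  define H where "H Xs = G (map rep Xs)" for Xs
  have rw: "map rep Xs \<in> words A n" if "Xs \<in> words Abar n" for Xs
    using that rep by (auto simp: words_iff)
  have HG: "H (map bar xs) = G xs" if "xs \<in> words A n" for xs
    unfolding H_def
    by (rule normalized_cong[OF U G rw[OF map_bar_words[OF that]] that])
      (use that bar_closed rep in \<open>auto simp: words_iff\<close>)
  have "multilinear K Abar n U H"
    unfolding multilinear_def
  proof (intro conjI ballI allI impI)
    fix Xs assume "Xs \<in> words Abar n"
    then show "H Xs \<in> carrier U" unfolding H_def using multilinear_closed[OF G(1)] rw by blast
  next
    fix us ws assume uw: "set us \<subseteq> carrier Abar" "set ws \<subseteq> carrier Abar" "Suc (length us + length ws) = n"
    then have "us \<in> words Abar (length us)" "ws \<in> words Abar (length ws)" by (auto simp: words_iff)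
    then obtain us' ws' where us': "us = map bar us'" "us' \<in> words A (length us)"
      and ws': "ws = map bar ws'" "ws' \<in> words A (length ws)"
      by (metis words_AbarE)
    have w: "us' @ x # ws' \<in> words A n" if "x \<in> carrier A" for x
      using us'(2) ws'(2) uw(3) that by (auto simp: words_iff)
    have l: "linear_map K A U (\<lambda>x. G (us' @ x # ws'))"
      using us'(2) ws'(2) uw(3) by (intro multilinear_slot[OF G(1)]) (auto simp: words_iff)
    have E: "H (us @ bar x # ws) = G (us' @ x # ws')" if "x \<in> carrier A" for x
      using HG[OF w[OF that]] us' ws' by simp
    show "linear_map K Abar U (\<lambda>X. H (us @ X # ws))"
    proof (rule linear_mapI)
      fix X assume "X \<in> carrier Abar"
      then obtain x where x: "x \<in> carrier A" "X = bar x" by (auto simp: Abar_carrier)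
      then show "H (us @ X # ws) \<in> carrier U" using E linear_map_closed[OF l] by simp
      show "H (us @ c \<odot>\<^bsub>Abar\<^esub> X # ws) = c \<odot>\<^bsub>U\<^esub> H (us @ X # ws)" if "c \<in> carrier K" for c
        using x E linear_map_smult[OF l that] that by (simp flip: linear_map_smult[OF bar_linear])
      show "H (us @ (X \<oplus>\<^bsub>Abar\<^esub> Y) # ws) = H (us @ X # ws) \<oplus>\<^bsub>U\<^esub> H (us @ Y # ws)" if Y: "Y \<in> carrier Abar" for Y
      proof -
        obtain y where y: "y \<in> carrier A" "Y = bar y" using Y by (auto simp: Abar_carrier)
        show ?thesis using x y E linear_map_add[OF l] by (simp flip: linear_map_add[OF bar_linear])
      qed
    qed
  qed
  from power_lift[OF Abar_module U this] obtain h where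
    h: "linear_map K (SAbar n) U h" "\<forall>Xs\<in>words Abar n. h (pure_power K Abar Xs) = H Xs"
    by (auto simp: SAbar_def)
  then show ?thesis using HG map_bar_words by (auto simp: sbars_def)
qed

lemma SAbar_generated:
  assumes "submodule M K (SAbar n)" "\<And>xs. xs \<in> words A n \<Longrightarrow> sbars xs \<in> M"
  shows "carrier (SAbar n) \<subseteq> M"
  using assms unfolding SAbar_def
  by (intro power_generated[OF Abar_module]) (auto elim!: words_AbarE simp: sbars_def)

lemma SAbar_ext:
  assumes "module K U" "linear_map K (SAbar n) U f" "linear_map K (SAbar n) U g"
    and "\<And>xs. xs \<in> words A n \<Longrightarrow> f (sbars xs) = g (sbars xs)" and "t \<in> carrier (SAbar n)"
  shows "f t = g t"
proof -
  have "carrier (SAbar n) \<subseteq> {t \<in> carrier (SAbar n). f t = g t}"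
    by (rule SAbar_generated[OF submodule_equalizer[OF SAbar_module assms(1-3)]])
      (use assms(4) sbars_closed in auto)
  then show ?thesis using assms(5) by auto
qed

text \<open>For fixed x, the s whose tensor with x lies in \<open>M\<close> form a submodule of
  \<open>SAbar n\<close>, so in the second factor it is enough to consider words.\<close>

lemma tensor_SAbar_generated:
  assumes "module K V" "submodule M K (tensor K V (SAbar n))"
    and "\<And>x as. x \<in> carrier V \<Longrightarrow> as \<in> words A n \<Longrightarrow> pure K V (SAbar n) x (sbars as) \<in> M"
  shows "carrier (tensor K V (SAbar n)) \<subseteq> M"
proof (rule tensor_generated[OF assms(1) SAbar_module assms(2)])
  fix x s assume x: "x \<in> carrier V" and s: "s \<in> carrier (SAbar n)"
  have "linear_map K (SAbar n) (tensor K V (SAbar n)) (pure K V (SAbar n) x)"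
    using pure_bilinear[OF assms(1) SAbar_module] x by (simp add: bilinear_def)
  from submodule_vimage[OF SAbar_module tensor_module[OF assms(1) SAbar_module] this assms(2)]
  have "carrier (SAbar n) \<subseteq> {s \<in> carrier (SAbar n). pure K V (SAbar n) x s \<in> M}"
    by (rule SAbar_generated) (use assms(3) x sbars_closed in auto)
  then show "pure K V (SAbar n) x s \<in> M" using s by auto
qed

lemma tensor_SAbar_ext:
  assumes "module K V" "module K U"
    and "linear_map K (tensor K V (SAbar n)) U f" "linear_map K (tensor K V (SAbar n)) U g"
    and "\<And>x as. x \<in> carrier V \<Longrightarrow> as \<in> words A n \<Longrightarrow>
      f (pure K V (SAbar n) x (sbars as)) = g (pure K V (SAbar n) x (sbars as))"
    and "t \<in> carrier (tensor K V (SAbar n))"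
  shows "f t = g t"
proof -
  have "carrier (tensor K V (SAbar n)) \<subseteq> {t \<in> carrier (tensor K V (SAbar n)). f t = g t}"
    by (rule tensor_SAbar_generated[OF assms(1) submodule_equalizer[OF tensor_module[OF assms(1) SAbar_module] assms(2-4)]])
      (use assms(5) sbars_closed pure_closed[OF assms(1) SAbar_module] in auto)
  then show ?thesis using assms(6) by auto
qed

text \<open>Built by currying: each \<open>\<beta> x\<close> is lifted to \<open>SAbar n\<close>
  separately, and linearity of the lifts in x, known on the generators \<open>sbars as\<close>,
  spreads to all of \<open>SAbar n\<close>. The outcome is bilinear and hence a map on the tensor
  product.\<close>

lemma tensor_SAbar_lift:
  assumes V: "module K V" and U: "module K U"
    and \<beta>: "\<And>x. x \<in> carrier V \<Longrightarrow> multilinear K A n U (\<beta> x)" "\<And>x. x \<in> carrier V \<Longrightarrow> unit_null A 0 n U (\<beta> x)"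
      "\<And>as. as \<in> words A n \<Longrightarrow> linear_map K V U (\<lambda>x. \<beta> x as)"
  shows "\<exists>h. linear_map K (tensor K V (SAbar n)) U h \<and>
    (\<forall>x\<in>carrier V. \<forall>as\<in>words A n. h (pure K V (SAbar n) x (sbars as)) = \<beta> x as)"
proof -
  have "\<forall>x\<in>carrier V. \<exists>h. linear_map K (SAbar n) U h \<and> (\<forall>xs\<in>words A n. h (sbars xs) = \<beta> x xs)"
    using SAbar_lift[OF U \<beta>(1,2)] by blast
  then obtain g where g: "\<And>x. x \<in> carrier V \<Longrightarrow> linear_map K (SAbar n) U (g x)"
    "\<And>x xs. x \<in> carrier V \<Longrightarrow> xs \<in> words A n \<Longrightarrow> g x (sbars xs) = \<beta> x xs"
    by metis
  have "carrier (SAbar n) \<subseteq> {s \<in> carrier (SAbar n). linear_map K V U (\<lambda>x. g x s)}"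
  proof (rule SAbar_generated[OF submodule_linear_parameter[OF SAbar_module U g(1) V]])
    fix xs assume xs: "xs \<in> words A n"
    then have "linear_map K V U (\<lambda>x. g x (sbars xs)) \<longleftrightarrow> linear_map K V U (\<lambda>x. \<beta> x xs)"
      by (intro linear_map_cong[OF V]) (simp add: g(2))
    then show "sbars xs \<in> {s \<in> carrier (SAbar n). linear_map K V U (\<lambda>x. g x s)}"
      using \<beta>(3)[OF xs] sbars_closed[OF xs] by simp
  qed
  then have "bilinear K V (SAbar n) U g" using g(1) by (auto simp: bilinear_def)
  from tensor_lift[OF V SAbar_module U this] show ?thesis
    using g(2) sbars_closed by (metis (no_types, lifting))
qed

lemma pure_sbars_multilinear:
  assumes "module K V" "x \<in> carrier V"
  shows "multilinear K A n (tensor K V (SAbar n)) (\<lambda>as. pure K V (SAbar n) x (sbars as))"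
    and "unit_null A 0 n (tensor K V (SAbar n)) (\<lambda>as. pure K V (SAbar n) x (sbars as))"
proof -
  have l: "linear_map K (SAbar n) (tensor K V (SAbar n)) (pure K V (SAbar n) x)"
    using pure_bilinear[OF assms(1) SAbar_module] assms(2) by (simp add: bilinear_def)
  show "multilinear K A n (tensor K V (SAbar n)) (\<lambda>as. pure K V (SAbar n) x (sbars as))"
    by (rule multilinear_compose[OF sbars_multilinear l])
  show "unit_null A 0 n (tensor K V (SAbar n)) (\<lambda>as. pure K V (SAbar n) x (sbars as))"
    by (rule unit_null_compose[OF SAbar_module tensor_module[OF assms(1) SAbar_module] l sbars_unit_null])
qed

section \<open>Generators and universal property of \<open>Omega p\<close>\<close>

lemma Omega_module: "module K (Omega p)"
  unfolding Omega_def by (rule tensor_module[OF A_module SAbar_module])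

lemma om_Cons: "as \<in> words A p \<Longrightarrow> om (a # as) = pure K A (SAbar p) a (sbars as)"
  by (simp add: om_def words_iff)

lemma om_multilinear: "multilinear K A (Suc p) (Omega p) om"
proof -
  have "linear_map K A (Omega p) (\<lambda>x. om (x # l))" if "l \<in> words A p" for l
    using pure_bilinear[OF A_module SAbar_module, of p] sbars_closed[OF that] om_Cons[OF that]
    by (simp add: bilinear_def Omega_def)
  moreover have "multilinear K A p (Omega p) (\<lambda>l. om (a # l))" if "a \<in> carrier A" for a
    using pure_sbars_multilinear(1)[OF A_module that, of p]
    by (subst multilinear_cong[OF A_module om_Cons]) (simp_all add: Omega_def)
  ultimately show ?thesis by (simp add: multilinear_Suc)
qed

lemma om_closed: "xs \<in> words A (Suc p) \<Longrightarrow> om xs \<in> carrier (Omega p)"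
  by (rule multilinear_closed[OF om_multilinear])

lemma om_unit_null: "unit_null A 1 (Suc p) (Omega p) om"
proof -
  have "om (us @ \<one>\<^bsub>A\<^esub> # ws) = \<zero>\<^bsub>Omega p\<^esub>"
    if "1 \<le> length us" "set us \<subseteq> carrier A" "set ws \<subseteq> carrier A" "Suc (length us + length ws) = Suc p" for us ws
  proof -
    obtain u us' where us: "us = u # us'" using \<open>1 \<le> length us\<close> by (cases us) auto
    then have "om (us @ \<one>\<^bsub>A\<^esub> # ws) = pure K A (SAbar p) u (sbars (us' @ \<one>\<^bsub>A\<^esub> # ws))"
      using that by (simp add: om_Cons[of "us' @ \<one>\<^bsub>A\<^esub> # ws" p] words_iff)
    also have "\<dots> = \<zero>\<^bsub>Omega p\<^esub>"
      unfolding Omega_def using that us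
      by (intro unit_nullD[OF pure_sbars_multilinear(2)[OF A_module]]) auto
    finally show ?thesis .
  qed
  then show ?thesis by (simp add: unit_null_def)
qed

lemma Omega_generated:
  assumes "submodule M K (Omega p)" "\<And>xs. xs \<in> words A (Suc p) \<Longrightarrow> om xs \<in> M"
  shows "carrier (Omega p) \<subseteq> M"
  unfolding Omega_def
proof (rule tensor_SAbar_generated[OF A_module assms(1)[unfolded Omega_def]])
  fix x as assume "x \<in> carrier A" "as \<in> words A p"
  then show "pure K A (SAbar p) x (sbars as) \<in> M" using assms(2)[of "x # as"] by (simp add: om_Cons)
qed

lemma Omega_ext:
  assumes "module K U" "linear_map K (Omega p) U f" "linear_map K (Omega p) U g"
    and "\<And>xs. xs \<in> words A (Suc p) \<Longrightarrow> f (om xs) = g (om xs)" and "t \<in> carrier (Omega p)"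
  shows "f t = g t"
proof (rule tensor_SAbar_ext[OF A_module assms(1) assms(2,3)[unfolded Omega_def] _ assms(5)[unfolded Omega_def]])
  fix x as assume "x \<in> carrier A" "as \<in> words A p"
  then show "f (pure K A (SAbar p) x (sbars as)) = g (pure K A (SAbar p) x (sbars as))"
    using assms(4)[of "x # as"] by (simp add: om_Cons)
qed

lemma Omega_lift:
  assumes U: "module K U" and G: "multilinear K A (Suc p) U G" "unit_null A 1 (Suc p) U G"
  shows "\<exists>h. linear_map K (Omega p) U h \<and> (\<forall>xs\<in>words A (Suc p). h (om xs) = G xs)"
proof -
  have "unit_null A 0 p U (\<lambda>as. G (x # as))" if "x \<in> carrier A" for x
    using unit_nullD[OF G(2), of "x # _"] that by (auto simp: unit_null_def)
  then have "\<exists>h. linear_map K (Omega p) U h \<and>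
    (\<forall>x\<in>carrier A. \<forall>as\<in>words A p. h (pure K A (SAbar p) x (sbars as)) = G (x # as))"
    unfolding Omega_def
    using G(1) by (intro tensor_SAbar_lift[OF A_module U, of p "\<lambda>x as. G (x # as)"]) (simp_all add: multilinear_Suc)
  then show ?thesis by (metis (no_types, lifting) words_SucE om_Cons)
qed

lemma the_linear_map_Omega:
  assumes U: "module K U" and G: "multilinear K A (Suc p) U G" "unit_null A 1 (Suc p) U G"
  defines "f \<equiv> the_linear_map K (Omega p) U (\<lambda>f. \<forall>xs\<in>words A (p + 1). f (om xs) = G xs)"
  shows "linear_map K (Omega p) U f" "\<And>xs. xs \<in> words A (Suc p) \<Longrightarrow> f (om xs) = G xs"
proof -
  note S = the_linear_map_spec[OF Omega_module, of p U "\<lambda>f. \<forall>xs\<in>words A (p + 1). f (om xs) = G xs"]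
  have 1: "\<exists>h. linear_map K (Omega p) U h \<and> (\<forall>xs\<in>words A (p + 1). h (om xs) = G xs)"
    using Omega_lift[OF U G] by simp
  have "linear_map K (Omega p) U f \<and> (\<forall>xs\<in>words A (p + 1). f (om xs) = G xs)"
    unfolding f_def
    by (intro conjI S 1) (use Omega_ext[OF U] om_closed in auto)
  then show "linear_map K (Omega p) U f" "\<And>xs. xs \<in> words A (Suc p) \<Longrightarrow> f (om xs) = G xs" by auto
qed

section \<open>Left action, right action and the appending of a letter\<close>

lemma Omega_left:
  assumes "a \<in> carrier A"
  shows Omega_left_linear: "linear_map K (Omega p) (Omega p) (Omega_left p a)"
    and Omega_left_om: "\<And>xs. xs \<in> words A (Suc p) \<Longrightarrow> Omega_left p a (om xs) = om ((a \<otimes>\<^bsub>A\<^esub> hd xs) # tl xs)"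
proof -
  have "unit_null A 1 (Suc p) (Omega p) (\<lambda>xs. om ((a \<otimes>\<^bsub>A\<^esub> hd xs) # tl xs))"
    unfolding unit_null_def
  proof (intro allI impI)
    fix us ws assume uw: "1 \<le> length us" "set us \<subseteq> carrier A" "set ws \<subseteq> carrier A"
      "Suc (length us + length ws) = Suc p"
    obtain u us' where us: "us = u # us'" using uw(1) by (cases us) auto
    show "om ((a \<otimes>\<^bsub>A\<^esub> hd (us @ \<one>\<^bsub>A\<^esub> # ws)) # tl (us @ \<one>\<^bsub>A\<^esub> # ws)) = \<zero>\<^bsub>Omega p\<^esub>"
      using unit_nullD[OF om_unit_null, of "(a \<otimes>\<^bsub>A\<^esub> u) # us'" ws p] uw assms us by simp
  qed
  note L = the_linear_map_Omega[OF Omega_module multilinear_mult_hd[OF om_multilinear assms] this, folded Omega_left_def]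
  show "linear_map K (Omega p) (Omega p) (Omega_left p a)"
    "\<And>xs. xs \<in> words A (Suc p) \<Longrightarrow> Omega_left p a (om xs) = om ((a \<otimes>\<^bsub>A\<^esub> hd xs) # tl xs)"
    by (rule L)+
qed

lemma multilinear_append:
  assumes "multilinear K A (n + k) U G" "bs \<in> words A k"
  shows "multilinear K A n U (\<lambda>l. G (l @ bs))"
proof -
  have "linear_map K A U (\<lambda>x. G (us @ x # ws @ bs))"
    if "set us \<subseteq> carrier A" "set ws \<subseteq> carrier A" "Suc (length us + length ws) = n" for us ws
    using that assms(2) by (intro multilinear_slot[OF assms(1)]) (auto simp: words_iff)
  then show ?thesis using multilinear_closed[OF assms(1)] assms(2)
    by (auto simp: multilinear_def words_iff)
qed

lemma Omega_snoc:
  assumes "a \<in> carrier A"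
  shows Omega_snoc_linear: "linear_map K (Omega p) (Omega (Suc p)) (Omega_snoc p a)"
    and Omega_snoc_om: "\<And>xs. xs \<in> words A (Suc p) \<Longrightarrow> Omega_snoc p a (om xs) = om (xs @ [a])"
proof -
  have m: "multilinear K A (Suc p) (Omega (Suc p)) (\<lambda>xs. om (xs @ [a]))"
    using assms by (intro multilinear_append[where k = 1]) (simp_all add: om_multilinear words_iff)
  have "unit_null A 1 (Suc p) (Omega (Suc p)) (\<lambda>xs. om (xs @ [a]))"
    unfolding unit_null_def using unit_nullD[OF om_unit_null, of _ "_ @ [a]" "Suc p"] assms by auto
  note L = the_linear_map_Omega[OF Omega_module m this]
  show "linear_map K (Omega p) (Omega (Suc p)) (Omega_snoc p a)"
    "\<And>xs. xs \<in> words A (Suc p) \<Longrightarrow> Omega_snoc p a (om xs) = om (xs @ [a])"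
    using L by (simp_all add: Omega_snoc_def)
qed

lemma bar_d_zero: "module K U \<Longrightarrow> bar_d A U (\<lambda>l. \<zero>\<^bsub>U\<^esub>) xs = \<zero>\<^bsub>U\<^esub>"
  by (induction xs rule: induct_list012) (simp_all add: module_zero_minus_zero)

lemma bar_d_om_closed: "xs \<in> words A (Suc (Suc p)) \<Longrightarrow> bar_d A (Omega p) om xs \<in> carrier (Omega p)"
  by (rule bar_d_closed[OF Omega_module om_closed])

lemma words_append: "xs \<in> words A n \<Longrightarrow> ys \<in> words A k \<Longrightarrow> xs @ ys \<in> words A (n + k)"
  by (auto simp: words_iff)

lemma words_snoc: "xs \<in> words A n \<Longrightarrow> a \<in> carrier A \<Longrightarrow> xs @ [a] \<in> words A (Suc n)"
  by (auto simp: words_iff)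

lemma om_interior_normalized: "interior_normalized A (Suc p) (Omega p) om"
  unfolding interior_normalized_def
proof (intro allI impI)
  fix us ws assume "us \<noteq> []" "ws \<noteq> []" "set us \<subseteq> carrier A" "set ws \<subseteq> carrier A"
    "Suc (length us + length ws) = Suc p"
  moreover from this(1) have "1 \<le> length us" by (cases us) auto
  ultimately show "om (us @ \<one>\<^bsub>A\<^esub> # ws) = \<zero>\<^bsub>Omega p\<^esub>"
    by (intro unit_nullD[OF om_unit_null])
qed

text \<open>Since (-1)^(p-i) = (-1)^p (-1)^i, the defining sum is, up to a global sign,
  \<open>bar_d\<close> of \<open>om\<close> on the word with \<open>a\<close> appended. After
  appending, every slot but the first is strictly interior, so well-definedness comes from
  \<open>bar_d_interior_normalized\<close>.\<close>

lemma Omega_right: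
  assumes "a \<in> carrier A"
  shows Omega_right_linear: "linear_map K (Omega p) (Omega p) (Omega_right p a)"
    and Omega_right_om: "\<And>xs. xs \<in> words A (Suc p) \<Longrightarrow>
      Omega_right p a (om xs) = alt (Omega p) (int p) (bar_d A (Omega p) om (xs @ [a]))"
proof -
  interpret O: module K "Omega p" by (rule Omega_module)
  let ?G = "\<lambda>xs. \<Oplus>\<^bsub>Omega p\<^esub>i\<in>{0..p}. alt (Omega p) (int p - int i) (om (merge A i (xs @ [a])))"
  have G: "?G xs = alt (Omega p) (int p) (bar_d A (Omega p) om (xs @ [a]))" if xs: "xs \<in> words A (Suc p)" for xs
  proof -
    have w: "om (merge A i (xs @ [a])) \<in> carrier (Omega p)" if "i < Suc p" for i
      using merge_words[OF words_snoc[OF xs assms] that] by (rule om_closed)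
    have "alt (Omega p) (int p) (bar_d A (Omega p) om (xs @ [a])) =
      alt (Omega p) (int p) (\<Oplus>\<^bsub>Omega p\<^esub>i\<in>{..<Suc p}. alt (Omega p) (int i) (om (merge A i (xs @ [a]))))"
      using bar_d_sum[OF Omega_module om_closed words_snoc[OF xs assms]] by simp
    also have "\<dots> = (\<Oplus>\<^bsub>Omega p\<^esub>i\<in>{..<Suc p}. alt (Omega p) (int p) (alt (Omega p) (int i) (om (merge A i (xs @ [a])))))"
      using w alt_closed[OF Omega_module] by (intro linear_map_finsum[OF Omega_module Omega_module alt_linear[OF Omega_module]]) auto
    also have "\<dots> = ?G xs"
      using w alt_closed[OF Omega_module]
      by (intro O.finsum_cong') (auto simp: alt_alt[OF Omega_module] intro!: alt_cong)
    finally show ?thesis by simp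
  qed
  have ml: "multilinear K A (Suc p) (Omega p) (\<lambda>xs. alt (Omega p) (int p) (bar_d A (Omega p) om (xs @ [a])))"
    using assms
    by (intro multilinear_compose[OF multilinear_append[where k = 1] alt_linear[OF Omega_module]])
      (simp_all add: multilinear_bar_d[OF Omega_module om_multilinear] words_iff)
  then have m: "multilinear K A (Suc p) (Omega p) ?G"
    by (subst multilinear_cong[OF A_module G])
  have "unit_null A 1 (Suc p) (Omega p) ?G"
    unfolding unit_null_def
  proof (intro allI impI)
    fix us ws assume uw: "1 \<le> length us" "set us \<subseteq> carrier A" "set ws \<subseteq> carrier A"
      "Suc (length us + length ws) = Suc p"
    then have "bar_d A (Omega p) om (us @ \<one>\<^bsub>A\<^esub> # ws @ [a]) = \<zero>\<^bsub>Omega p\<^esub>"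
      using assms by (intro interior_normalizedD[OF bar_d_interior_normalized[OF Omega_module om_closed om_interior_normalized]]) auto
    then show "?G (us @ \<one>\<^bsub>A\<^esub> # ws) = \<zero>\<^bsub>Omega p\<^esub>"
      using G[of "us @ \<one>\<^bsub>A\<^esub> # ws"] uw by (simp add: words_iff alt_zero[OF Omega_module])
  qed
  note L = the_linear_map_Omega[OF Omega_module m this, folded Omega_right_def]
  show "linear_map K (Omega p) (Omega p) (Omega_right p a)" by (rule L)
  show "Omega_right p a (om xs) = alt (Omega p) (int p) (bar_d A (Omega p) om (xs @ [a]))"
    if "xs \<in> words A (Suc p)" for xs
    using L(2)[OF that] G[OF that] by simp
qed

lemma Omega_left_closed: "a \<in> carrier A \<Longrightarrow> w \<in> carrier (Omega p) \<Longrightarrow> Omega_left p a w \<in> carrier (Omega p)"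
  by (rule linear_map_closed[OF Omega_left_linear])

lemma Omega_right_closed: "a \<in> carrier A \<Longrightarrow> w \<in> carrier (Omega p) \<Longrightarrow> Omega_right p a w \<in> carrier (Omega p)"
  by (rule linear_map_closed[OF Omega_right_linear])

lemma Omega_snoc_closed: "a \<in> carrier A \<Longrightarrow> w \<in> carrier (Omega p) \<Longrightarrow> Omega_snoc p a w \<in> carrier (Omega (Suc p))"
  by (rule linear_map_closed[OF Omega_snoc_linear])

lemma Omega_linear_parameter:
  assumes "module K U" "\<And>a. a \<in> carrier A \<Longrightarrow> linear_map K (Omega p) U (T a)"
    and "\<And>xs. xs \<in> words A (Suc p) \<Longrightarrow> linear_map K A U (\<lambda>a. T a (om xs))"
    and "w \<in> carrier (Omega p)"
  shows "linear_map K A U (\<lambda>a. T a w)"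
proof -
  have "carrier (Omega p) \<subseteq> {w \<in> carrier (Omega p). linear_map K A U (\<lambda>a. T a w)}"
  proof (rule Omega_generated[OF submodule_linear_parameter[OF Omega_module assms(1) _ A_module]])
    show "linear_map K (Omega p) U (T a)" if "a \<in> carrier A" for a by (rule assms(2)[OF that])
    show "om xs \<in> {w \<in> carrier (Omega p). linear_map K A U (\<lambda>a. T a w)}" if "xs \<in> words A (Suc p)" for xs
      using assms(3)[OF that] om_closed[OF that] by simp
  qed
  then show ?thesis using assms(4) by blast
qed

lemma Omega_left_linear_param:
  assumes "w \<in> carrier (Omega p)" shows "linear_map K A (Omega p) (\<lambda>a. Omega_left p a w)"
proof (rule Omega_linear_parameter[OF Omega_module Omega_left_linear _ assms])
  fix xs assume xs: "xs \<in> words A (Suc p)"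
  then obtain x l where x: "xs = x # l" "x \<in> carrier A" "l \<in> words A p" by (rule words_SucE)
  have "linear_map K A (Omega p) (\<lambda>x. om (x # l))"
    using om_multilinear[of p] x(3) by (simp add: multilinear_Suc)
  from linear_map_compose[OF mult_right_linear[OF x(2)] this]
  have "linear_map K A (Omega p) (\<lambda>a. om ((a \<otimes>\<^bsub>A\<^esub> x) # l))" .
  then show "linear_map K A (Omega p) (\<lambda>a. Omega_left p a (om xs))"
    by (subst linear_map_cong[OF A_module Omega_left_om[OF _ xs]]) (simp_all add: x)
qed

lemma multilinear_last:
  assumes "multilinear K A (Suc n) U G" "xs \<in> words A n"
  shows "linear_map K A U (\<lambda>a. G (xs @ [a]))"
  using multilinear_slot[OF assms(1), of xs "[]"] assms(2) by (simp add: words_iff)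

lemma Omega_snoc_linear_param:
  assumes "w \<in> carrier (Omega p)" shows "linear_map K A (Omega (Suc p)) (\<lambda>a. Omega_snoc p a w)"
proof (rule Omega_linear_parameter[OF Omega_module Omega_snoc_linear _ assms])
  fix xs assume xs: "xs \<in> words A (Suc p)"
  show "linear_map K A (Omega (Suc p)) (\<lambda>a. Omega_snoc p a (om xs))"
    by (subst linear_map_cong[OF A_module Omega_snoc_om[OF _ xs]]) (auto intro: multilinear_last[OF om_multilinear xs])
qed

lemma Omega_right_linear_param:
  assumes "w \<in> carrier (Omega p)" shows "linear_map K A (Omega p) (\<lambda>a. Omega_right p a w)"
proof (rule Omega_linear_parameter[OF Omega_module Omega_right_linear _ assms])
  fix xs assume xs: "xs \<in> words A (Suc p)"
  have "linear_map K A (Omega p) (\<lambda>a. alt (Omega p) (int p) (bar_d A (Omega p) om (xs @ [a])))"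
    by (intro linear_map_alt_fun[OF Omega_module] multilinear_last[OF _ xs] multilinear_bar_d[OF Omega_module om_multilinear])
  then show "linear_map K A (Omega p) (\<lambda>a. Omega_right p a (om xs))"
    by (subst linear_map_cong[OF A_module Omega_right_om[OF _ xs]]) auto
qed

section \<open>Bimodule laws and their relation to appending\<close>

lemma Omega_snoc_one:
  assumes "w \<in> carrier (Omega p)" shows "Omega_snoc p \<one>\<^bsub>A\<^esub> w = \<zero>\<^bsub>Omega (Suc p)\<^esub>"
proof (rule Omega_ext[OF Omega_module Omega_snoc_linear linear_map_const_zero[OF Omega_module] _ assms])
  fix xs assume xs: "xs \<in> words A (Suc p)"
  then have "1 \<le> length xs" by (auto simp: words_iff)
  then show "Omega_snoc p \<one>\<^bsub>A\<^esub> (om xs) = \<zero>\<^bsub>Omega (Suc p)\<^esub>"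
    using unit_nullD[OF om_unit_null, of xs "[]" "Suc p"] xs by (simp add: Omega_snoc_om words_iff)
qed simp

lemma Omega_left_one:
  assumes "w \<in> carrier (Omega p)" shows "Omega_left p \<one>\<^bsub>A\<^esub> w = w"
  by (rule Omega_ext[OF Omega_module Omega_left_linear linear_map_id _ assms])
    (auto simp: Omega_left_om elim!: words_SucE)

lemma Omega_left_left:
  assumes "w \<in> carrier (Omega p)" "a \<in> carrier A" "b \<in> carrier A"
  shows "Omega_left p a (Omega_left p b w) = Omega_left p (a \<otimes>\<^bsub>A\<^esub> b) w"
  by (rule Omega_ext[OF Omega_module linear_map_compose[OF Omega_left_linear Omega_left_linear] Omega_left_linear _ assms(1)])
    (use assms(2,3) in \<open>auto simp: Omega_left_om A.m_assoc elim!: words_SucE\<close>)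

lemma Omega_snoc_left:
  assumes "w \<in> carrier (Omega p)" "a \<in> carrier A" "b \<in> carrier A"
  shows "Omega_left (Suc p) b (Omega_snoc p a w) = Omega_snoc p a (Omega_left p b w)"
proof (rule Omega_ext[OF Omega_module linear_map_compose[OF Omega_snoc_linear Omega_left_linear]
    linear_map_compose[OF Omega_left_linear Omega_snoc_linear] _ assms(1)])
  fix xs assume "xs \<in> words A (Suc p)"
  then obtain x l where x: "xs = x # l" "x \<in> carrier A" "l \<in> words A p" by (rule words_SucE)
  then have "x # l @ [a] \<in> words A (Suc (Suc p))" using assms(2) by (simp add: words_snoc)
  from Omega_left_om[OF assms(3) this]
  show "Omega_left (Suc p) b (Omega_snoc p a (om xs)) = Omega_snoc p a (Omega_left p b (om xs))"
    using x assms(2,3) by (simp add: Omega_left_om Omega_snoc_om)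
qed (use assms in auto)

text \<open>Only the first face changes the first letter, and there associativity moves
  \<open>a\<close> past the merge.\<close>

lemma bar_d_mult_hd:
  assumes "a \<in> carrier A" "x \<in> carrier A" "l \<in> words A (Suc n)"
  shows "bar_d A U (\<lambda>l. G ((a \<otimes>\<^bsub>A\<^esub> hd l) # tl l)) (x # l) = bar_d A U G ((a \<otimes>\<^bsub>A\<^esub> x) # l)"
  using assms by (auto simp: A.m_assoc elim!: words_SucE)

lemma Omega_left_right:
  assumes "w \<in> carrier (Omega p)" "a \<in> carrier A" "b \<in> carrier A"
  shows "Omega_left p a (Omega_right p b w) = Omega_right p b (Omega_left p a w)"
proof (rule Omega_ext[OF Omega_module linear_map_compose[OF Omega_right_linear Omega_left_linear]
    linear_map_compose[OF Omega_left_linear Omega_right_linear] _ assms(1)])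
  fix xs assume xs: "xs \<in> words A (Suc p)"
  then obtain x l where x: "xs = x # l" "x \<in> carrier A" "l \<in> words A p" by (rule words_SucE)
  have w: "xs @ [b] \<in> words A (Suc (Suc p))" by (rule words_snoc[OF xs assms(3)])
  have "Omega_left p a (Omega_right p b (om xs)) =
      alt (Omega p) (int p) (Omega_left p a (bar_d A (Omega p) om (xs @ [b])))"
    using xs assms(2,3) bar_d_om_closed[OF w]
    by (simp add: Omega_right_om linear_map_alt[OF Omega_module Omega_module Omega_left_linear])
  also have "Omega_left p a (bar_d A (Omega p) om (xs @ [b])) =
      bar_d A (Omega p) (\<lambda>l. Omega_left p a (om l)) (xs @ [b])"
    by (rule bar_d_hom[OF Omega_module Omega_module Omega_left_linear[OF assms(2)] om_closed w])
  also have "\<dots> = bar_d A (Omega p) (\<lambda>l. om ((a \<otimes>\<^bsub>A\<^esub> hd l) # tl l)) (xs @ [b])"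
    by (rule bar_d_cong[OF Omega_left_om[OF assms(2)] w])
  also have "\<dots> = bar_d A (Omega p) om ((a \<otimes>\<^bsub>A\<^esub> x) # l @ [b])"
    using bar_d_mult_hd[OF assms(2) x(2) words_snoc[OF x(3) assms(3)]] x(1) by simp
  also have "alt (Omega p) (int p) \<dots> = Omega_right p b (Omega_left p a (om xs))"
    using xs x assms(2,3) by (simp add: Omega_right_om Omega_left_om)
  finally show "Omega_left p a (Omega_right p b (om xs)) = Omega_right p b (Omega_left p a (om xs))" .
qed (use assms in auto)

text \<open>Every face except the last keeps the appended unit in a normalized slot and vanishes.
  The last face restores the word with sign (-1)^p, which cancels the global sign of the
  action.\<close>

lemma Omega_right_one:
  assumes "w \<in> carrier (Omega p)" shows "Omega_right p \<one>\<^bsub>A\<^esub> w = w"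
proof (rule Omega_ext[OF Omega_module Omega_right_linear linear_map_id _ assms])
  interpret O: module K "Omega p" by (rule Omega_module)
  fix xs assume xs: "xs \<in> words A (Suc p)"
  then obtain ys y where y: "xs = ys @ [y]" "y \<in> carrier A" "ys \<in> words A p" by (rule words_snocE)
  have "bar_d A (Omega p) (\<lambda>l. om (l @ [\<one>\<^bsub>A\<^esub>])) xs = \<zero>\<^bsub>Omega p\<^esub>"
  proof (cases p)
    case 0
    then show ?thesis using y by simp
  next
    case (Suc q)
    have "bar_d A (Omega p) (\<lambda>l. om (l @ [\<one>\<^bsub>A\<^esub>])) xs = bar_d A (Omega p) (\<lambda>l. \<zero>\<^bsub>Omega p\<^esub>) xs"
      using unit_nullD[OF om_unit_null, of _ "[]" p] Suc xs
      by (intro bar_d_cong[of p]) (auto simp: words_iff)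
    then show ?thesis by (simp add: bar_d_zero[OF Omega_module])
  qed
  then have "bar_d A (Omega p) om (xs @ [\<one>\<^bsub>A\<^esub>]) = alt (Omega p) (int p) (om xs)"
    using bar_d_snoc[OF Omega_module om_closed y(3) y(2), where b = "\<one>\<^bsub>A\<^esub>"] y alt_closed[OF Omega_module om_closed[OF xs]] by simp
  then show "Omega_right p \<one>\<^bsub>A\<^esub> (om xs) = om xs"
    using xs by (simp add: Omega_right_om alt_alt[OF Omega_module om_closed[OF xs]]) (simp add: alt_def)
qed simp

text \<open>Read off from the square of \<open>bar_d\<close> on the word with a and b appended: the
  last face of the outer operator gives the action of ab, its other faces the action of a followed
  by that of b, and the total is zero.\<close>

lemma Omega_right_right:
  assumes "w \<in> carrier (Omega p)" "a \<in> carrier A" "b \<in> carrier A"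
  shows "Omega_right p b (Omega_right p a w) = Omega_right p (a \<otimes>\<^bsub>A\<^esub> b) w"
proof (rule Omega_ext[OF Omega_module linear_map_compose[OF Omega_right_linear Omega_right_linear]
    Omega_right_linear _ assms(1)])
  interpret O: module K "Omega p" by (rule Omega_module)
  fix xs assume xs: "xs \<in> words A (Suc p)"
  have w: "xs @ [a] \<in> words A (Suc (Suc p))" by (rule words_snoc[OF xs assms(2)])
  have wab: "xs @ [a \<otimes>\<^bsub>A\<^esub> b] \<in> words A (Suc (Suc p))" using assms by (intro words_snoc[OF xs]) simp
  let ?D = "bar_d A (Omega p) om" and ?alt = "alt (Omega p) (int p)"
  let ?X = "bar_d A (Omega p) (\<lambda>l. ?D (l @ [b])) (xs @ [a])"
  have X: "?X \<in> carrier (Omega p)"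
    by (rule bar_d_closed[OF Omega_module bar_d_om_closed w]) (rule words_snoc[OF _ assms(3)])
  have "\<zero>\<^bsub>Omega p\<^esub> = bar_d A (Omega p) ?D (xs @ [a, b])"
    using bar_d_bar_d[OF Omega_module om_closed, where xs = "xs @ [a, b]"] xs assms(2,3)
      words_append[OF xs, of "[a, b]" 2] by (simp add: words_iff)
  also have "\<dots> = ?X \<oplus>\<^bsub>Omega p\<^esub> alt (Omega p) (int (Suc p)) (?D (xs @ [a \<otimes>\<^bsub>A\<^esub> b]))"
    by (rule bar_d_snoc[OF Omega_module bar_d_om_closed xs assms(2,3)])
  also have "alt (Omega p) (int (Suc p)) (?D (xs @ [a \<otimes>\<^bsub>A\<^esub> b])) = \<ominus>\<^bsub>Omega p\<^esub> ?alt (?D (xs @ [a \<otimes>\<^bsub>A\<^esub> b]))"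
    using alt_Suc[OF Omega_module bar_d_om_closed[OF wab], of "int p"] by (simp add: add.commute)
  finally have XY: "?X = ?alt (?D (xs @ [a \<otimes>\<^bsub>A\<^esub> b]))"
    using X alt_closed[OF Omega_module bar_d_om_closed[OF wab]]
    by (metis O.a_inv_closed O.minus_equality O.minus_minus)
  have "Omega_right p b (Omega_right p a (om xs)) = ?alt (Omega_right p b (?D (xs @ [a])))"
    using xs assms(2,3) bar_d_om_closed[OF w]
    by (simp add: Omega_right_om linear_map_alt[OF Omega_module Omega_module Omega_right_linear])
  also have "Omega_right p b (?D (xs @ [a])) = bar_d A (Omega p) (\<lambda>l. Omega_right p b (om l)) (xs @ [a])"
    by (rule bar_d_hom[OF Omega_module Omega_module Omega_right_linear[OF assms(3)] om_closed w])
  also have "\<dots> = bar_d A (Omega p) (\<lambda>l. ?alt (?D (l @ [b]))) (xs @ [a])"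
    by (rule bar_d_cong[OF Omega_right_om[OF assms(3)] w])
  also have "\<dots> = ?alt ?X"
    by (rule bar_d_hom[OF Omega_module Omega_module alt_linear[OF Omega_module] bar_d_om_closed w, symmetric])
      (rule words_snoc[OF _ assms(3)])
  also have "?alt (?alt ?X) = ?X" using X by (simp add: alt_alt[OF Omega_module]) (simp add: alt_def)
  also have "?X = Omega_right p (a \<otimes>\<^bsub>A\<^esub> b) (om xs)"
    using XY xs assms(2,3) by (simp add: Omega_right_om)
  finally show "Omega_right p b (Omega_right p a (om xs)) = Omega_right p (a \<otimes>\<^bsub>A\<^esub> b) (om xs)" .
qed (use assms in auto)

text \<open>On the word with a and b appended, the last face merges a and b, and the other faces
  form the action of a with b appended. The global sign is (-1)^(p+1) here but (-1)^p in the action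
  on \<open>Omega p\<close>, which accounts for the minus.\<close>

lemma Omega_snoc_right:
  assumes "w \<in> carrier (Omega p)" "a \<in> carrier A" "b \<in> carrier A"
  shows "Omega_right (Suc p) b (Omega_snoc p a w) =
    Omega_snoc p (a \<otimes>\<^bsub>A\<^esub> b) w \<ominus>\<^bsub>Omega (Suc p)\<^esub> Omega_snoc p b (Omega_right p a w)"
proof (rule Omega_ext[OF Omega_module linear_map_compose[OF Omega_snoc_linear Omega_right_linear]
    linear_map_diff[OF Omega_module Omega_snoc_linear linear_map_compose[OF Omega_right_linear Omega_snoc_linear]] _ assms(1)])
  interpret O: module K "Omega (Suc p)" by (rule Omega_module)
  fix xs assume xs: "xs \<in> words A (Suc p)"
  let ?D = "bar_d A (Omega p) om" and ?alt = "alt (Omega (Suc p)) (int (Suc p))"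
  have w: "xs @ [a] \<in> words A (Suc (Suc p))" by (rule words_snoc[OF xs assms(2)])
  have wab: "xs @ [a \<otimes>\<^bsub>A\<^esub> b] \<in> words A (Suc (Suc p))" using assms by (intro words_snoc[OF xs]) simp
  have S: "Omega_snoc p b (?D (xs @ [a])) \<in> carrier (Omega (Suc p))"
    by (rule Omega_snoc_closed[OF assms(3) bar_d_om_closed[OF w]])
  have "Omega_right (Suc p) b (Omega_snoc p a (om xs)) = ?alt (bar_d A (Omega (Suc p)) om (xs @ [a, b]))"
    using xs assms(2,3) w by (simp add: Omega_snoc_om Omega_right_om)
  also have "bar_d A (Omega (Suc p)) om (xs @ [a, b]) =
      bar_d A (Omega (Suc p)) (\<lambda>l. om (l @ [b])) (xs @ [a]) \<oplus>\<^bsub>Omega (Suc p)\<^esub> ?alt (om (xs @ [a \<otimes>\<^bsub>A\<^esub> b]))"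
    by (rule bar_d_snoc[OF Omega_module om_closed xs assms(2,3)])
  also have "bar_d A (Omega (Suc p)) (\<lambda>l. om (l @ [b])) (xs @ [a]) =
      bar_d A (Omega (Suc p)) (\<lambda>l. Omega_snoc p b (om l)) (xs @ [a])"
    by (rule bar_d_cong[OF Omega_snoc_om[OF assms(3), symmetric] w])
  also have "\<dots> = Omega_snoc p b (?D (xs @ [a]))"
    by (rule bar_d_hom[OF Omega_module Omega_module Omega_snoc_linear[OF assms(3)] om_closed w, symmetric])
  also have "?alt (Omega_snoc p b (?D (xs @ [a])) \<oplus>\<^bsub>Omega (Suc p)\<^esub> ?alt (om (xs @ [a \<otimes>\<^bsub>A\<^esub> b]))) =
      ?alt (Omega_snoc p b (?D (xs @ [a]))) \<oplus>\<^bsub>Omega (Suc p)\<^esub> om (xs @ [a \<otimes>\<^bsub>A\<^esub> b])"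
    using S om_closed[OF wab] alt_closed[OF Omega_module om_closed[OF wab]]
    by (simp add: linear_map_add[OF alt_linear[OF Omega_module]] alt_alt[OF Omega_module]) (simp add: alt_def)
  also have "?alt (Omega_snoc p b (?D (xs @ [a]))) = \<ominus>\<^bsub>Omega (Suc p)\<^esub> Omega_snoc p b (Omega_right p a (om xs))"
    using alt_Suc[OF Omega_module S, of "int p"] bar_d_om_closed[OF w] xs assms(2,3)
    by (simp add: Omega_right_om linear_map_alt[OF Omega_module Omega_module Omega_snoc_linear] add.commute)
  finally show "Omega_right (Suc p) b (Omega_snoc p a (om xs)) =
    Omega_snoc p (a \<otimes>\<^bsub>A\<^esub> b) (om xs) \<ominus>\<^bsub>Omega (Suc p)\<^esub> Omega_snoc p b (Omega_right p a (om xs))"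
    using xs assms Omega_snoc_closed[OF assms(3) Omega_right_closed[OF assms(2) om_closed[OF xs]]] om_closed[OF wab]
    by (simp add: Omega_snoc_om O.minus_eq O.a_comm)
qed (use assms in auto)

end


section \<open>The singular Hochschild complex\<close>

lemma module_zero_space:
  assumes "cring K" shows "module K (zero_space z)"
  unfolding zero_space_def
proof -
  interpret K: cring K by fact
  show "module K (vspace {z} z (\<lambda>_ _. z) (\<lambda>_ _. z))"
    by (rule moduleI, rule K.is_cring, rule abelian_groupI) auto
qed

lemma linear_map_functional_scale:
  assumes "module K U" "module K V" "linear_map K V (vspace (carrier K) \<zero>\<^bsub>K\<^esub> (add K) (mult K)) \<psi>" "v \<in> carrier U"
  shows "linear_map K V U (\<lambda>x. \<psi> x \<odot>\<^bsub>U\<^esub> v)"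
proof -
  interpret U: module K U by fact
  have "\<psi> x \<in> carrier K" if "x \<in> carrier V" for x using linear_map_closed[OF assms(3) that] by simp
  then show ?thesis
    using assms(4) linear_map_add[OF assms(3)] linear_map_smult[OF assms(3)]
    by (intro linear_mapI) (simp_all add: U.smult_l_distr U.smult_assoc1)
qed

section \<open>Cochains as normalized functions of words, and the Hochschild differential\<close>

context k_algebra
begin

text \<open>The trace of a cochain on words in \<open>A\<close>, with every argument normalized;
  \<open>Coch_cochain_fun\<close> and \<open>Coch_of_fun\<close> pass between the two
  descriptions.\<close>

definition cochain_fun where
  "cochain_fun n p F \<longleftrightarrow> multilinear K A n (Omega p) F \<and> unit_null A 0 n (Omega p) F"

lemma cochain_fun_closed: "cochain_fun n p F \<Longrightarrow> as \<in> words A n \<Longrightarrow> F as \<in> carrier (Omega p)"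
  by (auto simp: cochain_fun_def intro: multilinear_closed)

text \<open>The counterpart of \<open>multilinear_Suc\<close> at the other end of the word, for
  functions built from \<open>Omega_right\<close> or \<open>Omega_snoc\<close>, which take the last
  letter as a parameter.\<close>

lemma multilinear_snoc:
  assumes "module K U" "\<And>a. a \<in> carrier A \<Longrightarrow> multilinear K A n U (H a)"
    and "\<And>as. as \<in> words A n \<Longrightarrow> linear_map K A U (\<lambda>a. H a as)"
  shows "multilinear K A (Suc n) U (\<lambda>l. H (last l) (butlast l))"
  unfolding multilinear_def
proof (intro conjI ballI allI impI)
  fix xs assume "xs \<in> words A (Suc n)"
  then obtain as a where "xs = as @ [a]" "a \<in> carrier A" "as \<in> words A n" by (rule words_snocE)
  then show "H (last xs) (butlast xs) \<in> carrier U" using multilinear_closed[OF assms(2)] by simp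
next
  fix us ws assume uw: "set us \<subseteq> carrier A" "set ws \<subseteq> carrier A" "Suc (length us + length ws) = Suc n"
  show "linear_map K A U (\<lambda>x. H (last (us @ x # ws)) (butlast (us @ x # ws)))"
  proof (cases ws rule: rev_cases)
    case Nil
    then show ?thesis using assms(3)[of us] uw by (simp add: words_iff)
  next
    case (snoc ws' z)
    then have "linear_map K A U (\<lambda>x. H z (us @ x # ws'))"
      using uw by (intro multilinear_slot[OF assms(2)]) auto
    then show ?thesis using snoc by (simp add: butlast_append)
  qed
qed

lemma Coch_nonneg: "m + int p \<ge> 0 \<Longrightarrow> Coch m p = Hom K (SAbar (nat (m + int p))) (Omega p)"
  by (simp add: Coch_def)

lemma Coch_module: "module K (Coch m p)"
  by (simp add: Coch_def module_Hom SAbar_module Omega_module module_zero_space K.is_cring)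

lemma Coch_neg: "\<not> m + int p \<ge> 0 \<Longrightarrow> f \<in> carrier (Coch m p) \<Longrightarrow> f = \<zero>\<^bsub>Coch m p\<^esub>"
  by (simp add: Coch_def zero_space_def)

lemma Coch_ext:
  assumes "m + int p \<ge> 0" "f \<in> carrier (Coch m p)" "g \<in> carrier (Coch m p)"
    and "\<And>as. as \<in> words A (nat (m + int p)) \<Longrightarrow> f (sbars as) = g (sbars as)"
  shows "f = g"
proof (rule extensionalityI)
  let ?S = "SAbar (nat (m + int p))"
  have fg: "linear_map K ?S (Omega p) f" "linear_map K ?S (Omega p) g"
    using assms(1-3) by (simp_all add: Coch_nonneg Hom_iff)
  show "f \<in> extensional (carrier ?S)" "g \<in> extensional (carrier ?S)"
    using assms(1-3) by (simp_all add: Coch_nonneg Hom_iff)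
  show "f x = g x" if "x \<in> carrier ?S" for x
    by (rule SAbar_ext[OF Omega_module fg assms(4) that])
qed

lemma Coch_cochain_fun:
  assumes "m + int p \<ge> 0" "f \<in> carrier (Coch m p)"
  shows "cochain_fun (nat (m + int p)) p (\<lambda>as. f (sbars as))"
proof -
  have "linear_map K (SAbar (nat (m + int p))) (Omega p) f"
    using assms by (simp add: Coch_nonneg Hom_iff)
  then show ?thesis unfolding cochain_fun_def
    by (intro conjI multilinear_compose[OF sbars_multilinear] unit_null_compose[OF SAbar_module Omega_module _ sbars_unit_null])
qed

lemma Coch_of_fun:
  assumes "m + int p \<ge> 0" "cochain_fun (nat (m + int p)) p F"
  shows "\<exists>f\<in>carrier (Coch m p). \<forall>as\<in>words A (nat (m + int p)). f (sbars as) = F as"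
proof -
  let ?S = "SAbar (nat (m + int p))"
  obtain h where h: "linear_map K ?S (Omega p) h" "\<forall>as\<in>words A (nat (m + int p)). h (sbars as) = F as"
    using SAbar_lift[OF Omega_module, of "nat (m + int p)" p F] assms(2) by (auto simp: cochain_fun_def)
  have "linear_map K ?S (Omega p) (restrict h (carrier ?S))"
    by (subst linear_map_cong[OF SAbar_module, where g = h]) (simp_all add: h(1))
  then have "restrict h (carrier ?S) \<in> carrier (Coch m p)"
    using assms(1) by (simp add: Coch_nonneg Hom_iff)
  then show ?thesis using h(2) sbars_closed by (intro bexI[of _ "restrict h (carrier ?S)"]) auto
qed

lemma Coch_eval_linear:
  assumes "m + int p \<ge> 0" "s \<in> carrier (SAbar (nat (m + int p)))"
  shows "linear_map K (Coch m p) (Omega p) (\<lambda>f. f s)"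
  using assms by (intro linear_mapI) (auto simp: Coch_nonneg Hom_def linear_map_def)

lemma linear_map_Coch:
  assumes "m + int p \<ge> 0" "module K V" "\<And>x. x \<in> carrier V \<Longrightarrow> T x \<in> carrier (Coch m p)"
    and "\<And>as. as \<in> words A (nat (m + int p)) \<Longrightarrow> linear_map K V (Omega p) (\<lambda>x. T x (sbars as))"
  shows "linear_map K V (Coch m p) T"
proof (rule linear_mapI)
  interpret V: module K V by fact
  interpret C: module K "Coch m p" by (rule Coch_module)
  note ev = Coch_eval_linear[OF assms(1) sbars_closed]
  fix x assume x: "x \<in> carrier V"
  show "T x \<in> carrier (Coch m p)" using x by (rule assms(3))
  show "T (x \<oplus>\<^bsub>V\<^esub> y) = T x \<oplus>\<^bsub>Coch m p\<^esub> T y" if y: "y \<in> carrier V" for y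
    using x y assms(3)
    by (intro Coch_ext[OF assms(1)]) (simp_all add: linear_map_add[OF ev] linear_map_add[OF assms(4)])
  show "T (c \<odot>\<^bsub>V\<^esub> x) = c \<odot>\<^bsub>Coch m p\<^esub> T x" if c: "c \<in> carrier K" for c
    using x c assms(3)
    by (intro Coch_ext[OF assms(1)]) (simp_all add: linear_map_smult[OF ev] linear_map_smult[OF assms(4)])
qed

text \<open>A cochain \<open>F\<close> is extended to words with coefficients on both sides,
  \<open>[x, a\<^sub>1, \<dots>, a\<^sub>n, y] \<mapsto> x F(a\<^sub>1, \<dots>, a\<^sub>n) y\<close>; the Hochschild differential then becomes the
  restriction of \<^const>\<open>bar_d\<close> to \<open>x = y = 1\<close>.\<close>

definition hoch_ext where
  "hoch_ext p F ys = Omega_right p (last ys) (Omega_left p (hd ys) (F (butlast (tl ys))))"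

definition hoch where
  "hoch p F as = bar_d A (Omega p) (hoch_ext p F) (\<one>\<^bsub>A\<^esub> # as @ [\<one>\<^bsub>A\<^esub>])"

lemma words_ConsSnocE:
  assumes "ys \<in> words A (Suc (Suc n))"
  obtains x as y where "ys = x # as @ [y]" "x \<in> carrier A" "as \<in> words A n" "y \<in> carrier A"
proof -
  obtain x l where "ys = x # l" "x \<in> carrier A" "l \<in> words A (Suc n)" using assms by (rule words_SucE)
  moreover obtain as y where "l = as @ [y]" "y \<in> carrier A" "as \<in> words A n"
    using \<open>l \<in> words A (Suc n)\<close> by (rule words_snocE)
  ultimately show ?thesis using that by simp
qed

lemma hoch_ext_Cons_snoc: "hoch_ext p F (x # as @ [y]) = Omega_right p y (Omega_left p x (F as))"
  by (simp add: hoch_ext_def)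

lemma hoch_ext_closed:
  assumes "cochain_fun n p F" "ys \<in> words A (Suc (Suc n))"
  shows "hoch_ext p F ys \<in> carrier (Omega p)"
  using assms(2)
  by (rule words_ConsSnocE)
    (simp add: hoch_ext_Cons_snoc Omega_right_closed Omega_left_closed cochain_fun_closed[OF assms(1)])

lemma hoch_ext_multilinear:
  assumes "cochain_fun n p F" shows "multilinear K A (Suc (Suc n)) (Omega p) (hoch_ext p F)"
proof -
  have F: "multilinear K A n (Omega p) F" using assms by (simp add: cochain_fun_def)
  have "linear_map K A (Omega p) (\<lambda>x. hoch_ext p F (x # l))" if l: "l \<in> words A (Suc n)" for l
  proof -
    obtain as y where y: "l = as @ [y]" "y \<in> carrier A" "as \<in> words A n" using l by (rule words_snocE)
    show ?thesis
      using linear_map_compose[OF Omega_left_linear_param[OF cochain_fun_closed[OF assms y(3)]] Omega_right_linear[OF y(2)]]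
      by (simp add: y(1) hoch_ext_Cons_snoc)
  qed
  moreover have "multilinear K A (Suc n) (Omega p) (\<lambda>l. hoch_ext p F (x # l))" if x: "x \<in> carrier A" for x
  proof -
    have "multilinear K A (Suc n) (Omega p) (\<lambda>l. Omega_right p (last l) (Omega_left p x (F (butlast l))))"
      using x by (intro multilinear_snoc[OF Omega_module, where H = "\<lambda>y as. Omega_right p y (Omega_left p x (F as))"]
          multilinear_compose[OF F] linear_map_compose[OF Omega_left_linear Omega_right_linear]
          Omega_right_linear_param Omega_left_closed cochain_fun_closed[OF assms])
    then show ?thesis
    proof (subst multilinear_cong[OF A_module])
      fix xs assume "xs \<in> words A (Suc n)"
      then have "xs \<noteq> []" by (auto simp: words_iff)
      then show "hoch_ext p F (x # xs) = Omega_right p (last xs) (Omega_left p x (F (butlast xs)))"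
        by (simp add: hoch_ext_def)
    qed
  qed
  ultimately show ?thesis by (simp add: multilinear_Suc[of K A "Suc n"])
qed

lemma hoch_ext_interior_normalized:
  assumes "cochain_fun n p F" shows "interior_normalized A (Suc (Suc n)) (Omega p) (hoch_ext p F)"
  unfolding interior_normalized_def
proof (intro allI impI)
  fix us ws assume uw: "us \<noteq> []" "ws \<noteq> []" "set us \<subseteq> carrier A" "set ws \<subseteq> carrier A"
    "Suc (length us + length ws) = Suc (Suc n)"
  obtain x us' where us: "us = x # us'" using uw(1) by (cases us) auto
  obtain ws' y where ws: "ws = ws' @ [y]" using uw(2) by (cases ws rule: rev_cases) auto
  have "F (us' @ \<one>\<^bsub>A\<^esub> # ws') = \<zero>\<^bsub>Omega p\<^esub>"
    using assms uw us ws by (intro unit_nullD[where k = 0 and n = n]) (auto simp: cochain_fun_def)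
  moreover have "us @ \<one>\<^bsub>A\<^esub> # ws = x # (us' @ \<one>\<^bsub>A\<^esub> # ws') @ [y]" using us ws by simp
  ultimately show "hoch_ext p F (us @ \<one>\<^bsub>A\<^esub> # ws) = \<zero>\<^bsub>Omega p\<^esub>"
    using uw us ws by (simp only: hoch_ext_Cons_snoc)
      (simp add: linear_map_zero[OF Omega_module Omega_module Omega_left_linear]
        linear_map_zero[OF Omega_module Omega_module Omega_right_linear])
qed

lemma one_word_one: "as \<in> words A n \<Longrightarrow> \<one>\<^bsub>A\<^esub> # as @ [\<one>\<^bsub>A\<^esub>] \<in> words A (Suc (Suc n))"
  by (simp add: words_snoc)

text \<open>Framing by units puts every letter of the argument strictly inside the word, so interior
  normalization of the extended function becomes full normalization of
  \<open>hoch p F\<close>.\<close>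

lemma hoch_cochain_fun:
  assumes "cochain_fun n p F" shows "cochain_fun (Suc n) p (hoch p F)"
proof -
  have M: "multilinear K A (Suc (Suc (Suc n))) (Omega p) (bar_d A (Omega p) (hoch_ext p F))"
    by (rule multilinear_bar_d[OF Omega_module hoch_ext_multilinear[OF assms]])
  have I: "interior_normalized A (Suc (Suc (Suc n))) (Omega p) (bar_d A (Omega p) (hoch_ext p F))"
    by (rule bar_d_interior_normalized[OF Omega_module hoch_ext_closed[OF assms] hoch_ext_interior_normalized[OF assms]])
  have "multilinear K A (Suc n) (Omega p) (hoch p F)"
    unfolding multilinear_def
  proof (intro conjI ballI allI impI)
    fix xs assume "xs \<in> words A (Suc n)"
    then show "hoch p F xs \<in> carrier (Omega p)"
      unfolding hoch_def by (intro multilinear_closed[OF M] one_word_one)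
  next
    fix us ws assume "set us \<subseteq> carrier A" "set ws \<subseteq> carrier A" "Suc (length us + length ws) = Suc n"
    then show "linear_map K A (Omega p) (\<lambda>x. hoch p F (us @ x # ws))"
      using multilinear_slot[OF M, of "\<one>\<^bsub>A\<^esub> # us" "ws @ [\<one>\<^bsub>A\<^esub>]"] by (simp add: hoch_def)
  qed
  moreover have "unit_null A 0 (Suc n) (Omega p) (hoch p F)"
    unfolding unit_null_def
    using interior_normalizedD[OF I, of "\<one>\<^bsub>A\<^esub> # _" "_ @ [\<one>\<^bsub>A\<^esub>]"] by (simp add: hoch_def)
  ultimately show ?thesis by (simp add: cochain_fun_def)
qed

text \<open>The mirror image of \<open>bar_d_mult_hd\<close>: splitting off the last face isolates
  the only one that changes the last letter.\<close>

lemma bar_d_mult_last: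
  assumes "module K U" "\<And>l. l \<in> words A (Suc n) \<Longrightarrow> G l \<in> carrier U"
    and "xs \<in> words A (Suc n)" "a \<in> carrier A" "y \<in> carrier A"
  shows "bar_d A U (\<lambda>l. G (butlast l @ [last l \<otimes>\<^bsub>A\<^esub> y])) (xs @ [a]) = bar_d A U G (xs @ [a \<otimes>\<^bsub>A\<^esub> y])"
proof -
  obtain zs b where z: "xs = zs @ [b]" "b \<in> carrier A" "zs \<in> words A n" using assms(3) by (rule words_snocE)
  have cl: "G (butlast l @ [last l \<otimes>\<^bsub>A\<^esub> y]) \<in> carrier U" if l: "l \<in> words A (Suc n)" for l
  proof -
    obtain k c where "l = k @ [c]" "c \<in> carrier A" "k \<in> words A n" using l by (rule words_snocE)
    then show ?thesis using assms(2)[OF words_snoc[of k n "c \<otimes>\<^bsub>A\<^esub> y"]] assms(5) by simp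
  qed
  show ?thesis
    using bar_d_snoc[OF assms(1) cl z(3,2) assms(4)] bar_d_snoc[OF assms(1,2) z(3,2), where b = "a \<otimes>\<^bsub>A\<^esub> y"]
      assms(4,5) z(2) by (simp add: z(1) A.m_assoc)
qed

text \<open>By the bimodule laws, acting with x and y from outside on each face of the unit-framed
  word amounts to replacing the framing units by x and y. Consequently iterating \<open>hoch\<close>
  iterates \<open>bar_d\<close>.\<close>

lemma hoch_ext_hoch:
  assumes F: "cochain_fun n p F" and ys: "ys \<in> words A (Suc (Suc (Suc n)))"
  shows "hoch_ext p (hoch p F) ys = bar_d A (Omega p) (hoch_ext p F) ys"
proof -
  let ?E = "hoch_ext p F"
  obtain x as y where y: "ys = x # as @ [y]" "x \<in> carrier A" "as \<in> words A (Suc n)" "y \<in> carrier A"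
    using ys by (rule words_ConsSnocE)
  let ?T = "\<lambda>w. Omega_right p y (Omega_left p x w)"
  have T: "linear_map K (Omega p) (Omega p) ?T"
    by (rule linear_map_compose[OF Omega_left_linear[OF y(2)] Omega_right_linear[OF y(4)]])
  have w: "\<one>\<^bsub>A\<^esub> # as @ [\<one>\<^bsub>A\<^esub>] \<in> words A (Suc (Suc (Suc n)))" by (rule one_word_one[OF y(3)])
  \<comment> \<open>The outside actions are traded for multiplications of the two end letters, a
    form to which \<open>bar_d_mult_last\<close> and \<open>bar_d_mult_hd\<close> apply.\<close>
  have TE: "?T (?E l) = (\<lambda>k. ?E ((x \<otimes>\<^bsub>A\<^esub> hd k) # tl k)) (butlast l @ [last l \<otimes>\<^bsub>A\<^esub> y])"
    if l: "l \<in> words A (Suc (Suc n))" for l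
  proof -
    obtain u k v where k: "l = u # k @ [v]" "u \<in> carrier A" "k \<in> words A n" "v \<in> carrier A"
      using l by (rule words_ConsSnocE)
    have Fk: "F k \<in> carrier (Omega p)" by (rule cochain_fun_closed[OF F k(3)])
    show ?thesis using k(2,4) y(2,4) Fk
      by (simp add: k(1) hoch_ext_Cons_snoc Omega_left_right Omega_left_left Omega_right_right Omega_left_closed butlast_append)
  qed
  have "hoch_ext p (hoch p F) ys = ?T (bar_d A (Omega p) ?E (\<one>\<^bsub>A\<^esub> # as @ [\<one>\<^bsub>A\<^esub>]))"
    by (simp add: y(1) hoch_ext_Cons_snoc hoch_def)
  also have "\<dots> = bar_d A (Omega p) (\<lambda>l. ?T (?E l)) (\<one>\<^bsub>A\<^esub> # as @ [\<one>\<^bsub>A\<^esub>])"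
    by (rule bar_d_hom[OF Omega_module Omega_module T hoch_ext_closed[OF F] w])
  also have "\<dots> = bar_d A (Omega p) (\<lambda>l. (\<lambda>k. ?E ((x \<otimes>\<^bsub>A\<^esub> hd k) # tl k)) (butlast l @ [last l \<otimes>\<^bsub>A\<^esub> y])) ((\<one>\<^bsub>A\<^esub> # as) @ [\<one>\<^bsub>A\<^esub>])"
    using bar_d_cong[OF TE w] by simp
  also have "\<dots> = bar_d A (Omega p) (\<lambda>k. ?E ((x \<otimes>\<^bsub>A\<^esub> hd k) # tl k)) ((\<one>\<^bsub>A\<^esub> # as) @ [\<one>\<^bsub>A\<^esub> \<otimes>\<^bsub>A\<^esub> y])"
    using y multilinear_closed[OF multilinear_mult_hd[OF hoch_ext_multilinear[OF F] y(2)]]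
    by (intro bar_d_mult_last[OF Omega_module, of "Suc n"]) auto
  also have "\<dots> = bar_d A (Omega p) ?E ((x \<otimes>\<^bsub>A\<^esub> \<one>\<^bsub>A\<^esub>) # as @ [y])"
    using bar_d_mult_hd[OF y(2) A.one_closed words_snoc[OF y(3,4)]] y(4) by simp
  finally show ?thesis using y(1,2) by simp
qed

lemma hoch_hoch:
  assumes F: "cochain_fun n p F" and as: "as \<in> words A (Suc (Suc n))"
  shows "hoch p (hoch p F) as = \<zero>\<^bsub>Omega p\<^esub>"
proof -
  have "hoch p (hoch p F) as = bar_d A (Omega p) (bar_d A (Omega p) (hoch_ext p F)) (\<one>\<^bsub>A\<^esub> # as @ [\<one>\<^bsub>A\<^esub>])"
    unfolding hoch_def by (rule bar_d_cong[OF hoch_ext_hoch[OF F, unfolded hoch_def] one_word_one[OF as]])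
  also have "\<dots> = \<zero>\<^bsub>Omega p\<^esub>"
    by (rule bar_d_bar_d[OF Omega_module hoch_ext_closed[OF F] one_word_one[OF as]])
  finally show ?thesis .
qed

text \<open>Of the faces of the unit-framed word, the first absorbs the leading unit and leaves a
  left action, the last absorbs the trailing unit and leaves a right action; the faces in between
  are those of \<open>F\<close> itself.\<close>

lemma hoch_eq:
  assumes F: "cochain_fun n p F" and as: "as \<in> words A (Suc n)"
  shows "hoch p F as = Omega_left p (hd as) (F (tl as)) \<ominus>\<^bsub>Omega p\<^esub>
    (bar_d A (Omega p) F as \<oplus>\<^bsub>Omega p\<^esub> alt (Omega p) (int n) (Omega_right p (last as) (F (butlast as))))"
proof -
  let ?E = "hoch_ext p F"
  obtain a cs where a: "as = a # cs" "a \<in> carrier A" "cs \<in> words A n" using as by (rule words_SucE)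
  obtain bs b where b: "as = bs @ [b]" "b \<in> carrier A" "bs \<in> words A n" using as by (rule words_snocE)
  have E1: "?E (\<one>\<^bsub>A\<^esub> # l @ [\<one>\<^bsub>A\<^esub>]) = F l" if "l \<in> words A n" for l
    using cochain_fun_closed[OF F that] by (simp add: hoch_ext_Cons_snoc Omega_left_one Omega_right_one)
  have "hoch p F as = ?E (a # cs @ [\<one>\<^bsub>A\<^esub>]) \<ominus>\<^bsub>Omega p\<^esub> bar_d A (Omega p) (\<lambda>l. ?E (\<one>\<^bsub>A\<^esub> # l)) (as @ [\<one>\<^bsub>A\<^esub>])"
    using a by (simp add: hoch_def)
  also have "?E (a # cs @ [\<one>\<^bsub>A\<^esub>]) = Omega_left p (hd as) (F (tl as))"
    using a cochain_fun_closed[OF F a(3)] by (simp add: hoch_ext_Cons_snoc Omega_right_one Omega_left_closed)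
  also have "bar_d A (Omega p) (\<lambda>l. ?E (\<one>\<^bsub>A\<^esub> # l)) (as @ [\<one>\<^bsub>A\<^esub>]) =
      bar_d A (Omega p) (\<lambda>l. ?E (\<one>\<^bsub>A\<^esub> # l @ [\<one>\<^bsub>A\<^esub>])) as \<oplus>\<^bsub>Omega p\<^esub>
      alt (Omega p) (int n) (?E (\<one>\<^bsub>A\<^esub> # bs @ [b \<otimes>\<^bsub>A\<^esub> \<one>\<^bsub>A\<^esub>]))"
    using bar_d_snoc[OF Omega_module, where G = "\<lambda>l. ?E (\<one>\<^bsub>A\<^esub> # l)", OF _ b(3,2) A.one_closed] hoch_ext_closed[OF F] b(1)
    by simp
  also have "bar_d A (Omega p) (\<lambda>l. ?E (\<one>\<^bsub>A\<^esub> # l @ [\<one>\<^bsub>A\<^esub>])) as = bar_d A (Omega p) F as"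
    by (rule bar_d_cong[OF E1 as])
  also have "?E (\<one>\<^bsub>A\<^esub> # bs @ [b \<otimes>\<^bsub>A\<^esub> \<one>\<^bsub>A\<^esub>]) = Omega_right p (last as) (F (butlast as))"
    using b cochain_fun_closed[OF F b(3)] by (simp add: hoch_ext_Cons_snoc Omega_left_one)
  finally show ?thesis .
qed

text \<open>The definitions number the merges from 1 and \<open>bar_d\<close> numbers them from 0;
  the shift by one reverses every sign.\<close>

lemma neg_bar_d_sum:
  assumes U: "module K U" "\<And>l. l \<in> words A n \<Longrightarrow> G l \<in> carrier U" "xs \<in> words A (Suc n)"
  shows "\<ominus>\<^bsub>U\<^esub> bar_d A U G xs = (\<Oplus>\<^bsub>U\<^esub>j\<in>{1..n}. alt U (int j) (G (merge A (j - 1) xs)))"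
proof -
  interpret U: module K U by fact
  have cl: "G (merge A i xs) \<in> carrier U" if "i < n" for i
    using U(2)[OF merge_words[OF U(3) that]] .
  have sum: "bar_d A U G xs = (\<Oplus>\<^bsub>U\<^esub>i\<in>{..<n}. alt U (int i) (G (merge A i xs)))"
    by (rule bar_d_sum[OF U])
  have "\<ominus>\<^bsub>U\<^esub> bar_d A U G xs = (\<Oplus>\<^bsub>U\<^esub>i\<in>{..<n}. \<ominus>\<^bsub>U\<^esub> alt U (int i) (G (merge A i xs)))"
    unfolding sum
    using cl by (intro linear_map_finsum[OF U(1) U(1) linear_map_neg[OF U(1)]])
      (auto simp: linear_map_def intro!: alt_closed[OF U(1)])
  also have "\<dots> = (\<Oplus>\<^bsub>U\<^esub>i\<in>{..<n}. alt U (int (Suc i)) (G (merge A (Suc i - 1) xs)))"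
    using cl alt_Suc[OF U(1) cl] alt_closed[OF U(1)] by (intro U.finsum_cong') (auto simp: add.commute[of 1])
  also have "\<dots> = (\<Oplus>\<^bsub>U\<^esub>j\<in>Suc ` {..<n}. alt U (int j) (G (merge A (j - 1) xs)))"
    using cl alt_closed[OF U(1)] by (intro U.finsum_reindex[symmetric]) auto
  also have "Suc ` {..<n} = {1..n}" by (simp add: image_Suc_lessThan)
  finally show ?thesis .
qed

lemma hoch_formula:
  assumes F: "cochain_fun n p F" and as: "as \<in> words A (Suc n)"
  shows "hoch p F as = Omega_left p (hd as) (F (tl as))
    \<oplus>\<^bsub>Omega p\<^esub> (\<Oplus>\<^bsub>Omega p\<^esub>j\<in>{1..n}. alt (Omega p) (int j) (F (merge A (j - 1) as)))
    \<oplus>\<^bsub>Omega p\<^esub> alt (Omega p) (int n + 1) (Omega_right p (last as) (F (butlast as)))"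
proof -
  interpret O: module K "Omega p" by (rule Omega_module)
  obtain a cs where a: "as = a # cs" "a \<in> carrier A" "cs \<in> words A n" using as by (rule words_SucE)
  obtain bs b where b: "as = bs @ [b]" "b \<in> carrier A" "bs \<in> words A n" using as by (rule words_snocE)
  have c: "Omega_left p (hd as) (F (tl as)) \<in> carrier (Omega p)"
    using a cochain_fun_closed[OF F] by (simp add: Omega_left_closed)
  have d: "Omega_right p (last as) (F (butlast as)) \<in> carrier (Omega p)"
    using b cochain_fun_closed[OF F] by (simp add: Omega_right_closed)
  have e: "bar_d A (Omega p) F as \<in> carrier (Omega p)"
    by (rule bar_d_closed[OF Omega_module cochain_fun_closed[OF F] as])
  have neg: "\<ominus>\<^bsub>Omega p\<^esub> bar_d A (Omega p) F as =
      (\<Oplus>\<^bsub>Omega p\<^esub>j\<in>{1..n}. alt (Omega p) (int j) (F (merge A (j - 1) as)))"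
    by (rule neg_bar_d_sum[OF Omega_module cochain_fun_closed[OF F] as])
  show ?thesis
    unfolding hoch_eq[OF assms] neg[symmetric] alt_Suc[OF Omega_module d]
    using c e alt_closed[OF Omega_module d] by (simp add: O.minus_eq O.minus_add O.a_assoc)
qed

lemma delta:
  assumes m: "m + int p \<ge> 0" and f: "f \<in> carrier (Coch m p)"
  shows delta_closed_nonneg: "delta m p f \<in> carrier (Coch (m + 1) p)"
    and delta_sbars: "\<And>as. as \<in> words A (Suc (nat (m + int p))) \<Longrightarrow>
      delta m p f (sbars as) = alt (Omega p) (m + 1) (hoch p (\<lambda>as. f (sbars as)) as)"
proof -
  let ?N = "nat (m + int p)" and ?F = "\<lambda>as. f (sbars as)"
  have F: "cochain_fun ?N p ?F" by (rule Coch_cochain_fun[OF assms])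
  have N1: "nat (m + 1 + int p) = Suc ?N" "m + 1 + int p \<ge> 0" using m by simp_all
  note cl = cochain_fun_closed[OF hoch_cochain_fun[OF F]]
  have "cochain_fun (Suc ?N) p (\<lambda>as. alt (Omega p) (m + 1) (hoch p ?F as))"
    using hoch_cochain_fun[OF F] unfolding cochain_fun_def
    by (auto intro!: multilinear_compose[OF _ alt_linear[OF Omega_module]]
        unit_null_compose[OF Omega_module Omega_module alt_linear[OF Omega_module]])
  then obtain g where g: "g \<in> carrier (Coch (m + 1) p)"
    "\<And>as. as \<in> words A (Suc ?N) \<Longrightarrow> g (sbars as) = alt (Omega p) (m + 1) (hoch p ?F as)"
    using Coch_of_fun[OF N1(2), of "\<lambda>as. alt (Omega p) (m + 1) (hoch p ?F as)"] unfolding N1(1) by blast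
  let ?P = "\<lambda>g. g \<in> carrier (Coch (m + 1) p) \<and> (\<forall>as\<in>words A (?N + 1).
      alt (Omega p) (m + 1) (g (sbars as)) =
        Omega_left p (hd as) (?F (tl as))
        \<oplus>\<^bsub>Omega p\<^esub> (\<Oplus>\<^bsub>Omega p\<^esub>j\<in>{1..?N}. alt (Omega p) (int j) (?F (merge A (j - 1) as)))
        \<oplus>\<^bsub>Omega p\<^esub> alt (Omega p) (int ?N + 1) (Omega_right p (last as) (?F (butlast as))))"
  \<comment> \<open>The defining equation of \<open>delta\<close> carries the sign (-1)^(m+1) on its
    left side; \<open>alt\<close> is an involution, so the sign can be moved to the right.\<close>
  have invol: "alt (Omega p) (m + 1) (alt (Omega p) (m + 1) w) = w" if "w \<in> carrier (Omega p)" for w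
    using that by (simp add: alt_alt[OF Omega_module]) (simp add: alt_def)
  have "?P g" using g cl by (simp add: invol hoch_formula[OF F])
  moreover have "h = g" if h: "?P h" for h
  proof (rule Coch_ext[OF N1(2)])
    show "h \<in> carrier (Coch (m + 1) p)" "g \<in> carrier (Coch (m + 1) p)" using h g by auto
    fix as assume "as \<in> words A (nat (m + 1 + int p))"
    then have as: "as \<in> words A (Suc ?N)" by (simp add: N1)
    have hc: "h (sbars as) \<in> carrier (Omega p)"
      using h cochain_fun_closed[OF Coch_cochain_fun[OF N1(2)]] as N1(1) by auto
    have "alt (Omega p) (m + 1) (h (sbars as)) = hoch p ?F as"
      using h as hoch_formula[OF F as] by auto
    then show "h (sbars as) = g (sbars as)" using g(2)[OF as] invol[OF hc] by simp
  qed
  ultimately have "(THE g. ?P g) = g" by (rule the_equality)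
  then have "delta m p f = g" using m by (simp add: delta_def Let_def)
  then show "delta m p f \<in> carrier (Coch (m + 1) p)"
    "\<And>as. as \<in> words A (Suc ?N) \<Longrightarrow> delta m p f (sbars as) = alt (Omega p) (m + 1) (hoch p ?F as)"
    using g by simp_all
qed

lemma delta_linear: "linear_map K (Coch m p) (Coch (m + 1) p) (delta m p)"
proof (cases "m + int p \<ge> 0")
  case True
  let ?N = "nat (m + int p)"
  have N1: "nat (m + 1 + int p) = Suc ?N" "m + 1 + int p \<ge> 0" using True by simp_all
  show ?thesis
  proof (rule linear_map_Coch[OF N1(2) Coch_module delta_closed_nonneg[OF True]])
    fix as assume "as \<in> words A (nat (m + 1 + int p))"
    then have as: "as \<in> words A (Suc ?N)" by (simp add: N1)
    have "linear_map K (Coch m p) (Omega p) (\<lambda>f. hoch_ext p (\<lambda>as. f (sbars as)) l)"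
      if l: "l \<in> words A (Suc (Suc ?N))" for l
    proof -
      obtain x k y where k: "l = x # k @ [y]" "x \<in> carrier A" "k \<in> words A ?N" "y \<in> carrier A"
        using l by (rule words_ConsSnocE)
      show ?thesis
        unfolding k(1) hoch_ext_Cons_snoc
        by (rule linear_map_compose[OF linear_map_compose[OF Coch_eval_linear[OF True sbars_closed[OF k(3)]]
            Omega_left_linear[OF k(2)]] Omega_right_linear[OF k(4)]])
    qed
    then have "linear_map K (Coch m p) (Omega p) (\<lambda>f. hoch p (\<lambda>as. f (sbars as)) as)"
      unfolding hoch_def by (rule bar_d_linear[OF Omega_module _ one_word_one[OF as]])
    from linear_map_alt_fun[OF Omega_module this]
    show "linear_map K (Coch m p) (Omega p) (\<lambda>f. delta m p f (sbars as))"
      by (subst linear_map_cong[OF Coch_module delta_sbars[OF True _ as]])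
  qed
next
  case False
  then have "linear_map K (Coch m p) (Coch (m + 1) p) (delta m p) \<longleftrightarrow>
      linear_map K (Coch m p) (Coch (m + 1) p) (\<lambda>f. \<zero>\<^bsub>Coch (m + 1) p\<^esub>)"
    by (intro linear_map_cong[OF Coch_module]) (simp add: delta_def)
  then show ?thesis using linear_map_const_zero[OF Coch_module] by simp
qed

lemma delta_closed: "f \<in> carrier (Coch m p) \<Longrightarrow> delta m p f \<in> carrier (Coch (m + 1) p)"
  by (rule linear_map_closed[OF delta_linear])

lemma delta_delta:
  assumes f: "f \<in> carrier (Coch m p)"
  shows "delta (m + 1) p (delta m p f) = \<zero>\<^bsub>Coch (m + 2) p\<^esub>"
proof (cases "m + int p \<ge> 0")
  case True
  let ?N = "nat (m + int p)" and ?F = "\<lambda>as. f (sbars as)"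
  have F: "cochain_fun ?N p ?F" by (rule Coch_cochain_fun[OF True f])
  have N1: "nat (m + 1 + int p) = Suc ?N" "m + 1 + int p \<ge> 0"
    and N2: "nat (m + 2 + int p) = Suc (Suc ?N)" "m + 2 + int p \<ge> 0" using True by simp_all
  have m2: "m + 1 + 1 = m + 2" by simp
  note alin = alt_linear[OF Omega_module]
  show ?thesis
  proof (rule Coch_ext[OF N2(2)])
    show "delta (m + 1) p (delta m p f) \<in> carrier (Coch (m + 2) p)"
      using delta_closed[OF delta_closed[OF f]] by (simp only: m2)
    show "\<zero>\<^bsub>Coch (m + 2) p\<^esub> \<in> carrier (Coch (m + 2) p)" by (rule module_zero_closed[OF Coch_module])
    fix as assume "as \<in> words A (nat (m + 2 + int p))"
    then have as: "as \<in> words A (Suc (Suc ?N))" by (simp only: N2)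
    \<comment> \<open>The sign in \<open>delta m p f\<close> commutes with both actions and with
      \<open>bar_d\<close>, so it can be pulled out of the second differential, leaving the square
      of the unsigned \<open>hoch\<close>.\<close>
    have "hoch p (\<lambda>as. delta m p f (sbars as)) as =
        bar_d A (Omega p) (\<lambda>l. alt (Omega p) (m + 1) (hoch_ext p (hoch p ?F) l)) (\<one>\<^bsub>A\<^esub> # as @ [\<one>\<^bsub>A\<^esub>])"
      unfolding hoch_def[of p "\<lambda>as. delta m p f (sbars as)"]
    proof (rule bar_d_cong[OF _ one_word_one[OF as]])
      fix l assume "l \<in> words A (Suc (Suc (Suc ?N)))"
      then obtain x k y where k: "l = x # k @ [y]" "x \<in> carrier A" "k \<in> words A (Suc ?N)" "y \<in> carrier A"
        by (rule words_ConsSnocE)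
      have h: "hoch p ?F k \<in> carrier (Omega p)" by (rule cochain_fun_closed[OF hoch_cochain_fun[OF F] k(3)])
      show "hoch_ext p (\<lambda>as. delta m p f (sbars as)) l = alt (Omega p) (m + 1) (hoch_ext p (hoch p ?F) l)"
        using h k(2,4)
        by (simp add: k(1) hoch_ext_Cons_snoc delta_sbars[OF True f k(3)] Omega_left_closed
            linear_map_alt[OF Omega_module Omega_module Omega_left_linear]
            linear_map_alt[OF Omega_module Omega_module Omega_right_linear])
    qed
    also have "\<dots> = alt (Omega p) (m + 1) (hoch p (hoch p ?F) as)"
      unfolding hoch_def[of p "hoch p ?F" as]
      by (rule bar_d_hom[OF Omega_module Omega_module alin hoch_ext_closed[OF hoch_cochain_fun[OF F]] one_word_one[OF as], symmetric])
    also have "\<dots> = \<zero>\<^bsub>Omega p\<^esub>" by (simp add: hoch_hoch[OF F as] alt_zero[OF Omega_module])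
    finally have "delta (m + 1) p (delta m p f) (sbars as) = \<zero>\<^bsub>Omega p\<^esub>"
      using delta_sbars[OF N1(2) delta_closed[OF f], unfolded N1(1), OF as] by (simp add: alt_zero[OF Omega_module])
    also have "\<dots> = \<zero>\<^bsub>Coch (m + 2) p\<^esub> (sbars as)"
      using sbars_closed[OF as] N2 by (simp add: Coch_nonneg Hom_def)
    finally show "delta (m + 1) p (delta m p f) (sbars as) = \<zero>\<^bsub>Coch (m + 2) p\<^esub> (sbars as)" .
  qed
next
  case False
  have m2: "m + 1 + 1 = m + 2" by simp
  show ?thesis
    using False linear_map_zero[OF Coch_module Coch_module delta_linear, of "m + 1" p] by (simp add: delta_def[of m] m2)
qed

section \<open>The stabilization maps and their compatibility with the differential\<close>

lemma theta:
  assumes m: "m + int p \<ge> 0" and f: "f \<in> carrier (Coch m p)"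
  shows theta_closed_nonneg: "theta m p f \<in> carrier (Coch m (Suc p))"
    and theta_sbars: "\<And>as a. as \<in> words A (nat (m + int p)) \<Longrightarrow> a \<in> carrier A \<Longrightarrow>
      theta m p f (sbars (as @ [a])) = Omega_snoc p a (f (sbars as))"
proof -
  let ?N = "nat (m + int p)" and ?F = "\<lambda>as. f (sbars as)"
  let ?G = "\<lambda>l. Omega_snoc p (last l) (?F (butlast l))"
  have F: "cochain_fun ?N p ?F" by (rule Coch_cochain_fun[OF assms])
  have N1: "nat (m + int (Suc p)) = Suc ?N" "m + int (Suc p) \<ge> 0" using m by simp_all
  have "multilinear K A (Suc ?N) (Omega (Suc p)) ?G"
    using F by (intro multilinear_snoc[OF Omega_module, where H = "\<lambda>a as. Omega_snoc p a (?F as)"]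
        multilinear_compose[OF _ Omega_snoc_linear] Omega_snoc_linear_param cochain_fun_closed[OF F])
      (auto simp: cochain_fun_def)
  \<comment> \<open>A unit in the last slot is killed by \<open>Omega_snoc_one\<close>, a unit in an
    earlier slot by the normalization of \<open>f\<close>.\<close>
  moreover have "unit_null A 0 (Suc ?N) (Omega (Suc p)) ?G"
    unfolding unit_null_def
  proof (intro allI impI)
    fix us ws assume uw: "set us \<subseteq> carrier A" "set ws \<subseteq> carrier A" "Suc (length us + length ws) = Suc ?N"
    show "?G (us @ \<one>\<^bsub>A\<^esub> # ws) = \<zero>\<^bsub>Omega (Suc p)\<^esub>"
    proof (cases ws rule: rev_cases)
      case Nil
      then show ?thesis using Omega_snoc_one cochain_fun_closed[OF F, of us] uw by (simp add: words_iff)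
    next
      case (snoc ws' z)
      then have "?F (us @ \<one>\<^bsub>A\<^esub> # ws') = \<zero>\<^bsub>Omega p\<^esub>"
        using F uw by (intro unit_nullD[where k = 0 and n = ?N and G = ?F]) (auto simp: cochain_fun_def)
      then show ?thesis
        using snoc uw linear_map_zero[OF Omega_module Omega_module Omega_snoc_linear[of z p]]
        by (simp add: butlast_append)
    qed
  qed
  ultimately have "cochain_fun (Suc ?N) (Suc p) ?G" by (simp add: cochain_fun_def)
  then obtain g where g: "g \<in> carrier (Coch m (Suc p))" "\<And>as. as \<in> words A (Suc ?N) \<Longrightarrow> g (sbars as) = ?G as"
    using Coch_of_fun[OF N1(2), of ?G] unfolding N1(1) by blast
  let ?P = "\<lambda>g. g \<in> carrier (Coch m (p + 1)) \<and>
    (\<forall>as\<in>words A ?N. \<forall>a\<in>carrier A. g (sbars (as @ [a])) = Omega_snoc p a (f (sbars as)))"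
  have Pg: "?P g" using g words_snoc by simp
  moreover have "h = g" if h: "?P h" for h
  proof (rule Coch_ext[OF N1(2)])
    show "h \<in> carrier (Coch m (Suc p))" "g \<in> carrier (Coch m (Suc p))" using h g by auto
    fix as assume "as \<in> words A (nat (m + int (Suc p)))"
    then have "as \<in> words A (Suc ?N)" by (simp only: N1)
    then obtain bs b where "as = bs @ [b]" "b \<in> carrier A" "bs \<in> words A ?N" by (rule words_snocE)
    then show "h (sbars as) = g (sbars as)" using h Pg by simp
  qed
  ultimately have "(THE g. ?P g) = g" by (rule the_equality)
  then have "theta m p f = g" using m by (simp add: theta_def Let_def)
  then show "theta m p f \<in> carrier (Coch m (Suc p))"
    "\<And>as a. as \<in> words A ?N \<Longrightarrow> a \<in> carrier A \<Longrightarrow> theta m p f (sbars (as @ [a])) = Omega_snoc p a (f (sbars as))"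
    using g(1) Pg by simp_all
qed

lemma theta_linear: "linear_map K (Coch m p) (Coch m (Suc p)) (theta m p)"
proof (cases "m + int p \<ge> 0")
  case True
  let ?N = "nat (m + int p)"
  have N1: "nat (m + int (Suc p)) = Suc ?N" "m + int (Suc p) \<ge> 0" using True by simp_all
  show ?thesis
  proof (rule linear_map_Coch[OF N1(2) Coch_module theta_closed_nonneg[OF True]])
    fix as assume "as \<in> words A (nat (m + int (Suc p)))"
    then have "as \<in> words A (Suc ?N)" by (simp only: N1)
    then obtain bs b where b: "as = bs @ [b]" "b \<in> carrier A" "bs \<in> words A ?N" by (rule words_snocE)
    show "linear_map K (Coch m p) (Omega (Suc p)) (\<lambda>f. theta m p f (sbars as))"
      unfolding b(1)
      by (subst linear_map_cong[OF Coch_module theta_sbars[OF True _ b(3,2)]], assumption)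
        (rule linear_map_compose[OF Coch_eval_linear[OF True sbars_closed[OF b(3)]] Omega_snoc_linear[OF b(2)]])
  qed
next
  case False
  then have "linear_map K (Coch m p) (Coch m (Suc p)) (theta m p) \<longleftrightarrow>
      linear_map K (Coch m p) (Coch m (Suc p)) (\<lambda>f. \<zero>\<^bsub>Coch m (Suc p)\<^esub>)"
    by (intro linear_map_cong[OF Coch_module]) (simp add: theta_def)
  then show ?thesis using linear_map_const_zero[OF Coch_module] by simp
qed

lemma theta_closed: "f \<in> carrier (Coch m p) \<Longrightarrow> theta m p f \<in> carrier (Coch m (Suc p))"
  by (rule linear_map_closed[OF theta_linear])

text \<open>Appending a creates one new face of \<open>F'\<close>, the merge of b with a. By
  \<open>Omega_snoc_right\<close> the right action of a on the value of \<open>F'\<close> contains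
  the same merged term, and the signs make the two cancel. What remains of the right action is the
  right action term of \<open>hoch p F\<close> with a appended.\<close>

lemma hoch_snoc:
  assumes F: "cochain_fun n p F" and as: "as \<in> words A (Suc n)" and a: "a \<in> carrier A"
    and F': "cochain_fun (Suc n) (Suc p) F'"
    and F'F: "\<And>bs b. bs \<in> words A n \<Longrightarrow> b \<in> carrier A \<Longrightarrow> F' (bs @ [b]) = Omega_snoc p b (F bs)"
  shows "hoch (Suc p) F' (as @ [a]) = Omega_snoc p a (hoch p F as)"
proof -
  let ?O = "Omega (Suc p)"
  interpret O: module K ?O by (rule Omega_module)
  note mm = Omega_module Omega_module
  obtain x t where x: "as = x # t" "x \<in> carrier A" "t \<in> words A n" using as by (rule words_SucE)
  obtain bs b where b: "as = bs @ [b]" "b \<in> carrier A" "bs \<in> words A n" using as by (rule words_snocE)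
  note Fc = cochain_fun_closed[OF F] and snl = Omega_snoc_linear[OF a]
  let ?L = "Omega_left p x (F t)" and ?R = "Omega_right p b (F bs)" and ?B = "bar_d A (Omega p) F as"
  let ?S = "alt ?O (int n) (Omega_snoc p (b \<otimes>\<^bsub>A\<^esub> a) (F bs))" and ?T = "alt ?O (int n) (Omega_snoc p a ?R)"
  have L: "?L \<in> carrier (Omega p)" using x Fc by (simp add: Omega_left_closed)
  have R: "?R \<in> carrier (Omega p)" using b Fc by (simp add: Omega_right_closed)
  have B: "?B \<in> carrier (Omega p)" by (rule bar_d_closed[OF Omega_module Fc as])
  have sR: "Omega_snoc p a ?R \<in> carrier ?O" by (rule Omega_snoc_closed[OF a R])
  have s: "Omega_snoc p (b \<otimes>\<^bsub>A\<^esub> a) (F bs) \<in> carrier ?O"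
    using a b Fc by (simp add: Omega_snoc_closed)
  have S: "?S \<in> carrier ?O" "?T \<in> carrier ?O" by (rule alt_closed[OF Omega_module s], rule alt_closed[OF Omega_module sR])
  have w: "as @ [a] \<in> words A (Suc (Suc n))" by (rule words_snoc[OF as a])
  have 1: "Omega_left (Suc p) (hd (as @ [a])) (F' (tl (as @ [a]))) = Omega_snoc p a ?L"
    using x a Fc by (simp add: F'F Omega_snoc_left)
  have "bar_d A ?O F' (as @ [a]) = bar_d A ?O (\<lambda>l. F' (l @ [a])) as \<oplus>\<^bsub>?O\<^esub> alt ?O (int n) (F' (bs @ [b \<otimes>\<^bsub>A\<^esub> a]))"
    using bar_d_snoc[OF Omega_module cochain_fun_closed[OF F'] b(3,2) a] b(1) by simp
  also have "bar_d A ?O (\<lambda>l. F' (l @ [a])) as = bar_d A ?O (\<lambda>l. Omega_snoc p a (F l)) as"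
    by (rule bar_d_cong[OF F'F[OF _ a] as])
  also have "\<dots> = Omega_snoc p a ?B" by (rule bar_d_hom[OF mm snl Fc as, symmetric])
  also have "F' (bs @ [b \<otimes>\<^bsub>A\<^esub> a]) = Omega_snoc p (b \<otimes>\<^bsub>A\<^esub> a) (F bs)" using a b by (simp add: F'F)
  finally have 2: "bar_d A ?O F' (as @ [a]) = Omega_snoc p a ?B \<oplus>\<^bsub>?O\<^esub> ?S" .
  have "Omega_right (Suc p) (last (as @ [a])) (F' (butlast (as @ [a]))) =
      Omega_snoc p (b \<otimes>\<^bsub>A\<^esub> a) (F bs) \<ominus>\<^bsub>?O\<^esub> Omega_snoc p a ?R"
    using b a Fc by (simp add: F'F Omega_snoc_right butlast_append)
  then have "alt ?O (int (Suc n)) (Omega_right (Suc p) (last (as @ [a])) (F' (butlast (as @ [a])))) =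
      \<ominus>\<^bsub>?O\<^esub> alt ?O (int n) (Omega_snoc p (b \<otimes>\<^bsub>A\<^esub> a) (F bs) \<ominus>\<^bsub>?O\<^esub> Omega_snoc p a ?R)"
    using alt_Suc[OF Omega_module, of "Omega_snoc p (b \<otimes>\<^bsub>A\<^esub> a) (F bs) \<ominus>\<^bsub>?O\<^esub> Omega_snoc p a ?R" "Suc p" "int n"] s sR
    by (simp add: add.commute)
  also have "\<dots> = \<ominus>\<^bsub>?O\<^esub> (?S \<ominus>\<^bsub>?O\<^esub> ?T)"
    using s sR by (simp add: linear_map_minus[OF mm alt_linear[OF Omega_module]])
  finally have 3: "alt ?O (int (Suc n)) (Omega_right (Suc p) (last (as @ [a])) (F' (butlast (as @ [a])))) =
      \<ominus>\<^bsub>?O\<^esub> (?S \<ominus>\<^bsub>?O\<^esub> ?T)" .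
  have "hoch (Suc p) F' (as @ [a]) = Omega_snoc p a ?L \<ominus>\<^bsub>?O\<^esub>
      (Omega_snoc p a ?B \<oplus>\<^bsub>?O\<^esub> ?S \<oplus>\<^bsub>?O\<^esub> \<ominus>\<^bsub>?O\<^esub> (?S \<ominus>\<^bsub>?O\<^esub> ?T))"
    unfolding hoch_eq[OF F' w] 1 2 3 ..
  \<comment> \<open>The merged term \<open>?S\<close> drops out here, coming once from the new face
    and once from the right action.\<close>
  also have "Omega_snoc p a ?B \<oplus>\<^bsub>?O\<^esub> ?S \<oplus>\<^bsub>?O\<^esub> \<ominus>\<^bsub>?O\<^esub> (?S \<ominus>\<^bsub>?O\<^esub> ?T) = Omega_snoc p a ?B \<oplus>\<^bsub>?O\<^esub> ?T"
    using S Omega_snoc_closed[OF a B] by (simp add: O.minus_eq O.minus_add O.a_assoc O.r_neg2)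
  also have "Omega_snoc p a ?L \<ominus>\<^bsub>?O\<^esub> (Omega_snoc p a ?B \<oplus>\<^bsub>?O\<^esub> ?T) =
      Omega_snoc p a (?L \<ominus>\<^bsub>Omega p\<^esub> (?B \<oplus>\<^bsub>Omega p\<^esub> alt (Omega p) (int n) ?R))"
    using L B R alt_closed[OF Omega_module R]
    by (simp add: linear_map_minus[OF mm snl] linear_map_add[OF snl] linear_map_alt[OF mm snl] module_a_closed[OF Omega_module])
  also have "\<dots> = Omega_snoc p a (hoch p F as)"
  proof -
    have "hd as = x" "tl as = t" using x(1) by simp_all
    moreover have "last as = b" "butlast as = bs" using b(1) by simp_all
    ultimately show ?thesis unfolding hoch_eq[OF F as] by simp
  qed
  finally show ?thesis .
qed

text \<open>The sign of \<open>delta\<close> depends on the degree m only and not on the stage p, so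
  \<open>hoch_snoc\<close> carries over without a correction.\<close>

lemma theta_delta:
  assumes f: "f \<in> carrier (Coch m p)"
  shows "theta (m + 1) p (delta m p f) = delta m (Suc p) (theta m p f)"
proof (cases "m + int p \<ge> 0")
  case True
  let ?N = "nat (m + int p)" and ?F = "\<lambda>as. f (sbars as)" and ?F' = "\<lambda>as. theta m p f (sbars as)"
  have N1: "nat (m + 1 + int p) = Suc ?N" "m + 1 + int p \<ge> 0"
    and N1': "nat (m + int (Suc p)) = Suc ?N" "m + int (Suc p) \<ge> 0"
    and N2: "nat (m + 1 + int (Suc p)) = Suc (Suc ?N)" "m + 1 + int (Suc p) \<ge> 0" using True by simp_all
  have F: "cochain_fun ?N p ?F" by (rule Coch_cochain_fun[OF True f])
  have F': "cochain_fun (Suc ?N) (Suc p) ?F'"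
    using Coch_cochain_fun[OF N1'(2) theta_closed[OF f]] by (simp only: N1')
  show ?thesis
  proof (rule Coch_ext[OF N2(2) theta_closed[OF delta_closed[OF f]] delta_closed[OF theta_closed[OF f]]])
    fix as assume "as \<in> words A (nat (m + 1 + int (Suc p)))"
    then have as: "as \<in> words A (Suc (Suc ?N))" by (simp only: N2)
    then obtain bs b where b: "as = bs @ [b]" "b \<in> carrier A" "bs \<in> words A (Suc ?N)" by (rule words_snocE)
    have h: "hoch p ?F bs \<in> carrier (Omega p)" by (rule cochain_fun_closed[OF hoch_cochain_fun[OF F] b(3)])
    have "theta (m + 1) p (delta m p f) (sbars as) = Omega_snoc p b (delta m p f (sbars bs))"
      unfolding b(1) using theta_sbars[OF N1(2) delta_closed[OF f], unfolded N1(1), OF b(3,2)] .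
    also have "\<dots> = alt (Omega (Suc p)) (m + 1) (Omega_snoc p b (hoch p ?F bs))"
      using h by (simp add: delta_sbars[OF True f b(3)] linear_map_alt[OF Omega_module Omega_module Omega_snoc_linear[OF b(2)]])
    also have "Omega_snoc p b (hoch p ?F bs) = hoch (Suc p) ?F' (bs @ [b])"
      by (rule hoch_snoc[OF F b(3,2) F' theta_sbars[OF True f], symmetric])
    also have "alt (Omega (Suc p)) (m + 1) \<dots> = delta m (Suc p) (theta m p f) (sbars as)"
      using delta_sbars[OF N1'(2) theta_closed[OF f], unfolded N1'(1), OF as] b(1) by simp
    finally show "theta (m + 1) p (delta m p f) (sbars as) = delta m (Suc p) (theta m p f) (sbars as)" .
  qed
next
  case False
  then show ?thesis
    using linear_map_zero[OF Coch_module Coch_module theta_linear, of "m + 1" p]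
      linear_map_zero[OF Coch_module Coch_module delta_linear, of m "Suc p"]
    by (simp add: theta_def[of m] delta_def[of m p])
qed

section \<open>Injectivity of the stabilization maps\<close>

lemma trivial_Omega:
  assumes "\<one>\<^bsub>A\<^esub> = \<zero>\<^bsub>A\<^esub>" "w \<in> carrier (Omega p)" shows "w = \<zero>\<^bsub>Omega p\<^esub>"
proof (rule Omega_ext[OF Omega_module linear_map_id linear_map_const_zero[OF Omega_module] _ assms(2)])
  fix xs assume "xs \<in> words A (Suc p)"
  then obtain x l where x: "xs = x # l" "x \<in> carrier A" "l \<in> words A p" by (rule words_SucE)
  have "x = \<zero>\<^bsub>A\<^esub>" using A.l_one[OF x(2)] A.l_null[OF x(2)] assms(1) by simp
  moreover have "linear_map K A (Omega p) (\<lambda>x. om (x # l))"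
    using om_multilinear[of p] x(3) by (simp add: multilinear_Suc)
  ultimately show "om xs = \<zero>\<^bsub>Omega p\<^esub>" using linear_map_zero[OF A_module Omega_module] x(1) by simp
qed

text \<open>The nonzero class of \<open>a\<close> in \<open>Abar\<close> is detected by a functional
  on \<open>Abar\<close>; pulled back along \<open>bar\<close>, it automatically kills the
  unit.\<close>

lemma functional_modulo_ground:
  assumes "a \<in> carrier A" "a \<notin> ground"
  obtains \<psi> where "linear_map K A (vspace (carrier K) \<zero>\<^bsub>K\<^esub> (add K) (mult K)) \<psi>" "\<psi> a = \<one>\<^bsub>K\<^esub>" "\<psi> \<one>\<^bsub>A\<^esub> = \<zero>\<^bsub>K\<^esub>"
proof -
  let ?k = "vspace (carrier K) \<zero>\<^bsub>K\<^esub> (add K) (mult K)"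
  have "bar a \<noteq> \<zero>\<^bsub>Abar\<^esub>" using bar_zero_iff assms by simp
  note fn = linear_functional_exists[OF K.field_axioms Abar_module bar_closed[OF assms(1)] this]
  obtain \<phi> where \<phi>: "linear_map K Abar ?k \<phi>" "\<phi> (bar a) = \<one>\<^bsub>K\<^esub>" using fn(2) by blast
  have "\<phi> (bar \<one>\<^bsub>A\<^esub>) = \<zero>\<^bsub>K\<^esub>" using linear_map_zero[OF Abar_module fn(1) \<phi>(1)] by (simp add: bar_one)
  then show ?thesis using that[OF linear_map_compose[OF bar_linear \<phi>(1)]] \<phi>(2) by simp
qed

text \<open>Contracting the last slot with \<psi> is a left inverse of appending \<open>a\<close>:
  it is well defined on \<open>Omega (Suc p)\<close> because \<psi> kills the unit, and it inverts
  because \<psi> takes the value 1 at \<open>a\<close>.\<close>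

lemma Omega_snoc_eq_zero:
  assumes a: "a \<in> carrier A" "a \<notin> ground" and w: "w \<in> carrier (Omega p)"
    and z: "Omega_snoc p a w = \<zero>\<^bsub>Omega (Suc p)\<^esub>"
  shows "w = \<zero>\<^bsub>Omega p\<^esub>"
proof -
  interpret O: module K "Omega p" by (rule Omega_module)
  obtain \<psi> where \<psi>: "linear_map K A (vspace (carrier K) \<zero>\<^bsub>K\<^esub> (add K) (mult K)) \<psi>" "\<psi> a = \<one>\<^bsub>K\<^esub>" "\<psi> \<one>\<^bsub>A\<^esub> = \<zero>\<^bsub>K\<^esub>"
    using a by (rule functional_modulo_ground)
  have \<psi>c: "\<psi> x \<in> carrier K" if "x \<in> carrier A" for x using linear_map_closed[OF \<psi>(1) that] by simp
  let ?G = "\<lambda>l. \<psi> (last l) \<odot>\<^bsub>Omega p\<^esub> om (butlast l)"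
  have "multilinear K A (Suc (Suc p)) (Omega p) ?G"
    using \<psi>c by (intro multilinear_snoc[OF Omega_module, where H = "\<lambda>a l. \<psi> a \<odot>\<^bsub>Omega p\<^esub> om l"]
        multilinear_compose[OF om_multilinear] linear_map_scale[OF Omega_module linear_map_id]
        linear_map_functional_scale[OF Omega_module A_module \<psi>(1)] om_closed) auto
  moreover have "unit_null A 1 (Suc (Suc p)) (Omega p) ?G"
    unfolding unit_null_def
  proof (intro allI impI)
    fix us ws assume uw: "1 \<le> length us" "set us \<subseteq> carrier A" "set ws \<subseteq> carrier A" "Suc (length us + length ws) = Suc (Suc p)"
    show "?G (us @ \<one>\<^bsub>A\<^esub> # ws) = \<zero>\<^bsub>Omega p\<^esub>"
    proof (cases ws rule: rev_cases)
      case Nil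
      then show ?thesis using \<psi>(3) om_closed[of us p] uw by (simp add: words_iff)
    next
      case (snoc ws' z)
      then show ?thesis using unit_nullD[OF om_unit_null, of us ws' p] uw \<psi>c by (simp add: butlast_append)
    qed
  qed
  ultimately have "\<exists>L. linear_map K (Omega (Suc p)) (Omega p) L \<and>
      (\<forall>xs\<in>words A (Suc (Suc p)). L (om xs) = ?G xs)"
    by (rule Omega_lift[OF Omega_module])
  then obtain L where L: "linear_map K (Omega (Suc p)) (Omega p) L"
    "\<And>xs. xs \<in> words A (Suc (Suc p)) \<Longrightarrow> L (om xs) = ?G xs"
    by blast
  have "L (Omega_snoc p a w) = w"
  proof (rule Omega_ext[OF Omega_module linear_map_compose[OF Omega_snoc_linear[OF a(1)] L(1)] linear_map_id _ w])
    fix xs assume "xs \<in> words A (Suc p)"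
    then show "L (Omega_snoc p a (om xs)) = om xs"
      using L(2)[OF words_snoc[of xs "Suc p" a]] a(1) \<psi>(2) om_closed by (simp add: Omega_snoc_om)
  qed
  then show ?thesis using z linear_map_zero[OF Omega_module Omega_module L(1)] by simp
qed

text \<open>One element \<open>a\<close> outside the ground field serves all cochains: on a word
  ending in \<open>a\<close>, \<open>theta m p f\<close> returns the value of \<open>f\<close> with
  \<open>a\<close> appended, and appending \<open>a\<close> loses nothing. The zero algebra has no
  such \<open>a\<close>, but there every \<open>Omega p\<close> is zero.\<close>

lemma theta_inj:
  assumes nt: "\<one>\<^bsub>A\<^esub> = \<zero>\<^bsub>A\<^esub> \<or> (\<exists>a\<in>carrier A. a \<notin> ground)"
  shows "inj_on (theta m p) (carrier (Coch m p))"
proof (rule inj_on_linear_map[OF Coch_module Coch_module theta_linear])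
  fix f assume f: "f \<in> carrier (Coch m p)" and z: "theta m p f = \<zero>\<^bsub>Coch m (Suc p)\<^esub>"
  show "f = \<zero>\<^bsub>Coch m p\<^esub>"
  proof (cases "m + int p \<ge> 0")
    case True
    let ?N = "nat (m + int p)"
    have N1: "nat (m + int (Suc p)) = Suc ?N" "m + int (Suc p) \<ge> 0" using True by simp_all
    show ?thesis
    proof (rule Coch_ext[OF True f module_zero_closed[OF Coch_module]])
      fix as assume as: "as \<in> words A ?N"
      have c: "f (sbars as) \<in> carrier (Omega p)" by (rule cochain_fun_closed[OF Coch_cochain_fun[OF True f] as])
      have "f (sbars as) = \<zero>\<^bsub>Omega p\<^esub>"
        using nt
      proof (elim disjE bexE)
        assume "\<one>\<^bsub>A\<^esub> = \<zero>\<^bsub>A\<^esub>" then show ?thesis using trivial_Omega c by blast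
      next
        fix a assume a: "a \<in> carrier A" "a \<notin> ground"
        have "Omega_snoc p a (f (sbars as)) = \<zero>\<^bsub>Coch m (Suc p)\<^esub> (sbars (as @ [a]))"
          using theta_sbars[OF True f as a(1)] z by simp
        also have "\<dots> = \<zero>\<^bsub>Omega (Suc p)\<^esub>"
          using sbars_closed[OF words_snoc[OF as a(1)]] N1 by (simp add: Coch_nonneg Hom_def)
        finally show ?thesis using Omega_snoc_eq_zero a c by blast
      qed
      also have "\<dots> = \<zero>\<^bsub>Coch m p\<^esub> (sbars as)"
        using sbars_closed[OF as] True by (simp add: Coch_nonneg Hom_def)
      finally show "f (sbars as) = \<zero>\<^bsub>Coch m p\<^esub> (sbars as)" .
    qed
  qed (use f Coch_neg in blast)
qed

end


section \<open>Colimits of sequences\<close>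

text \<open>The operations of the colimit are unions over all representatives. Such a union is the
  common value once all members agree and at least one exists.\<close>

lemma UN_pair_const:
  assumes "z \<in> S" "\<And>p x. (p, x) \<in> S \<Longrightarrow> f p x = c"
  shows "(\<Union>(p, x)\<in>S. f p x) = c"
proof -
  have "(case u of (p, x) \<Rightarrow> f p x) = c" if "u \<in> S" for u using assms(2) that by (cases u) simp
  then show ?thesis using assms(1) by blast
qed

lemma push_linear:
  assumes "\<And>p. linear_map K (V p) (V (Suc p)) (t p)"
  shows "linear_map K (V p) (V (p + k)) (push t p k)"
proof (induction k)
  case 0 then show ?case by (simp add: linear_map_def)
next
  case (Suc k)
  from linear_map_compose[OF this assms] show ?case by simp
qed

lemma push_push: "push t (p + k) l (push t p k x) = push t p (k + l) x"
  by (induction l) (simp_all add: add.assoc)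

lemma push_trans: "p \<le> q \<Longrightarrow> q \<le> r \<Longrightarrow> push t q (r - q) (push t p (q - p) x) = push t p (r - p) x"
  using push_push[of t p "q - p" "r - q" x] by simp

locale sequence =
  fixes K :: "('k, 'c) ring_scheme" and V :: "nat \<Rightarrow> ('k, 'v, 'd) module_scheme" and t
  assumes V_module: "module K (V p)" and t_linear: "linear_map K (V p) (V (Suc p)) (t p)"
begin

lemma push_linear': "p \<le> r \<Longrightarrow> linear_map K (V p) (V r) (push t p (r - p))"
  using push_linear[of K V t p "r - p"] t_linear by simp

lemma push_closed: "p \<le> r \<Longrightarrow> x \<in> carrier (V p) \<Longrightarrow> push t p (r - p) x \<in> carrier (V r)"
  by (rule linear_map_closed[OF push_linear'])

text \<open>Equality at one stage persists to all later ones. Having it for every s beyond r lets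
  several pairs of representatives be compared at a single stage.\<close>

lemma colim_relD:
  assumes "((p, x), (q, y)) \<in> colim_rel V t"
  obtains r where "p \<le> r" "q \<le> r" "\<And>s. r \<le> s \<Longrightarrow> push t p (s - p) x = push t q (s - q) y"
proof -
  obtain r where r: "p \<le> r" "q \<le> r" "push t p (r - p) x = push t q (r - q) y"
    using assms by (auto simp: colim_rel_def)
  have "push t p (s - p) x = push t q (s - q) y" if "r \<le> s" for s
    using push_trans[OF r(1) that, of t x] push_trans[OF r(2) that, of t y] r(3) by simp
  then show ?thesis using that r by blast
qed

lemma colim_relI:
  "x \<in> carrier (V p) \<Longrightarrow> y \<in> carrier (V q) \<Longrightarrow> p \<le> r \<Longrightarrow> q \<le> r \<Longrightarrow>
    push t p (r - p) x = push t q (r - q) y \<Longrightarrow> ((p, x), (q, y)) \<in> colim_rel V t"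
  by (auto simp: colim_rel_def)

lemma colim_rel_equiv: "equiv (SIGMA p : UNIV. carrier (V p)) (colim_rel V t)"
proof (rule equivI)
  show "colim_rel V t \<subseteq> (SIGMA p : UNIV. carrier (V p)) \<times> (SIGMA p : UNIV. carrier (V p))"
    by (auto simp: colim_rel_def)
  show "refl_on (SIGMA p : UNIV. carrier (V p)) (colim_rel V t)"
    by (auto simp: refl_on_def colim_rel_def)
  show "sym (colim_rel V t)"
  proof (rule symI)
    fix a b assume "(a, b) \<in> colim_rel V t"
    moreover obtain p x q y where "a = (p, x)" "b = (q, y)" by (cases a, cases b) auto
    ultimately show "(b, a) \<in> colim_rel V t" by (auto simp: colim_rel_def)
  qed
  show "trans (colim_rel V t)"
  proof (rule transI)
    fix a b c assume abc: "(a, b) \<in> colim_rel V t" "(b, c) \<in> colim_rel V t"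
    obtain p x q y r z where s: "a = (p, x)" "b = (q, y)" "c = (r, z)" by (cases a, cases b, cases c) auto
    obtain n where n: "p \<le> n" "q \<le> n" "\<And>s. n \<le> s \<Longrightarrow> push t p (s - p) x = push t q (s - q) y"
      using abc(1) unfolding s by (rule colim_relD) blast
    obtain m where m: "q \<le> m" "r \<le> m" "\<And>s. m \<le> s \<Longrightarrow> push t q (s - q) y = push t r (s - r) z"
      using abc(2) unfolding s by (rule colim_relD) blast
    have xz: "x \<in> carrier (V p)" "z \<in> carrier (V r)" using abc by (auto simp: colim_rel_def s)
    have "push t p (max n m - p) x = push t r (max n m - r) z"
      using n(3)[of "max n m"] m(3)[of "max n m"] by simp
    then show "(a, c) \<in> colim_rel V t"
      using n(1) m(2) xz unfolding s by (intro colim_relI[of x p z r "max n m"]) auto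
  qed
qed

lemma colim_in_eq_iff:
  "x \<in> carrier (V p) \<Longrightarrow> y \<in> carrier (V q) \<Longrightarrow>
    colim_in V t p x = colim_in V t q y \<longleftrightarrow> ((p, x), (q, y)) \<in> colim_rel V t"
  unfolding colim_in_def by (rule eq_equiv_class_iff[OF colim_rel_equiv]) auto

lemma mem_colim_in: "(q, y) \<in> colim_in V t p x \<longleftrightarrow> ((p, x), (q, y)) \<in> colim_rel V t"
  by (simp add: colim_in_def)

lemma colim_carrierE:
  assumes "X \<in> carrier (colim V t)"
  obtains p x where "x \<in> carrier (V p)" "X = colim_in V t p x"
  using assms by (auto simp: colim_def colim_in_def elim!: quotientE)

lemma colim_in_push:
  assumes "x \<in> carrier (V p)" "p \<le> r"
  shows "colim_in V t r (push t p (r - p) x) = colim_in V t p x"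
  using assms push_closed[OF assms(2,1)]
  by (subst colim_in_eq_iff) (auto intro!: colim_relI[of _ r _ p r])

lemma colim_carrier_stage:
  assumes "X \<in> carrier (colim V t)"
  obtains p where "\<And>r. p \<le> r \<Longrightarrow> \<exists>x\<in>carrier (V r). X = colim_in V t r x"
proof -
  obtain p x where "x \<in> carrier (V p)" "X = colim_in V t p x" using assms by (rule colim_carrierE)
  then have "\<exists>x\<in>carrier (V r). X = colim_in V t r x" if "p \<le> r" for r
    using colim_in_push push_closed \<open>p \<le> r\<close> by metis
  then show ?thesis using that by blast
qed

text \<open>The definition of the sum uses the stage \<open>max p q\<close>; linearity of
  \<open>push\<close> permits any later stage, where sums of different representatives become
  comparable.\<close>

lemma stage_sum:
  assumes "x \<in> carrier (V p)" "y \<in> carrier (V q)" "max p q \<le> r"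
  shows "colim_in V t (max p q) (push t p (max p q - p) x \<oplus>\<^bsub>V (max p q)\<^esub> push t q (max p q - q) y) =
    colim_in V t r (push t p (r - p) x \<oplus>\<^bsub>V r\<^esub> push t q (r - q) y)"
proof -
  let ?m = "max p q"
  have c: "push t p (?m - p) x \<in> carrier (V ?m)" "push t q (?m - q) y \<in> carrier (V ?m)"
    using assms push_closed by auto
  have "push t ?m (r - ?m) (push t p (?m - p) x \<oplus>\<^bsub>V ?m\<^esub> push t q (?m - q) y) =
      push t p (r - p) x \<oplus>\<^bsub>V r\<^esub> push t q (r - q) y"
    using linear_map_add[OF push_linear'[OF assms(3)] c] assms(3) push_trans[of p ?m r t x] push_trans[of q ?m r t y] by simp
  then show ?thesis
    using colim_in_push[OF module_a_closed[OF V_module c] assms(3)] by simp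
qed

lemma colim_add:
  assumes x: "x \<in> carrier (V p)" and y: "y \<in> carrier (V p)"
  shows "colim_in V t p x \<oplus>\<^bsub>colim V t\<^esub> colim_in V t p y = colim_in V t p (x \<oplus>\<^bsub>V p\<^esub> y)"
proof -
  have *: "colim_in V t (max q r) (push t q (max q r - q) x' \<oplus>\<^bsub>V (max q r)\<^esub> push t r (max q r - r) y') =
      colim_in V t p (x \<oplus>\<^bsub>V p\<^esub> y)"
    if x': "(q, x') \<in> colim_in V t p x" and y': "(r, y') \<in> colim_in V t p y" for q x' r y'
  proof -
    obtain n where n: "p \<le> n" "q \<le> n" "\<And>s. n \<le> s \<Longrightarrow> push t p (s - p) x = push t q (s - q) x'"
      using x' unfolding mem_colim_in by (rule colim_relD) blast
    obtain m where m: "p \<le> m" "r \<le> m" "\<And>s. m \<le> s \<Longrightarrow> push t p (s - p) y = push t r (s - r) y'"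
      using y' unfolding mem_colim_in by (rule colim_relD) blast
    have c: "x' \<in> carrier (V q)" "y' \<in> carrier (V r)"
      using x' y' unfolding mem_colim_in by (auto simp: colim_rel_def)
    let ?s = "max n m"
    have "colim_in V t (max q r) (push t q (max q r - q) x' \<oplus>\<^bsub>V (max q r)\<^esub> push t r (max q r - r) y') =
        colim_in V t ?s (push t q (?s - q) x' \<oplus>\<^bsub>V ?s\<^esub> push t r (?s - r) y')"
      using n m c by (intro stage_sum) auto
    also have "\<dots> = colim_in V t ?s (push t p (?s - p) x \<oplus>\<^bsub>V ?s\<^esub> push t p (?s - p) y)"
      using n(3)[of ?s] m(3)[of ?s] by simp
    also have "\<dots> = colim_in V t p (x \<oplus>\<^bsub>V p\<^esub> y)"
      using stage_sum[OF x y, of ?s] n m by simp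
    finally show ?thesis .
  qed
  have mem: "(p, x) \<in> colim_in V t p x" "(p, y) \<in> colim_in V t p y"
    using x y by (auto simp: mem_colim_in colim_rel_def)
  show ?thesis
    unfolding colim_def vspace_simps by (rule UN_pair_const[OF mem(1)], rule UN_pair_const[OF mem(2)], rule *)
qed

lemma colim_smult:
  assumes c: "c \<in> carrier K" and x: "x \<in> carrier (V p)"
  shows "c \<odot>\<^bsub>colim V t\<^esub> colim_in V t p x = colim_in V t p (c \<odot>\<^bsub>V p\<^esub> x)"
proof -
  have *: "colim_in V t q (c \<odot>\<^bsub>V q\<^esub> x') = colim_in V t p (c \<odot>\<^bsub>V p\<^esub> x)"
    if x': "(q, x') \<in> colim_in V t p x" for q x'
  proof -
    obtain n where n: "p \<le> n" "q \<le> n" "\<And>s. n \<le> s \<Longrightarrow> push t p (s - p) x = push t q (s - q) x'"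
      using x' unfolding mem_colim_in by (rule colim_relD) blast
    have c': "x' \<in> carrier (V q)" using x' unfolding mem_colim_in by (auto simp: colim_rel_def)
    have "push t q (n - q) (c \<odot>\<^bsub>V q\<^esub> x') = push t p (n - p) (c \<odot>\<^bsub>V p\<^esub> x)"
      using linear_map_smult[OF push_linear'[OF n(1)] c x] linear_map_smult[OF push_linear'[OF n(2)] c c'] n(3)[of n] by simp
    then show ?thesis
      using c c' x n module.smult_closed[OF V_module c]
      by (subst colim_in_eq_iff) (auto intro!: colim_relI[of _ q _ p n])
  qed
  have mem: "(p, x) \<in> colim_in V t p x" using x by (auto simp: mem_colim_in colim_rel_def)
  show ?thesis
    unfolding colim_def vspace_simps by (rule UN_pair_const[OF mem], rule *)
qed

lemma colim_zero: "\<zero>\<^bsub>colim V t\<^esub> = colim_in V t p \<zero>\<^bsub>V p\<^esub>"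
proof -
  have "push t 0 (p - 0) \<zero>\<^bsub>V 0\<^esub> = \<zero>\<^bsub>V p\<^esub>"
    by (rule linear_map_zero[OF V_module V_module push_linear']) simp
  then show ?thesis
    using colim_in_push[OF module_zero_closed[OF V_module], of 0 p] by (simp add: colim_def)
qed

lemma colim_in_closed: "x \<in> carrier (V p) \<Longrightarrow> colim_in V t p x \<in> carrier (colim V t)"
  by (auto simp: colim_def colim_in_def intro!: quotientI)

text \<open>Each module axiom involves at most three elements of the colimit; represented at one
  stage, it reduces to the axiom in \<open>V r\<close>.\<close>

lemma colim_stage3:
  assumes "X \<in> carrier (colim V t)" "Y \<in> carrier (colim V t)" "Z \<in> carrier (colim V t)"
  obtains r x y z where "x \<in> carrier (V r)" "X = colim_in V t r x"
    "y \<in> carrier (V r)" "Y = colim_in V t r y" "z \<in> carrier (V r)" "Z = colim_in V t r z"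
proof -
  obtain p where p: "\<And>r. p \<le> r \<Longrightarrow> \<exists>x\<in>carrier (V r). X = colim_in V t r x"
    using assms(1) by (rule colim_carrier_stage) blast
  obtain q where q: "\<And>r. q \<le> r \<Longrightarrow> \<exists>x\<in>carrier (V r). Y = colim_in V t r x"
    using assms(2) by (rule colim_carrier_stage) blast
  obtain s where s: "\<And>r. s \<le> r \<Longrightarrow> \<exists>x\<in>carrier (V r). Z = colim_in V t r x"
    using assms(3) by (rule colim_carrier_stage) blast
  show ?thesis using p[of "p + q + s"] q[of "p + q + s"] s[of "p + q + s"] that by auto
qed

lemma colim_module: "module K (colim V t)"
proof -
  interpret V0: module K "V 0" by (rule V_module)
  note ops = colim_add colim_smult colim_in_closed module_a_closed[OF V_module]
    module.smult_closed[OF V_module] module_a_inv_closed[OF V_module] module_zero_closed[OF V_module]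
  note ag = module_abelian_group[OF V_module]
  show ?thesis
  proof (rule moduleI, goal_cases)
    case 1 show ?case by (rule V0.R.is_cring)
  next
    case 2
    show ?case
    proof (rule abelian_groupI, goal_cases)
      case (1 X Y)
      obtain r x y where r: "x \<in> carrier (V r)" "X = colim_in V t r x" "y \<in> carrier (V r)" "Y = colim_in V t r y"
      by (rule colim_stage3[OF 1 1(2)]) blast
      then show ?case by (simp add: ops)
    next
      case 2 show ?case by (simp add: colim_zero[of 0] ops)
    next
      case (3 X Y Z)
      obtain r x y z where r: "x \<in> carrier (V r)" "X = colim_in V t r x" "y \<in> carrier (V r)" "Y = colim_in V t r y" "z \<in> carrier (V r)" "Z = colim_in V t r z"
      by (rule colim_stage3[OF 3]) blast
      then show ?case by (simp add: ops abelian_groupE(3)[OF ag])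
    next
      case (4 X Y)
      obtain r x y where r: "x \<in> carrier (V r)" "X = colim_in V t r x" "y \<in> carrier (V r)" "Y = colim_in V t r y"
      by (rule colim_stage3[OF 4 4(2)]) blast
      then show ?case by (simp add: ops abelian_groupE(4)[OF ag])
    next
      case (5 X)
      obtain r x where r: "x \<in> carrier (V r)" "X = colim_in V t r x"
      by (rule colim_stage3[OF 5 5 5]) blast
      then show ?case by (simp add: colim_zero[of r] ops abelian_groupE(5)[OF ag])
    next
      case (6 X)
      obtain r x where r: "x \<in> carrier (V r)" "X = colim_in V t r x"
      by (rule colim_stage3[OF 6 6 6]) blast
      then have "colim_in V t r (\<ominus>\<^bsub>V r\<^esub> x) \<oplus>\<^bsub>colim V t\<^esub> X = \<zero>\<^bsub>colim V t\<^esub>"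
        by (simp add: ops abelian_group.l_neg[OF ag] colim_zero[of r])
      then show ?case using r by (intro bexI[of _ "colim_in V t r (\<ominus>\<^bsub>V r\<^esub> x)"]) (simp_all add: ops)
    qed
  next
    case (3 c X)
    obtain r x where r: "x \<in> carrier (V r)" "X = colim_in V t r x"
      by (rule colim_stage3[OF 3(2,2,2)]) blast
    then show ?case using 3(1) by (simp add: ops)
  next
    case (4 c d X)
    obtain r x where r: "x \<in> carrier (V r)" "X = colim_in V t r x"
      by (rule colim_stage3[OF 4(3,3,3)]) blast
    then show ?case using 4(1,2) by (simp add: ops module.smult_l_distr[OF V_module] V0.R.a_closed)
  next
    case (5 c X Y)
    obtain r x y where r: "x \<in> carrier (V r)" "X = colim_in V t r x" "y \<in> carrier (V r)" "Y = colim_in V t r y"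
      by (rule colim_stage3[OF 5(2,3,3)]) blast
    then show ?case using 5(1) by (simp add: ops module.smult_r_distr[OF V_module])
  next
    case (6 c d X)
    obtain r x where r: "x \<in> carrier (V r)" "X = colim_in V t r x"
      by (rule colim_stage3[OF 6(3,3,3)]) blast
    then show ?case using 6(1,2) by (simp add: ops module.smult_assoc1[OF V_module])
  next
    case (7 X)
    obtain r x where r: "x \<in> carrier (V r)" "X = colim_in V t r x"
      by (rule colim_stage3[OF 7 7 7]) blast
    then show ?case by (simp add: ops module.smult_one[OF V_module])
  qed
qed

lemma colim_in_linear: "linear_map K (V p) (colim V t) (colim_in V t p)"
  by (rule linear_mapI) (simp_all add: colim_in_closed colim_add colim_smult)

lemma colim_in_t: "x \<in> carrier (V p) \<Longrightarrow> colim_in V t (Suc p) (t p x) = colim_in V t p x"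
  using colim_in_push[of x p "Suc p"] by simp

text \<open>Elements with the same class agree at some later stage, and the composites
  \<open>push\<close> of injective maps are injective.\<close>

lemma inj_colim_in:
  assumes "\<And>p. inj_on (t p) (carrier (V p))"
  shows "inj_on (colim_in V t p) (carrier (V p))"
proof (rule inj_onI)
  have inj: "inj_on (push t p k) (carrier (V p))" for k
  proof (induction k)
    case (Suc k)
    show ?case
    proof (rule inj_onI)
      fix x y assume xy: "x \<in> carrier (V p)" "y \<in> carrier (V p)" "push t p (Suc k) x = push t p (Suc k) y"
      then have "push t p k x = push t p k y"
        using inj_onD[OF assms, of "p + k"] linear_map_closed[OF push_linear[of K V t p k]] t_linear by simp
      then show "x = y" using inj_onD[OF Suc] xy by blast
    qed
  qed simp
  fix x y assume xy: "x \<in> carrier (V p)" "y \<in> carrier (V p)" "colim_in V t p x = colim_in V t p y"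
  then obtain r where "push t p (r - p) x = push t p (r - p) y"
    by (auto simp: colim_in_eq_iff colim_rel_def)
  then show "x = y" using inj_onD[OF inj] xy by blast
qed

end

text \<open>By \<open>fu\<close>, applying f commutes with \<open>push\<close>, so equivalent pairs
  have equivalent images and the union in \<open>colim_map\<close> is over a constant
  family.\<close>

lemma colim_map_in:
  assumes V: "sequence K V t" and W: "sequence K W u"
    and f: "\<And>p. linear_map K (V p) (W p) (f p)"
    and fu: "\<And>p x. x \<in> carrier (V p) \<Longrightarrow> f (Suc p) (t p x) = u p (f p x)"
    and x: "x \<in> carrier (V p)"
  shows "colim_map W u f (colim_in V t p x) = colim_in W u p (f p x)"
proof -
  interpret V: sequence K V t by fact
  interpret W: sequence K W u by fact
  have comm: "f (p + k) (push t p k x) = push u p k (f p x)" if "x \<in> carrier (V p)" for p k x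
  proof (induction k)
    case (Suc k)
    then show ?case
      using fu[of "push t p k x" "p + k"] linear_map_closed[OF push_linear[of K V t p k] that] V.t_linear by simp
  qed simp
  have comm': "f r (push t p (r - p) x) = push u p (r - p) (f p x)" if "x \<in> carrier (V p)" "p \<le> r" for p r x
    using comm[OF that(1), of "r - p"] that(2) by simp
  have *: "colim_in W u q (f q y) = colim_in W u p (f p x)" if y: "(q, y) \<in> colim_in V t p x" for q y
  proof -
    obtain n where n: "p \<le> n" "q \<le> n" "\<And>s. n \<le> s \<Longrightarrow> push t p (s - p) x = push t q (s - q) y"
      using y unfolding V.mem_colim_in by (rule V.colim_relD) blast
    have y': "y \<in> carrier (V q)" using y unfolding V.mem_colim_in by (auto simp: colim_rel_def)
    have "push u q (n - q) (f q y) = push u p (n - p) (f p x)"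
      using comm'[OF x n(1)] comm'[OF y' n(2)] n(3)[of n] by simp
    then show ?thesis
      using linear_map_closed[OF f] x y' n
      by (subst W.colim_in_eq_iff) (auto intro!: W.colim_relI[of _ q _ p n])
  qed
  have mem: "(p, x) \<in> colim_in V t p x" using x by (auto simp: V.mem_colim_in colim_rel_def)
  show ?thesis
    unfolding colim_map_def by (rule UN_pair_const[OF mem], rule *)
qed

lemma colim_map_linear:
  assumes V: "sequence K V t" and W: "sequence K W u"
    and f: "\<And>p. linear_map K (V p) (W p) (f p)"
    and fu: "\<And>p x. x \<in> carrier (V p) \<Longrightarrow> f (Suc p) (t p x) = u p (f p x)"
  shows "linear_map K (colim V t) (colim W u) (colim_map W u f)"
proof -
  interpret V: sequence K V t by fact
  interpret W: sequence K W u by fact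
  note in_eq = colim_map_in[OF V W f fu] and fc = linear_map_closed[OF f]
  show ?thesis
  proof (rule linear_mapI)
    fix X assume X: "X \<in> carrier (colim V t)"
    then obtain p x where x: "x \<in> carrier (V p)" "X = colim_in V t p x" by (rule V.colim_carrierE)
    show "colim_map W u f X \<in> carrier (colim W u)" using x by (simp add: in_eq W.colim_in_closed fc)
    show "colim_map W u f (c \<odot>\<^bsub>colim V t\<^esub> X) = c \<odot>\<^bsub>colim W u\<^esub> colim_map W u f X" if c: "c \<in> carrier K" for c
      using x c module.smult_closed[OF V.V_module c]
      by (simp add: in_eq V.colim_smult W.colim_smult fc linear_map_smult[OF f])
    show "colim_map W u f (X \<oplus>\<^bsub>colim V t\<^esub> Y) = colim_map W u f X \<oplus>\<^bsub>colim W u\<^esub> colim_map W u f Y"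
      if Y: "Y \<in> carrier (colim V t)" for Y
    proof -
      obtain r x y z where "x \<in> carrier (V r)" "X = colim_in V t r x" "y \<in> carrier (V r)" "Y = colim_in V t r y"
        using X Y Y by (rule V.colim_stage3)
      then show ?thesis
        using module_a_closed[OF V.V_module]
        by (simp add: in_eq V.colim_add W.colim_add fc linear_map_add[OF f])
    qed
  qed
qed

section \<open>The singular Hochschild complex as a colimit of complexes\<close>

context k_algebra
begin

lemma Coch_sequence: "sequence K (Coch m) (theta m)"
  by (simp add: sequence_def Coch_module theta_linear)

lemmas Csg_module = sequence.colim_module[OF Coch_sequence, folded Csg_def]

lemma delta_sg_linear: "linear_map K (Csg m) (Csg (m + 1)) (delta_sg m)"
  unfolding Csg_def delta_sg_def
  by (rule colim_map_linear[where f = "delta m" and u = "theta (m + 1)" and t = "theta m"])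
    (simp_all add: Coch_sequence delta_linear theta_delta)

lemma delta_sg_in:
  "f \<in> carrier (Coch m p) \<Longrightarrow>
    delta_sg m (colim_in (Coch m) (theta m) p f) = colim_in (Coch (m + 1)) (theta (m + 1)) p (delta m p f)"
  unfolding delta_sg_def
  by (rule colim_map_in[where f = "delta m" and u = "theta (m + 1)" and t = "theta m" and V = "Coch m" and K = K])
    (simp_all add: Coch_sequence delta_linear theta_delta)

lemma Csg_complex: "cochain_complex K Csg delta_sg"
  unfolding cochain_complex_def
proof (intro conjI allI ballI Csg_module delta_sg_linear)
  fix n x assume "x \<in> carrier (Csg n)"
  then obtain p f where f: "f \<in> carrier (Coch n p)" "x = colim_in (Coch n) (theta n) p f"
    unfolding Csg_def by (rule sequence.colim_carrierE[OF Coch_sequence])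
  have n2: "n + 1 + 1 = n + 2" by simp
  have "delta_sg (n + 1) (delta_sg n x) =
      colim_in (Coch (n + 2)) (theta (n + 2)) p (delta (n + 1) p (delta n p f))"
    unfolding f(2) delta_sg_in[OF f(1)] delta_sg_in[OF delta_closed[OF f(1)]] n2 ..
  also have "\<dots> = \<zero>\<^bsub>Csg (n + 2)\<^esub>"
    unfolding Csg_def delta_delta[OF f(1)] by (rule sequence.colim_zero[OF Coch_sequence, symmetric])
  finally show "delta_sg (n + 1) (delta_sg n x) = \<zero>\<^bsub>Csg (n + 2)\<^esub>" .
qed

end


section \<open>The generalized Tate-Hochschild complex\<close>

lemma bilinear_left: "bilinear K V W U \<beta> \<Longrightarrow> y \<in> carrier W \<Longrightarrow> linear_map K V U (\<lambda>x. \<beta> x y)"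
  by (simp add: bilinear_def)

lemma bilinear_right: "bilinear K V W U \<beta> \<Longrightarrow> x \<in> carrier V \<Longrightarrow> linear_map K W U (\<beta> x)"
  by (simp add: bilinear_def)

lemma bilinear_compose:
  assumes "bilinear K V W U \<beta>" "linear_map K V' V f" "linear_map K W' W g"
  shows "bilinear K V' W' U (\<lambda>x y. \<beta> (f x) (g y))"
  unfolding bilinear_def
proof (intro conjI ballI)
  fix y assume "y \<in> carrier W'"
  then show "linear_map K V' U (\<lambda>x. \<beta> (f x) (g y))"
    using linear_map_compose[OF assms(2) bilinear_left[OF assms(1)]] linear_map_closed[OF assms(3)] by blast
next
  fix x assume "x \<in> carrier V'"
  then show "linear_map K W' U (\<lambda>y. \<beta> (f x) (g y))"
    using linear_map_compose[OF assms(3) bilinear_right[OF assms(1)]] linear_map_closed[OF assms(2)] by blast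
qed

section \<open>The tensor square of \<open>A\<close> and the dual bimodule\<close>

context k_algebra
begin

lemma AA_module: "module K AA"
  unfolding AA_def by (rule tensor_module[OF A_module A_module])

abbreviation pureAA where "pureAA \<equiv> pure K A A"

lemma pureAA_bilinear: "bilinear K A A AA pureAA"
  unfolding AA_def by (rule pure_bilinear[OF A_module A_module])

lemma pureAA_closed: "x \<in> carrier A \<Longrightarrow> y \<in> carrier A \<Longrightarrow> pureAA x y \<in> carrier AA"
  unfolding AA_def by (rule pure_closed[OF A_module A_module])

lemma AA_ext:
  assumes "module K U" "linear_map K AA U f" "linear_map K AA U g"
    and "\<And>x y. x \<in> carrier A \<Longrightarrow> y \<in> carrier A \<Longrightarrow> f (pureAA x y) = g (pureAA x y)" "w \<in> carrier AA"
  shows "f w = g w"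
  by (rule tensor_ext[OF A_module A_module assms(1) assms(2,3)[unfolded AA_def] assms(4) assms(5)[unfolded AA_def]])

lemma the_linear_map_AA:
  assumes U: "module K U" and \<beta>: "bilinear K A A U \<beta>"
  defines "f \<equiv> the_linear_map K AA U (\<lambda>f. \<forall>x\<in>carrier A. \<forall>y\<in>carrier A. f (pureAA x y) = \<beta> x y)"
  shows "linear_map K AA U f"
    and "\<And>x y. x \<in> carrier A \<Longrightarrow> y \<in> carrier A \<Longrightarrow> f (pureAA x y) = \<beta> x y"
proof -
  note S = the_linear_map_spec[OF AA_module, of U "\<lambda>f. \<forall>x\<in>carrier A. \<forall>y\<in>carrier A. f (pureAA x y) = \<beta> x y"]
  have 1: "\<exists>h. linear_map K AA U h \<and> (\<forall>x\<in>carrier A. \<forall>y\<in>carrier A. h (pureAA x y) = \<beta> x y)"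
    unfolding AA_def by (rule tensor_lift[OF A_module A_module U \<beta>])
  have "linear_map K AA U f \<and> (\<forall>x\<in>carrier A. \<forall>y\<in>carrier A. f (pureAA x y) = \<beta> x y)"
    unfolding f_def by (intro conjI S 1) (use AA_ext[OF U] pureAA_closed in auto)
  then show "linear_map K AA U f"
    "\<And>x y. x \<in> carrier A \<Longrightarrow> y \<in> carrier A \<Longrightarrow> f (pureAA x y) = \<beta> x y" by auto
qed

lemma outer:
  assumes "a \<in> carrier A" "b \<in> carrier A"
  shows outer_linear: "linear_map K AA AA (outer a b)"
    and outer_pure: "\<And>x y. x \<in> carrier A \<Longrightarrow> y \<in> carrier A \<Longrightarrow> outer a b (pureAA x y) = pureAA (a \<otimes>\<^bsub>A\<^esub> x) (y \<otimes>\<^bsub>A\<^esub> b)"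
  using the_linear_map_AA[OF AA_module bilinear_compose[OF pureAA_bilinear mult_left_linear[OF assms(1)] mult_right_linear[OF assms(2)]]]
  by (simp_all add: outer_def)

lemma inner:
  assumes "a \<in> carrier A" "b \<in> carrier A"
  shows inner_linear: "linear_map K AA AA (inner a b)"
    and inner_pure: "\<And>x y. x \<in> carrier A \<Longrightarrow> y \<in> carrier A \<Longrightarrow> inner a b (pureAA x y) = pureAA (x \<otimes>\<^bsub>A\<^esub> b) (a \<otimes>\<^bsub>A\<^esub> y)"
  using the_linear_map_AA[OF AA_module bilinear_compose[OF pureAA_bilinear mult_right_linear[OF assms(2)] mult_left_linear[OF assms(1)]]]
  by (simp_all add: inner_def)

lemma mult_map_linear: "linear_map K AA A mult_map"
  and mult_map_pure: "x \<in> carrier A \<Longrightarrow> y \<in> carrier A \<Longrightarrow> mult_map (pureAA x y) = x \<otimes>\<^bsub>A\<^esub> y"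
proof -
  have "bilinear K A A A (\<lambda>x y. x \<otimes>\<^bsub>A\<^esub> y)"
    using mult_left_linear mult_right_linear by (simp add: bilinear_def)
  from the_linear_map_AA[OF A_module this]
  show "linear_map K AA A mult_map"
    "x \<in> carrier A \<Longrightarrow> y \<in> carrier A \<Longrightarrow> mult_map (pureAA x y) = x \<otimes>\<^bsub>A\<^esub> y"
    by (simp_all add: mult_map_def)
qed

text \<open>The outer structure multiplies x from the left and y from the right, the inner one x
  from the right and y from the left, so associativity separates them. This is why the inner
  structure preserves the condition that cuts out \<open>Adual\<close>.\<close>

lemma outer_inner:
  assumes "a \<in> carrier A" "b \<in> carrier A" "c \<in> carrier A" "d \<in> carrier A" "w \<in> carrier AA"
  shows "outer a b (inner c d w) = inner c d (outer a b w)"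
  by (rule AA_ext[OF AA_module linear_map_compose[OF inner_linear outer_linear] linear_map_compose[OF outer_linear inner_linear] _ assms(5)])
    (use assms in \<open>simp_all add: outer_pure inner_pure A.m_assoc\<close>)

lemma Adual_simps [simp]:
  "\<zero>\<^bsub>Adual\<^esub> = \<zero>\<^bsub>AA\<^esub>" "x \<oplus>\<^bsub>Adual\<^esub> y = x \<oplus>\<^bsub>AA\<^esub> y" "c \<odot>\<^bsub>Adual\<^esub> x = c \<odot>\<^bsub>AA\<^esub> x"
  by (simp_all add: Adual_def)

lemma Adual_iff:
  "w \<in> carrier Adual \<longleftrightarrow> w \<in> carrier AA \<and> (\<forall>a\<in>carrier A. outer a \<one>\<^bsub>A\<^esub> w = outer \<one>\<^bsub>A\<^esub> a w)"
  by (simp add: Adual_def)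

lemma Adual_closed: "w \<in> carrier Adual \<Longrightarrow> w \<in> carrier AA"
  by (simp add: Adual_iff)

lemma Adual_module: "module K Adual"
proof -
  interpret T: module K AA by (rule AA_module)
  let ?H = "{w \<in> carrier AA. \<forall>a\<in>carrier A. outer a \<one>\<^bsub>A\<^esub> w = outer \<one>\<^bsub>A\<^esub> a w}"
  note l = outer_linear[OF _ A.one_closed] and r = outer_linear[OF A.one_closed]
  have "submodule ?H K AA"
    by (rule T.submoduleI)
      (auto simp: linear_map_zero[OF AA_module AA_module l] linear_map_zero[OF AA_module AA_module r]
        linear_map_a_inv[OF AA_module AA_module l] linear_map_a_inv[OF AA_module AA_module r]
        linear_map_add[OF l] linear_map_add[OF r] linear_map_smult[OF l] linear_map_smult[OF r])
  from submodule.submodule_is_module[OF this AA_module] show ?thesis by (simp add: Adual_def)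
qed

lemma Adual_linear: "linear_map K AA U f \<Longrightarrow> linear_map K Adual U f"
  by (auto simp: linear_map_def Adual_closed)

lemma inner_Adual:
  assumes "a \<in> carrier A" "b \<in> carrier A" "w \<in> carrier Adual"
  shows "inner a b w \<in> carrier Adual"
  using assms linear_map_closed[OF inner_linear[OF assms(1,2)]]
  by (simp add: Adual_iff outer_inner)

section \<open>Hochschild chains with coefficients in the dual bimodule\<close>

lemma Ch_module: "module K (Ch p)"
  unfolding Ch_def by (rule tensor_module[OF Adual_module SAbar_module])

lemma ch_eq: "as \<in> words A p \<Longrightarrow> ch w as = pure K Adual (SAbar p) w (sbars as)"
  by (simp add: ch_def words_iff)

lemma ch_closed: "w \<in> carrier Adual \<Longrightarrow> as \<in> words A p \<Longrightarrow> ch w as \<in> carrier (Ch p)"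
  unfolding Ch_def by (simp add: ch_eq pure_closed[OF Adual_module SAbar_module] sbars_closed)

lemma ch_linear_left:
  assumes "as \<in> words A p" shows "linear_map K Adual (Ch p) (\<lambda>w. ch w as)"
  using bilinear_left[OF pure_bilinear[OF Adual_module SAbar_module] sbars_closed[OF assms]]
  by (simp add: ch_eq[OF assms] Ch_def)

lemma ch_multilinear:
  assumes "w \<in> carrier Adual"
  shows "multilinear K A p (Ch p) (ch w)" "unit_null A 0 p (Ch p) (ch w)"
proof -
  note P = pure_sbars_multilinear[OF Adual_module assms, of p]
  show "multilinear K A p (Ch p) (ch w)"
    unfolding Ch_def using P(1) by (subst multilinear_cong[OF A_module ch_eq])
  show "unit_null A 0 p (Ch p) (ch w)"
    using P(2) unfolding Ch_def unit_null_def by (simp add: ch_eq[of _ p] words_iff)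
qed

lemma Ch_generated:
  assumes "submodule M K (Ch p)"
    and "\<And>w as. w \<in> carrier Adual \<Longrightarrow> as \<in> words A p \<Longrightarrow> ch w as \<in> M"
  shows "carrier (Ch p) \<subseteq> M"
  unfolding Ch_def
proof (rule tensor_SAbar_generated[OF Adual_module assms(1)[unfolded Ch_def]])
  fix x as assume "x \<in> carrier Adual" "as \<in> words A p"
  then show "pure K Adual (SAbar p) x (sbars as) \<in> M" using assms(2)[of x as] by (simp add: ch_eq)
qed

lemma Ch_ext:
  assumes "module K U" "linear_map K (Ch p) U f" "linear_map K (Ch p) U g"
    and "\<And>w as. w \<in> carrier Adual \<Longrightarrow> as \<in> words A p \<Longrightarrow> f (ch w as) = g (ch w as)"
    and "c \<in> carrier (Ch p)"
  shows "f c = g c"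
proof -
  have "carrier (Ch p) \<subseteq> {c \<in> carrier (Ch p). f c = g c}"
    by (rule Ch_generated[OF submodule_equalizer[OF Ch_module assms(1-3)]]) (use assms(4) ch_closed in auto)
  then show ?thesis using assms(5) by auto
qed

text \<open>Existence enters as a hypothesis because it has two sources: the universal property of
  the tensor product for \<open>iota_neg\<close>, and factorization through an injective map for
  \<open>hoch_b\<close> and \<open>mu\<close>.\<close>

lemma the_linear_map_Ch:
  assumes U: "module K U" and ex: "\<exists>h. linear_map K (Ch p) U h \<and> (\<forall>w\<in>carrier Adual. \<forall>as\<in>words A p. h (ch w as) = \<beta> w as)"
  defines "f \<equiv> the_linear_map K (Ch p) U (\<lambda>f. \<forall>w\<in>carrier Adual. \<forall>as\<in>words A p. f (ch w as) = \<beta> w as)"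
  shows "linear_map K (Ch p) U f"
    and "\<And>w as. w \<in> carrier Adual \<Longrightarrow> as \<in> words A p \<Longrightarrow> f (ch w as) = \<beta> w as"
proof -
  note S = the_linear_map_spec[OF Ch_module, of p U "\<lambda>f. \<forall>w\<in>carrier Adual. \<forall>as\<in>words A p. f (ch w as) = \<beta> w as"]
  have "linear_map K (Ch p) U f \<and> (\<forall>w\<in>carrier Adual. \<forall>as\<in>words A p. f (ch w as) = \<beta> w as)"
    unfolding f_def by (intro conjI S ex) (use Ch_ext[OF U] ch_closed in auto)
  then show "linear_map K (Ch p) U f"
    "\<And>w as. w \<in> carrier Adual \<Longrightarrow> as \<in> words A p \<Longrightarrow> f (ch w as) = \<beta> w as" by auto
qed

section \<open>Insertion of letters between two tensor factors, and its differential\<close>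

lemma sandwich_bilinear:
  assumes "multilinear K A (Suc (Suc p)) U G" "as \<in> words A p"
  shows "bilinear K A A U (\<lambda>x y. G (x # as @ [y]))"
  unfolding bilinear_def
proof (intro conjI ballI)
  fix y assume "y \<in> carrier A"
  then show "linear_map K A U (\<lambda>x. G (x # as @ [y]))"
    using multilinear_slot[OF assms(1), of "[]" "as @ [y]"] assms(2) by (simp add: words_iff)
next
  fix x assume "x \<in> carrier A"
  then show "linear_map K A U (\<lambda>y. G (x # as @ [y]))"
    using multilinear_slot[OF assms(1), of "x # as" "[]"] assms(2) by (simp add: words_iff)
qed

lemma insert_between:
  assumes "as \<in> words A p"
  shows insert_between_linear: "linear_map K AA (Omega (Suc p)) (insert_between as)"
    and insert_between_pure: "\<And>x y. x \<in> carrier A \<Longrightarrow> y \<in> carrier A \<Longrightarrow>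
      insert_between as (pureAA x y) = om (x # as @ [y])"
  using the_linear_map_AA[OF Omega_module sandwich_bilinear[OF om_multilinear assms]] assms
  by (simp_all add: insert_between_def words_iff)

lemma insert_between_closed:
  "as \<in> words A p \<Longrightarrow> w \<in> carrier AA \<Longrightarrow> insert_between as w \<in> carrier (Omega (Suc p))"
  by (rule linear_map_closed[OF insert_between_linear])

text \<open>For general w no formula is available, so linearity in each letter is tested on pure
  tensors, where it is that of \<open>om\<close>. The factor x precedes the inserted letters, hence
  units among them sit in normalized slots.\<close>

lemma insert_between_multilinear:
  assumes w: "w \<in> carrier AA"
  shows "multilinear K A p (Omega (Suc p)) (\<lambda>as. insert_between as w)"
    and "unit_null A 0 p (Omega (Suc p)) (\<lambda>as. insert_between as w)"
proof -
  have "linear_map K A (Omega (Suc p)) (\<lambda>a. insert_between (us @ a # ws) w)"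
    if uw: "set us \<subseteq> carrier A" "set ws \<subseteq> carrier A" "Suc (length us + length ws) = p" for us ws
  proof -
    have wd: "us @ a # ws \<in> words A p" if "a \<in> carrier A" for a using uw that by (auto simp: words_iff)
    have "carrier AA \<subseteq> {w \<in> carrier AA. linear_map K A (Omega (Suc p)) (\<lambda>a. insert_between (us @ a # ws) w)}"
      unfolding AA_def
    proof (rule tensor_generated[OF A_module A_module])
      show "submodule {w \<in> carrier (tensor K A A). linear_map K A (Omega (Suc p)) (\<lambda>a. insert_between (us @ a # ws) w)} K (tensor K A A)"
        using submodule_linear_parameter[OF AA_module Omega_module insert_between_linear[OF wd] A_module]
        by (simp add: AA_def)
      fix x y assume xy: "x \<in> carrier A" "y \<in> carrier A"
      have "linear_map K A (Omega (Suc p)) (\<lambda>a. om ((x # us) @ a # ws @ [y]))"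
        using uw xy by (intro multilinear_slot[OF om_multilinear]) auto
      then have "linear_map K A (Omega (Suc p)) (\<lambda>a. insert_between (us @ a # ws) (pureAA x y))"
        by (subst linear_map_cong[OF A_module insert_between_pure[OF wd xy]]) simp_all
      then show "pureAA x y \<in> {w \<in> carrier (tensor K A A). linear_map K A (Omega (Suc p)) (\<lambda>a. insert_between (us @ a # ws) w)}"
        using pureAA_closed[OF xy] by (simp add: AA_def)
    qed
    then show ?thesis using w by blast
  qed
  then show "multilinear K A p (Omega (Suc p)) (\<lambda>as. insert_between as w)"
    using insert_between_closed[OF _ w] by (simp add: multilinear_def)
  have "insert_between (us @ \<one>\<^bsub>A\<^esub> # ws) w = \<zero>\<^bsub>Omega (Suc p)\<^esub>"
    if uw: "set us \<subseteq> carrier A" "set ws \<subseteq> carrier A" "Suc (length us + length ws) = p" for us ws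
  proof -
    have wd: "us @ \<one>\<^bsub>A\<^esub> # ws \<in> words A p" using uw by (auto simp: words_iff)
    show ?thesis
    proof (rule AA_ext[OF Omega_module insert_between_linear[OF wd] linear_map_const_zero[OF Omega_module] _ w])
      fix x y assume xy: "x \<in> carrier A" "y \<in> carrier A"
      show "insert_between (us @ \<one>\<^bsub>A\<^esub> # ws) (pureAA x y) = \<zero>\<^bsub>Omega (Suc p)\<^esub>"
        using unit_nullD[OF om_unit_null, of "x # us" "ws @ [y]" "Suc p"] uw xy
        by (simp add: insert_between_pure[OF wd])
    qed
  qed
  then show "unit_null A 0 p (Omega (Suc p)) (\<lambda>as. insert_between as w)" by (simp add: unit_null_def)
qed

lemma iota_neg_linear: "linear_map K (Ch p) (Omega (Suc p)) (iota_neg p)"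
  and iota_neg_ch: "w \<in> carrier Adual \<Longrightarrow> as \<in> words A p \<Longrightarrow> iota_neg p (ch w as) = insert_between as w"
proof -
  have "\<exists>h. linear_map K (Ch p) (Omega (Suc p)) h \<and>
      (\<forall>w\<in>carrier Adual. \<forall>as\<in>words A p. h (pure K Adual (SAbar p) w (sbars as)) = insert_between as w)"
    unfolding Ch_def
    by (rule tensor_SAbar_lift[OF Adual_module Omega_module])
      (use insert_between_multilinear[OF Adual_closed] Adual_linear[OF insert_between_linear] in auto)
  then have "\<exists>h. linear_map K (Ch p) (Omega (Suc p)) h \<and>
      (\<forall>w\<in>carrier Adual. \<forall>as\<in>words A p. h (ch w as) = insert_between as w)"
    by (simp add: ch_eq cong: ball_cong)
  from the_linear_map_Ch[OF Omega_module this]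
  show "linear_map K (Ch p) (Omega (Suc p)) (iota_neg p)"
    "w \<in> carrier Adual \<Longrightarrow> as \<in> words A p \<Longrightarrow> iota_neg p (ch w as) = insert_between as w"
    by (simp_all add: iota_neg_def)
qed

lemma elem_cochain:
  assumes "w \<in> carrier (Omega q)"
  shows elem_cochain_closed: "elem_cochain q w \<in> carrier (Coch (- int q) q)"
    and elem_cochain_nil: "elem_cochain q w (sbars []) = w"
proof -
  have q: "- int q + int q \<ge> 0" "nat (- int q + int q) = 0" by simp_all
  have "cochain_fun 0 q (\<lambda>_. w)" using assms by (simp add: cochain_fun_def unit_null_def)
  then obtain f where f: "f \<in> carrier (Coch (- int q) q)" "f (sbars []) = w"
    using Coch_of_fun[OF q(1), of "\<lambda>_. w"] unfolding q(2) by auto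
  have "g = f" if g: "g \<in> carrier (Coch (- int q) q) \<and> g (sbars []) = w" for g
  proof (rule Coch_ext[OF q(1)])
    show "g (sbars as) = f (sbars as)" if "as \<in> words A (nat (- int q + int q))" for as
      using that g f(2) by simp
  qed (use g f(1) in simp_all)
  then have "elem_cochain q w = f" unfolding elem_cochain_def using f by (intro the_equality) blast+
  then show "elem_cochain q w \<in> carrier (Coch (- int q) q)" "elem_cochain q w (sbars []) = w"
    using f by simp_all
qed

lemma elem_cochain_linear: "linear_map K (Omega q) (Coch (- int q) q) (elem_cochain q)"
proof (rule linear_map_Coch[OF _ Omega_module elem_cochain_closed])
  fix as assume "as \<in> words A (nat (- int q + int q))"
  then have "as = []" by simp
  then show "linear_map K (Omega q) (Omega q) (\<lambda>w. elem_cochain q w (sbars as))"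
    using linear_map_cong[OF Omega_module elem_cochain_nil, of q "\<lambda>x. x"] linear_map_id
    by (simp add: linear_map_cong[OF Omega_module elem_cochain_nil])
qed simp_all

lemma elem_cochain_inj: "inj_on (elem_cochain q) (carrier (Omega q))"
  by (rule inj_on_inverseI[of _ "\<lambda>f. f (sbars [])"]) (rule elem_cochain_nil)

text \<open>The computation behind the compatibility of \<open>\<iota>\<close> with the differentials: for a dual element
  \<open>w = \<Sum>x \<otimes> y\<close> the terms \<open>ax \<otimes> y\<close> and \<open>x \<otimes> ya\<close> of the differential of \<open>x \<otimes> s a\<^sub>1 \<otimes> \<dots> \<otimes> s y\<close> cancel,
  and what is left is in the image of \<open>theta\<close>.\<close>

lemma insert_between_right:
  assumes as: "as \<in> words A p" and \<Psi>: "linear_map K AA (Omega p) \<Psi>"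
    "\<And>x y. x \<in> carrier A \<Longrightarrow> y \<in> carrier A \<Longrightarrow> \<Psi> (pureAA x y) = bar_d A (Omega p) om (x # as @ [y])"
    and a: "a \<in> carrier A" and w: "w \<in> carrier AA"
  shows "Omega_right (Suc p) a (insert_between as w) = insert_between as (outer \<one>\<^bsub>A\<^esub> a w) \<oplus>\<^bsub>Omega (Suc p)\<^esub>
    alt (Omega (Suc p)) (int (Suc p)) (Omega_snoc p a (\<Psi> w))"
proof (rule AA_ext[OF Omega_module linear_map_compose[OF insert_between_linear[OF as] Omega_right_linear[OF a]]
      linear_map_plus[OF Omega_module linear_map_compose[OF outer_linear[OF A.one_closed a] insert_between_linear[OF as]]
        linear_map_alt_fun[OF Omega_module linear_map_compose[OF \<Psi>(1) Omega_snoc_linear[OF a]]]] _ w])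
  let ?O = "Omega (Suc p)" and ?alt = "alt (Omega (Suc p)) (int (Suc p))"
  interpret O: module K ?O by (rule Omega_module)
  fix x y assume xy: "x \<in> carrier A" "y \<in> carrier A"
  have xas: "x # as \<in> words A (Suc p)" using as xy by simp
  have xasy: "x # as @ [y] \<in> words A (Suc (Suc p))" using words_snoc[OF xas xy(2)] by simp
  have ya: "x # as @ [y \<otimes>\<^bsub>A\<^esub> a] \<in> words A (Suc (Suc p))" using words_snoc[OF xas, of "y \<otimes>\<^bsub>A\<^esub> a"] xy a by simp
  have S: "Omega_snoc p a (\<Psi> (pureAA x y)) \<in> carrier ?O"
    using \<Psi>(2)[OF xy] bar_d_om_closed[OF xasy] a by (simp add: Omega_snoc_closed)
  \<comment> \<open>The face merging y with a yields the outer action on w; all other faces leave a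
    untouched at the end and give \<Psi> with a appended.\<close>
  have "bar_d A ?O om ((x # as) @ [y, a]) =
      bar_d A ?O (\<lambda>l. om (l @ [a])) ((x # as) @ [y]) \<oplus>\<^bsub>?O\<^esub> ?alt (om ((x # as) @ [y \<otimes>\<^bsub>A\<^esub> a]))"
    by (rule bar_d_snoc[OF Omega_module om_closed xas xy(2) a])
  also have "bar_d A ?O (\<lambda>l. om (l @ [a])) ((x # as) @ [y]) = bar_d A ?O (\<lambda>l. Omega_snoc p a (om l)) (x # as @ [y])"
    using bar_d_cong[OF Omega_snoc_om[OF a, symmetric] xasy] by simp
  also have "\<dots> = Omega_snoc p a (\<Psi> (pureAA x y))"
    unfolding \<Psi>(2)[OF xy] by (rule bar_d_hom[OF Omega_module Omega_module Omega_snoc_linear[OF a] om_closed xasy, symmetric])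
  finally have E: "bar_d A ?O om (x # as @ [y, a]) =
      Omega_snoc p a (\<Psi> (pureAA x y)) \<oplus>\<^bsub>?O\<^esub> ?alt (om (x # as @ [y \<otimes>\<^bsub>A\<^esub> a]))" by simp
  have "Omega_right (Suc p) a (insert_between as (pureAA x y)) = ?alt (bar_d A ?O om (x # as @ [y, a]))"
    using Omega_right_om[OF a xasy] by (simp add: insert_between_pure[OF as xy])
  also have "\<dots> = ?alt (Omega_snoc p a (\<Psi> (pureAA x y))) \<oplus>\<^bsub>?O\<^esub> om (x # as @ [y \<otimes>\<^bsub>A\<^esub> a])"
    using S om_closed[OF ya] alt_closed[OF Omega_module om_closed[OF ya]]
    by (simp add: E linear_map_add[OF alt_linear[OF Omega_module]] alt_alt[OF Omega_module]) (simp add: alt_def)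
  also have "om (x # as @ [y \<otimes>\<^bsub>A\<^esub> a]) = insert_between as (outer \<one>\<^bsub>A\<^esub> a (pureAA x y))"
    using xy a by (simp add: outer_pure insert_between_pure[OF as])
  finally show "Omega_right (Suc p) a (insert_between as (pureAA x y)) =
      insert_between as (outer \<one>\<^bsub>A\<^esub> a (pureAA x y)) \<oplus>\<^bsub>?O\<^esub> ?alt (Omega_snoc p a (\<Psi> (pureAA x y)))"
    using S alt_closed[OF Omega_module S] om_closed[OF ya] xy a
    by (simp add: outer_pure insert_between_pure[OF as] O.a_comm)
qed

lemma insert_between_left:
  assumes as: "as \<in> words A p" and a: "a \<in> carrier A" and w: "w \<in> carrier AA"
  shows "Omega_left (Suc p) a (insert_between as w) = insert_between as (outer a \<one>\<^bsub>A\<^esub> w)"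
proof (rule AA_ext[OF Omega_module linear_map_compose[OF insert_between_linear[OF as] Omega_left_linear[OF a]]
      linear_map_compose[OF outer_linear[OF a A.one_closed] insert_between_linear[OF as]] _ w])
  fix x y assume xy: "x \<in> carrier A" "y \<in> carrier A"
  then have "x # as @ [y] \<in> words A (Suc (Suc p))" using as by (simp add: words_snoc)
  from Omega_left_om[OF a this] show "Omega_left (Suc p) a (insert_between as (pureAA x y)) =
      insert_between as (outer a \<one>\<^bsub>A\<^esub> (pureAA x y))"
    using xy a by (simp add: insert_between_pure[OF as] outer_pure)
qed

text \<open>\<Psi> stands for the inserted chain differential and is kept abstract so that
  \<open>hoch_b\<close> and \<open>mu\<close> share one computation. Membership of w in
  \<open>Adual\<close> equates the two outer terms, which then cancel.\<close>

lemma delta_elem_insert_between: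
  assumes as: "as \<in> words A p" and \<Psi>: "linear_map K AA (Omega p) \<Psi>"
    "\<And>x y. x \<in> carrier A \<Longrightarrow> y \<in> carrier A \<Longrightarrow> \<Psi> (pureAA x y) = bar_d A (Omega p) om (x # as @ [y])"
    and w: "w \<in> carrier Adual"
  shows "delta (- int (Suc p)) (Suc p) (elem_cochain (Suc p) (insert_between as w)) =
    theta (- int p) p (elem_cochain p (\<Psi> w))"
proof -
  let ?O = "Omega (Suc p)" and ?m = "- int (Suc p)" and ?J = "insert_between as w"
  interpret O: module K ?O by (rule Omega_module)
  have wA: "w \<in> carrier AA" by (rule Adual_closed[OF w])
  have J: "?J \<in> carrier ?O" by (rule insert_between_closed[OF as wA])
  have P: "\<Psi> w \<in> carrier (Omega p)" by (rule linear_map_closed[OF \<Psi>(1) wA])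
  have m: "?m + int (Suc p) \<ge> 0" "nat (?m + int (Suc p)) = 0" "?m + 1 = - int p" by simp_all
  have n: "- int p + int p \<ge> 0" "nat (- int p + int p) = 0" by simp_all
  have k: "- int p + int (Suc p) \<ge> 0" "nat (- int p + int (Suc p)) = Suc 0" by simp_all
  let ?f = "elem_cochain (Suc p) ?J"
  have f: "?f \<in> carrier (Coch ?m (Suc p))" by (rule elem_cochain_closed[OF J])
  have g: "elem_cochain p (\<Psi> w) \<in> carrier (Coch (- int p) p)" by (rule elem_cochain_closed[OF P])
  show ?thesis
  proof (rule Coch_ext[OF k(1)])
    show "delta ?m (Suc p) ?f \<in> carrier (Coch (- int p) (Suc p))" using delta_closed[OF f] by (simp only: m(3))
    show "theta (- int p) p (elem_cochain p (\<Psi> w)) \<in> carrier (Coch (- int p) (Suc p))" by (rule theta_closed[OF g])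
    fix bs assume "bs \<in> words A (nat (- int p + int (Suc p)))"
    then have "bs \<in> words A (Suc 0)" by (simp only: k)
    then obtain a where a: "bs = [a]" "a \<in> carrier A" by (auto elim: words_SucE)
    have a1: "[a] \<in> words A (Suc 0)" using a by simp
    have F: "cochain_fun 0 (Suc p) (\<lambda>as. ?f (sbars as))" using Coch_cochain_fun[OF m(1) f] by (simp only: m(2))
    let ?S = "Omega_snoc p a (\<Psi> w)"
    have S: "?S \<in> carrier ?O" by (rule Omega_snoc_closed[OF a(2) P])
    have R: "Omega_right (Suc p) a ?J \<in> carrier ?O" by (rule Omega_right_closed[OF a(2) J])
    have "hoch (Suc p) (\<lambda>as. ?f (sbars as)) [a] = Omega_left (Suc p) a ?J \<ominus>\<^bsub>?O\<^esub> Omega_right (Suc p) a ?J"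
      using hoch_eq[OF F a1] R by (simp add: elem_cochain_nil[OF J])
    also have "\<dots> = insert_between as (outer \<one>\<^bsub>A\<^esub> a w) \<ominus>\<^bsub>?O\<^esub>
        (insert_between as (outer \<one>\<^bsub>A\<^esub> a w) \<oplus>\<^bsub>?O\<^esub> alt ?O (int (Suc p)) ?S)"
      using w a(2) by (simp add: insert_between_left[OF as a(2) wA] insert_between_right[OF as \<Psi> a(2) wA] Adual_iff)
    also have "\<dots> = \<ominus>\<^bsub>?O\<^esub> alt ?O (int (Suc p)) ?S"
      using alt_closed[OF Omega_module S] insert_between_closed[OF as linear_map_closed[OF outer_linear[OF A.one_closed a(2)] wA]]
      by (simp add: O.minus_eq O.minus_add O.r_neg2)
    also have "\<dots> = alt ?O (int p) ?S"
      using alt_Suc[OF Omega_module S, of "int (Suc p)"] by (simp add: alt_def)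
    finally have "hoch (Suc p) (\<lambda>as. ?f (sbars as)) [a] = alt ?O (int p) ?S" .
    \<comment> \<open>In degree m = -(p+1) the sign (-1)^(m+1) of \<open>delta\<close> equals (-1)^p
      and cancels the sign left over from the right action.\<close>
    then have "delta ?m (Suc p) ?f (sbars bs) = alt ?O (- int p) (alt ?O (int p) ?S)"
      using delta_sbars[OF m(1) f, unfolded m(2,3), OF a1] a(1) by simp
    also have "\<dots> = ?S" using S by (simp add: alt_alt[OF Omega_module])
    also have "\<dots> = theta (- int p) p (elem_cochain p (\<Psi> w)) (sbars bs)"
      using theta_sbars[OF n(1) g, unfolded n(2), of "[]" a] a by (simp add: elem_cochain_nil[OF P])
    finally show "delta ?m (Suc p) ?f (sbars bs) = theta (- int p) p (elem_cochain p (\<Psi> w)) (sbars bs)" .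
  qed
qed

section \<open>Injectivity in negative degrees\<close>

lemma trivial_AA:
  assumes "\<one>\<^bsub>A\<^esub> = \<zero>\<^bsub>A\<^esub>" "w \<in> carrier AA" shows "w = \<zero>\<^bsub>AA\<^esub>"
proof (rule AA_ext[OF AA_module linear_map_id linear_map_const_zero[OF AA_module] _ assms(2)])
  fix x y assume xy: "x \<in> carrier A" "y \<in> carrier A"
  have "x = \<zero>\<^bsub>A\<^esub>" using A.l_one[OF xy(1)] A.l_null[OF xy(1)] assms(1) by simp
  then show "pureAA x y = \<zero>\<^bsub>AA\<^esub>"
    using linear_map_zero[OF A_module AA_module bilinear_left[OF pureAA_bilinear xy(2)]] by simp
qed

lemma insert_between_nil_inj:
  assumes nt: "\<one>\<^bsub>A\<^esub> = \<zero>\<^bsub>A\<^esub> \<or> (\<exists>a\<in>carrier A. a \<notin> ground)"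
  shows "inj_on (insert_between []) (carrier Adual)"
proof (rule inj_on_linear_map[OF Adual_module Omega_module Adual_linear[OF insert_between_linear]])
  have nil: "[] \<in> words A 0" by simp
  then show "[] \<in> words A 0" .
  fix w assume w: "w \<in> carrier Adual" and z: "insert_between [] w = \<zero>\<^bsub>Omega (Suc 0)\<^esub>"
  have wA: "w \<in> carrier AA" by (rule Adual_closed[OF w])
  have "w = \<zero>\<^bsub>AA\<^esub>"
  proof (cases "\<one>\<^bsub>A\<^esub> = \<zero>\<^bsub>A\<^esub>")
    case True
    then show ?thesis using trivial_AA wA by blast
  next
    case False
    interpret T: module K AA by (rule AA_module)
    let ?k = "vspace (carrier K) \<zero>\<^bsub>K\<^esub> (add K) (mult K)"
    obtain a where a: "a \<in> carrier A" "a \<notin> ground" using nt False by blast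
    obtain \<psi> where \<psi>: "linear_map K A ?k \<psi>" "\<psi> a = \<one>\<^bsub>K\<^esub>" "\<psi> \<one>\<^bsub>A\<^esub> = \<zero>\<^bsub>K\<^esub>"
      using a by (rule functional_modulo_ground)
    \<comment> \<open>\<psi> vanishes on the unit and will detect \<open>a\<close> in the second
      factor; \<epsilon> is 1 on the unit, so \<open>?q\<close> below is the projection that removes
      the component along the unit.\<close>
    obtain \<epsilon> where \<epsilon>: "linear_map K A ?k \<epsilon>" "\<epsilon> \<one>\<^bsub>A\<^esub> = \<one>\<^bsub>K\<^esub>"
      using linear_functional_exists(2)[OF K.field_axioms A_module A.one_closed False] by blast
    have \<epsilon>c: "\<epsilon> x \<in> carrier K" if "x \<in> carrier A" for x using linear_map_closed[OF \<epsilon>(1) that] by simp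
    have slice: "\<exists>E. linear_map K AA A E \<and> (\<forall>x\<in>carrier A. \<forall>y\<in>carrier A. E (pureAA x y) = \<phi> y \<odot>\<^bsub>A\<^esub> x)"
      if \<phi>: "linear_map K A ?k \<phi>" for \<phi>
    proof -
      have "\<phi> y \<in> carrier K" if "y \<in> carrier A" for y using linear_map_closed[OF \<phi> that] by simp
      then have "bilinear K A A A (\<lambda>x y. \<phi> y \<odot>\<^bsub>A\<^esub> x)"
        using linear_map_scale[OF A_module linear_map_id] linear_map_functional_scale[OF A_module A_module \<phi>]
        by (simp add: bilinear_def)
      from tensor_lift[OF A_module A_module A_module this] show ?thesis by (simp add: AA_def)
    qed
    obtain E where E: "linear_map K AA A E" "\<And>x y. x \<in> carrier A \<Longrightarrow> y \<in> carrier A \<Longrightarrow> E (pureAA x y) = \<epsilon> y \<odot>\<^bsub>A\<^esub> x"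
      using slice[OF \<epsilon>(1)] by blast
    obtain P where P: "linear_map K AA A P" "\<And>x y. x \<in> carrier A \<Longrightarrow> y \<in> carrier A \<Longrightarrow> P (pureAA x y) = \<psi> y \<odot>\<^bsub>A\<^esub> x"
      using slice[OF \<psi>(1)] by blast
    let ?q = "\<lambda>y. y \<ominus>\<^bsub>A\<^esub> \<epsilon> y \<odot>\<^bsub>A\<^esub> \<one>\<^bsub>A\<^esub>"
    have q: "linear_map K A A ?q"
      by (intro linear_map_diff[OF A_module] linear_map_id linear_map_functional_scale[OF A_module A_module \<epsilon>(1)]) simp
    have q1: "?q \<one>\<^bsub>A\<^esub> = \<zero>\<^bsub>A\<^esub>" by (simp add: \<epsilon>(2) A.minus_eq A.r_neg)
    \<comment> \<open>\<open>?q\<close> kills the unit, so its application to the second factor is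
      well defined on \<open>Omega (Suc 0)\<close>. The vanishing of the image of w there thus
      becomes an identity in the tensor square itself: w is the tensor of \<open>E w\<close> with
      the unit.\<close>
    let ?G = "\<lambda>l. pureAA (hd l) (?q (last l))"
    have "multilinear K A (Suc (Suc 0)) AA ?G"
      using bilinear_left[OF pureAA_bilinear linear_map_closed[OF q]]
        linear_map_compose[OF q bilinear_right[OF pureAA_bilinear]]
        linear_map_closed[OF q] pureAA_closed
      by (auto simp: multilinear_Suc elim!: words_SucE)
    moreover have "unit_null A 1 (Suc (Suc 0)) AA ?G"
      unfolding unit_null_def
    proof (intro allI impI)
      fix us ws assume "1 \<le> length us" "set us \<subseteq> carrier A" "set ws \<subseteq> carrier A" "Suc (length us + length ws) = Suc (Suc 0)"
      then obtain u where "us = [u]" "ws = []" "u \<in> carrier A" by (cases us) auto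
      then show "?G (us @ \<one>\<^bsub>A\<^esub> # ws) = \<zero>\<^bsub>AA\<^esub>"
        using q1 linear_map_zero[OF A_module AA_module bilinear_right[OF pureAA_bilinear]] by simp
    qed
    ultimately have "\<exists>h. linear_map K (Omega (Suc 0)) AA h \<and> (\<forall>xs\<in>words A (Suc (Suc 0)). h (om xs) = ?G xs)"
      by (rule Omega_lift[OF AA_module])
    then obtain T where T: "linear_map K (Omega (Suc 0)) AA T" "\<And>xs. xs \<in> words A (Suc (Suc 0)) \<Longrightarrow> T (om xs) = ?G xs"
      by blast
    have E1: "linear_map K AA AA (\<lambda>w. pureAA (E w) \<one>\<^bsub>A\<^esub>)"
      by (rule linear_map_compose[OF E(1) bilinear_left[OF pureAA_bilinear A.one_closed]])
    have "T (insert_between [] w) = w \<ominus>\<^bsub>AA\<^esub> pureAA (E w) \<one>\<^bsub>A\<^esub>"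
    proof (rule AA_ext[OF AA_module linear_map_compose[OF insert_between_linear[OF nil] T(1)]
          linear_map_diff[OF AA_module linear_map_id E1] _ wA])
      fix x y assume xy: "x \<in> carrier A" "y \<in> carrier A"
      note r = bilinear_right[OF pureAA_bilinear xy(1)] and l = bilinear_left[OF pureAA_bilinear A.one_closed]
      have "T (insert_between [] (pureAA x y)) = pureAA x (?q y)"
        using xy T(2)[of "[x, y]"] by (simp add: insert_between_pure[OF nil])
      also have "\<dots> = pureAA x y \<ominus>\<^bsub>AA\<^esub> pureAA x (\<epsilon> y \<odot>\<^bsub>A\<^esub> \<one>\<^bsub>A\<^esub>)"
        using xy \<epsilon>c by (intro linear_map_minus[OF A_module AA_module r]) auto
      also have "pureAA x (\<epsilon> y \<odot>\<^bsub>A\<^esub> \<one>\<^bsub>A\<^esub>) = \<epsilon> y \<odot>\<^bsub>AA\<^esub> pureAA x \<one>\<^bsub>A\<^esub>"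
        using xy \<epsilon>c by (intro linear_map_smult[OF r]) auto
      also have "\<dots> = pureAA (\<epsilon> y \<odot>\<^bsub>A\<^esub> x) \<one>\<^bsub>A\<^esub>"
        using xy \<epsilon>c by (intro linear_map_smult[OF l, symmetric]) auto
      finally show "T (insert_between [] (pureAA x y)) = pureAA x y \<ominus>\<^bsub>AA\<^esub> pureAA (E (pureAA x y)) \<one>\<^bsub>A\<^esub>"
        using xy by (simp add: E(2))
    qed
    then have "w \<ominus>\<^bsub>AA\<^esub> pureAA (E w) \<one>\<^bsub>A\<^esub> = \<zero>\<^bsub>AA\<^esub>"
      using z linear_map_zero[OF Omega_module AA_module T(1)] by simp
    then have wE: "w = pureAA (E w) \<one>\<^bsub>A\<^esub>"
      using T.minus_equality[of w "\<ominus>\<^bsub>AA\<^esub> pureAA (E w) \<one>\<^bsub>A\<^esub>"] wA linear_map_closed[OF E1 wA] by (simp add: T.minus_eq)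
    have Ew: "E w \<in> carrier A" by (rule linear_map_closed[OF E(1) wA])
    \<comment> \<open>The duality condition equates the tensor of a E(w) with 1 and the tensor of
      E(w) with a. Contracting the second factor with \<psi> turns the former into 0 and the latter
      into E(w).\<close>
    have "pureAA (a \<otimes>\<^bsub>A\<^esub> E w) \<one>\<^bsub>A\<^esub> = outer a \<one>\<^bsub>A\<^esub> (pureAA (E w) \<one>\<^bsub>A\<^esub>)"
      using a Ew by (simp add: outer_pure)
    also have "\<dots> = outer \<one>\<^bsub>A\<^esub> a (pureAA (E w) \<one>\<^bsub>A\<^esub>)"
      using w a unfolding wE[symmetric] by (simp add: Adual_iff)
    also have "\<dots> = pureAA (E w) a" using a Ew by (simp add: outer_pure)
    finally have "P (pureAA (a \<otimes>\<^bsub>A\<^esub> E w) \<one>\<^bsub>A\<^esub>) = P (pureAA (E w) a)" by simp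
    then have "\<zero>\<^bsub>A\<^esub> = E w" using a Ew by (simp add: P(2) \<psi>)
    then show ?thesis
      using wE linear_map_zero[OF A_module AA_module bilinear_left[OF pureAA_bilinear A.one_closed]] by simp
  qed
  then show "w = \<zero>\<^bsub>Adual\<^esub>" by simp
qed

text \<open>Applying a retraction \<open>r\<close> of \<open>insert_between []\<close> to the outer
  letters of a word, and keeping the letters between them, gives a left inverse of
  \<open>iota_neg p\<close>. Linearity of \<open>r\<close> is enough, because the middle letters
  never interact with it.\<close>

lemma iota_neg_inj:
  assumes nt: "\<one>\<^bsub>A\<^esub> = \<zero>\<^bsub>A\<^esub> \<or> (\<exists>a\<in>carrier A. a \<notin> ground)"
  shows "inj_on (iota_neg p) (carrier (Ch p))"
proof -
  have nil: "[] \<in> words A 0" by simp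
  obtain r where r: "linear_map K (Omega (Suc 0)) Adual r" "\<And>w. w \<in> carrier Adual \<Longrightarrow> r (insert_between [] w) = w"
    using linear_left_inverse[OF K.field_axioms Adual_module Omega_module Adual_linear[OF insert_between_linear[OF nil]]
        insert_between_nil_inj[OF nt]] by blast
  have xy: "[x, y] \<in> words A (Suc (Suc 0))" if "x \<in> carrier A" "y \<in> carrier A" for x y using that by simp
  have rc: "r (om [x, y]) \<in> carrier Adual" if "x \<in> carrier A" "y \<in> carrier A" for x y
    using linear_map_closed[OF r(1) om_closed[OF xy[OF that]]] .
  have rl: "linear_map K A Adual (\<lambda>x. r (om [x, y]))" if "y \<in> carrier A" for y
    using linear_map_compose[OF bilinear_left[OF sandwich_bilinear[OF om_multilinear nil] that] r(1)] by simp
  have rr: "linear_map K A Adual (\<lambda>y. r (om [x, y]))" if "x \<in> carrier A" for x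
    using linear_map_compose[OF bilinear_right[OF sandwich_bilinear[OF om_multilinear nil] that] r(1)] by simp
  let ?G = "\<lambda>l. ch (r (om [hd l, last l])) (butlast (tl l))"
  have m: "multilinear K A (Suc (Suc p)) (Ch p) ?G"
    unfolding multilinear_Suc[of K A "Suc p"]
  proof (intro conjI ballI)
    fix l assume "l \<in> words A (Suc p)"
    then obtain as y where y: "l = as @ [y]" "y \<in> carrier A" "as \<in> words A p" by (rule words_snocE)
    show "linear_map K A (Ch p) (\<lambda>x. ?G (x # l))"
      using linear_map_compose[OF rl[OF y(2)] ch_linear_left[OF y(3)]] by (simp add: y(1))
  next
    fix x assume x: "x \<in> carrier A"
    have "multilinear K A (Suc p) (Ch p) (\<lambda>l. ch (r (om [x, last l])) (butlast l))"
      using x by (intro multilinear_snoc[OF Ch_module, where H = "\<lambda>y as. ch (r (om [x, y])) as"]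
          ch_multilinear rc linear_map_compose[OF rr ch_linear_left])
    then show "multilinear K A (Suc p) (Ch p) (\<lambda>l. ?G (x # l))"
    proof (subst multilinear_cong[OF A_module])
      fix xs assume "xs \<in> words A (Suc p)"
      then have "xs \<noteq> []" by (auto simp: words_iff)
      then show "?G (x # xs) = ch (r (om [x, last xs])) (butlast xs)" by simp
    qed
  qed
  have n: "unit_null A 1 (Suc (Suc p)) (Ch p) ?G"
    unfolding unit_null_def
  proof (intro allI impI)
    fix us ws assume uw: "1 \<le> length us" "set us \<subseteq> carrier A" "set ws \<subseteq> carrier A" "Suc (length us + length ws) = Suc (Suc p)"
    obtain x us' where us: "us = x # us'" using uw(1) by (cases us) auto
    \<comment> \<open>A unit in the last slot is killed inside \<open>om [x, y]\<close>, an earlier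
      one by the normalization of \<open>ch\<close>.\<close>
    show "?G (us @ \<one>\<^bsub>A\<^esub> # ws) = \<zero>\<^bsub>Ch p\<^esub>"
    proof (cases ws rule: rev_cases)
      case Nil
      have "om [x, \<one>\<^bsub>A\<^esub>] = \<zero>\<^bsub>Omega (Suc 0)\<^esub>"
        using unit_nullD[OF om_unit_null, of "[x]" "[]" "Suc 0"] us uw by simp
      then show ?thesis
        using Nil us uw linear_map_zero[OF Omega_module Adual_module r(1)]
          linear_map_zero[OF Adual_module Ch_module ch_linear_left[of us' p]] by (simp add: words_iff)
    next
      case (snoc ws' z)
      then show ?thesis
        using unit_nullD[OF ch_multilinear(2)[OF rc], of x z us' ws' p] us uw by (simp add: butlast_append)
    qed
  qed
  have "\<exists>h. linear_map K (Omega (Suc p)) (Ch p) h \<and> (\<forall>xs\<in>words A (Suc (Suc p)). h (om xs) = ?G xs)"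
    by (rule Omega_lift[OF Ch_module m n])
  then obtain R where R: "linear_map K (Omega (Suc p)) (Ch p) R"
    "\<And>xs. xs \<in> words A (Suc (Suc p)) \<Longrightarrow> R (om xs) = ?G xs"
    by blast
  have RJ: "R (insert_between as w) = ch (r (insert_between [] w)) as" if as: "as \<in> words A p" and w: "w \<in> carrier AA" for as w
  proof (rule AA_ext[OF Ch_module linear_map_compose[OF insert_between_linear[OF as] R(1)]
        linear_map_compose[OF linear_map_compose[OF insert_between_linear[OF nil] r(1)] ch_linear_left[OF as]] _ w])
    fix x y assume "x \<in> carrier A" "y \<in> carrier A"
    then show "R (insert_between as (pureAA x y)) = ch (r (insert_between [] (pureAA x y))) as"
      using R(2)[of "x # as @ [y]"] as by (simp add: insert_between_pure[OF as] insert_between_pure[OF nil] words_snoc)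
  qed
  have "R (iota_neg p c) = c" if "c \<in> carrier (Ch p)" for c
    by (rule Ch_ext[OF Ch_module linear_map_compose[OF iota_neg_linear R(1)] linear_map_id _ that])
      (simp add: iota_neg_ch RJ Adual_closed r(2))
  then show ?thesis by (rule inj_on_inverseI)
qed

text \<open>The faces of the word x, \<open>as\<close>, y match the terms of the Hochschild
  boundary: x times the first letter is the inner right action, the last letter times y is the inner
  left action, and merges inside \<open>as\<close> are common to both. This supplies the \<Psi>
  required by \<open>delta_elem_insert_between\<close>.\<close>

lemma insert_between_merge:
  assumes as: "as \<in> words A (Suc q)"
  defines "\<Psi> \<equiv> \<lambda>w. insert_between (tl as) (inner \<one>\<^bsub>A\<^esub> (hd as) w)
    \<oplus>\<^bsub>Omega (Suc q)\<^esub> (\<Oplus>\<^bsub>Omega (Suc q)\<^esub>j\<in>{1..q}. alt (Omega (Suc q)) (int j) (insert_between (merge A (j - 1) as) w))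
    \<oplus>\<^bsub>Omega (Suc q)\<^esub> alt (Omega (Suc q)) (int (Suc q)) (insert_between (butlast as) (inner (last as) \<one>\<^bsub>A\<^esub> w))"
  shows "linear_map K AA (Omega (Suc q)) \<Psi>"
    and "\<And>x y. x \<in> carrier A \<Longrightarrow> y \<in> carrier A \<Longrightarrow> \<Psi> (pureAA x y) = bar_d A (Omega (Suc q)) om (x # as @ [y])"
proof -
  let ?O = "Omega (Suc q)"
  interpret O: module K ?O by (rule Omega_module)
  obtain a t where a: "as = a # t" "a \<in> carrier A" "t \<in> words A q" using as by (rule words_SucE)
  obtain bs b where b: "as = bs @ [b]" "b \<in> carrier A" "bs \<in> words A q" using as by (rule words_snocE)
  have ht: "hd as = a" "tl as = t" using a(1) by simp_all
  have lb: "last as = b" "butlast as = bs" using b(1) by simp_all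
  have mw: "merge A (j - 1) as \<in> words A q" if "j \<in> {1..q}" for j
    using merge_words[OF as] that by auto
  show "linear_map K AA ?O \<Psi>"
    unfolding \<Psi>_def ht lb
    by (intro linear_map_plus[OF Omega_module] linear_map_finsum_fun[OF Omega_module] linear_map_alt_fun[OF Omega_module]
        linear_map_compose[OF inner_linear insert_between_linear] insert_between_linear mw a b A.one_closed) auto
  fix x y assume xy: "x \<in> carrier A" "y \<in> carrier A"
  have cw: "x # l @ [y] \<in> words A (Suc (Suc q))" if "l \<in> words A q" for l
    using that xy by (simp add: words_snoc)
  have c: "om (x # l @ [y]) \<in> carrier ?O" if "l \<in> words A q" for l
    by (rule om_closed[OF cw[OF that]])
  have xlc: "om (x # l) \<in> carrier ?O" if "l \<in> words A (Suc q)" for l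
    using that xy by (intro om_closed) simp
  have by': "om (x # bs @ [b \<otimes>\<^bsub>A\<^esub> y]) \<in> carrier ?O"
    using xlc[OF words_snoc[OF b(3), of "b \<otimes>\<^bsub>A\<^esub> y"]] b xy by simp
  have xa: "om ((x \<otimes>\<^bsub>A\<^esub> a) # t @ [y]) \<in> carrier ?O"
    using a xy by (intro om_closed) (simp add: words_snoc)
  let ?B = "bar_d A ?O (\<lambda>l. om (x # l @ [y])) as"
  have B: "?B \<in> carrier ?O" by (rule bar_d_closed[OF Omega_module c as])
  have neg: "\<ominus>\<^bsub>?O\<^esub> ?B = (\<Oplus>\<^bsub>?O\<^esub>j\<in>{1..q}. alt ?O (int j) (om (x # merge A (j - 1) as @ [y])))"
    by (rule neg_bar_d_sum[OF Omega_module c as])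
  have "bar_d A ?O om (x # as @ [y]) = om ((x \<otimes>\<^bsub>A\<^esub> a) # t @ [y]) \<ominus>\<^bsub>?O\<^esub> bar_d A ?O (\<lambda>l. om (x # l)) (as @ [y])"
    by (simp add: a(1))
  also have "bar_d A ?O (\<lambda>l. om (x # l)) (as @ [y]) = ?B \<oplus>\<^bsub>?O\<^esub> alt ?O (int q) (om (x # bs @ [b \<otimes>\<^bsub>A\<^esub> y]))"
    using bar_d_snoc[OF Omega_module xlc b(3,2) xy(2)] b(1) by simp
  also have "om ((x \<otimes>\<^bsub>A\<^esub> a) # t @ [y]) \<ominus>\<^bsub>?O\<^esub> (?B \<oplus>\<^bsub>?O\<^esub> alt ?O (int q) (om (x # bs @ [b \<otimes>\<^bsub>A\<^esub> y]))) =
      om ((x \<otimes>\<^bsub>A\<^esub> a) # t @ [y]) \<oplus>\<^bsub>?O\<^esub> \<ominus>\<^bsub>?O\<^esub> ?B \<oplus>\<^bsub>?O\<^esub> alt ?O (int q + 1) (om (x # bs @ [b \<otimes>\<^bsub>A\<^esub> y]))"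
    unfolding alt_Suc[OF Omega_module by'] using xa B alt_closed[OF Omega_module by']
    by (simp add: O.minus_eq O.minus_add O.a_assoc)
  also have "om ((x \<otimes>\<^bsub>A\<^esub> a) # t @ [y]) = insert_between t (inner \<one>\<^bsub>A\<^esub> a (pureAA x y))"
    using xy a by (simp add: inner_pure insert_between_pure[OF a(3)])
  also have "om (x # bs @ [b \<otimes>\<^bsub>A\<^esub> y]) = insert_between bs (inner b \<one>\<^bsub>A\<^esub> (pureAA x y))"
    using xy b by (simp add: inner_pure insert_between_pure[OF b(3)])
  also have "\<ominus>\<^bsub>?O\<^esub> ?B = (\<Oplus>\<^bsub>?O\<^esub>j\<in>{1..q}. alt ?O (int j) (insert_between (merge A (j - 1) as) (pureAA x y)))"
    unfolding neg
  proof (rule O.finsum_cong')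
    show "(\<lambda>j. alt ?O (int j) (insert_between (merge A (j - 1) as) (pureAA x y))) \<in> {1..q} \<rightarrow> carrier ?O"
      by (intro Pi_I alt_closed[OF Omega_module] insert_between_closed mw pureAA_closed xy)
    fix j assume j: "j \<in> {1..q}"
    show "alt ?O (int j) (om (x # merge A (j - 1) as @ [y])) =
        alt ?O (int j) (insert_between (merge A (j - 1) as) (pureAA x y))"
      unfolding insert_between_pure[OF mw[OF j] xy] ..
  qed simp
  finally show "\<Psi> (pureAA x y) = bar_d A ?O om (x # as @ [y])"
    by (simp add: \<Psi>_def ht lb add.commute)
qed

lemma delta_elem_iota_linear:
  "linear_map K (Ch p) (Coch (- int p) (Suc p)) (\<lambda>c. delta (- int (Suc p)) (Suc p) (elem_cochain (Suc p) (iota_neg p c)))"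
proof -
  have "- int (Suc p) + 1 = - int p" by simp
  with linear_map_compose[OF linear_map_compose[OF iota_neg_linear elem_cochain_linear] delta_linear]
  show ?thesis by metis
qed

text \<open>On generators the singular differential lands in the image of the injective
  \<open>T\<close>, hence it does so everywhere, and factoring through \<open>T\<close> yields a
  linear map. By injectivity its values on generators are those of \<beta>, so the prescribed values
  are consistent although their multilinearity was never verified.\<close>

lemma Ch_factor:
  assumes V: "module K V" and T: "linear_map K V (Coch (- int p) (Suc p)) T" "inj_on T (carrier V)"
    and \<beta>: "\<And>w as. w \<in> carrier Adual \<Longrightarrow> as \<in> words A p \<Longrightarrow> \<beta> w as \<in> carrier V"
    and eq: "\<And>w as. w \<in> carrier Adual \<Longrightarrow> as \<in> words A p \<Longrightarrow>
      delta (- int (Suc p)) (Suc p) (elem_cochain (Suc p) (insert_between as w)) = T (\<beta> w as)"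
  defines "f \<equiv> the_linear_map K (Ch p) V (\<lambda>f. \<forall>w\<in>carrier Adual. \<forall>as\<in>words A p. f (ch w as) = \<beta> w as)"
  shows "linear_map K (Ch p) V f"
    and "\<And>c. c \<in> carrier (Ch p) \<Longrightarrow>
      T (f c) = delta (- int (Suc p)) (Suc p) (elem_cochain (Suc p) (iota_neg p c))"
proof -
  let ?S = "\<lambda>c. delta (- int (Suc p)) (Suc p) (elem_cochain (Suc p) (iota_neg p c))"
  note S = delta_elem_iota_linear
  have "carrier (Ch p) \<subseteq> {c \<in> carrier (Ch p). ?S c \<in> T ` carrier V}"
    by (rule Ch_generated[OF submodule_vimage[OF Ch_module Coch_module S submodule_image[OF V Coch_module T(1)]]])
      (use ch_closed \<beta> eq in \<open>auto simp: iota_neg_ch\<close>)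
  then obtain h where h: "linear_map K (Ch p) V h" "\<And>c. c \<in> carrier (Ch p) \<Longrightarrow> T (h c) = ?S c"
    using factor_through_injective[OF Ch_module V Coch_module T S] by blast
  have "h (ch w as) = \<beta> w as" if "w \<in> carrier Adual" "as \<in> words A p" for w as
    using inj_onD[OF T(2), of "h (ch w as)" "\<beta> w as"] h(2)[OF ch_closed[OF that]] linear_map_closed[OF h(1) ch_closed[OF that]]
      \<beta>[OF that] eq[OF that] that by (simp add: iota_neg_ch)
  then have ex: "\<exists>h. linear_map K (Ch p) V h \<and> (\<forall>w\<in>carrier Adual. \<forall>as\<in>words A p. h (ch w as) = \<beta> w as)"
    using h(1) by blast
  note f = the_linear_map_Ch[OF V ex, folded f_def]
  show "linear_map K (Ch p) V f" by (rule f(1))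
  show "T (f c) = ?S c" if "c \<in> carrier (Ch p)" for c
  proof (rule Ch_ext[OF Coch_module linear_map_compose[OF f(1) T(1)] S _ that])
    fix w as assume w: "w \<in> carrier Adual" "as \<in> words A p"
    show "T (f (ch w as)) = ?S (ch w as)" unfolding f(2)[OF w] iota_neg_ch[OF w] eq[OF w] ..
  qed
qed

section \<open>The Tate-Hochschild complex and \<open>iota\<close> in all degrees\<close>

lemma Tate_nonneg:
  assumes "i \<ge> 0"
  shows "carrier (Tate i) = Inl ` carrier (Coch i 0)" "\<zero>\<^bsub>Tate i\<^esub> = Inl \<zero>\<^bsub>Coch i 0\<^esub>"
    "Inl f \<oplus>\<^bsub>Tate i\<^esub> Inl g = Inl (f \<oplus>\<^bsub>Coch i 0\<^esub> g)" "c \<odot>\<^bsub>Tate i\<^esub> Inl f = Inl (c \<odot>\<^bsub>Coch i 0\<^esub> f)"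
  using assms by (simp_all add: Tate_def)

lemma Tate_neg:
  assumes "i = - int (Suc p)"
  shows "carrier (Tate i) = Inr ` carrier (Ch p)" "\<zero>\<^bsub>Tate i\<^esub> = Inr \<zero>\<^bsub>Ch p\<^esub>"
    "Inr x \<oplus>\<^bsub>Tate i\<^esub> Inr y = Inr (x \<oplus>\<^bsub>Ch p\<^esub> y)" "c \<odot>\<^bsub>Tate i\<^esub> Inr x = Inr (c \<odot>\<^bsub>Ch p\<^esub> x)"
  using assms by (simp_all add: Tate_def Let_def)

lemma degree_cases:
  fixes i :: int obtains "i \<ge> 0" | p where "i = - int (Suc p)"
proof (cases "i \<ge> 0")
  case False
  then have "i = - int (Suc (nat (- i - 1)))" by simp
  then show ?thesis by (rule that(2))
qed (rule that(1))

lemma Tate_module: "module K (Tate i)"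
proof (cases i rule: degree_cases)
  case 1
  then show ?thesis
    unfolding Tate_def by (simp add: module_transport[OF Coch_module, where h = Inl])
next
  case (2 p)
  then show ?thesis
    unfolding Tate_def by (simp add: module_transport[OF Ch_module, where h = Inr] Let_def)
qed

lemma linear_map_Tate_nonneg:
  assumes "i \<ge> 0" "linear_map K (Coch i 0) W f"
  shows "linear_map K (Tate i) W (\<lambda>x. f (projl x))"
  using assms(2) linear_map_closed[OF assms(2)]
  by (intro linear_mapI) (auto simp: Tate_nonneg[OF assms(1)] linear_map_add linear_map_smult)

lemma linear_map_Tate_neg:
  assumes "i = - int (Suc p)" "linear_map K (Ch p) W f"
  shows "linear_map K (Tate i) W (\<lambda>x. f (projr x))"
  using assms(2) linear_map_closed[OF assms(2)]
  by (intro linear_mapI) (auto simp: Tate_neg[OF assms(1)] linear_map_add linear_map_smult)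

lemma Inl_linear: "i \<ge> 0 \<Longrightarrow> linear_map K (Coch i 0) (Tate i) Inl"
  by (rule linear_mapI) (simp_all add: Tate_nonneg)

lemma Inr_linear: "i = - int (Suc p) \<Longrightarrow> linear_map K (Ch p) (Tate i) Inr"
  by (rule linear_mapI) (simp_all add: Tate_neg)

lemma d_Tate_simps:
  "i \<ge> 0 \<Longrightarrow> d_Tate i = (\<lambda>x. Inl (delta i 0 (projl x)))"
  "d_Tate (- 1) = (\<lambda>x. Inl (mu (projr x)))"
  by (simp_all add: fun_eq_iff d_Tate_def)

lemma d_Tate_neg:
  assumes "i = - int (Suc (Suc q))" shows "d_Tate i = (\<lambda>x. Inr (hoch_b (Suc q) (projr x)))"
proof -
  have "\<not> i \<ge> 0" "i \<noteq> - 1" "- i - 1 = int (Suc q)" using assms by simp_all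
  then show ?thesis by (simp add: fun_eq_iff d_Tate_def del: of_nat_Suc)
qed

lemma iota_nonneg: "i \<ge> 0 \<Longrightarrow> iota i = (\<lambda>x. colim_in (Coch i) (theta i) 0 (projl x))"
  by (simp add: fun_eq_iff iota_def)

lemma iota_neg_eq:
  assumes "i = - int (Suc p)"
  shows "iota i = (\<lambda>x. colim_in (Coch i) (theta i) (Suc p) (elem_cochain (Suc p) (iota_neg p (projr x))))"
proof -
  have "\<not> i \<ge> 0" "- i - 1 = int p" using assms by simp_all
  then show ?thesis by (simp add: fun_eq_iff iota_def)
qed

lemma colim_Coch_in_linear: "linear_map K (Coch m p) (Csg m) (colim_in (Coch m) (theta m) p)"
  unfolding Csg_def by (rule sequence.colim_in_linear[OF Coch_sequence])

lemma colim_Coch_in_theta: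
  "f \<in> carrier (Coch m p) \<Longrightarrow> colim_in (Coch m) (theta m) (Suc p) (theta m p f) = colim_in (Coch m) (theta m) p f"
  by (rule sequence.colim_in_t[OF Coch_sequence])

lemma elem_iota_linear: "linear_map K (Ch p) (Coch (- int (Suc p)) (Suc p)) (\<lambda>c. elem_cochain (Suc p) (iota_neg p c))"
  by (rule linear_map_compose[OF iota_neg_linear elem_cochain_linear])

lemma iota_linear: "linear_map K (Tate i) (Csg i) (iota i)"
proof (cases i rule: degree_cases)
  case 1
  show ?thesis unfolding iota_nonneg[OF 1] by (rule linear_map_Tate_nonneg[OF 1 colim_Coch_in_linear])
next
  case (2 p)
  show ?thesis
    unfolding iota_neg_eq[OF 2]
    by (rule linear_map_Tate_neg[OF 2 linear_map_compose[OF elem_iota_linear[of p, folded 2] colim_Coch_in_linear]])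
qed

section \<open>Negative differentials, compatibility with \<open>iota\<close>, and the
  embedding\<close>

context
  assumes nt: "\<one>\<^bsub>A\<^esub> = \<zero>\<^bsub>A\<^esub> \<or> (\<exists>a\<in>carrier A. a \<notin> ground)"
begin

text \<open>Both claims come out of a single use of \<open>Ch_factor\<close>: the map is produced
  from the very identity that relates it to the singular differential.\<close>

lemma hoch_b:
  shows hoch_b_linear: "linear_map K (Ch (Suc q)) (Ch q) (hoch_b (Suc q))"
    and theta_iota_hoch_b: "\<And>c. c \<in> carrier (Ch (Suc q)) \<Longrightarrow>
      theta (- int (Suc q)) (Suc q) (elem_cochain (Suc q) (iota_neg q (hoch_b (Suc q) c))) =
      delta (- int (Suc (Suc q))) (Suc (Suc q)) (elem_cochain (Suc (Suc q)) (iota_neg (Suc q) c))"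
proof -
  let ?T = "\<lambda>c. theta (- int (Suc q)) (Suc q) (elem_cochain (Suc q) (iota_neg q c))"
  let ?\<beta> = "\<lambda>w as. ch (inner \<one>\<^bsub>A\<^esub> (hd as) w) (tl as)
    \<oplus>\<^bsub>Ch q\<^esub> (\<Oplus>\<^bsub>Ch q\<^esub>j\<in>{1..q}. alt (Ch q) (int j) (ch w (merge A (j - 1) as)))
    \<oplus>\<^bsub>Ch q\<^esub> alt (Ch q) (int (Suc q)) (ch (inner (last as) \<one>\<^bsub>A\<^esub> w) (butlast as))"
  interpret C: module K "Ch q" by (rule Ch_module)
  have E: "linear_map K (Ch q) (Coch (- int (Suc q)) (Suc q)) (\<lambda>c. elem_cochain (Suc q) (iota_neg q c))"
    by (rule linear_map_compose[OF iota_neg_linear elem_cochain_linear])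
  have T: "linear_map K (Ch q) (Coch (- int (Suc q)) (Suc (Suc q))) ?T"
    by (rule linear_map_compose[OF E theta_linear])
  \<comment> \<open>The extra \<open>theta\<close> in \<open>?T\<close> is there because the
    differential of a chain arrives one stage later than the representative of its boundary.\<close>
  have Ti: "inj_on ?T (carrier (Ch q))"
    by (rule inj_on_compose[OF inj_on_compose[OF iota_neg_inj[OF nt] elem_cochain_inj iota_neg_linear] theta_inj[OF nt] E])
  have parts: "ch (inner \<one>\<^bsub>A\<^esub> (hd as) w) (tl as) \<in> carrier (Ch q)"
    "\<And>j. j \<in> {1..q} \<Longrightarrow> ch w (merge A (j - 1) as) \<in> carrier (Ch q)"
    "ch (inner (last as) \<one>\<^bsub>A\<^esub> w) (butlast as) \<in> carrier (Ch q)"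
    "iota_neg q (?\<beta> w as) = insert_between (tl as) (inner \<one>\<^bsub>A\<^esub> (hd as) w)
      \<oplus>\<^bsub>Omega (Suc q)\<^esub> (\<Oplus>\<^bsub>Omega (Suc q)\<^esub>j\<in>{1..q}. alt (Omega (Suc q)) (int j) (insert_between (merge A (j - 1) as) w))
      \<oplus>\<^bsub>Omega (Suc q)\<^esub> alt (Omega (Suc q)) (int (Suc q)) (insert_between (butlast as) (inner (last as) \<one>\<^bsub>A\<^esub> w))"
    if w: "w \<in> carrier Adual" and as: "as \<in> words A (Suc q)" for w as
  proof -
    interpret O: module K "Omega (Suc q)" by (rule Omega_module)
    obtain a t where a: "as = a # t" "a \<in> carrier A" "t \<in> words A q" using as by (rule words_SucE)
    obtain bs b where b: "as = bs @ [b]" "b \<in> carrier A" "bs \<in> words A q" using as by (rule words_snocE)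
    have ht: "hd as = a" "tl as = t" using a(1) by simp_all
    have lb: "last as = b" "butlast as = bs" using b(1) by simp_all
    have mw: "merge A (j - 1) as \<in> words A q" if "j \<in> {1..q}" for j
      using merge_words[OF as] that by auto
    have 1: "inner \<one>\<^bsub>A\<^esub> a w \<in> carrier Adual" "inner b \<one>\<^bsub>A\<^esub> w \<in> carrier Adual"
      using a b w inner_Adual by auto
    show c1: "ch (inner \<one>\<^bsub>A\<^esub> (hd as) w) (tl as) \<in> carrier (Ch q)" unfolding ht by (rule ch_closed[OF 1(1) a(3)])
    show c2: "ch w (merge A (j - 1) as) \<in> carrier (Ch q)" if "j \<in> {1..q}" for j by (rule ch_closed[OF w mw[OF that]])
    show c3: "ch (inner (last as) \<one>\<^bsub>A\<^esub> w) (butlast as) \<in> carrier (Ch q)" unfolding lb by (rule ch_closed[OF 1(2) b(3)])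
    note L = iota_neg_linear[of q] and mm = Ch_module[of q] Omega_module[of "Suc q"]
    have s: "(\<lambda>j. alt (Ch q) (int j) (ch w (merge A (j - 1) as))) \<in> {1..q} \<rightarrow> carrier (Ch q)"
      using c2 alt_closed[OF Ch_module] by blast
    have fs: "(\<Oplus>\<^bsub>Ch q\<^esub>j\<in>{1..q}. alt (Ch q) (int j) (ch w (merge A (j - 1) as))) \<in> carrier (Ch q)"
      using s by (rule C.finsum_closed)
    have "iota_neg q (\<Oplus>\<^bsub>Ch q\<^esub>j\<in>{1..q}. alt (Ch q) (int j) (ch w (merge A (j - 1) as))) =
        (\<Oplus>\<^bsub>Omega (Suc q)\<^esub>j\<in>{1..q}. iota_neg q (alt (Ch q) (int j) (ch w (merge A (j - 1) as))))"
      by (rule linear_map_finsum[OF mm L _ s]) simp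
    also have "\<dots> = (\<Oplus>\<^bsub>Omega (Suc q)\<^esub>j\<in>{1..q}. alt (Omega (Suc q)) (int j) (insert_between (merge A (j - 1) as) w))"
    proof (rule O.finsum_cong')
      fix j assume j: "j \<in> {1..q}"
      show "iota_neg q (alt (Ch q) (int j) (ch w (merge A (j - 1) as))) =
          alt (Omega (Suc q)) (int j) (insert_between (merge A (j - 1) as) w)"
        unfolding linear_map_alt[OF mm L c2[OF j]] iota_neg_ch[OF w mw[OF j]] ..
    qed (use insert_between_closed[OF mw Adual_closed[OF w]] alt_closed[OF Omega_module] in auto)
    finally have sum: "iota_neg q (\<Oplus>\<^bsub>Ch q\<^esub>j\<in>{1..q}. alt (Ch q) (int j) (ch w (merge A (j - 1) as))) =
        (\<Oplus>\<^bsub>Omega (Suc q)\<^esub>j\<in>{1..q}. alt (Omega (Suc q)) (int j) (insert_between (merge A (j - 1) as) w))" .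
    have i1: "iota_neg q (ch (inner \<one>\<^bsub>A\<^esub> (hd as) w) (tl as)) = insert_between (tl as) (inner \<one>\<^bsub>A\<^esub> (hd as) w)"
      unfolding ht by (rule iota_neg_ch[OF 1(1) a(3)])
    have i3: "iota_neg q (ch (inner (last as) \<one>\<^bsub>A\<^esub> w) (butlast as)) = insert_between (butlast as) (inner (last as) \<one>\<^bsub>A\<^esub> w)"
      unfolding lb by (rule iota_neg_ch[OF 1(2) b(3)])
    show "iota_neg q (?\<beta> w as) = insert_between (tl as) (inner \<one>\<^bsub>A\<^esub> (hd as) w)
      \<oplus>\<^bsub>Omega (Suc q)\<^esub> (\<Oplus>\<^bsub>Omega (Suc q)\<^esub>j\<in>{1..q}. alt (Omega (Suc q)) (int j) (insert_between (merge A (j - 1) as) w))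
      \<oplus>\<^bsub>Omega (Suc q)\<^esub> alt (Omega (Suc q)) (int (Suc q)) (insert_between (butlast as) (inner (last as) \<one>\<^bsub>A\<^esub> w))"
      unfolding linear_map_add[OF L C.a_closed[OF c1 fs] alt_closed[OF Ch_module c3]] linear_map_add[OF L c1 fs]
        sum i1 linear_map_alt[OF mm L c3] i3 ..
  qed
  have \<beta>: "?\<beta> w as \<in> carrier (Ch q)" if "w \<in> carrier Adual" "as \<in> words A (Suc q)" for w as
    by (intro C.a_closed alt_closed[OF Ch_module] C.finsum_closed parts[OF that] Pi_I)
  have eq: "delta (- int (Suc (Suc q))) (Suc (Suc q)) (elem_cochain (Suc (Suc q)) (insert_between as w)) = ?T (?\<beta> w as)"
    if "w \<in> carrier Adual" "as \<in> words A (Suc q)" for w as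
    unfolding parts(4)[OF that]
    by (rule delta_elem_insert_between[OF that(2) insert_between_merge[OF that(2)] that(1)])
  have hb: "hoch_b (Suc q) = the_linear_map K (Ch (Suc q)) (Ch q)
      (\<lambda>f. \<forall>w\<in>carrier Adual. \<forall>as\<in>words A (Suc q). f (ch w as) = ?\<beta> w as)"
    by (simp add: hoch_b_def)
  note F = Ch_factor[OF Ch_module T Ti \<beta> eq, folded hb]
  show "linear_map K (Ch (Suc q)) (Ch q) (hoch_b (Suc q))" by (rule F(1))
  show "?T (hoch_b (Suc q) c) = delta (- int (Suc (Suc q))) (Suc (Suc q)) (elem_cochain (Suc (Suc q)) (iota_neg (Suc q) c))"
    if "c \<in> carrier (Ch (Suc q))" for c by (rule F(2)) (rule that | assumption)+
qed

lemma mu: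
  shows mu_linear: "linear_map K (Ch 0) (Coch 0 0) mu"
    and theta_mu: "\<And>c. c \<in> carrier (Ch 0) \<Longrightarrow>
      theta 0 0 (mu c) = delta (- 1) (Suc 0) (elem_cochain (Suc 0) (iota_neg 0 c))"
proof -
  let ?\<beta> = "\<lambda>w as :: 'c list. elem_cochain 0 (om [mult_map w])"
  have ml: "linear_map K AA (Omega 0) (\<lambda>w. om [mult_map w])"
    using linear_map_compose[OF mult_map_linear, of "Omega 0" "\<lambda>x. om [x]"] om_multilinear[of 0]
    by (simp add: multilinear_Suc)
  have T: "linear_map K (Coch 0 0) (Coch (- int 0) (Suc 0)) (theta 0 0)" using theta_linear[of 0 0] by simp
  have \<beta>: "?\<beta> w as \<in> carrier (Coch 0 0)" if "w \<in> carrier Adual" "as \<in> words A 0" for w as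
    using elem_cochain_closed[OF linear_map_closed[OF ml Adual_closed[OF that(1)]]] by simp
  have eq: "delta (- int (Suc 0)) (Suc 0) (elem_cochain (Suc 0) (insert_between as w)) = theta 0 0 (?\<beta> w as)"
    if "w \<in> carrier Adual" "as \<in> words A 0" for w as
  proof -
    \<comment> \<open>With no letters in between, the word x, y has the single face xy, so here
      \<Psi> is multiplication.\<close>
    have "om [mult_map (pureAA x y)] = bar_d A (Omega 0) om (x # as @ [y])" if "x \<in> carrier A" "y \<in> carrier A" for x y
    proof -
      interpret O: module K "Omega 0" by (rule Omega_module)
      have "om [x \<otimes>\<^bsub>A\<^esub> y] \<in> carrier (Omega 0)" using that by (intro om_closed) simp
      then show ?thesis using that \<open>as \<in> words A 0\<close> alt_zero[OF Omega_module, of 1 0]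
        by (simp add: mult_map_pure O.minus_eq alt_def)
    qed
    from delta_elem_insert_between[OF that(2) ml this that(1)] show ?thesis by simp
  qed
  have mu_eq: "mu = the_linear_map K (Ch 0) (Coch 0 0) (\<lambda>f. \<forall>w\<in>carrier Adual. \<forall>as\<in>words A 0. f (ch w as) = ?\<beta> w as)"
    by (simp add: mu_def Ball_def)
  note F = Ch_factor[where T = "theta 0 0" and \<beta> = ?\<beta> and V = "Coch 0 0" and p = 0,
      OF Coch_module T theta_inj[OF nt] \<beta> eq, folded mu_eq]
  show "linear_map K (Ch 0) (Coch 0 0) mu" by (rule F(1))
  show "theta 0 0 (mu c) = delta (- 1) (Suc 0) (elem_cochain (Suc 0) (iota_neg 0 c))" if "c \<in> carrier (Ch 0)" for c
  proof -
    have "theta 0 0 (mu c) = delta (- int (Suc 0)) (Suc 0) (elem_cochain (Suc 0) (iota_neg 0 c))"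
      by (rule F(2)) (rule that | assumption)+
    then show ?thesis by simp
  qed
qed

lemma d_Tate_linear: "linear_map K (Tate i) (Tate (i + 1)) (d_Tate i)"
proof (cases i rule: degree_cases)
  case 1
  then show ?thesis
    unfolding d_Tate_simps(1)[OF 1]
    by (intro linear_map_Tate_nonneg[OF 1 linear_map_compose[OF delta_linear Inl_linear]]) simp
next
  case (2 p)
  show ?thesis
  proof (cases p)
    case 0
    then have i: "i = - 1" using 2 by simp
    show ?thesis
      unfolding i d_Tate_simps(2) using linear_map_Tate_neg[of "- 1" 0, OF _ linear_map_compose[OF mu_linear Inl_linear]] by simp
  next
    case (Suc q)
    have i: "i = - int (Suc (Suc q))" "i + 1 = - int (Suc q)" using 2 Suc by simp_all
    show ?thesis
      unfolding d_Tate_neg[OF i(1)]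
      by (rule linear_map_Tate_neg[OF i(1) linear_map_compose[OF hoch_b_linear Inr_linear[OF i(2)]]])
  qed
qed

lemma colim_Coch_in_inj: "inj_on (colim_in (Coch m) (theta m) p) (carrier (Coch m p))"
  by (rule sequence.inj_colim_in[OF Coch_sequence theta_inj[OF nt]])

lemma iota_inj: "inj_on (iota i) (carrier (Tate i))"
proof (cases i rule: degree_cases)
  case 1
  show ?thesis
    unfolding iota_nonneg[OF 1] Tate_nonneg(1)[OF 1] using colim_Coch_in_inj[of i 0] by (auto simp: inj_on_def)
next
  case (2 p)
  have "inj_on (\<lambda>c. colim_in (Coch i) (theta i) (Suc p) (elem_cochain (Suc p) (iota_neg p c))) (carrier (Ch p))"
    by (rule inj_on_compose[OF inj_on_compose[OF iota_neg_inj[OF nt] elem_cochain_inj iota_neg_linear]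
          colim_Coch_in_inj elem_iota_linear[of p, folded 2]])
  then show ?thesis
    unfolding iota_neg_eq[OF 2] Tate_neg(1)[OF 2] by (auto simp: inj_on_def)
qed

text \<open>In negative degree the singular differential, computed at stage p+1, is
  \<open>theta\<close> of the representative of the Tate differential at stage p, and
  \<open>theta\<close> does not change the class in the colimit.\<close>

lemma iota_d_Tate:
  assumes x: "x \<in> carrier (Tate i)"
  shows "iota (i + 1) (d_Tate i x) = delta_sg i (iota i x)"
proof (cases i rule: degree_cases)
  case 1
  then obtain f where f: "x = Inl f" "f \<in> carrier (Coch i 0)" using x by (auto simp: Tate_nonneg)
  have 2: "i + 1 \<ge> 0" using 1 by simp
  show ?thesis unfolding iota_nonneg[OF 1] iota_nonneg[OF 2] d_Tate_simps(1)[OF 1]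
    using f by (simp add: delta_sg_in)
next
  case (2 p)
  then obtain c where c: "x = Inr c" "c \<in> carrier (Ch p)" using x by (auto simp: Tate_neg)
  let ?m = "- int (Suc p)"
  have mi: "?m + 1 = - int p" by simp
  have e: "elem_cochain (Suc p) (iota_neg p c) \<in> carrier (Coch ?m (Suc p))"
    by (rule linear_map_closed[OF elem_iota_linear c(2)])
  have "delta_sg i (iota i x) = delta_sg ?m (colim_in (Coch ?m) (theta ?m) (Suc p) (elem_cochain (Suc p) (iota_neg p c)))"
    unfolding iota_neg_eq[OF 2] unfolding 2 c(1) by simp
  also have "\<dots> = colim_in (Coch (- int p)) (theta (- int p)) (Suc p) (delta ?m (Suc p) (elem_cochain (Suc p) (iota_neg p c)))"
    unfolding delta_sg_in[OF e] mi ..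
  also have "\<dots> = iota (i + 1) (d_Tate i x)"
  proof (cases p)
    case 0
    have i: "i = - 1" using 2 0 by simp
    have "theta 0 0 (mu c) = delta (- 1) (Suc 0) (elem_cochain (Suc 0) (iota_neg 0 c))" using c(2) 0 by (simp add: theta_mu)
    then have "colim_in (Coch 0) (theta 0) (Suc 0) (delta (- 1) (Suc 0) (elem_cochain (Suc 0) (iota_neg 0 c))) =
        colim_in (Coch 0) (theta 0) 0 (mu c)"
      using colim_Coch_in_theta[OF linear_map_closed[OF mu_linear]] c(2) 0 by metis
    then show ?thesis using 0 c(1) by (simp add: i d_Tate_simps(2) iota_nonneg)
  next
    case (Suc q)
    have i: "i = - int (Suc (Suc q))" "i + 1 = - int (Suc q)" using 2 Suc by simp_all
    have c': "c \<in> carrier (Ch (Suc q))" using c Suc by simp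
    have "colim_in (Coch (- int (Suc q))) (theta (- int (Suc q))) (Suc (Suc q))
        (delta (- int (Suc (Suc q))) (Suc (Suc q)) (elem_cochain (Suc (Suc q)) (iota_neg (Suc q) c))) =
      colim_in (Coch (- int (Suc q))) (theta (- int (Suc q))) (Suc q) (elem_cochain (Suc q) (iota_neg q (hoch_b (Suc q) c)))"
      unfolding theta_iota_hoch_b[OF c', symmetric]
      by (rule colim_Coch_in_theta[OF linear_map_closed[OF elem_iota_linear linear_map_closed[OF hoch_b_linear c']]])
    then show ?thesis
      unfolding iota_neg_eq[OF i(2)] d_Tate_neg[OF i(1)] unfolding i(2) c(1) Suc sum.sel .
  qed
  finally show ?thesis by simp
qed

text \<open>That \<open>d_Tate\<close> is a differential is read off from \<open>delta_sg\<close> through the injective map \<open>iota\<close>.\<close>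

lemma Tate_complex: "cochain_complex K Tate d_Tate"
  unfolding cochain_complex_def
proof (intro conjI allI ballI Tate_module d_Tate_linear)
  fix n x assume x: "x \<in> carrier (Tate n)"
  have n2: "n + 1 + 1 = n + 2" by simp
  have dx: "d_Tate n x \<in> carrier (Tate (n + 1))" by (rule linear_map_closed[OF d_Tate_linear x])
  have ddx: "d_Tate (n + 1) (d_Tate n x) \<in> carrier (Tate (n + 2))"
    using linear_map_closed[OF d_Tate_linear dx] by (simp only: n2)
  have "iota (n + 2) (d_Tate (n + 1) (d_Tate n x)) = delta_sg (n + 1) (delta_sg n (iota n x))"
    using iota_d_Tate[OF dx] iota_d_Tate[OF x] by (simp only: n2)
  also have "\<dots> = \<zero>\<^bsub>Csg (n + 2)\<^esub>"
    using Csg_complex linear_map_closed[OF iota_linear x] by (simp add: cochain_complex_def)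
  also have "\<dots> = iota (n + 2) \<zero>\<^bsub>Tate (n + 2)\<^esub>"
    by (rule linear_map_zero[OF Tate_module Csg_module iota_linear, symmetric])
  finally show "d_Tate (n + 1) (d_Tate n x) = \<zero>\<^bsub>Tate (n + 2)\<^esub>"
    using inj_onD[OF iota_inj] ddx module_zero_closed[OF Tate_module] by blast
qed

lemma iota_embedding: "complex_embedding K Tate d_Tate Csg delta_sg iota"
  unfolding complex_embedding_def cochain_map_def
  using Tate_complex Csg_complex iota_linear iota_d_Tate iota_inj by blast

end

text \<open>If the unit is nonzero, a functional with value 1 on it recovers c from its c-fold
  multiple, so the scalar map is injective; if moreover every element were a scalar, it would be
  onto as well.\<close>

lemma one_zero_or_not_ground:
  assumes "\<not> bij_betw (\<lambda>c. c \<odot>\<^bsub>A\<^esub> \<one>\<^bsub>A\<^esub>) (carrier K) (carrier A)"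
  shows "\<one>\<^bsub>A\<^esub> = \<zero>\<^bsub>A\<^esub> \<or> (\<exists>a\<in>carrier A. a \<notin> ground)"
proof (rule ccontr)
  assume "\<not> ?thesis"
  then have ne: "\<one>\<^bsub>A\<^esub> \<noteq> \<zero>\<^bsub>A\<^esub>" and sub: "carrier A \<subseteq> ground" by auto
  let ?k = "vspace (carrier K) \<zero>\<^bsub>K\<^esub> (add K) (mult K)"
  obtain \<epsilon> where \<epsilon>: "linear_map K A ?k \<epsilon>" "\<epsilon> \<one>\<^bsub>A\<^esub> = \<one>\<^bsub>K\<^esub>"
    using linear_functional_exists(2)[OF K.field_axioms A_module A.one_closed ne] by blast
  have "\<epsilon> (c \<odot>\<^bsub>A\<^esub> \<one>\<^bsub>A\<^esub>) = c" if "c \<in> carrier K" for c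
    using linear_map_smult[OF \<epsilon>(1) that A.one_closed] \<epsilon>(2) that by simp
  then have "inj_on (\<lambda>c. c \<odot>\<^bsub>A\<^esub> \<one>\<^bsub>A\<^esub>) (carrier K)" by (rule inj_on_inverseI)
  moreover have "(\<lambda>c. c \<odot>\<^bsub>A\<^esub> \<one>\<^bsub>A\<^esub>) ` carrier K = carrier A"
    using sub by (auto simp: ground_def)
  ultimately show False using assms by (simp add: bij_betw_def)
qed

end

theorem lemma6p1:
  fixes K :: "('k, 'c) ring_scheme" and A :: "('k, 'a, 'd) module_scheme"
  assumes alg: "k_algebra K A"
    and not_ground_field: "\<not> bij_betw (\<lambda>c. c \<odot>\<^bsub>A\<^esub> \<one>\<^bsub>A\<^esub>) (carrier K) (carrier A)"
  shows "complex_embedding K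
           (k_algebra.Tate K A) (k_algebra.d_Tate K A)
           (k_algebra.Csg K A) (k_algebra.delta_sg K A)
           (k_algebra.iota K A)"
  by (rule k_algebra.iota_embedding[OF alg k_algebra.one_zero_or_not_ground[OF alg not_ground_field]])

end
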